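(* Let $f:\mathbb{R}\to[0,+\infty)$ be even, smooth and nonincreasing in $[0,+\infty)$, with support in $[-1,1]$, and let $\{r_n\}_{n\in\mathbb{N}}\subset(0,+\infty)$ with $r_n\to0$ as $n\to+\infty$. Let $u_0\in C(\mathbb{R}^d)$ be a uniformly continuous function, constant outside a compact set. For every $n\in\mathbb{N}$ let $u^n$ be the viscosity solution of the Cauchy problem (CP) with curvature $\mathscr{H}=\kappa^f_{r_n}$ and initial datum $u_0$. Then $u^n\to u^\infty$ locally uniformly, where $u^\infty:\mathbb{R}^d\times[0,+\infty)\to\mathbb{R}$ is the (unique) viscosity solution of (CP) with curvature $\mathscr{H}=c_f\,\mathrm{H}^1$ and initial datum $u_0$, with $c_f=\int_0^1f(s)\,ds$.
   Context: Let $d\ge2$. Fix an integer $\ell\ge 2$ and $\beta\in[0,1]$. $\mathfrak{C}$ is the class of subsets of $\mathbb{R}^d$ that are the closure of an open set with compact $C^{\ell,\beta}$ boundary. $B_\rho$ is the open ball of radius $\rho$ centred at $0$. For $E\in\mathfrak{C}$, $\nu_E$ is the outer unit normal to $\partial E$ (extended near $\partial E$ as the gradient of the signed distance, negative inside $E$, so that $D\nu_E(x)$ has as eigenvalues the principal curvatures of $\partial E$ at $x$, nonnegative for convex $E$, and $0$), and $\mathrm{d}(y,F)$ is the distance from the point $y$ to the set $F$. $\mathrm{H}^1(x,E)=\operatorname{tr}D\nu_E(x)$ is the scalar mean curvature (sum of the principal curvatures) of $\partial E$ at $x$. For $r>0$, $E\in\mathfrak{C}$, $x\in\partial E$: $\kappa_r^{\mathrm{ou}}(x,E)=\frac1{2r}\det(I+rD\nu_E(x))$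 if $\mathrm{d}(x+r\nu_E(x),E)=r$, and $0$ otherwise; $\kappa_r^{\mathrm{in}}(x,E)=-\frac1{2r}\det(I-rD\nu_E(x))$ if $\mathrm{d}(x-r\nu_E(x),\mathbb{R}^d\setminus E)=r$, and $0$ otherwise; $$\kappa_r^f(x,E)=\int_0^1(-sf'(s))\big[\kappa_{rs}^{\mathrm{ou}}(x,E)+\kappa_{rs}^{\mathrm{in}}(x,E)\big]\,ds.$$ Cauchy problem (CP), for a curvature function $\mathscr{H}(x,E)\in\mathbb{R}$ ($E\in\mathfrak{C}$, $x\in\partial E$): $$\partial_t u(x,t)+|Du(x,t)|\,\mathscr{H}(x,\{y:u(y,t)\ge u(x,t)\})=0,\qquad u(\cdot,0)=u_0,$$ where $D$ is the spatial gradient. Viscosity solutions are defined as follows. Let $\overline c(\rho)=\max_{x\in\partial B_\rho}\max\{\mathscr{H}(x,\overline B_\rho),-\mathscr{H}(x,\mathbb{R}^d\setminus B_\rho)\}$ and fix any nonincreasing continuous $\gamma:(0,+\infty)\to\mathbb{R}$ with $\gamma\ge\overline c$ (the unique solution does not depend on this choice). Let $\mathcal{F}$ be the set of $g\in C^\infty([0,+\infty))$ with $g(0)=g'(0)=g''(0)=0$, $g''>0$ at all $r>0$ in a neighbourhood of $0$, $g$ constant on $[M,+\infty)$ for some $M>0$, and $\lim_{\rho\to0^+}g'(\rho)\gamma(\rho)=0$. A function $h:\mathbb{R}^d\times A\to\mathbb{R}$, $A\subseteq[0,+\infty)$, is constant outside a compact set if for every $t\in A$ there is a compact $\mathcal{K}_t\subset\mathbb{R}^d$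 such that for every $t'\in A\cap[0,t)$, $h(\cdot,t')$ is constant on $\mathbb{R}^d\setminus\mathcal{K}_t$. Given $\hat z=(\hat x,\hat t)\in\mathbb{R}^d\times(0,+\infty)$ and an open bounded interval $A\subset(0,+\infty)$ containing $\hat t$, a function $\varphi\in C^0(\mathbb{R}^d\times\overline A)$ is admissible at $\hat z$ if it is $C^2$ near $\hat z$, constant outside a compact set, and, in case $D\varphi(\hat z)=0$, there are $g\in\mathcal{F}$ and $\omega\in C^\infty([0,+\infty))$ with $\omega(0)=\omega'(0)=0$, $\omega(r)>0$ for $r\ne0$, such that $|\varphi(x,t)-\varphi(\hat z)-\varphi_t(\hat z)(t-\hat t)|\le g(|x-\hat x|)+\omega(|t-\hat t|)$ on $\mathbb{R}^d\times A$. A level set of $\varphi(\cdot,t)$ is noncritical if $D\varphi$ does not vanish on it. An upper semicontinuous $u:\mathbb{R}^d\times[0,+\infty)\to\mathbb{R}$, constant outside a compact set, is a subsolution if $u(\cdot,0)\le u_0$ and for every $z=(x,t)$ with $t>0$ and every $C^\infty$ test function $\varphi$ admissible at $z$ such that $u-\varphi$ has a maximum at $z$ (in the domain of $\varphi$): (i) if $D\varphi(z)=0$ then $\varphi_t(z)\le0$; (ii) if $\{\varphi(\cdot,t)=\varphi(z)\}$ is noncritical then $\varphi_t(z)+|D\varphi(z)|\,\mathscr{H}(x,\{y:\varphi(y,t)\ge\varphi(z)\})\le0$. Supersolutions are lower semicontinuous functions constant outside a compact set defined symmetrically ($u(\cdot,0)\ge u_0$, minimum in place of maximum, inequalities $\ge0$,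 same superlevel set). $u$ is a viscosity solution if its upper semicontinuous envelope is a subsolution and its lower semicontinuous envelope is a supersolution. *)

theory Defs
  imports "HOL-Analysis.Analysis"
begin

section \<open>Differentiability classes\<close>

text \<open>
  The set \<open>S\<close> is meant to be open, or the half-line \<open>{0..}\<close> in the reals; derivatives are taken
  within \<open>S\<close>, so on the half-line they are one-sided at \<open>0\<close>.
\<close>

primrec derivatives_satisfy ::
    "('a::real_normed_vector set \<Rightarrow> ('a \<Rightarrow> 'b::real_normed_vector) \<Rightarrow> bool) \<Rightarrow>
     nat \<Rightarrow> 'a set \<Rightarrow> ('a \<Rightarrow> 'b) \<Rightarrow> bool" where
  "derivatives_satisfy P 0 S g = P S g"
| "derivatives_satisfy P (Suc k) S g =
     ((\<forall>x\<in>S. g differentiable (at x within S)) \<and>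
      (\<forall>v. derivatives_satisfy P k S (\<lambda>x. frechet_derivative g (at x within S) v)))"

definition Ck_on :: "nat \<Rightarrow> 'a::real_normed_vector set \<Rightarrow> ('a \<Rightarrow> 'b::real_normed_vector) \<Rightarrow> bool" where
  "Ck_on = derivatives_satisfy continuous_on"

definition smooth_on :: "'a::real_normed_vector set \<Rightarrow> ('a \<Rightarrow> 'b::real_normed_vector) \<Rightarrow> bool" where
  "smooth_on S g \<longleftrightarrow> (\<forall>k. Ck_on k S g)"

definition loc_holder_on ::
    "real \<Rightarrow> 'a::real_normed_vector set \<Rightarrow> ('a \<Rightarrow> 'b::real_normed_vector) \<Rightarrow> bool" where
  "loc_holder_on \<beta> S g \<longleftrightarrow> continuous_on S g \<and>
     (\<forall>x\<in>S. \<exists>e>0. \<exists>C. \<forall>y\<in>ball x e \<inter> S. \<forall>z\<in>ball x e \<inter> S.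
        norm (g y - g z) \<le> C * dist y z powr \<beta>)"

text \<open>For \<open>\<beta> = 0\<close> the Holder condition is implied by continuity, so that this is \<open>C\<^sup>k\<close>.\<close>

definition Ck_holder_on ::
    "nat \<Rightarrow> real \<Rightarrow> 'a::real_normed_vector set \<Rightarrow> ('a \<Rightarrow> 'b::real_normed_vector) \<Rightarrow> bool" where
  "Ck_holder_on k \<beta> = derivatives_satisfy (loc_holder_on \<beta>) k"

definition grad :: "(real^'n \<Rightarrow> real) \<Rightarrow> real^'n \<Rightarrow> real^'n" where
  "grad g x = (\<chi> i. frechet_derivative g (at x) (axis i 1))"


section \<open>Regular sets and their curvatures\<close>

definition regular_class :: "nat \<Rightarrow> real \<Rightarrow> (real^'n) set set" where
  "regular_class l \<beta> = {E. (\<exists>U. open U \<and> E = closure U) \<and> compact (frontier E) \<and>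
     (\<forall>x\<in>frontier E. \<exists>N \<phi>. open N \<and> x \<in> N \<and> Ck_holder_on l \<beta> N \<phi> \<and>
        (\<forall>y\<in>N. grad \<phi> y \<noteq> 0) \<and> E \<inter> N = {y\<in>N. \<phi> y \<le> 0})}"

definition signed_dist :: "(real^'n) set \<Rightarrow> real^'n \<Rightarrow> real" where
  "signed_dist E x = infdist x E - infdist x (- E)"

definition outer_normal :: "(real^'n) set \<Rightarrow> real^'n \<Rightarrow> real^'n" where
  "outer_normal E = grad (signed_dist E)"

abbreviation D_normal :: "real^'n \<Rightarrow> (real^'n) set \<Rightarrow> real^'n^'n" where
  "D_normal x E \<equiv> jacobian (outer_normal E) (at x)"

definition mean_curvature :: "real^'n \<Rightarrow> (real^'n) set \<Rightarrow> real" where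
  "mean_curvature x E = trace (D_normal x E)"

definition kappa_ou :: "real \<Rightarrow> real^'n \<Rightarrow> (real^'n) set \<Rightarrow> real" where
  "kappa_ou r x E =
     (if infdist (x + r *\<^sub>R outer_normal E x) E = r
      then 1 / (2 * r) * det (mat 1 + r *\<^sub>R D_normal x E) else 0)"

definition kappa_in :: "real \<Rightarrow> real^'n \<Rightarrow> (real^'n) set \<Rightarrow> real" where
  "kappa_in r x E =
     (if infdist (x - r *\<^sub>R outer_normal E x) (- E) = r
      then - (1 / (2 * r)) * det (mat 1 - r *\<^sub>R D_normal x E) else 0)"

definition kappa_f :: "(real \<Rightarrow> real) \<Rightarrow> real \<Rightarrow> real^'n \<Rightarrow> (real^'n) set \<Rightarrow> real" where
  "kappa_f f r x E =
     integral {0..1} (\<lambda>s. - s * deriv f s * (kappa_ou (r * s) x E + kappa_in (r * s) x E))"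

text \<open>
  Curvature functions are defined only for \<open>E\<close> in the regular class and \<open>x\<close> on its boundary.
\<close>

definition on_regular :: "nat \<Rightarrow> real \<Rightarrow> (real^'n \<Rightarrow> (real^'n) set \<Rightarrow> real) \<Rightarrow>
    real^'n \<Rightarrow> (real^'n) set \<Rightarrow> real" where
  "on_regular l \<beta> H x E = (if E \<in> regular_class l \<beta> \<and> x \<in> frontier E then H x E else undefined)"


section \<open>Viscosity solutions of the Cauchy problem\<close>

definition cbar :: "(real^'n \<Rightarrow> (real^'n) set \<Rightarrow> real) \<Rightarrow> real \<Rightarrow> real" where
  "cbar H \<rho> = (SUP x\<in>sphere 0 \<rho>. max (H x (cball 0 \<rho>)) (- H x (- ball 0 \<rho>)))"

definition majorizes_cbar :: "(real^'n \<Rightarrow> (real^'n) set \<Rightarrow> real) \<Rightarrow> (real \<Rightarrow> real) \<Rightarrow> bool" where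
  "majorizes_cbar H \<gamma> \<longleftrightarrow>
     antimono_on {0<..} \<gamma> \<and> continuous_on {0<..} \<gamma> \<and> (\<forall>\<rho>>0. cbar H \<rho> \<le> \<gamma> \<rho>)"

definition half_line_deriv :: "(real \<Rightarrow> real) \<Rightarrow> real \<Rightarrow> real" where
  "half_line_deriv g r = vector_derivative g (at r within {0..})"

definition test_profiles :: "(real \<Rightarrow> real) \<Rightarrow> (real \<Rightarrow> real) set" where
  "test_profiles \<gamma> = {g. smooth_on {0..} g \<and>
     g 0 = 0 \<and> half_line_deriv g 0 = 0 \<and> half_line_deriv (half_line_deriv g) 0 = 0 \<and>
     (\<exists>\<delta>>0. \<forall>r. 0 < r \<and> r < \<delta> \<longrightarrow> half_line_deriv (half_line_deriv g) r > 0) \<and>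
     (\<exists>M>0. \<forall>r\<ge>M. g r = g M) \<and>
     ((\<lambda>\<rho>. half_line_deriv g \<rho> * \<gamma> \<rho>) \<longlongrightarrow> 0) (at_right 0)}"

definition const_outside_compact :: "real set \<Rightarrow> ((real^'n) \<times> real \<Rightarrow> real) \<Rightarrow> bool" where
  "const_outside_compact A h \<longleftrightarrow>
     (\<forall>t\<in>A. \<exists>K. compact K \<and> (\<forall>t'\<in>A \<inter> {0..<t}. \<exists>c. \<forall>x. x \<notin> K \<longrightarrow> h (x, t') = c))"

definition space_grad :: "((real^'n) \<times> real \<Rightarrow> real) \<Rightarrow> (real^'n) \<times> real \<Rightarrow> real^'n" where
  "space_grad \<phi> z = grad (\<lambda>y. \<phi> (y, snd z)) (fst z)"

definition time_deriv :: "((real^'n) \<times> real \<Rightarrow> real) \<Rightarrow> (real^'n) \<times> real \<Rightarrow> real" where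
  "time_deriv \<phi> z = deriv (\<lambda>s. \<phi> (fst z, s)) (snd z)"

text \<open>Here the open time interval is \<open>{a<..<b}\<close>, and \<open>\<phi>\<close> is a function on \<open>UNIV \<times> {a..b}\<close>.\<close>

definition admissible_at ::
    "(real \<Rightarrow> real) \<Rightarrow> real \<Rightarrow> real \<Rightarrow> (real^'n) \<times> real \<Rightarrow> ((real^'n) \<times> real \<Rightarrow> real) \<Rightarrow> bool" where
  "admissible_at \<gamma> a b z \<phi> \<longleftrightarrow>
     0 \<le> a \<and> a < snd z \<and> snd z < b \<and>
     continuous_on (UNIV \<times> {a..b}) \<phi> \<and>
     (\<exists>N. open N \<and> z \<in> N \<and> N \<subseteq> UNIV \<times> {a<..<b} \<and> Ck_on 2 N \<phi>) \<and>
     const_outside_compact {a..b} \<phi> \<and>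
     (space_grad \<phi> z = 0 \<longrightarrow>
       (\<exists>g\<in>test_profiles \<gamma>. \<exists>\<omega>. smooth_on {0..} \<omega> \<and> \<omega> 0 = 0 \<and> half_line_deriv \<omega> 0 = 0 \<and>
          (\<forall>r>0. \<omega> r > 0) \<and>
          (\<forall>x. \<forall>t\<in>{a<..<b}. \<bar>\<phi> (x, t) - \<phi> z - time_deriv \<phi> z * (t - snd z)\<bar>
                    \<le> g (norm (x - fst z)) + \<omega> \<bar>t - snd z\<bar>)))"

definition noncritical_level :: "((real^'n) \<times> real \<Rightarrow> real) \<Rightarrow> (real^'n) \<times> real \<Rightarrow> bool" where
  "noncritical_level \<phi> z \<longleftrightarrow> (\<forall>y. \<phi> (y, snd z) = \<phi> z \<longrightarrow> space_grad \<phi> (y, snd z) \<noteq> 0)"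

definition superlevel :: "((real^'n) \<times> real \<Rightarrow> real) \<Rightarrow> (real^'n) \<times> real \<Rightarrow> (real^'n) set" where
  "superlevel \<phi> z = {y. \<phi> (y, snd z) \<ge> \<phi> z}"

abbreviation space_time :: "((real^'n) \<times> real) set" where
  "space_time \<equiv> UNIV \<times> {0..}"

definition usc_on :: "'a::topological_space set \<Rightarrow> ('a \<Rightarrow> real) \<Rightarrow> bool" where
  "usc_on S u \<longleftrightarrow> (\<forall>z\<in>S. \<forall>c>u z. \<forall>\<^sub>F w in at z within S. u w < c)"

definition lsc_on :: "'a::topological_space set \<Rightarrow> ('a \<Rightarrow> real) \<Rightarrow> bool" where
  "lsc_on S u \<longleftrightarrow> (\<forall>z\<in>S. \<forall>c<u z. \<forall>\<^sub>F w in at z within S. c < u w)"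

definition subsolution ::
    "(real \<Rightarrow> real) \<Rightarrow> (real^'n \<Rightarrow> (real^'n) set \<Rightarrow> real) \<Rightarrow> (real^'n \<Rightarrow> real) \<Rightarrow>
     ((real^'n) \<times> real \<Rightarrow> real) \<Rightarrow> bool" where
  "subsolution \<gamma> H u0 u \<longleftrightarrow>
     usc_on space_time u \<and> const_outside_compact {0..} u \<and> (\<forall>x. u (x, 0) \<le> u0 x) \<and>
     (\<forall>a b z \<phi>. admissible_at \<gamma> a b z \<phi> \<and> smooth_on (UNIV \<times> {a<..<b}) \<phi> \<and>
        (\<forall>w\<in>UNIV \<times> {a..b}. u w - \<phi> w \<le> u z - \<phi> z) \<longrightarrow>
        (space_grad \<phi> z = 0 \<longrightarrow> time_deriv \<phi> z \<le> 0) \<and>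
        (noncritical_level \<phi> z \<longrightarrow>
           time_deriv \<phi> z + norm (space_grad \<phi> z) * H (fst z) (superlevel \<phi> z) \<le> 0))"

definition supersolution ::
    "(real \<Rightarrow> real) \<Rightarrow> (real^'n \<Rightarrow> (real^'n) set \<Rightarrow> real) \<Rightarrow> (real^'n \<Rightarrow> real) \<Rightarrow>
     ((real^'n) \<times> real \<Rightarrow> real) \<Rightarrow> bool" where
  "supersolution \<gamma> H u0 u \<longleftrightarrow>
     lsc_on space_time u \<and> const_outside_compact {0..} u \<and> (\<forall>x. u (x, 0) \<ge> u0 x) \<and>
     (\<forall>a b z \<phi>. admissible_at \<gamma> a b z \<phi> \<and> smooth_on (UNIV \<times> {a<..<b}) \<phi> \<and>
        (\<forall>w\<in>UNIV \<times> {a..b}. u w - \<phi> w \<ge> u z - \<phi> z) \<longrightarrow>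
        (space_grad \<phi> z = 0 \<longrightarrow> time_deriv \<phi> z \<ge> 0) \<and>
        (noncritical_level \<phi> z \<longrightarrow>
           time_deriv \<phi> z + norm (space_grad \<phi> z) * H (fst z) (superlevel \<phi> z) \<ge> 0))"

text \<open>
  The envelopes are formed in the extended reals; a viscosity solution is required to have
  real-valued ones.
\<close>

definition usc_envelope :: "((real^'n) \<times> real \<Rightarrow> real) \<Rightarrow> (real^'n) \<times> real \<Rightarrow> ereal" where
  "usc_envelope u z = (INF e\<in>{0<..}. SUP w\<in>ball z e \<inter> space_time. ereal (u w))"

definition lsc_envelope :: "((real^'n) \<times> real \<Rightarrow> real) \<Rightarrow> (real^'n) \<times> real \<Rightarrow> ereal" where
  "lsc_envelope u z = (SUP e\<in>{0<..}. INF w\<in>ball z e \<inter> space_time. ereal (u w))"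

definition viscosity_solution ::
    "(real \<Rightarrow> real) \<Rightarrow> (real^'n \<Rightarrow> (real^'n) set \<Rightarrow> real) \<Rightarrow> (real^'n \<Rightarrow> real) \<Rightarrow>
     ((real^'n) \<times> real \<Rightarrow> real) \<Rightarrow> bool" where
  "viscosity_solution \<gamma> H u0 u \<longleftrightarrow>
     (\<exists>v. (\<forall>z\<in>space_time. ereal (v z) = usc_envelope u z) \<and> subsolution \<gamma> H u0 v) \<and>
     (\<exists>v. (\<forall>z\<in>space_time. ereal (v z) = lsc_envelope u z) \<and> supersolution \<gamma> H u0 v)"

end

theory Submission
 imports Defs "HOL-Complex_Analysis.Complex_Analysis"
begin

text \<open>A maximum point with nonvanishing gradient has superlevel sets of the test function nearby with two-sided
balls of a uniform radius, which makes the curvatures at scale \<open>r n\<close> converge there to a multiple of the mean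
curvature. As the curvatures of balls are bounded uniformly in \<open>n\<close>, critical points and initial values are
handled by barriers, so the half-relaxed limits of the \<open>u n\<close> are a subsolution and a supersolution of the
limit problem; comparison shows that they agree, and this is locally uniform convergence.

The comparison principle replaces second order differentiability of semiconvex functions by compactness: after
doubling variables and sup-convolution both functions are differentiable at the maximum point, and their
parabolic blow-ups there are semiconvex with sum bounded by a quadratic. Harmonic polynomials approximating a
limit of the blow-ups on a sphere provide test functions for both, and the two inequalities contradict each
other.\<close>

section \<open>Calculus of the differentiability classes\<close>

text \<open>A test function must be constant at infinity, and the curvature inequality is available
  only if its whole level set is noncritical; at a critical point a profile adapted to
  \<open>\<gamma>\<close> has to control it. A paraboloid is not constant at infinity and may have
  critical levels, so it is completed by a quartic term and truncated by a strictly increasing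
  cutoff, which leaves the superlevel set unchanged. What results is \<open>local_sub\<close>, a
  pointwise inequality free of \<open>\<gamma>\<close>, of level sets and of the nonlocal operator:
  limits satisfy it, comparison rests on it, and it implies the original notion for the limit
  curvature. Supersolutions become subsolutions of \<open>- u\<close>, as the curvatures are odd
  under complementation. In the comparison the limit operator degenerates in the normal and time
  directions; a small multiple \<open>\<kappa>\<close> of the full Laplacian, paid for by
  semiconvexity, and a linear change of variables turn it into the Laplacian of space-time, so that
  harmonic functions can serve as tests. Where the gradient vanishes, a penalisation quartic in
  space leaves a test of cubic order.\<close>

lemma has_derivative_within_cong:
 assumes "!!x. x \<in> S ==> f x = g x" "x \<in> S"
 shows "(f has_derivative D) (at x within S) \<longleftrightarrow> (g has_derivative D) (at x within S)"
 using assms has_derivative_transform[of x S f g D] has_derivative_transform[of x S g f D] by auto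

lemma frechet_derivative_within_cong:
 assumes "!!x. x \<in> S ==> f x = g x" "x \<in> S"
 shows "frechet_derivative f (at x within S) = frechet_derivative g (at x within S)"
 using has_derivative_within_cong[OF assms] unfolding frechet_derivative_def by auto

lemma Ck_on_0: "Ck_on 0 S f \<longleftrightarrow> continuous_on S f"
 by (simp add: Ck_on_def)

lemma Ck_on_Suc: "Ck_on (Suc k) S f \<longleftrightarrow> (\<forall>x\<in>S. f differentiable (at x within S)) &
  (\<forall>v. Ck_on k S (%x. frechet_derivative f (at x within S) v))" by (simp add: Ck_on_def)

lemma Ck_on_cong:
 assumes "!!x. x \<in> S ==> f x = g x" "Ck_on k S f"
 shows "Ck_on k S g" using assms
proof (induction k arbitrary: f g)
 case 0
 then show ?case using continuous_on_eq unfolding Ck_on_0 by blast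
next
 case (Suc k)
 have "Ck_on k S (%x. frechet_derivative g (at x within S) v)" for v
 proof (rule Suc.IH)
  show "Ck_on k S (%x. frechet_derivative f (at x within S) v)" using Suc.prems by (simp add: Ck_on_Suc)
 qed (simp add: frechet_derivative_within_cong[of S f g, OF Suc.prems(1)])
 moreover have "\<forall>x\<in>S. g differentiable (at x within S)"
  using Suc.prems has_derivative_within_cong[of S f g] unfolding Ck_on_Suc differentiable_def by blast
 ultimately show ?case by (simp add: Ck_on_Suc)
qed

text \<open>Induction step of the closure rules below: on an open set the derivative within
  \<open>S\<close> is the ordinary one, so any known formula \<open>D\<close> may stand for
  it.\<close>

lemma Ck_on_SucI:
 assumes "open S" "!!x. x \<in> S ==> (f has_derivative D x) (at x)" and "!!v. Ck_on k S (%x. D x v)"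
 shows "Ck_on (Suc k) S f"
proof -
 have w: "at x within S = at x" if "x \<in> S" for x using assms(1) that at_within_open by blast
 have *: "(f has_derivative D x) (at x within S)" if "x \<in> S" for x
  using assms(2)[OF that] w[OF that] by simp
 have "frechet_derivative f (at x within S) = D x" if "x \<in> S" for x
  unfolding w[OF that] using frechet_derivative_at[OF assms(2)[OF that]] by simp
 then have "Ck_on k S (%x. frechet_derivative f (at x within S) v)" for v
  by (intro Ck_on_cong[OF _ assms(3)[of v]]) simp
 moreover have "\<forall>x\<in>S. f differentiable (at x within S)"
  using * unfolding differentiable_def by blast
 ultimately show ?thesis unfolding Ck_on_Suc by blast
qed

lemma Ck_on_SucD:
 assumes "open S" "Ck_on (Suc k) S f"
 shows "!!x. x \<in> S ==> (f has_derivative frechet_derivative f (at x)) (at x)"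
  and "Ck_on k S (%x. frechet_derivative f (at x) v)"
proof -
 have w: "at x within S = at x" if "x \<in> S" for x using assms(1) that at_within_open by blast
 show "(f has_derivative frechet_derivative f (at x)) (at x)" if "x \<in> S" for x
  using assms(2) w[OF that] that frechet_derivative_works unfolding Ck_on_Suc by metis
 have "Ck_on k S (%x. frechet_derivative f (at x within S) v)" using assms(2) unfolding Ck_on_Suc by blast
 then show "Ck_on k S (%x. frechet_derivative f (at x) v)" by (rule Ck_on_cong[rotated]) (simp add: w)
qed

lemma Ck_on_Suc_imp: "Ck_on (Suc k) S f ==> Ck_on k S f"
proof (induction k arbitrary: f)
 case 0
 then show ?case unfolding Ck_on_Suc Ck_on_0 continuous_on_eq_continuous_within
  using differentiable_imp_continuous_within by blast
next
 case (Suc k)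
 then show ?case using Ck_on_Suc[of k S f] Ck_on_Suc[of "Suc k" S f] by blast
qed

lemma Ck_on_subset:
 assumes "Ck_on k S f" "open S" "open T" "T <= S"
 shows "Ck_on k T f" using assms
proof (induction k arbitrary: f)
 case 0
 then show ?case by (auto simp: Ck_on_0 intro: continuous_on_subset)
next
 case (Suc k)
 show ?case using Suc Ck_on_SucD[OF Suc.prems(2,1)]
  by (intro Ck_on_SucI[where D="%x. frechet_derivative f (at x)"]) auto
qed

lemma Ck_on_const: "open S ==> Ck_on k S (%x. c)"
proof (induction k arbitrary: c)
 case (Suc k)
 then show ?case by (intro Ck_on_SucI[where D="%x v. 0"]) auto
qed (simp add: Ck_on_0)

lemma Ck_on_bounded_linear: "open S ==> bounded_linear f ==> Ck_on k S f"
 by (cases k)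
  (auto simp: Ck_on_0 intro!: Ck_on_SucI[where D="%x. f"] Ck_on_const bounded_linear_imp_has_derivative
   linear_continuous_on)

lemma Ck_on_add:
 "open S ==> Ck_on k S f ==> Ck_on k S g ==> Ck_on k S (%x. f x + g x)"
proof (induction k arbitrary: f g)
 case (Suc k)
 show ?case using Suc Ck_on_SucD[OF Suc.prems(1,2)] Ck_on_SucD[OF Suc.prems(1,3)]
  by (intro Ck_on_SucI[where D="%x v. frechet_derivative f (at x) v + frechet_derivative g (at x) v"])
   (auto intro!: has_derivative_add)
qed (auto simp: Ck_on_0 intro: continuous_intros)

lemma Ck_on_mult:
 fixes f g :: "'a::real_normed_vector => real"
 shows "open S ==> Ck_on k S f ==> Ck_on k S g ==> Ck_on k S (%x. f x * g x)"
proof (induction k arbitrary: f g)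
 case (Suc k)
 show ?case using Suc Ck_on_SucD[OF Suc.prems(1,2)] Ck_on_SucD[OF Suc.prems(1,3)]
  by (intro Ck_on_SucI[where D="%x v. f x * frechet_derivative g (at x) v + frechet_derivative f (at x) v * g x"])
   (auto intro!: has_derivative_mult Ck_on_add Suc.IH dest: Ck_on_Suc_imp)
qed (auto simp: Ck_on_0 intro: continuous_intros)

lemma smooth_onD: "smooth_on S f ==> Ck_on k S f"
 by (simp add: smooth_on_def)

lemma smooth_onI: "(!!k. Ck_on k S f) ==> smooth_on S f"
 by (simp add: smooth_on_def)

lemma smooth_on_frechet:
 "open S ==> smooth_on S f ==> smooth_on S (%x. frechet_derivative f (at x) v)"
 using Ck_on_SucD(2) by (fastforce simp: smooth_on_def)

lemma smooth_on_has_derivative: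
 "open S ==> smooth_on S f ==> x \<in> S ==> (f has_derivative frechet_derivative f (at x)) (at x)"
 using Ck_on_SucD(1) by (fastforce simp: smooth_on_def)

lemma smooth_on_subset: "smooth_on S f ==> open S ==> open T ==> T <= S ==> smooth_on T f"
 by (auto simp: smooth_on_def intro: Ck_on_subset)

lemma smooth_on_imp_continuous_on: "smooth_on S f ==> continuous_on S f"
 using smooth_onD[of S f 0] by (simp add: Ck_on_0)

lemma smooth_on_cong: "smooth_on S f ==> (!!x. x \<in> S ==> f x = g x) ==> smooth_on S g"
 unfolding smooth_on_def using Ck_on_cong by blast

lemma smooth_on_const: "open S ==> smooth_on S (%x. c)"
 by (simp add: smooth_on_def Ck_on_const)

lemma smooth_on_bounded_linear: "open S ==> bounded_linear f ==> smooth_on S f"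
 by (simp add: smooth_on_def Ck_on_bounded_linear)

lemma smooth_on_add: "open S ==> smooth_on S f ==> smooth_on S g ==> smooth_on S (%x. f x + g x)"
 by (simp add: smooth_on_def Ck_on_add)

lemma smooth_on_mult:
 fixes f g :: "'a::real_normed_vector => real"
 shows "open S ==> smooth_on S f ==> smooth_on S g ==> smooth_on S (%x. f x * g x)"
 by (simp add: smooth_on_def Ck_on_mult)

lemma smooth_on_cmult:
 fixes f :: "'a::real_normed_vector => real"
 shows "open S ==> smooth_on S f ==> smooth_on S (%x. c * f x)" by (intro smooth_on_mult smooth_on_const)

lemma smooth_on_uminus:
 fixes f :: "'a::real_normed_vector => real"
 shows "open S ==> smooth_on S f ==> smooth_on S (%x. - f x)" using smooth_on_cmult[of S f "-1"] by simp

lemma smooth_on_diff: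
 fixes f g :: "'a::real_normed_vector => real"
 shows "open S ==> smooth_on S f ==> smooth_on S g ==> smooth_on S (%x. f x - g x)"
 using smooth_on_add[of S f "%x. - g x"] smooth_on_uminus[of S g] by simp

lemma smooth_on_power:
 fixes f :: "'a::real_normed_vector => real"
 shows "open S ==> smooth_on S f ==> smooth_on S (%x. f x ^ n)"
 by (induction n) (auto intro: smooth_on_const smooth_on_mult)

lemma Ck_on_compose_affine:
 assumes "open S" "open T" "bounded_linear L" "!!x. x \<in> T ==> c + L x \<in> S" "Ck_on k S f"
 shows "Ck_on k T (%x. f (c + L x))" using assms(5)
proof (induction k arbitrary: f)
 case 0
 have "continuous_on T (%x. c + L x)" using assms(3) by (intro continuous_intros linear_continuous_on)
 with 0 assms(4) show ?case by (auto simp: Ck_on_0 intro!: continuous_on_compose2[of S f T "%x. c + L x"])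
next
 case (Suc k)
 have D: "((%x. f (c + L x)) has_derivative (%v. frechet_derivative f (at (c + L x)) (L v))) (at x)"
  if "x \<in> T" for x
 proof -
  have "((%x. c + L x) has_derivative L) (at x)"
   using assms(3) by (auto intro!: derivative_eq_intros bounded_linear_imp_has_derivative)
  then show ?thesis
   using diff_chain_at[of "%x. c + L x" L x f] Ck_on_SucD(1)[OF assms(1) Suc.prems assms(4)[OF that]]
   by (simp add: o_def)
 qed
 show ?case using Suc.IH[OF Ck_on_SucD(2)[OF assms(1) Suc.prems]] D
  by (intro Ck_on_SucI[OF assms(2), where D="%x v. frechet_derivative f (at (c + L x)) (L v)"]) auto
qed

lemma smooth_on_compose_affine:
 assumes "open S" "open T" "bounded_linear L" "!!x. x \<in> T ==> c + L x \<in> S" "smooth_on S f"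
 shows "smooth_on T (%x. f (c + L x))"
 using Ck_on_compose_affine[OF assms(1-4)] assms(5) by (auto simp: smooth_on_def)

lemma Ck_on_compose_real:
 fixes h :: "real => real"
 assumes "open S" "smooth_on UNIV h" "Ck_on k S f"
 shows "Ck_on k S (%x. h (f x))" using assms(2,3)
proof (induction k arbitrary: h)
 case 0
 then show ?case using continuous_on_compose2[of UNIV h S f] smooth_on_imp_continuous_on[of UNIV h]
  by (simp add: Ck_on_0)
next
 case (Suc k)
 let ?h' = "%y. frechet_derivative h (at y) 1"
 have D: "((%x. h (f x)) has_derivative (%v. frechet_derivative f (at x) v * ?h' (f x))) (at x)"
  if "x \<in> S" for x
 proof -
  have 1: "(h has_derivative frechet_derivative h (at (f x))) (at (f x))"
   using Suc.prems by (intro smooth_on_has_derivative) auto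
  have "frechet_derivative h (at (f x)) v = v * ?h' (f x)" for v
   using linear_scale[OF has_derivative_linear[OF 1], of v 1] by simp
  then have "frechet_derivative h (at (f x)) = (%v. v * ?h' (f x))" by (rule ext)
  then have "(h has_derivative (%v. v * ?h' (f x))) (at (f x))" by (rule has_derivative_eq_rhs[OF 1])
  from diff_chain_at[OF Ck_on_SucD(1)[OF assms(1) Suc.prems(2) that] this]
  show ?thesis by (simp add: o_def)
 qed
 have "smooth_on UNIV ?h'" using Suc.prems by (intro smooth_on_frechet) auto
 then have "Ck_on k S (%x. ?h' (f x))" using Suc.IH Suc.prems Ck_on_Suc_imp by blast
 then show ?case using Ck_on_SucD(2)[OF assms(1) Suc.prems(2)]
  by (intro Ck_on_SucI[OF assms(1) D] Ck_on_mult assms)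
qed

lemma smooth_on_compose_real:
 fixes h :: "real => real"
 shows "open S ==> smooth_on UNIV h ==> smooth_on S f ==> smooth_on S (%x. h (f x))"
 by (auto simp: smooth_on_def[of S] intro: Ck_on_compose_real)

lemma smooth_on_inner_self:
 assumes "open S"
 shows "smooth_on S (%x::'a::real_inner. x \<bullet> x)"
proof (rule smooth_onI)
 fix k
 show "Ck_on k S (%x. x \<bullet> x)"
 proof (cases k)
  case (Suc m)
  have "Ck_on m S (%x. 2 * (x \<bullet> v))" for v
   using assms by (intro Ck_on_bounded_linear bounded_linear_intros)
  moreover have "((%x. x \<bullet> x) has_derivative (%v. 2 * (x \<bullet> v))) (at x)" for x :: 'a
   by (auto intro!: derivative_eq_intros simp: inner_commute)
  ultimately show ?thesis unfolding Suc using assms by (intro Ck_on_SucI) auto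
 qed (auto simp: Ck_on_0 intro!: continuous_intros)
qed

section \<open>One-sided derivatives on the half-line\<close>

lemma half_line_nontrivial: "x >= 0 ==> at x within {0..} ~= (bot :: real filter)"
proof -
 assume "x >= 0"
 then have "at_right x <= at x within {0..}" by (intro at_le) auto
 then show ?thesis using trivial_limit_at_right_real[of x] bot.extremum_uniqueI by metis
qed

lemma half_line_derivative:
 fixes g :: "real => real"
 assumes d: "g differentiable (at x within {0..})" and x: "x >= 0"
 shows "(g has_vector_derivative half_line_deriv g x) (at x within {0..})"
  and "frechet_derivative g (at x within {0..}) = (%v. v * half_line_deriv g x)"
proof -
 show v: "(g has_vector_derivative half_line_deriv g x) (at x within {0..})"
  using d unfolding half_line_deriv_def by (simp add: vector_derivative_works)
 let ?F = "frechet_derivative g (at x within {0..})"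
 have F: "(g has_derivative ?F) (at x within {0..})" using d by (simp add: frechet_derivative_works)
 have "?F = (%w. w *\<^sub>R ?F 1)"
 proof
  show "?F w = w *\<^sub>R ?F 1" for w using linear_scale[OF has_derivative_linear[OF F], of w 1] by simp
 qed
 then have lin: "?F = (%w. w *\<^sub>R ?F 1)" .
 from has_derivative_eq_rhs[OF F this] have "(g has_vector_derivative ?F 1) (at x within {0..})"
  unfolding has_vector_derivative_def .
 from vector_derivative_unique_within[OF half_line_nontrivial[OF x] this v]
 show "?F = (%v. v * half_line_deriv g x)" using lin by (metis real_scaleR_def)
qed

lemma frechet_derivative_half_line:
 fixes g :: "real => real"
 assumes "g differentiable (at x)" "x >= 0"
 shows "frechet_derivative g (at x within {0..}) = frechet_derivative g (at x)"
  and "half_line_deriv g x = deriv g x"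
proof -
 have g: "(g has_real_derivative deriv g x) (at x)"
  using assms by (simp add: DERIV_deriv_iff_real_differentiable)
 have d: "g differentiable (at x within {0..})" by (rule differentiable_at_withinI[OF assms(1)])
 show hd: "half_line_deriv g x = deriv g x"
  using vector_derivative_unique_within[OF half_line_nontrivial half_line_derivative(1)[OF d]] assms(2)
   has_field_derivative_at_within[OF g] by (simp add: has_real_derivative_iff_has_vector_derivative)
 show "frechet_derivative g (at x within {0..}) = frechet_derivative g (at x)"
  unfolding half_line_derivative(2)[OF d assms(2)] hd mult_commute_abs
  by (rule frechet_derivative_at[OF g[unfolded has_field_derivative_def]])
qed

lemma smooth_on_half_line:
 fixes g :: "real => real"
 assumes "smooth_on UNIV g"
 shows "smooth_on {0..} g"
proof -
 have "Ck_on k UNIV g ==> Ck_on k {0..} g" for k and g :: "real => real"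
 proof (induction k arbitrary: g)
  case 0
  then show ?case by (auto simp: Ck_on_0 intro: continuous_on_subset)
 next
  case (Suc k)
  have d: "g differentiable (at x)" for x using Suc.prems by (simp add: Ck_on_Suc)
  have "Ck_on k {0..} (%x. frechet_derivative g (at x) v)" for v
   using Suc.IH Suc.prems unfolding Ck_on_Suc by blast
  then have "Ck_on k {0..} (%x. frechet_derivative g (at x within {0..}) v)" for v
   by (rule Ck_on_cong[rotated]) (simp add: frechet_derivative_half_line(1)[OF d])
  moreover have "\<forall>x\<in>{0..}. g differentiable (at x within {0..})"
   using d differentiable_at_withinI by blast
  ultimately show ?case unfolding Ck_on_Suc by blast
 qed
 with assms show ?thesis by (simp add: smooth_on_def)
qed

text \<open>Derivatives of members are again combinations of members, so one induction on the order
  covers the whole family. It serves the functions \<open>exp (- 1 / r) / r ^ m\<close>, series of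
  these, and \<open>exp\<close>.\<close>

lemma smooth_on_real_family:
 fixes F :: "nat => real => real" and n :: "nat => nat"
 assumes "!!m x. (F m has_real_derivative (\<Sum>i<n m. a m i * F (p m i) x)) (at x)"
 shows "smooth_on UNIV (F m)"
proof (rule smooth_onI)
 fix k
 show "Ck_on k UNIV (F m)"
 proof (induction k arbitrary: m)
  case 0
  then show ?case using DERIV_isCont[OF assms] by (simp add: Ck_on_0 continuous_at_imp_continuous_on)
 next
  case (Suc k)
  have "Ck_on k UNIV (%x. \<Sum>i<N. a m i * F (p m i) x)" for N :: nat
   by (induction N) (simp_all add: Ck_on_add Ck_on_mult Ck_on_const Suc)
  then show ?case
   by (intro Ck_on_SucI[OF _ assms[unfolded has_field_derivative_def]] Ck_on_mult Ck_on_const open_UNIV)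
 qed
qed

subsection \<open>Directional derivatives and second order expansion\<close>

definition dir_deriv :: "('a::real_normed_vector => real) => 'a => 'a => real" where
 "dir_deriv q x v = frechet_derivative q (at x) v"

definition dir_deriv2 :: "('a::real_normed_vector => real) => 'a => 'a => 'a => real" where
 "dir_deriv2 q x v = dir_deriv (%y. dir_deriv q y v) x"

context
 fixes S :: "'a::real_normed_vector set" and q :: "'a => real"
 assumes S: "open S" and q: "Ck_on 2 S q"
begin

lemma C2_has_derivative: "x \<in> S ==> (q has_derivative dir_deriv q x) (at x)"
 using Ck_on_SucD(1)[OF S, of 1 q] q unfolding dir_deriv_def by (simp add: numeral_2_eq_2 eta_contract_eq)

lemma C2_dir_deriv: "Ck_on 1 S (%y. dir_deriv q y v)"
 using Ck_on_SucD(2)[OF S, of 1 q] q unfolding dir_deriv_def by (simp add: numeral_2_eq_2)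

lemma C2_has_derivative2: "x \<in> S ==> ((%y. dir_deriv q y v) has_derivative dir_deriv2 q x v) (at x)"
 using Ck_on_SucD(1)[OF S, of 0 "%y. dir_deriv q y v"] C2_dir_deriv[of v]
 unfolding dir_deriv2_def dir_deriv_def[of "%y. dir_deriv q y v"] by (simp add: eta_contract_eq)

lemma C2_continuous_dir_deriv2: "continuous_on S (%y. dir_deriv2 q y v w)"
 using Ck_on_SucD(2)[OF S, of 0 "%y. dir_deriv q y v" w] C2_dir_deriv[of v]
 unfolding dir_deriv2_def dir_deriv_def[of "%y. dir_deriv q y v"] by (simp add: Ck_on_0)

lemma C2_linear: "x \<in> S ==> linear (dir_deriv q x)"
 using C2_has_derivative has_derivative_linear by blast

lemma C2_linear2: "x \<in> S ==> linear (dir_deriv2 q x v)"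
 using C2_has_derivative2 has_derivative_linear by blast

lemma C2_linear1:
 assumes x: "x \<in> S"
 shows "linear (%v. dir_deriv2 q x v w)"
proof (rule linearI)
 fix v v'
 have "((%y. dir_deriv q y v + dir_deriv q y v') has_derivative
   (%w. dir_deriv2 q x v w + dir_deriv2 q x v' w)) (at x)"
  by (intro has_derivative_add C2_has_derivative2 x)
 then have "((%y. dir_deriv q y (v + v')) has_derivative
   (%w. dir_deriv2 q x v w + dir_deriv2 q x v' w)) (at x)"
  by (rule has_derivative_transform_within_open[OF _ S x]) (simp add: C2_linear linear_add)
 from has_derivative_unique[OF this C2_has_derivative2[OF x]]
 show "dir_deriv2 q x (v + v') w = dir_deriv2 q x v w + dir_deriv2 q x v' w" by (simp add: fun_eq_iff)
next
 fix v and c :: real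
 have "((%y. c * dir_deriv q y v) has_derivative (%w. c * dir_deriv2 q x v w)) (at x)"
  by (intro has_derivative_mult_right C2_has_derivative2 x)
 then have "((%y. dir_deriv q y (c *\<^sub>R v)) has_derivative (%w. c * dir_deriv2 q x v w)) (at x)"
  by (rule has_derivative_transform_within_open[OF _ S x]) (simp add: C2_linear linear_scale)
 from has_derivative_unique[OF this C2_has_derivative2[OF x]]
 show "dir_deriv2 q x (c *\<^sub>R v) w = c *\<^sub>R dir_deriv2 q x v w" by (simp add: fun_eq_iff)
qed

end

lemma dir_deriv_eqI: "(q has_derivative D) (at x) ==> dir_deriv q x = D"
 unfolding dir_deriv_def using frechet_derivative_at by metis

lemma dir_deriv2_eqI:
 assumes "!!y. (q has_derivative D y) (at y)" "((%y. D y v) has_derivative D2) (at x)"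
 shows "dir_deriv2 q x v = D2"
 using dir_deriv_eqI[OF assms(1)] dir_deriv_eqI[OF assms(2)] unfolding dir_deriv2_def by simp

lemma linear_basis_expansion:
 fixes f :: "'a::euclidean_space => 'b::real_vector"
 assumes "linear f"
 shows "f v = (\<Sum>b\<in>Basis. (v \<bullet> b) *\<^sub>R f b)"
 using linear_sum[OF assms, of "%b. (v \<bullet> b) *\<^sub>R b" Basis] linear_scale[OF assms]
 by (simp add: euclidean_representation)

text \<open>Stated for a pair \<open>L\<close>, \<open>H\<close> rather than for derivatives of
  \<open>q\<close>, so that it can be carried along the translations of the sup-convolution and the
  scalings of the blow-up.\<close>

definition second_expansion :: "('a::real_normed_vector => real) => 'a => ('a => real) => ('a => 'a => real) => bool" where
 "second_expansion q x L H \<longleftrightarrow> (\<forall>e>0. \<forall>\<^sub>F y in nhds x.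
   \<bar>q y - q x - L (y - x) - H (y - x) (y - x) / 2\<bar> <= e * (norm (y - x))^2)"

text \<open>The mean value theorem is applied once, to the remainder \<open>r\<close> along the
  segment. The derivative of \<open>r\<close> is an error in the first order expansion of
  \<open>dir_deriv q\<close>, which is controlled in each basis direction by differentiability at
  \<open>x\<close>.\<close>

lemma C2_second_expansion:
 fixes q :: "'a::euclidean_space => real"
 assumes S: "open S" and q: "Ck_on 2 S q" and x: "x \<in> S"
 shows "second_expansion q x (dir_deriv q x) (dir_deriv2 q x)" unfolding second_expansion_def
proof (intro allI impI)
 fix e :: real assume e: "e > 0"
 let ?n = "real DIM('a)"
 \<comment> \<open>One share of \<open>e\<close> for each basis direction in the sum below.\<close>
 define e1 where "e1 = e / ?n"
 have e1: "e1 > 0" unfolding e1_def using e by simp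
 let ?D = "dir_deriv q" and ?H = "dir_deriv2 q x"
 have "\<forall>\<^sub>F y in nhds x. y \<in> S & (\<forall>b\<in>Basis. \<bar>?D y b - ?D x b - ?H b (y - x)\<bar> <= e1 * norm (y - x))"
 proof (intro eventually_conj eventually_ball_finite ballI)
  show "\<forall>\<^sub>F y in nhds x. y \<in> S" using S x by (simp add: eventually_nhds_in_open)
  fix b :: 'a
  show "\<forall>\<^sub>F y in nhds x. \<bar>?D y b - ?D x b - ?H b (y - x)\<bar> <= e1 * norm (y - x)"
   using C2_has_derivative2[OF S q x, of b] e1
   unfolding has_derivative_at_alt eventually_nhds_metric dist_norm real_norm_def by blast
 qed simp
 then obtain d where d: "d > 0" "!!y. dist y x < d ==> y \<in> S"
  "!!y b. dist y x < d ==> b \<in> Basis ==> \<bar>?D y b - ?D x b - ?H b (y - x)\<bar> <= e1 * norm (y - x)"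
  unfolding eventually_nhds_metric by blast
 show "\<forall>\<^sub>F y in nhds x. \<bar>q y - q x - ?D x (y - x) - ?H (y - x) (y - x) / 2\<bar> <= e * (norm (y - x))^2"
  unfolding eventually_nhds_metric
 proof (intro exI[of _ d] conjI allI impI d)
  fix y assume y: "dist y x < d"
  define v where "v = y - x"
  define r where "r s = q (x + s *\<^sub>R v) - s * ?D x v - s^2 * ?H v v / 2" for s :: real
  have near: "dist (x + s *\<^sub>R v) x < d" if "0 <= s" "s <= 1" for s
   using that y mult_left_le_one_le[of "norm v" s] by (auto simp: v_def dist_norm)
  have r': "(r has_derivative (%h. h * (?D (x + s *\<^sub>R v) v - ?D x v - s * ?H v v))) (at s)"
   if "0 <= s" "s <= 1" for s
  proof -
   have "((%s. x + s *\<^sub>R v) has_derivative (%h. h *\<^sub>R v)) (at s)"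
    by (auto intro!: derivative_eq_intros)
   from diff_chain_at[OF this C2_has_derivative[OF S q d(2)[OF near[OF that]]]]
   have "((%s. q (x + s *\<^sub>R v)) has_derivative (%h. ?D (x + s *\<^sub>R v) (h *\<^sub>R v))) (at s)"
    by (simp add: o_def)
   then have *: "((%s. q (x + s *\<^sub>R v)) has_derivative (%h. h * ?D (x + s *\<^sub>R v) v)) (at s)"
    using linear_scale[OF C2_linear[OF S q d(2)[OF near[OF that]]]] by simp
   show ?thesis unfolding r_def by (rule derivative_eq_intros * refl | simp add: algebra_simps)+
  qed
  have "\<exists>s\<in>{0<..<1}. r 1 - r 0 = (1 - 0) * (?D (x + s *\<^sub>R v) v - ?D x v - s * ?H v v)"
   by (rule mvt_simple) (auto intro: has_derivative_at_withinI r')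
  then obtain s where s: "0 < s" "s < 1" "r 1 - r 0 = ?D (x + s *\<^sub>R v) v - ?D x v - s * ?H v v"
   by auto
  have s': "dist (x + s *\<^sub>R v) x < d" using near s by simp
  have lin: "linear (%w. ?D (x + s *\<^sub>R v) w - ?D x w - s * ?H w v)"
   using C2_linear[OF S q d(2)[OF s']] C2_linear[OF S q x]
    linear_add[OF C2_linear1[OF S q x, of v]] linear_scale[OF C2_linear1[OF S q x, of v]]
   by (intro linearI) (simp_all add: linear_add linear_scale algebra_simps)
  have "?D (x + s *\<^sub>R v) v - ?D x v - s * ?H v v =
    (\<Sum>b\<in>Basis. (v \<bullet> b) * (?D (x + s *\<^sub>R v) b - ?D x b - s * ?H b v))"
   using linear_basis_expansion[OF lin, of v] by simp
  also have "\<bar>...\<bar> <= (\<Sum>b\<in>(Basis::'a set). e1 * (norm v)^2)"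
  proof (rule order.trans[OF sum_abs sum_mono])
   fix b :: 'a assume b: "b \<in> Basis"
   have "?H b (s *\<^sub>R v) = s * ?H b v" using linear_scale[OF C2_linear2[OF S q x]] by simp
   then have "\<bar>?D (x + s *\<^sub>R v) b - ?D x b - s * ?H b v\<bar> <= e1 * norm (s *\<^sub>R v)"
    using d(3)[OF s' b] by simp
   also have "... <= e1 * norm v" using s e1 by (simp add: mult_left_le_one_le)
   finally show "\<bar>(v \<bullet> b) * (?D (x + s *\<^sub>R v) b - ?D x b - s * ?H b v)\<bar> <= e1 * (norm v)^2"
    using Basis_le_norm[OF b, of v] mult_mono[of "\<bar>v \<bullet> b\<bar>" "norm v" "\<bar>?D (x + s *\<^sub>R v) b - ?D x b - s * ?H b v\<bar>" "e1 * norm v"]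
    by (simp add: abs_mult power2_eq_square mult_ac)
  qed
  also have "... = e * (norm v)^2" unfolding e1_def by simp
  finally show "\<bar>q y - q x - ?D x (y - x) - ?H (y - x) (y - x) / 2\<bar> <= e * (norm (y - x))^2"
   using s(3) unfolding r_def v_def by simp
 qed
qed

section \<open>Flat functions and cutoffs\<close>

text \<open>The powers of \<open>1 / r\<close> make the family closed under differentiation, up to
  linear combinations.\<close>

definition flat :: "nat => real => real" where
 "flat m r = (if r > 0 then exp (- 1 / r) / r ^ m else 0)"

lemma flat_nonneg: "flat m r >= 0"
 by (simp add: flat_def)

lemma flat_eq_0: "r <= 0 ==> flat m r = 0"
 by (simp add: flat_def)

lemma flat_pos: "r > 0 ==> flat m r > 0"
 by (simp add: flat_def)

lemma power_le_fact_exp: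
 fixes x :: real
 assumes "x >= 0"
 shows "x ^ m <= fact m * exp x"
proof -
 have "(\<Sum>k\<in>{m}. x ^ k /\<^sub>R fact k) <= (\<Sum>k. x ^ k /\<^sub>R fact k)"
  using assms by (intro sum_le_suminf summable_exp_generic) auto
 then show ?thesis by (simp add: exp_def field_simps)
qed

text \<open>With \<open>x = 1 / r\<close> this is one term of the exponential series. The bound does
  not depend on \<open>r\<close>, as uniform convergence of the series built from
  \<open>flat\<close> requires.\<close>

lemma flat_le_fact: "flat m r <= fact m"
proof (cases "r > 0")
 case True
 have "(1 / r) ^ m <= fact m * exp (1 / r)" using True by (intro power_le_fact_exp) simp
 then have "(1 / r) ^ m * exp (- (1 / r)) <= fact m * exp (1 / r) * exp (- (1 / r))"
  by (rule mult_right_mono) simp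
 then have "(1 / r) ^ m * exp (- (1 / r)) <= fact m" by (simp add: mult.assoc flip: exp_add)
 then show ?thesis using True by (simp add: flat_def power_divide)
qed (simp add: flat_def)

lemma flat_Suc: "r > 0 ==> flat (Suc m) r = flat m r / r"
 by (simp add: flat_def)

lemma flat_has_derivative: "(flat m has_real_derivative flat (m + 2) r - m * flat (m + 1) r) (at r)"
proof (cases r "0 :: real" rule: linorder_cases)
 case less
 have "((%r. 0) has_real_derivative 0) (at r)" by simp
 then have "(flat m has_real_derivative 0) (at r)"
  by (rule has_field_derivative_transform_within_open[of _ _ _ "{..<0}"]) (use less in \<open>auto simp: flat_def\<close>)
 with less show ?thesis by (simp add: flat_def)
next
 case equal
 have "norm ((flat m h - flat m 0) / (h - 0)) <= fact (m + 2) * \<bar>h\<bar>" if "h ~= 0" for h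
 proof (cases "h > 0")
  case True
  \<comment> \<open>Two powers are traded for \<open>h^2\<close>; after division by \<open>h\<close>
    one factor is left to make the quotient tend to 0.\<close>
  then have "flat m h = flat (m + 2) h * h^2" by (simp add: flat_def power2_eq_square)
  also have "... <= fact (m + 2) * h^2" by (intro mult_right_mono flat_le_fact) simp
  finally show ?thesis using True flat_nonneg[of m h] by (simp add: flat_eq_0 power2_eq_square field_simps)
 next
  case False
  then have "flat m h = 0" "flat m 0 = 0" by (auto simp: flat_eq_0)
  then show ?thesis by (simp del: fact_Suc)
 qed
 then have "\<forall>\<^sub>F h in at 0. norm ((flat m h - flat m 0) / (h - 0)) <= fact (m + 2) * \<bar>h\<bar>"
  unfolding eventually_at_filter by (intro always_eventually) blast
 moreover have "((%h::real. fact (m + 2) * \<bar>h\<bar>) \<longlongrightarrow> 0) (at 0)"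
  by (intro tendsto_mult_right_zero tendsto_rabs_zero tendsto_ident_at)
 ultimately have "((%h. (flat m h - flat m 0) / (h - 0)) \<longlongrightarrow> 0) (at 0)"
  by (rule Lim_null_comparison)
 with equal show ?thesis by (simp add: has_field_derivative_iff flat_eq_0)
next
 case greater
 have "((%r. exp (- 1 / r) / r ^ m) has_real_derivative flat (m + 2) r - m * flat (m + 1) r) (at r)"
  using greater by (auto intro!: derivative_eq_intros simp: flat_def divide_simps power2_eq_square)
   (cases m; simp add: algebra_simps)
 then show ?thesis
  by (rule has_field_derivative_transform_within_open[of _ _ _ "{0<..}"]) (use greater in \<open>auto simp: flat_def\<close>)
qed

lemma smooth_on_flat: "smooth_on UNIV (flat m)"
proof (rule smooth_on_real_family)
 show "(flat m has_real_derivative (\<Sum>i<(2::nat). (if i = 0 then 1 else - real m) * flat (if i = 0 then m + 2 else m + 1) x)) (at x)" for m x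
  using flat_has_derivative[of m x] by (simp add: numeral_2_eq_2)
qed

text \<open>The factor \<open>exp 1\<close> makes it vanish at 0, with derivative 1 there. Being
  strictly increasing below 1 and constant above, it truncates a test function without moving its
  superlevel sets at lower levels.\<close>

definition cutoff :: "real => real" where
 "cutoff v = 1 - exp 1 * flat 0 (1 - v)"

lemma smooth_on_cutoff: "smooth_on UNIV cutoff"
proof -
 have "smooth_on UNIV (%v. flat 0 (1 + - v))"
  by (rule smooth_on_compose_affine[OF _ _ _ _ smooth_on_flat]) (auto intro: bounded_linear_minus[OF bounded_linear_ident])
 then show ?thesis
  unfolding cutoff_def[abs_def] by (intro smooth_on_diff smooth_on_cmult smooth_on_const) auto
qed

lemma cutoff_has_derivative: "(cutoff has_real_derivative exp 1 * flat 2 (1 - v)) (at v)"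
proof -
 have "((%v. flat 0 (1 - v)) has_real_derivative (flat (0 + 2) (1 - v) - real 0 * flat (0 + 1) (1 - v)) * (- 1)) (at v)"
  by (rule DERIV_chain2[OF flat_has_derivative]) (auto intro!: derivative_eq_intros)
 then show ?thesis unfolding cutoff_def[abs_def] by (auto intro!: derivative_eq_intros simp: numeral_2_eq_2)
qed

lemma cutoff_deriv_has_derivative:
 "((%v. exp 1 * flat 2 (1 - v)) has_real_derivative exp 1 * (2 * flat 3 (1 - v) - flat 4 (1 - v))) (at v)"
proof -
 have "((%v. flat 2 (1 - v)) has_real_derivative (flat (2 + 2) (1 - v) - real 2 * flat (2 + 1) (1 - v)) * (- 1)) (at v)"
  by (rule DERIV_chain2[OF flat_has_derivative]) (auto intro!: derivative_eq_intros)
 from DERIV_cmult[OF this, of "exp 1"] show ?thesis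
  by (simp add: numeral_3_eq_3 eval_nat_numeral algebra_simps)
qed

lemma cutoff_0: "cutoff 0 = 0"
 by (simp add: cutoff_def flat_def flip: exp_add)

lemma cutoff_eq_1: "v >= 1 ==> cutoff v = 1"
 by (simp add: cutoff_def flat_def)

lemma cutoff_less_1: "v < 1 ==> cutoff v < 1"
 by (simp add: cutoff_def flat_def)

lemma cutoff_strict_mono:
 assumes "v < w" "v < 1"
 shows "cutoff v < cutoff w"
proof (cases "w < 1")
 case True
 then have "- 1 / (1 - v) > - 1 / (1 - w)" using assms by (simp add: field_simps)
 with True assms show ?thesis by (simp add: cutoff_def flat_def)
qed (use cutoff_less_1[OF assms(2)] in \<open>simp add: cutoff_eq_1\<close>)

lemma cutoff_mono: "v <= w ==> cutoff v <= cutoff w"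
 using cutoff_strict_mono[of v w] cutoff_eq_1[of v] cutoff_eq_1[of w] by (cases "v < 1"; cases "v = w") auto

text \<open>For \<open>y = 1 - v\<close> this is \<open>1 - 1 / y \<le> ln y\<close>. Rescaled, it
  keeps a truncated test function above the minimum of the original and the truncation
  height.\<close>

lemma cutoff_ge_min: "cutoff v >= min v 1"
proof (cases "v < 1")
 case True
 have "1 - 1 / (1 - v) <= ln (1 - v)" using True ln_le_minus_one[of "1 / (1 - v)"] by (simp add: ln_div)
 then have "exp (1 - 1 / (1 - v)) <= exp (ln (1 - v))" by simp
 also have "... = 1 - v" using True by simp
 finally show ?thesis using True by (simp add: cutoff_def flat_def flip: exp_add)
qed (simp add: cutoff_eq_1)

section \<open>Series of flat functions, small against a given weight\<close>

lemma summable_flat_series: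
 assumes "summable c" "!!k. c k >= 0"
 shows "summable (%k. c k * flat m (s k))"
proof (rule summable_comparison_test'[where g="%k. c k * fact m" and N=0])
 show "summable (%k. c k * fact m)" using assms(1) by (rule summable_mult2)
 show "norm (c k * flat m (s k)) <= c k * fact m" for k
  using assms(2)[of k] flat_nonneg[of m] flat_le_fact[of m "s k"] by (simp add: abs_mult mult_left_mono)
qed

lemma flat_series_has_derivative:
 assumes c: "summable c" "!!k. c k >= 0"
 shows "((%s. \<Sum>k. c k * flat m (s - a k)) has_real_derivative
   (\<Sum>k. c k * flat (m + 2) (s - a k)) - m * (\<Sum>k. c k * flat (m + 1) (s - a k))) (at s)"
proof -
 let ?f' = "%k s. c k * (flat (m + 2) (s - a k) - m * flat (m + 1) (s - a k))"
 have "((%s. \<Sum>k. c k * flat m (s - a k)) has_real_derivative (\<Sum>k. ?f' k s)) (at s)"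
 proof (rule has_field_derivative_series'(2)[of UNIV])
  show "((%s. c k * flat m (s - a k)) has_real_derivative ?f' k s) (at s within UNIV)" for k s
  proof -
   have "((%s. flat m (s - a k)) has_real_derivative
     (flat (m + 2) (s - a k) - m * flat (m + 1) (s - a k)) * 1) (at s)"
    by (rule DERIV_chain2[OF flat_has_derivative]) (auto intro!: derivative_eq_intros)
   from DERIV_cmult[OF this, of "c k"] show ?thesis by simp
  qed
  show "uniformly_convergent_on UNIV (%n x. \<Sum>i<n. ?f' i x)"
  proof (rule Weierstrass_m_test'[where M="%k. c k * (fact (m + 2) + real m * fact (m + 1))"])
   show "summable (%k. c k * (fact (m + 2) + real m * fact (m + 1)))" using c(1) by (rule summable_mult2)
   show "norm (?f' k x) <= c k * (fact (m + 2) + real m * fact (m + 1))" for k x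
   proof -
    have "real m * flat (m + 1) (x - a k) <= real m * fact (m + 1)"
     by (intro mult_left_mono flat_le_fact) simp
    then have "\<bar>flat (m + 2) (x - a k) - m * flat (m + 1) (x - a k)\<bar> <= fact (m + 2) + real m * fact (m + 1)"
     using flat_le_fact[of "m + 2" "x - a k"] flat_nonneg[of "m + 2" "x - a k"]
      mult_nonneg_nonneg[of "real m" "flat (m + 1) (x - a k)", OF _ flat_nonneg] fact_ge_zero[of "m + 2"]
      mult_nonneg_nonneg[of "real m" "fact (m + 1)"] unfolding abs_le_iff by linarith
    then show ?thesis using c(2)[of k] by (simp add: abs_mult mult_left_mono del: fact_Suc)
   qed
  qed
 qed (auto intro: summable_flat_series c)
 also have "(\<Sum>k. ?f' k s) = (\<Sum>k. c k * flat (m + 2) (s - a k) - m * (c k * flat (m + 1) (s - a k)))"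
  by (simp add: algebra_simps)
 also have "... = (\<Sum>k. c k * flat (m + 2) (s - a k)) - (\<Sum>k. m * (c k * flat (m + 1) (s - a k)))"
  by (intro suminf_diff[symmetric] summable_mult summable_flat_series c)
 also have "(\<Sum>k. m * (c k * flat (m + 1) (s - a k))) = m * (\<Sum>k. c k * flat (m + 1) (s - a k))"
  by (intro suminf_mult summable_flat_series c)
 finally show ?thesis .
qed

text \<open>The weights of the series are chosen against \<open>\<mu>\<close>: the \<open>k\<close>-th summand lives on \<open>s > 1/(k+1)\<close>.\<close>

lemma flat_profile:
 assumes \<mu>: "antimono_on {0<..} \<mu>" "!!s. s > 0 ==> \<mu> s >= 0"
 obtains G G1 G2 :: "real => real" where
  "smooth_on UNIV G"
  "!!s. (G has_real_derivative G1 s) (at s)" "!!s. (G1 has_real_derivative G2 s) (at s)"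
  "!!s. s <= 0 ==> G s = 0 & G1 s = 0 & G2 s = 0"
  "!!s. s > 0 ==> G s > 0 & G1 s > 0"
  "!!s. 0 < s ==> s < 1/2 ==> G2 s > 0"
  "!!s. s > 0 ==> G1 s * \<mu> s <= 4 * s"
proof -
 define a where "a k = 1 / (real k + 1)" for k
 have a: "a k > 0" for k by (simp add: a_def)
 \<comment> \<open>Where the \<open>k\<close>-th summand is nonzero one has \<open>s > a k\<close>,
   hence \<open>\<mu> s \<le> \<mu> (a k)\<close> and \<open>1 / (real k + 1) < s\<close>: the
   denominator absorbs \<open>\<mu> s\<close> and supplies the factor \<open>s\<close>, while the
   geometric factor sums to 2.\<close>
 define c where "c k = (1/2) ^ k / ((real k + 1) * (1 + \<mu> (a k)))" for k
 have \<mu>a: "\<mu> (a k) >= 0" for k using \<mu>(2) a by blast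
 have c0: "c k > 0" for k unfolding c_def using \<mu>a[of k] by (intro divide_pos_pos mult_pos_pos) auto
 have "c k <= (1/2) ^ k" for k
 proof -
  have "1 * 1 <= (real k + 1) * (1 + \<mu> (a k))" using \<mu>a[of k] by (intro mult_mono) auto
  then have "(1/2) ^ k / ((real k + 1) * (1 + \<mu> (a k))) <= (1/2) ^ k / 1"
   by (intro divide_left_mono) auto
  then show ?thesis unfolding c_def by simp
 qed
 then have "norm (c k) <= (1/2) ^ k" for k using c0[of k] by simp
 then have c: "summable c"
  by (intro summable_comparison_test'[of "%k. (1/2) ^ k" 0 c]) (auto intro: summable_geometric)
 have c': "c k >= 0" for k using c0[of k] by simp
 note sm = summable_flat_series[OF c c']
 define F where "F m s = (\<Sum>k. c k * flat m (s - a k))" for m s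
 have F': "(F m has_real_derivative F (m + 2) s - m * F (m + 1) s) (at s)" for m s
  unfolding F_def by (rule flat_series_has_derivative[OF c c'])
 have small: "\<exists>k. a k < s" if "s > 0" for s
 proof -
  obtain k where "inverse (real (Suc k)) < s" using reals_Archimedean[OF \<open>s > 0\<close>] by blast
  then have "a k < s" unfolding a_def inverse_eq_divide by (simp add: add.commute)
  then show ?thesis by blast
 qed
 have pos: "F m s > 0" if "s > 0" for m s
 proof -
  obtain k where "a k < s" using small[OF \<open>s > 0\<close>] by blast
  then show ?thesis unfolding F_def
   by (intro suminf_pos2[OF sm, of _ _ k] mult_nonneg_nonneg c' flat_nonneg mult_pos_pos c0 flat_pos) simp
 qed
 have zero: "F m s = 0" if "s <= 0" for m s
 proof -
  have "flat m (s - a k) = 0" for k using that a[of k] by (intro flat_eq_0) simp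
  then show ?thesis by (simp add: F_def)
 qed
 show ?thesis
 proof
  show "smooth_on UNIV (F 0)"
  proof (rule smooth_on_real_family)
   show "(F m has_real_derivative (\<Sum>i<(2::nat). (if i = 0 then 1 else - real m) * F (if i = 0 then m + 2 else m + 1) x)) (at x)" for m x
    using F'[of m x] by (simp add: numeral_2_eq_2)
  qed
  show "(F 0 has_real_derivative F 2 s) (at s)" for s using F'[of 0 s] by (simp add: numeral_2_eq_2)
  show "(F 2 has_real_derivative F 4 s - 2 * F 3 s) (at s)" for s
   using F'[of 2 s] by (simp add: eval_nat_numeral)
  show "F 0 s = 0 & F 2 s = 0 & F 4 s - 2 * F 3 s = 0" if "s <= 0" for s using zero[OF that] by simp
  show "F 0 s > 0 & F 2 s > 0" if "s > 0" for s using pos[OF that] by simp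
  show "F 4 s - 2 * F 3 s > 0" if s: "0 < s" "s < 1/2" for s
  proof -
   \<comment> \<open>\<open>flat 4\<close> is \<open>flat 3\<close> divided by its argument, and
     that argument is below \<open>s < 1/2\<close>; this is the origin of the threshold 1/2.\<close>
   have eq: "c k * flat 4 (s - a k) - 2 * (c k * flat 3 (s - a k)) =
     c k * flat 3 (s - a k) * (1 / (s - a k) - 2)" if "s > a k" for k
    using flat_Suc[of "s - a k" 3] that by (simp add: eval_nat_numeral algebra_simps)
   have t: "1 / (s - a k) - 2 > 0" if "s > a k" for k using that s a[of k] by (simp add: field_simps)
   have nn: "c k * flat 4 (s - a k) - 2 * (c k * flat 3 (s - a k)) >= 0" for k
   proof (cases "s > a k")
    case True
    then show ?thesis unfolding eq[OF True] using t[OF True]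
     by (intro mult_nonneg_nonneg c' flat_nonneg) simp
   qed (simp add: flat_eq_0)
   obtain k where k: "a k < s" using small s by blast
   have "0 < (\<Sum>k. c k * flat 4 (s - a k) - 2 * (c k * flat 3 (s - a k)))"
   proof (rule suminf_pos2[of _ k])
    show "summable (%k. c k * flat 4 (s - a k) - 2 * (c k * flat 3 (s - a k)))"
     by (intro summable_diff summable_mult sm)
    show "0 < c k * flat 4 (s - a k) - 2 * (c k * flat 3 (s - a k))"
     unfolding eq[OF k] using t[OF k] k by (intro mult_pos_pos c0 flat_pos) auto
   qed (rule nn)
   also have "... = F 4 s - 2 * F 3 s"
    unfolding F_def by (simp only: suminf_diff[OF sm summable_mult[OF sm], symmetric] suminf_mult[OF sm])
   finally show ?thesis .
  qed
  show "F 2 s * \<mu> s <= 4 * s" if s: "s > 0" for s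
  proof -
   have le: "c k * flat 2 (s - a k) * \<mu> s <= (1/2) ^ k * (2 * s)" for k
   proof (cases "s > a k")
    case True
    have ks: "1 / (real k + 1) <= s" using True by (simp add: a_def)
    have "\<mu> s <= \<mu> (a k)" using monotone_onD[OF \<mu>(1), of "a k" s] a[of k] True by simp
    then have m: "\<mu> s / (1 + \<mu> (a k)) <= 1" using \<mu>a[of k] by (simp add: field_simps)
    have "c k * flat 2 (s - a k) * \<mu> s = (1/2) ^ k * (flat 2 (s - a k) * (1 / (real k + 1) * (\<mu> s / (1 + \<mu> (a k)))))"
     unfolding c_def by simp
    also have "... <= (1/2) ^ k * (2 * (s * 1))"
     using flat_le_fact[of 2 "s - a k"] ks m \<mu>(2)[OF s] \<mu>a[of k] s
     by (intro mult_left_mono mult_mono) (auto simp: flat_nonneg fact_2)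
    finally show ?thesis by simp
   qed (use s in \<open>simp add: flat_eq_0\<close>)
   have "F 2 s * \<mu> s = (\<Sum>k. c k * flat 2 (s - a k) * \<mu> s)"
    unfolding F_def by (rule suminf_mult2[OF sm])
   also have "... <= (\<Sum>k. (1/2) ^ k * (2 * s))"
    by (intro suminf_le le summable_mult2 sm summable_geometric) simp
   also have "... = 4 * s"
    using suminf_mult2[OF summable_geometric[of "1/2 :: real"], of "2 * s"] suminf_geometric[of "1/2 :: real"] by simp
   finally show ?thesis .
  qed
 qed
qed

lemma half_line_deriv_cong:
 assumes "!!r. r >= 0 ==> f r = g r" "r >= 0"
 shows "half_line_deriv f r = half_line_deriv g r"
proof -
 have "(f has_vector_derivative D) (at r within {0..}) \<longleftrightarrow> (g has_vector_derivative D) (at r within {0..})" for D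
  unfolding has_vector_derivative_def by (rule has_derivative_within_cong) (use assms in auto)
 then show ?thesis unfolding half_line_deriv_def vector_derivative_def by simp
qed

lemma half_line_deriv_eq:
 assumes "(f has_real_derivative f') (at r)" "r >= 0"
 shows "half_line_deriv f r = f'"
 using assms frechet_derivative_half_line(2)[of f r] DERIV_imp_deriv real_differentiable_def by metis

text \<open>The barriers have critical points, where the test function must be dominated by a
  profile \<open>g\<close> with \<open>g' * \<gamma>\<close> tending to 0, and
  \<open>\<gamma>\<close> may blow up at 0. The function from \<open>flat_profile\<close> decays
  against \<open>\<gamma>\<close>; composing it with \<open>cutoff\<close> turns it into a step that
  is still strictly increasing between 0 and 1.\<close>

lemma flat_step:
 assumes \<gamma>: "antimono_on {0<..} \<gamma>" and S: "S > 0" and c: "c > 0"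
 obtains G G1 :: "real => real" where
  "smooth_on UNIV G" "!!s. (G has_real_derivative G1 s) (at s)"
  "!!s. s <= 0 ==> G s = 0 & G1 s = 0" "!!s. s >= 1 ==> G s = 1"
  "!!s. 0 < s ==> s < 1 ==> G1 s > 0" "!!s. s < 1 ==> G s < 1" "mono G"
  "!!s. G s >= 0" "!!s. s > 0 ==> G s > 0"
  "!!s t. 0 < s ==> s < 1 ==> G t >= G s \<longleftrightarrow> t >= s"
  "(%\<rho>. S * G (c * \<rho>)) \<in> test_profiles \<gamma>"
proof -
 \<comment> \<open>\<open>\<gamma>\<close> need not have a sign. Up to \<open>1 / c\<close> it is
   bounded below by \<open>\<gamma> (1 / c)\<close>, so that in the variable
   \<open>s = c * \<rho>\<close> this \<open>\<mu>\<close> dominates its absolute value and is still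
   antitone.\<close>
 define \<mu> where "\<mu> s = max 0 (\<gamma> (s / c)) + \<bar>\<gamma> (1 / c)\<bar>" for s
 have "antimono_on {0<..} \<mu>"
 proof (rule monotone_onI)
  fix x y :: real assume "x \<in> {0<..}" "y \<in> {0<..}" "x <= y"
  then have "\<gamma> (y / c) <= \<gamma> (x / c)"
   using c by (intro monotone_onD[OF \<gamma>]) (auto simp: divide_right_mono)
  then show "\<mu> x >= \<mu> y" unfolding \<mu>_def by auto
 qed
 moreover have "\<mu> s >= 0" for s unfolding \<mu>_def by simp
 ultimately obtain G G1 G2 where G: "smooth_on UNIV G"
  "!!s. (G has_real_derivative G1 s) (at s)" "!!s. (G1 has_real_derivative G2 s) (at s)"
  "!!s. s <= 0 ==> G s = 0 & G1 s = 0 & G2 s = 0"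
  "!!s. s > 0 ==> G s > 0 & G1 s > 0"
  "!!s. 0 < s ==> s < 1/2 ==> G2 s > 0"
  "!!s. s > 0 ==> G1 s * \<mu> s <= 4 * s" using flat_profile[of \<mu>] by blast
 have G_less: "G s < G t" if "s < t" "t > 0" for s t
 proof (cases "s <= 0")
  case True
  then show ?thesis using G(4,5) that by fastforce
 next
  case False
  then show ?thesis using that by (intro DERIV_pos_imp_increasing[of s t G]) (use G(2,5) in force)+
 qed
 have G_mono: "G s <= G t" if "s <= t" for s t
  using that G_less[of s t] G(4)[of s] G(4)[of t] by (cases "s = t"; cases "t > 0") auto
 have G1: "G 1 > 0" using G(5) by simp
 define T where "T s = cutoff (G s / G 1)" for s
 define T1 where "T1 s = exp 1 * flat 2 (1 - G s / G 1) * (G1 s / G 1)" for s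
 define T2 where "T2 s = exp 1 * (2 * flat 3 (1 - G s / G 1) - flat 4 (1 - G s / G 1)) * (G1 s / G 1)^2
   + exp 1 * flat 2 (1 - G s / G 1) * (G2 s / G 1)" for s
 have T': "(T has_real_derivative T1 s) (at s)" for s
  unfolding T_def T1_def by (rule DERIV_chain2[OF cutoff_has_derivative]) (intro DERIV_cdivide G)
 have T1': "(T1 has_real_derivative T2 s) (at s)" for s
 proof -
  have "((%s. exp 1 * flat 2 (1 - G s / G 1)) has_real_derivative
    exp 1 * (2 * flat 3 (1 - G s / G 1) - flat 4 (1 - G s / G 1)) * (G1 s / G 1)) (at s)"
   by (rule DERIV_chain2[OF cutoff_deriv_has_derivative]) (intro DERIV_cdivide G)
  from DERIV_mult[OF this DERIV_cdivide[OF G(3)[of s], of "G 1"]]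
  show ?thesis unfolding T1_def T2_def by (simp add: power2_eq_square algebra_simps)
 qed
 have smT: "smooth_on UNIV T"
 proof -
  have "smooth_on UNIV (%s. (1 / G 1) * G s)" by (intro smooth_on_cmult G open_UNIV)
  from smooth_on_compose_real[OF open_UNIV smooth_on_cutoff this]
  show ?thesis unfolding T_def[abs_def] by simp
 qed
 have T0: "T s = 0 & T1 s = 0 & T2 s = 0" if "s <= 0" for s
  using G(4)[OF that] by (simp add: T_def T1_def T2_def cutoff_0)
 have ratio: "G s / G 1 < 1" if "s < 1" for s using G_less[OF that] G1 by simp
 have T1pos: "T1 s > 0" if "0 < s" "s < 1" for s unfolding T1_def using G(5)[OF that(1)] G1 ratio[OF that(2)]
  by (intro mult_pos_pos divide_pos_pos flat_pos) auto
 have T_mono: "mono T"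
  unfolding T_def[abs_def] by (intro monoI cutoff_mono divide_right_mono G_mono) (use G1 in auto)
 have T_less: "T s < T t" if "s < t" "0 < t" "s < 1" for s t
  unfolding T_def using G_less[OF that(1,2)] G1 ratio[OF that(3)]
  by (intro cutoff_strict_mono divide_strict_right_mono)
 show ?thesis
 proof
  show "smooth_on UNIV T" by fact
  show "(T has_real_derivative T1 s) (at s)" for s by fact
  show "T s = 0 & T1 s = 0" if "s <= 0" for s using T0[OF that] by simp
  show "T s = 1" if "s >= 1" for s unfolding T_def using G_mono[OF that] G1 by (intro cutoff_eq_1) simp
  show "T1 s > 0" if "0 < s" "s < 1" for s by (rule T1pos[OF that])
  show "T s < 1" if "s < 1" for s unfolding T_def using ratio[OF that] by (rule cutoff_less_1)
  show "mono T" by fact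
  show "T s >= 0" for s using monoD[OF T_mono, of 0 s] T0[of 0] T0[of s] by (cases "s >= 0") auto
  show "T s > 0" if "s > 0" for s using T_less[of 0 s] T0[of 0] that by simp
  show "T t >= T s \<longleftrightarrow> t >= s" if "0 < s" "s < 1" for s t
   using T_less[of t s] that monoD[OF T_mono, of s t] by (cases "t >= s") auto
  let ?g = "%\<rho>. S * T (c * \<rho>)"
  have g1: "(?g has_real_derivative S * (T1 (c * \<rho>) * c)) (at \<rho>)" for \<rho>
   by (intro DERIV_cmult DERIV_chain2[OF T']) (auto intro!: derivative_eq_intros)
  have h1: "half_line_deriv ?g \<rho> = S * (T1 (c * \<rho>) * c)" if "\<rho> >= 0" for \<rho>
   using half_line_deriv_eq[OF g1 that] .
  have "((%\<rho>. S * (T1 (c * \<rho>) * c)) has_real_derivative S * (T2 (c * \<rho>) * c * c)) (at \<rho>)" for \<rho>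
   by (intro DERIV_cmult DERIV_cmult_right DERIV_chain2[OF T1']) (auto intro!: derivative_eq_intros)
  note g2 = this
  have h2: "half_line_deriv (half_line_deriv ?g) \<rho> = S * (T2 (c * \<rho>) * c * c)" if "\<rho> >= 0" for \<rho>
   using half_line_deriv_cong[of "half_line_deriv ?g", OF h1 that] half_line_deriv_eq[OF g2 that] by simp
  have "smooth_on UNIV (%\<rho>. T (0 + c * \<rho>))"
   by (rule smooth_on_compose_affine[OF _ _ _ _ smT]) (auto intro: bounded_linear_mult_right)
  then have "smooth_on UNIV ?g" by (intro smooth_on_cmult) simp_all
  then have 1: "smooth_on {0..} ?g" by (rule smooth_on_half_line)
  have 2: "\<exists>\<delta>>0. \<forall>r. 0 < r & r < \<delta> --> half_line_deriv (half_line_deriv ?g) r > 0"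
  proof -
   have "(G \<longlongrightarrow> G 0) (at_right 0)"
    using DERIV_isCont[OF G(2)] by (simp add: continuous_at isCont_def filterlim_at_split)
   then have "\<forall>\<^sub>F s in at_right 0. G s < G 1 / 2"
    using G1 G(4)[of 0] by (intro order_tendstoD(2)) auto
   then obtain \<delta> where \<delta>: "\<delta> > 0" "!!s. 0 < s ==> s < \<delta> ==> G s < G 1 / 2"
    unfolding eventually_at_right_field by blast
   \<comment> \<open>The second derivative of \<open>cutoff\<close> at \<open>v\<close> is positive
     for \<open>v < 1/2\<close>, by the relation between \<open>flat 3\<close> and
     \<open>flat 4\<close>; hence the bound \<open>G s < G 1 / 2\<close>.\<close>
   have "T2 s > 0" if "0 < s" "s < min \<delta> (1/2)" for s
   proof -
    have s: "G s / G 1 < 1 / 2" using \<delta>(2)[of s] that G1 by (simp add: field_simps)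
    then have y: "1 - G s / G 1 > 1 / 2" by simp
    define y where "y = 1 - G s / G 1"
    have "y > 1 / 2" using y[folded y_def] .
    then have y0: "y > 0" "2 * y > 1" by linarith+
    have "flat 4 y = flat 3 y / y" using flat_Suc[of y 3] y0 by simp
    moreover have "flat 3 y * 1 < flat 3 y * (2 * y)"
     using y0 flat_pos[of y 3] by (intro mult_strict_left_mono) auto
    ultimately have "flat 4 y < 2 * flat 3 y" using y0 by (simp add: pos_divide_less_eq mult_ac)
    then have "flat 4 (1 - G s / G 1) < 2 * flat 3 (1 - G s / G 1)" unfolding y_def .
    then show ?thesis unfolding T2_def using y G(5,6)[of s] that G1
     by (intro add_pos_pos mult_pos_pos divide_pos_pos flat_pos zero_less_power) auto
   qed
   note T2_pos = this
   have "half_line_deriv (half_line_deriv ?g) r > 0" if r: "0 < r" "r < min \<delta> (1/2) / c" for r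
   proof -
    have "c * r < min \<delta> (1/2)" using r c pos_less_divide_eq[of c r] by (simp only: mult.commute)
    then show ?thesis using T2_pos[of "c * r"] S c r by (simp add: h2)
   qed
   then show ?thesis using c \<delta>(1) by (intro exI[of _ "min \<delta> (1/2) / c"]) auto
  qed
  have 3: "\<exists>M>0. \<forall>r\<ge>M. ?g r = ?g M"
  proof (intro exI[of _ "1 / c"] conjI allI impI)
   fix r assume "r >= 1 / c"
   then have "c * r >= 1" using c by (simp add: field_simps)
   then show "?g r = ?g (1 / c)"
    unfolding T_def using G_mono[of 1 "c * r"] G(5)[of 1] c by (simp add: cutoff_eq_1)
  qed (use c in simp)
  have 4: "((%\<rho>. half_line_deriv ?g \<rho> * \<gamma> \<rho>) \<longlongrightarrow> 0) (at_right 0)"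
  proof (rule Lim_null_comparison)
   let ?C = "S * c * (exp 1 * 2 * 4 / G 1 * c)"
   show "((%\<rho>. ?C * \<rho>) \<longlongrightarrow> 0) (at_right 0)" using G1 by (auto intro!: tendsto_eq_intros)
   show "\<forall>\<^sub>F \<rho> in at_right 0. norm (half_line_deriv ?g \<rho> * \<gamma> \<rho>) <= ?C * \<rho>"
    unfolding eventually_at_right_field
   proof (intro exI[of _ "1 / c"] conjI allI impI)
    fix \<rho> assume \<rho>: "0 < \<rho>" "\<rho> < 1 / c"
    have cr: "c * \<rho> > 0" "c * \<rho> < 1" using \<rho> c by (auto simp: field_simps)
    have "\<gamma> (1 / c) <= \<gamma> \<rho>" using monotone_onD[OF \<gamma>, of \<rho> "1 / c"] \<rho> c by simp
    then have "\<bar>\<gamma> \<rho>\<bar> <= \<mu> (c * \<rho>)" unfolding \<mu>_def using c by (auto simp: abs_if max_def)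
    then have "G1 (c * \<rho>) * \<bar>\<gamma> \<rho>\<bar> <= G1 (c * \<rho>) * \<mu> (c * \<rho>)"
     using G(5)[OF cr(1)] by (intro mult_left_mono) auto
    also have "... <= 4 * (c * \<rho>)" by (rule G(7)[OF cr(1)])
    finally have g: "G1 (c * \<rho>) * \<bar>\<gamma> \<rho>\<bar> <= 4 * (c * \<rho>)" .
    have "T1 (c * \<rho>) * \<bar>\<gamma> \<rho>\<bar> = exp 1 * flat 2 (1 - G (c * \<rho>) / G 1) * (G1 (c * \<rho>) * \<bar>\<gamma> \<rho>\<bar>) / G 1"
     unfolding T1_def by simp
    also have "... <= exp 1 * 2 * (4 * (c * \<rho>)) / G 1"
    proof (intro divide_right_mono mult_mono[OF _ g])
     show "exp 1 * flat 2 (1 - G (c * \<rho>) / G 1) <= exp 1 * 2"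
      using flat_le_fact[of 2 "1 - G (c * \<rho>) / G 1"] by (simp add: fact_2)
    qed (use G(5)[OF cr(1)] G1 in \<open>simp_all add: less_imp_le\<close>)
    finally have "S * c * (T1 (c * \<rho>) * \<bar>\<gamma> \<rho>\<bar>) <= S * c * (exp 1 * 2 * (4 * (c * \<rho>)) / G 1)"
     using S c by (intro mult_left_mono) auto
    then show "norm (half_line_deriv ?g \<rho> * \<gamma> \<rho>) <= ?C * \<rho>"
     using h1[of \<rho>] \<rho> S c T1pos[OF cr] by (simp add: abs_mult mult_ac)
   qed (use c in simp)
  qed
  show "?g \<in> test_profiles \<gamma>"
   unfolding test_profiles_def using 1 2 3 4 h1[of 0] h2[of 0] T0[of 0] by simp
 qed
qed

section \<open>The signed distance from a level set\<close>

lemma balls_disjoint_dist: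
 fixes c d :: "'a::real_normed_vector"
 assumes "ball c r Int ball d s = {}" "r > 0" "s > 0"
 shows "dist c d >= r + s"
proof (rule ccontr)
 assume "~ ?thesis"
 then have less: "dist c d < r + s" by simp
 define w where "w = c + (r / (r + s)) *\<^sub>R (d - c)"
 have "dist c w = r / (r + s) * dist c d" using assms by (simp add: w_def dist_norm norm_minus_commute)
 also have "... < r / (r + s) * (r + s)" using less assms by (intro mult_strict_left_mono) auto
 finally have "dist c w < r" using assms by simp
 have "d - w = (1 - r / (r + s)) *\<^sub>R (d - c)" by (simp add: w_def algebra_simps)
 also have "1 - r / (r + s) = s / (r + s)" using assms by (simp add: field_simps)
 finally have "dist d w = s / (r + s) * dist c d" using assms by (simp add: dist_norm norm_minus_commute)
 also have "... < s / (r + s) * (r + s)" using less assms by (intro mult_strict_left_mono) auto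
 finally have "dist d w < s" using assms by simp
 with \<open>dist c w < r\<close> assms(1) show False by auto
qed

lemma infdist_closure: "infdist x (closure A) = infdist x A"
 by (simp add: infdist_eq_setdist)

lemma infdist_geI: "A ~= {} ==> (!!a. a \<in> A ==> r <= dist x a) ==> r <= infdist x A"
 by (auto simp: infdist_notempty intro: cINF_greatest)

lemma signed_dist_compl: "signed_dist (- E) x = - signed_dist E x"
 by (simp add: signed_dist_def)

lemma signed_dist_le:
 assumes "ball c R <= E" "R > 0" "- E ~= {}"
 shows "signed_dist E z <= dist z c - R"
proof (cases "dist z c < R")
 case True
 then have "infdist z E = 0" using assms by (auto simp: dist_commute)
 moreover have "R - dist z c <= infdist z (- E)"
 proof (rule infdist_geI[OF assms(3)])
  fix a assume "a \<in> - E"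
  then have "dist c a >= R" using assms(1) by (auto simp: not_less)
  then show "R - dist z c <= dist z a" using dist_triangle[of c a z] by (simp add: dist_commute)
 qed
 ultimately show ?thesis by (simp add: signed_dist_def)
next
 case False
 then have nz: "z ~= c" using assms by auto
 define w where "w = c + (R / dist z c) *\<^sub>R (z - c)"
 have "dist c w = R" using nz assms(2) by (simp add: w_def dist_norm)
 then have "w \<in> closure E" using closure_mono[OF assms(1)] assms(2) by auto
 moreover have "dist z w = dist z c - R"
 proof -
  have "z - w = (1 - R / dist z c) *\<^sub>R (z - c)" by (simp add: w_def algebra_simps)
  then have "dist z w = \<bar>1 - R / dist z c\<bar> * dist z c" by (simp add: dist_norm)
  also have "... = \<bar>(1 - R / dist z c) * dist z c\<bar>" by (simp add: abs_mult)
  also have "(1 - R / dist z c) * dist z c = dist z c - R" using nz by (simp add: field_simps)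
  finally show ?thesis using False by simp
 qed
 ultimately have "infdist z E <= dist z c - R" using infdist_le[of w "closure E" z] by (simp add: infdist_closure)
 then show ?thesis using infdist_nonneg[of z "- E"] by (simp add: signed_dist_def)
qed

lemma signed_dist_ge:
 assumes "ball c R Int E = {}" "R > 0" "E ~= {}"
 shows "signed_dist E z >= R - dist z c"
 using signed_dist_le[of c R "- E" z] assms by (simp add: signed_dist_compl disjoint_eq_subset_Compl)

lemma has_derivative_squeeze:
 fixes f l u :: "'a::real_normed_vector => real"
 assumes "(l has_derivative D) (at z)" "(u has_derivative D) (at z)"
  and "!!w. l w <= f w" "!!w. f w <= u w" "l z = u z"
 shows "(f has_derivative D) (at z)" unfolding has_derivative_at_alt
proof (intro conjI allI impI)
 show "bounded_linear D" using assms(1) by (rule has_derivative_bounded_linear)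
 fix e :: real assume "e > 0"
 obtain d1 where d1: "d1 > 0" "!!y. norm (y - z) < d1 ==> norm (l y - l z - D (y - z)) <= e * norm (y - z)"
  using assms(1) \<open>e > 0\<close> unfolding has_derivative_at_alt by blast
 obtain d2 where d2: "d2 > 0" "!!y. norm (y - z) < d2 ==> norm (u y - u z - D (y - z)) <= e * norm (y - z)"
  using assms(2) \<open>e > 0\<close> unfolding has_derivative_at_alt by blast
 have fz: "f z = l z" using assms(3,4)[of z] assms(5) by simp
 show "\<exists>d>0. \<forall>y. norm (y - z) < d --> norm (f y - f z - D (y - z)) <= e * norm (y - z)"
 proof (intro exI[of _ "min d1 d2"] conjI allI impI)
  fix y assume "norm (y - z) < min d1 d2"
  then show "norm (f y - f z - D (y - z)) <= e * norm (y - z)"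
   using d1(2)[of y] d2(2)[of y] assms(3)[of y] assms(4)[of y] assms(5) fz by (simp add: abs_le_iff)
 qed (use d1 d2 in simp)
qed

lemma has_derivative_dist:
 fixes z c :: "'a::real_inner"
 assumes "z ~= c"
 shows "((%w. dist w c) has_derivative (%v. v \<bullet> sgn (z - c))) (at z)"
proof -
 have "(norm has_derivative (%v. v \<bullet> sgn (z - c))) (at (z - c))"
  using assms by (intro has_derivative_norm) simp
 moreover have "((%w. w - c) has_derivative (%v. v)) (at z)" by (auto intro!: derivative_eq_intros)
 ultimately show ?thesis
  using diff_chain_at[of "%w. w - c" "%v. v" z norm "%v. v \<bullet> sgn (z - c)"] by (simp add: o_def dist_norm)
qed

lemma grad_eqI:
 assumes "(f has_derivative (%v. v \<bullet> p)) (at x)"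
 shows "grad f x = p"
 unfolding grad_def frechet_derivative_at[OF assms, symmetric] by (simp add: vec_eq_iff inner_axis')

text \<open>The signed distance lies between those of the two tangent balls, which agree in value
  and derivative along the common normal; differentiability comes from the balls rather than from
  \<open>E\<close>.\<close>

lemma outer_normal_sandwich:
 fixes \<nu> :: "real^'n"
 assumes "ball (y - R *\<^sub>R \<nu>) R <= E" "ball (y + R *\<^sub>R \<nu>) R Int E = {}" "norm \<nu> = 1" "\<bar>s\<bar> < R"
 shows "outer_normal E (y + s *\<^sub>R \<nu>) = \<nu>"
proof -
 let ?z = "y + s *\<^sub>R \<nu>"
 have R: "R > 0" using assms by simp
 have ne: "E ~= {}" "- E ~= {}"
  using assms(1,2) R centre_in_ball[of "y - R *\<^sub>R \<nu>" R] centre_in_ball[of "y + R *\<^sub>R \<nu>" R] by blast+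
 have z1: "?z - (y - R *\<^sub>R \<nu>) = (s + R) *\<^sub>R \<nu>" by (simp add: algebra_simps)
 have z2: "?z - (y + R *\<^sub>R \<nu>) = (s - R) *\<^sub>R \<nu>" by (simp add: algebra_simps)
 have nz: "\<nu> ~= 0" using assms(3) by auto
 have "sgn \<nu> = \<nu>" using assms(3) by (simp add: sgn_div_norm)
 moreover have "s + R > 0" "s - R < 0" using assms(4) by linarith+
 then have "sgn (s + R) = 1" "sgn (s - R) = - 1" by (simp_all add: sgn_if)
 ultimately have s1: "sgn ((s + R) *\<^sub>R \<nu>) = \<nu>" "sgn ((s - R) *\<^sub>R \<nu>) = - \<nu>"
  by (simp_all add: sgn_scaleR)
 have ne1: "?z ~= y - R *\<^sub>R \<nu>" "?z ~= y + R *\<^sub>R \<nu>" using z1 z2 nz assms(4) by auto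
 have "(signed_dist E has_derivative (%v. v \<bullet> \<nu>)) (at ?z)"
 proof (rule has_derivative_squeeze)
  show "((%w. R - dist w (y + R *\<^sub>R \<nu>)) has_derivative (%v. v \<bullet> \<nu>)) (at ?z)"
   using has_derivative_dist[OF ne1(2)] unfolding z2 s1 by (auto intro!: derivative_eq_intros)
  show "((%w. dist w (y - R *\<^sub>R \<nu>) - R) has_derivative (%v. v \<bullet> \<nu>)) (at ?z)"
   using has_derivative_dist[OF ne1(1)] unfolding z1 s1 by (auto intro!: derivative_eq_intros)
  show "R - dist w (y + R *\<^sub>R \<nu>) <= signed_dist E w" for w
   by (rule signed_dist_ge) (use assms R ne in auto)
  show "signed_dist E w <= dist w (y - R *\<^sub>R \<nu>) - R" for w
   by (rule signed_dist_le) (use assms R ne in auto)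
  show "R - dist ?z (y + R *\<^sub>R \<nu>) = dist ?z (y - R *\<^sub>R \<nu>) - R"
   unfolding dist_norm z1 z2 using assms(3,4) by simp
 qed
 then show ?thesis unfolding outer_normal_def by (rule grad_eqI)
qed

definition tangent_proj :: "'a::real_inner => 'a => 'a" where
 "tangent_proj \<nu> v = v - (\<nu> \<bullet> v) *\<^sub>R \<nu>"

lemma bounded_linear_tangent_proj: "bounded_linear (tangent_proj \<nu>)"
 unfolding tangent_proj_def
 by (intro bounded_linear_sub bounded_linear_ident bounded_linear_scaleR_const bounded_linear_inner_right)

lemma has_derivative_quadratic_error:
 fixes f :: "'a::real_normed_vector => 'b::real_normed_vector"
 assumes "bounded_linear D" "d > 0"
  and "!!y. norm (y - x) < d ==> norm (f y - f x - D (y - x)) <= K * (norm (y - x))^2"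
 shows "(f has_derivative D) (at x)" unfolding has_derivative_at_alt
proof (intro conjI allI impI assms(1))
 fix e :: real assume e: "e > 0"
 show "\<exists>d>0. \<forall>y. norm (y - x) < d --> norm (f y - f x - D (y - x)) <= e * norm (y - x)"
 proof (intro exI[of _ "min d (e / (\<bar>K\<bar> + 1))"] conjI allI impI)
  fix y assume y: "norm (y - x) < min d (e / (\<bar>K\<bar> + 1))"
  have "(\<bar>K\<bar> + 1) * norm (y - x) <= e" using y by (simp add: field_simps)
  moreover have "K * norm (y - x) <= (\<bar>K\<bar> + 1) * norm (y - x)" by (intro mult_right_mono) auto
  ultimately have "K * norm (y - x) * norm (y - x) <= e * norm (y - x)" by (intro mult_right_mono) auto
  then show "norm (f y - f x - D (y - x)) <= e * norm (y - x)"
   using assms(3)[of y] y by (simp add: power2_eq_square)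
 qed (use assms e in auto)
qed

context
 fixes q :: "real^'n => real" and g :: "real^'n => real^'n" and x0 :: "real^'n"
  and \<rho> C m a :: real and E :: "(real^'n) set"
 assumes \<rho>: "\<rho> > 0" and C: "C >= 0" and m: "m > 0"
  and expansion: "!!y w. y \<in> ball x0 \<rho> ==> w \<in> ball x0 \<rho> ==>
    \<bar>q w - q y - g y \<bullet> (w - y)\<bar> <= C * (norm (w - y))^2"
  and g_ge: "!!y. y \<in> ball x0 \<rho> ==> norm (g y) >= m"
  and E: "!!w. w \<in> ball x0 \<rho> ==> w \<in> E \<longleftrightarrow> q w >= a"
begin

abbreviation "normal y \<equiv> - sgn (g y)"
text \<open>A ball of radius \<open>r\<close> tangent at \<open>y\<close> stays on one side of the
  level set when \<open>2 * r * C < m\<close>; the bound \<open>\<rho> / 4\<close> keeps it inside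
  the ball where the expansion is known.\<close>

abbreviation "radius \<equiv> min (m / (2 * C + 1)) (\<rho> / 4)"

lemma radius_pos: "radius > 0" using \<rho> C m by simp

lemma norm_normal: "y \<in> ball x0 \<rho> ==> norm (normal y) = 1"
 using g_ge[of y] m by (simp add: norm_sgn) fastforce

text \<open>A point \<open>y + \<eta>\<close> of the ball satisfies \<open>(norm \<eta>)^2 < 2 * r *
  (\<sigma> * (normal y \<bullet> \<eta>))\<close>, so the quadratic error is smaller than the
  linear term. The sign \<open>\<sigma>\<close> treats the inner and the outer ball
  together.\<close>

lemma touching_ball:
 assumes y: "dist x0 y < \<rho> / 2" and r: "0 < r" "r <= radius" and \<sigma>: "\<bar>\<sigma>\<bar> = 1"
  and w: "w \<in> ball (y + (\<sigma> * r) *\<^sub>R normal y) r"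
 shows "w \<in> ball x0 \<rho>" and "\<sigma> * (q w - q y) < 0"
proof -
 have yb: "y \<in> ball x0 \<rho>" using y \<rho> by simp
 define \<eta> where "\<eta> = w - y"
 let ?\<nu> = "normal y"
 have nu: "norm ?\<nu> = 1" by (rule norm_normal[OF yb])
 have "norm (\<eta> - (\<sigma> * r) *\<^sub>R ?\<nu>) < r"
  using w by (simp add: \<eta>_def dist_norm norm_minus_commute algebra_simps)
 then have lt: "norm (\<eta> - (\<sigma> * r) *\<^sub>R ?\<nu>) ^ 2 < r^2" by (intro power_strict_mono) auto
 have \<sigma>2: "\<sigma> * \<sigma> = 1" using \<sigma> by (metis abs_mult_self_eq mult_1)
 have "norm (\<eta> - (\<sigma> * r) *\<^sub>R ?\<nu>) ^ 2 = \<eta> \<bullet> \<eta> - 2 * (\<sigma> * r) * (\<eta> \<bullet> ?\<nu>) + (\<sigma> * r)^2 * (?\<nu> \<bullet> ?\<nu>)"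
  unfolding power2_norm_eq_inner
  by (simp add: inner_diff_left inner_diff_right inner_commute power2_eq_square algebra_simps)
 also have "?\<nu> \<bullet> ?\<nu> = 1" using nu by (metis norm_eq_1)
 also have "(\<sigma> * r)^2 = r^2" using \<sigma>2 by (simp add: power2_eq_square mult_ac)
 finally have key: "(norm \<eta>)^2 < 2 * r * (\<sigma> * (?\<nu> \<bullet> \<eta>))"
  using lt by (simp add: power2_norm_eq_inner inner_commute mult_ac)
 have "\<sigma> * (?\<nu> \<bullet> \<eta>) <= norm \<eta>"
  using Cauchy_Schwarz_ineq2[of ?\<nu> \<eta>] nu \<sigma> abs_ge_self[of "\<sigma> * (?\<nu> \<bullet> \<eta>)"] by (simp add: abs_mult)
 then have "(norm \<eta>)^2 < 2 * r * norm \<eta>"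
  using key r mult_left_mono[of "\<sigma> * (?\<nu> \<bullet> \<eta>)" "norm \<eta>" "2 * r"] by linarith
 then have n: "norm \<eta> < 2 * r" "\<eta> ~= 0"
  using norm_ge_zero[of \<eta>] by (auto simp: power2_eq_square mult_less_cancel_right)
 have "dist x0 w <= dist x0 y + dist y w" by (rule dist_triangle)
 also have "dist y w = norm \<eta>" by (simp add: \<eta>_def dist_norm norm_minus_commute)
 finally show wb: "w \<in> ball x0 \<rho>" using n(1) y r by simp
 have "g y = - (norm (g y) *\<^sub>R ?\<nu>)" by (cases "g y = 0") (simp_all add: sgn_div_norm)
 then have gw: "g y \<bullet> \<eta> = - (norm (g y) * (?\<nu> \<bullet> \<eta>))" by (metis inner_minus_left inner_scaleR_left)
 have pos: "\<sigma> * (?\<nu> \<bullet> \<eta>) > 0"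
  using key r by (smt (verit) mult_nonneg_nonpos zero_le_power2)
 have "\<sigma> * (q w - q y) <= \<sigma> * (g y \<bullet> \<eta>) + C * (norm \<eta>)^2"
 proof -
  have "\<sigma> * (q w - q y - g y \<bullet> \<eta>) <= \<bar>q w - q y - g y \<bullet> \<eta>\<bar>"
   using \<sigma> abs_ge_self[of "\<sigma> * (q w - q y - g y \<bullet> \<eta>)"] by (simp add: abs_mult)
  then show ?thesis using expansion[OF yb wb] by (simp add: \<eta>_def algebra_simps)
 qed
 also have "\<sigma> * (g y \<bullet> \<eta>) = - (norm (g y) * (\<sigma> * (?\<nu> \<bullet> \<eta>)))" unfolding gw by simp
 also have "... <= - (m * (\<sigma> * (?\<nu> \<bullet> \<eta>)))"
  using mult_right_mono[OF g_ge[OF yb], of "\<sigma> * (?\<nu> \<bullet> \<eta>)"] pos by simp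
 also have "- (m * (\<sigma> * (?\<nu> \<bullet> \<eta>))) + C * (norm \<eta>)^2 < 0"
 proof -
  have "r * (2 * C + 1) <= m" using r C by (simp add: le_divide_eq)
  then have "2 * r * C < m" using r by (simp add: algebra_simps)
  have "C * (norm \<eta>)^2 <= C * (2 * r * (\<sigma> * (?\<nu> \<bullet> \<eta>)))"
   using key C by (intro mult_left_mono) auto
  also have "... = 2 * r * C * (\<sigma> * (?\<nu> \<bullet> \<eta>))" by simp
  also have "... < m * (\<sigma> * (?\<nu> \<bullet> \<eta>))"
   using \<open>2 * r * C < m\<close> pos by (rule mult_strict_right_mono)
  finally show ?thesis by simp
 qed
 finally show "\<sigma> * (q w - q y) < 0" by simp
qed

lemma touching_balls:
 assumes "dist x0 y < \<rho> / 2" "q y = a" "0 < r" "r <= radius"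
 shows "ball (y - r *\<^sub>R normal y) r <= E" "ball (y + r *\<^sub>R normal y) r Int E = {}"
proof -
 show "ball (y - r *\<^sub>R normal y) r <= E"
 proof
  fix w assume "w \<in> ball (y - r *\<^sub>R normal y) r"
  then have "w \<in> ball x0 \<rho> & -1 * (q w - q y) < 0"
   using touching_ball[OF assms(1,3,4), of "-1" w] by simp
  then show "w \<in> E" using E assms(2) by simp
 qed
 show "ball (y + r *\<^sub>R normal y) r Int E = {}"
 proof -
  have "w ~: E" if "w \<in> ball (y + r *\<^sub>R normal y) r" for w
   using touching_ball[OF assms(1,3,4), of 1 w] that E[of w] assms(2) by simp
  then show ?thesis by blast
 qed
qed

lemma continuous_on_level: "continuous_on (ball x0 \<rho>) q"
proof (rule continuous_at_imp_continuous_on, rule ballI)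
 fix y assume y: "y \<in> ball x0 \<rho>"
 have "(q has_derivative (\<bullet>) (g y)) (at y)"
 proof (rule has_derivative_quadratic_error)
  show "\<rho> - dist x0 y > 0" using y by simp
  show "norm (q w - q y - g y \<bullet> (w - y)) <= C * (norm (w - y))^2" if "norm (w - y) < \<rho> - dist x0 y" for w
   using that expansion[OF y, of w] dist_triangle[of x0 w y] by (simp add: dist_norm norm_minus_commute)
 qed (rule bounded_linear_inner_right)
 then show "isCont q y" by (rule has_derivative_continuous)
qed

text \<open>The ball around \<open>z\<close> that reaches a nearest point \<open>y\<close> misses
  the level set, so \<open>q - a\<close> has a sign on it, and it is disjoint from the tangent ball
  at \<open>y\<close> on the other side. The two balls touch at \<open>y\<close>; equality in the
  triangle inequality makes \<open>z - y\<close> parallel to the normal.\<close>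

lemma nearest_point:
 assumes z: "dist x0 z < radius / 2" and x0: "q x0 = a"
 obtains y s where "q y = a" "z = y + s *\<^sub>R normal y" "dist x0 y <= 2 * dist x0 z" "\<bar>s\<bar> <= dist x0 z"
proof -
 let ?K = "cball x0 (\<rho> / 2) Int q -` {a}"
 have "closedin (top_of_set (cball x0 (\<rho> / 2))) (cball x0 (\<rho> / 2) Int q -` {a})"
 proof (intro continuous_closedin_preimage continuous_on_subset[OF continuous_on_level])
  show "cball x0 (\<rho> / 2) <= ball x0 \<rho>" using \<rho> by auto
 qed simp
 then have cl: "closed ?K" using closed_cball closedin_closed_trans by blast
 have "x0 \<in> ?K" using x0 \<rho> by simp
 then obtain y where y: "y \<in> ?K" "!!y'. y' \<in> ?K ==> dist z y <= dist z y'"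
  using distance_attains_inf[OF cl, of z] by blast
 define t where "t = dist z y"
 have t: "t <= dist x0 z" using y(2)[OF \<open>x0 \<in> ?K\<close>] by (simp add: t_def dist_commute)
 have dy: "dist x0 y <= 2 * dist x0 z" using dist_triangle[of x0 y z] t by (simp add: t_def)
 have qy: "q y = a" using y(1) by simp
 have small: "dist x0 z < \<rho> / 8" using z by simp
 have dy2: "dist x0 y < \<rho> / 2" using dy small zero_le_dist[of x0 z] by linarith
 have yb: "y \<in> ball x0 \<rho>" using dy2 \<rho> by simp
 show ?thesis
 proof (cases "t = 0")
  case True
  then show ?thesis using that[of y 0] qy dy by (simp add: t_def)
 next
  case False
  then have t0: "t > 0" by (simp add: t_def)
  let ?r = radius
  note balls = touching_ball[OF dy2 radius_pos order.refl]
  have sub: "ball z t <= cball x0 (\<rho> / 2)"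
  proof
   fix w assume "w \<in> ball z t"
   then show "w \<in> cball x0 (\<rho> / 2)" using dist_triangle[of x0 w z] t small zero_le_dist[of x0 z] unfolding mem_ball mem_cball by linarith
  qed
  have sub': "ball z t <= ball x0 \<rho>" using sub \<rho> by auto
  have nohit: "q w ~= a" if "w \<in> ball z t" for w using y(2)[of w] that sub by (auto simp: t_def)
  have conn: "connected (q ` ball z t)"
   using continuous_on_subset[OF continuous_on_level sub'] by (intro connected_continuous_image) auto
  have cases: "(\<forall>w\<in>ball z t. q w > a) \<or> (\<forall>w\<in>ball z t. q w < a)"
  proof (rule ccontr)
   assume "~ ?thesis"
   then obtain w w' where w: "w \<in> ball z t" "w' \<in> ball z t" "q w <= a" "q w' >= a" by (auto simp: not_less)
   then have "a \<in> q ` ball z t" using connectedD_interval[OF conn, of "q w" "q w'" a] by auto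
   then show False using nohit by blast
  qed
  have collinear: "z - y = - (\<sigma> * t) *\<^sub>R normal y"
   if \<sigma>: "\<bar>\<sigma>\<bar> = 1" "\<forall>w\<in>ball z t. \<sigma> * (q w - a) > 0" for \<sigma>
  proof -
   let ?c = "y + (\<sigma> * ?r) *\<^sub>R normal y"
   have "w ~: ball ?c ?r" if "w \<in> ball z t" for w
    using balls(2)[OF \<sigma>(1), of w] \<sigma>(2) that qy by fastforce
   then have "ball z t Int ball ?c ?r = {}" by blast
   then have ge: "dist z ?c >= t + ?r" using t0 radius_pos by (rule balls_disjoint_dist)
   let ?u = "z - y" and ?v = "- ((\<sigma> * ?r) *\<^sub>R normal y)"
   have nu: "norm ?u = t" by (simp add: t_def dist_norm)
   have nv: "norm ?v = ?r" using norm_normal[OF yb] \<sigma>(1) radius_pos by (simp add: abs_mult)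
   have "norm (?u + ?v) = norm ?u + norm ?v"
   proof (rule antisym[OF norm_triangle_ineq])
    have "norm (?u + ?v) = dist z ?c" by (simp add: dist_norm algebra_simps)
    then show "norm ?u + norm ?v <= norm (?u + ?v)" using ge nu nv by simp
   qed
   from iffD1[OF norm_triangle_eq this] have "t *\<^sub>R ?v = ?r *\<^sub>R ?u" unfolding nu nv .
   then have "?r *\<^sub>R ?u = ?r *\<^sub>R (- (\<sigma> * t) *\<^sub>R normal y)" by (simp add: mult_ac)
   then show ?thesis using radius_pos by (metis less_irrefl scaleR_left_imp_eq)
  qed
  from cases obtain \<sigma> :: real where \<sigma>: "\<bar>\<sigma>\<bar> = 1" "\<forall>w\<in>ball z t. \<sigma> * (q w - a) > 0"
  proof
   assume "\<forall>w\<in>ball z t. q w > a"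
   then show ?thesis using that[of 1] by simp
  next
   assume "\<forall>w\<in>ball z t. q w < a"
   then show ?thesis using that[of "-1"] by simp
  qed
  show ?thesis
  proof (rule that[of y "- (\<sigma> * t)"])
   show "z = y + - (\<sigma> * t) *\<^sub>R normal y" using collinear[OF \<sigma>] by (simp add: algebra_simps)
   show "\<bar>- (\<sigma> * t)\<bar> <= dist x0 z" using \<sigma>(1) t t0 by (simp add: abs_mult)
  qed (use qy dy in auto)
 qed
qed

lemma outer_normal_near:
 assumes "dist x0 y < \<rho> / 2" "q y = a" "\<bar>s\<bar> < radius"
 shows "outer_normal E (y + s *\<^sub>R normal y) = normal y"
 using touching_balls[OF assms(1,2) radius_pos order.refl] assms \<rho>
 by (intro outer_normal_sandwich[where R=radius] norm_normal) auto

lemma infdist_touching: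
 assumes "dist x0 y < \<rho> / 2" "q y = a" "0 < r" "r <= radius"
 shows "infdist (y + r *\<^sub>R normal y) E = r" "infdist (y - r *\<^sub>R normal y) (- E) = r"
proof -
 have yb: "y \<in> ball x0 \<rho>" using assms \<rho> by simp
 have yE: "y \<in> E" using E[OF yb] assms by simp
 note tb = touching_balls[OF assms]
 have d: "dist (y + r *\<^sub>R normal y) y = r" "dist (y - r *\<^sub>R normal y) y = r"
  using norm_normal[OF yb] assms(3) by (simp_all add: dist_norm)
 show "infdist (y + r *\<^sub>R normal y) E = r"
 proof (rule antisym)
  show "infdist (y + r *\<^sub>R normal y) E <= r" using infdist_le[OF yE, of "y + r *\<^sub>R normal y"] d by simp
  show "r <= infdist (y + r *\<^sub>R normal y) E"
   using tb(2) yE by (intro infdist_geI) (auto simp: not_less disjoint_iff)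
 qed
 have "ball (y + r *\<^sub>R normal y) r <= - E" using tb(2) by blast
 then have "closure (ball (y + r *\<^sub>R normal y) r) <= closure (- E)" by (rule closure_mono)
 then have yc: "y \<in> closure (- E)" using assms(3) d by (simp add: subset_iff)
 then have ne: "- E ~= {}" by auto
 show "infdist (y - r *\<^sub>R normal y) (- E) = r"
 proof (rule antisym)
  show "infdist (y - r *\<^sub>R normal y) (- E) <= r"
   using infdist_le[OF yc, of "y - r *\<^sub>R normal y"] d by (simp add: infdist_closure)
  show "r <= infdist (y - r *\<^sub>R normal y) (- E)"
   using tb(1) by (intro infdist_geI[OF ne]) (auto simp: not_less subset_iff)
 qed
qed

text \<open>Near \<open>x0\<close> the outer normal is \<open>normal (Y z)\<close> for a nearest
  point \<open>Y z\<close> of the level set, and \<open>Y\<close> is differentiated at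
  \<open>x0\<close> only. Its derivative is the tangential projection: the level equation makes the
  normal part of \<open>Y z - x0\<close> quadratic, and the tangential part of
  \<open>z - Y z\<close> is \<open>s z\<close> times a change of the normal, hence quadratic
  too.\<close>

lemma outer_normal_has_derivative:
 assumes x0: "q x0 = a" and D\<nu>: "((%y. normal y) has_derivative D\<nu>) (at x0)"
 shows "outer_normal E x0 = normal x0"
  and "(outer_normal E has_derivative (%v. D\<nu> (tangent_proj (normal x0) v))) (at x0)"
proof -
 show on0: "outer_normal E x0 = normal x0" using outer_normal_near[of x0 0] x0 \<rho> radius_pos by simp
 have "\<exists>y s. q y = a & z = y + s *\<^sub>R normal y & dist x0 y <= 2 * dist x0 z & \<bar>s\<bar> <= dist x0 z"
  if "dist x0 z < radius / 2" for z using nearest_point[OF that x0] by metis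
 then obtain Y s where Y: "!!z. dist x0 z < radius / 2 ==> q (Y z) = a"
  "!!z. dist x0 z < radius / 2 ==> z = Y z + s z *\<^sub>R normal (Y z)"
  "!!z. dist x0 z < radius / 2 ==> dist x0 (Y z) <= 2 * dist x0 z"
  "!!z. dist x0 z < radius / 2 ==> \<bar>s z\<bar> <= dist x0 z" by metis
 have Y0: "Y x0 = x0" using Y(3)[of x0] radius_pos by simp
 have nb: "norm (normal x0) = 1" using norm_normal[of x0] \<rho> by simp
 obtain L d where L: "d > 0" "!!y. norm (y - x0) < d ==> norm (normal y - normal x0) <= L * norm (y - x0)"
 proof -
  obtain d where d: "d > 0" "!!y. norm (y - x0) < d ==>
    norm (normal y - normal x0 - D\<nu> (y - x0)) <= 1 * norm (y - x0)"
   using D\<nu> unfolding has_derivative_at_alt by (metis zero_less_one)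
  have "norm (normal y - normal x0) <= (onorm D\<nu> + 1) * norm (y - x0)" if "norm (y - x0) < d" for y
   using d(2)[OF that] onorm[OF has_derivative_bounded_linear[OF D\<nu>], of "y - x0"]
    norm_triangle_ineq[of "normal y - normal x0 - D\<nu> (y - x0)" "D\<nu> (y - x0)"]
   by (simp add: algebra_simps)
  then show ?thesis using that d(1) by blast
 qed
 define P where "P = tangent_proj (normal x0)"
 define \<delta> where "\<delta> = min (d / 2) (radius / 2)"
 have \<delta>: "\<delta> > 0" using L(1) radius_pos by (simp add: \<delta>_def)
 have linP: "bounded_linear P" unfolding P_def by (rule bounded_linear_tangent_proj)
 have Pn: "norm (P v) <= 2 * norm v" for v
 proof -
  have "norm (P v) <= norm v + norm ((normal x0 \<bullet> v) *\<^sub>R normal x0)"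
   unfolding P_def tangent_proj_def by (rule norm_triangle_ineq4)
  also have "norm ((normal x0 \<bullet> v) *\<^sub>R normal x0) <= norm v"
   using Cauchy_Schwarz_ineq2[of "normal x0" v] nb by simp
  finally show ?thesis by simp
 qed
 have "(Y has_derivative P) (at x0)"
 proof (rule has_derivative_quadratic_error[OF linP \<delta>])
  fix z assume z: "norm (z - x0) < \<delta>"
  then have z': "dist x0 z < radius / 2" by (simp add: \<delta>_def dist_norm norm_minus_commute)
  define e where "e = Y z - x0"
  have ne: "norm e <= 2 * norm (z - x0)" using Y(3)[OF z'] by (simp add: e_def dist_norm norm_minus_commute)
  have ns: "\<bar>s z\<bar> <= norm (z - x0)" using Y(4)[OF z'] by (simp add: dist_norm norm_minus_commute)
  have Yb: "Y z \<in> ball x0 \<rho>"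
  proof -
   have "dist x0 z < \<rho> / 8" using z' by simp
   then show ?thesis using Y(3)[OF z'] zero_le_dist[of x0 z] unfolding mem_ball by linarith
  qed
  have g0: "norm (g x0) >= m" using g_ge[of x0] \<rho> by simp
  have "\<bar>g x0 \<bullet> e\<bar> <= C * (norm e)^2"
   using expansion[of x0 "Y z"] Yb \<rho> Y(1)[OF z'] x0 by (simp add: e_def)
  moreover have "\<bar>g x0 \<bullet> e\<bar> = norm (g x0) * \<bar>normal x0 \<bullet> e\<bar>"
  proof -
   have "g x0 = norm (g x0) *\<^sub>R sgn (g x0)" by (cases "g x0 = 0") (simp_all add: sgn_div_norm)
   then have "g x0 \<bullet> e = norm (g x0) * (sgn (g x0) \<bullet> e)" by (metis inner_scaleR_left)
   then show ?thesis by (simp add: abs_mult)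
  qed
  ultimately have "m * \<bar>normal x0 \<bullet> e\<bar> <= C * (norm e)^2"
   using mult_right_mono[OF g0, of "\<bar>normal x0 \<bullet> e\<bar>"] by simp
  also have "... <= C * (2 * norm (z - x0))^2" using ne C by (intro mult_left_mono power_mono) auto
  finally have 1: "\<bar>normal x0 \<bullet> e\<bar> <= 4 * C / m * (norm (z - x0))^2"
   using m by (simp add: field_simps power_mult_distrib)
  have "norm (normal (Y z) - normal x0) <= L * norm (Y z - x0)"
   using ne z by (intro L(2)) (simp add: e_def \<delta>_def)
  also have "... <= \<bar>L\<bar> * (2 * norm (z - x0))"
   using ne by (intro mult_mono) (auto simp: e_def)
  finally have 2: "norm (normal (Y z) - normal x0) <= 2 * \<bar>L\<bar> * norm (z - x0)" by simp
  have z_eq: "z - x0 = e + s z *\<^sub>R normal (Y z)"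
   using Y(2)[OF z'] unfolding e_def by (metis add_diff_eq add.commute)
  have P0: "P (normal x0) = 0" using nb unfolding P_def tangent_proj_def by (simp add: norm_eq_1)
  have "P (z - x0) = P e + s z *\<^sub>R P (normal (Y z) - normal x0)" unfolding z_eq using P0
   by (simp add: linear_simps[OF linP] bounded_linear.linear[OF linP, THEN linear_scale]
     linear_diff[OF bounded_linear.linear[OF linP]])
  then have "Y z - Y x0 - P (z - x0) = (normal x0 \<bullet> e) *\<^sub>R normal x0 - s z *\<^sub>R P (normal (Y z) - normal x0)"
   unfolding Y0 by (simp add: e_def[symmetric] P_def tangent_proj_def)
  also have "norm ... <= \<bar>normal x0 \<bullet> e\<bar> + \<bar>s z\<bar> * norm (P (normal (Y z) - normal x0))"
   by (rule order.trans[OF norm_triangle_ineq4]) (simp add: nb[simplified])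
  also have "... <= 4 * C / m * (norm (z - x0))^2 + norm (z - x0) * (2 * (2 * \<bar>L\<bar> * norm (z - x0)))"
   using 1 2 ns order.trans[OF Pn mult_left_mono[OF 2, of 2]] by (intro add_mono mult_mono) auto
  also have "... = (4 * C / m + 4 * \<bar>L\<bar>) * (norm (z - x0))^2"
   by (simp add: algebra_simps power2_eq_square)
  finally show "norm (Y z - Y x0 - P (z - x0)) <= (4 * C / m + 4 * \<bar>L\<bar>) * (norm (z - x0))^2" .
 qed
 then have "((%z. normal (Y z)) has_derivative (%v. D\<nu> (P v))) (at x0)"
  using diff_chain_at[of Y P x0 "%y. normal y" D\<nu>] D\<nu> Y0 by (simp add: o_def)
 then show "(outer_normal E has_derivative (%v. D\<nu> (tangent_proj (normal x0) v))) (at x0)"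
  unfolding P_def
 proof (rule has_derivative_transform_within_open)
  show "open (ball x0 (radius / 2))" "x0 \<in> ball x0 (radius / 2)" using radius_pos by auto
  fix z assume "z \<in> ball x0 (radius / 2)"
  then have z': "dist x0 z < radius / 2" by simp
  have "outer_normal E (Y z + s z *\<^sub>R normal (Y z)) = normal (Y z)"
   using Y(1,3,4)[OF z'] z' \<rho> by (intro outer_normal_near) auto
  then show "normal (Y z) = outer_normal E z" using Y(2)[OF z'] by metis
 qed
qed

end

subsection \<open>Smooth level sets\<close>

lemma cart_linear_expansion:
 fixes f :: "real^'n => real"
 assumes "linear f"
 shows "f v = (\<chi> i. f (axis i 1)) \<bullet> v"
proof -
 have "f v = f (\<Sum>i\<in>UNIV. v $ i *\<^sub>R axis i 1)"
  using basis_expansion[of v] by (simp add: scalar_mult_eq_scaleR)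
 also have "... = (\<Sum>i\<in>UNIV. v $ i * f (axis i 1))"
  using assms by (simp add: linear_sum linear_scale)
 finally show ?thesis by (simp add: inner_vec_def mult.commute)
qed

definition hess_map :: "(real^'n => real) => real^'n => real^'n => real^'n" where
 "hess_map q x w = (\<chi> i. dir_deriv2 q x (axis i 1) w)"

lemma grad_nth: "grad q x $ i = dir_deriv q x (axis i 1)"
 by (simp add: grad_def dir_deriv_def)

lemma has_derivative_cart:
 fixes f :: "'a::real_normed_vector => real^'n"
 assumes "!!i. ((%x. f x $ i) has_derivative (%v. D v $ i)) (at x within S)"
 shows "(f has_derivative D) (at x within S)" unfolding has_derivative_componentwise_within[of f]
 using assms by (auto simp: Basis_vec_def inner_axis)

context
 fixes S :: "(real^'n) set" and q :: "real^'n => real"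
 assumes S: "open S" and q: "Ck_on 2 S q"
begin

lemma dir_deriv_eq_grad: "x \<in> S ==> dir_deriv q x v = grad q x \<bullet> v"
 using cart_linear_expansion[OF C2_linear[OF S q], of x v] by (simp add: grad_def dir_deriv_def)

lemma dir_deriv2_eq_hess: "x \<in> S ==> dir_deriv2 q x v w = v \<bullet> hess_map q x w"
 using cart_linear_expansion[OF C2_linear1[OF S q], of x v w] by (simp add: hess_map_def inner_commute)

lemma grad_has_derivative: "x \<in> S ==> (grad q has_derivative hess_map q x) (at x)"
 by (rule has_derivative_cart) (simp add: grad_nth hess_map_def C2_has_derivative2[OF S q])

lemma linear_hess_map: "x \<in> S ==> linear (hess_map q x)"
 using grad_has_derivative has_derivative_linear by blast

lemma continuous_on_grad: "continuous_on S (grad q)"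
 using grad_has_derivative has_derivative_continuous continuous_at_imp_continuous_on by blast

end

lemma C1_lipschitz_cball:
 fixes f :: "'a::euclidean_space => real"
 assumes S: "open S" and f: "Ck_on 1 S f" and e: "cball x e <= S"
 obtains L where "L >= 0" "!!y z. y \<in> cball x e ==> z \<in> cball x e ==> \<bar>f y - f z\<bar> <= L * dist y z"
proof -
 have d: "(f has_derivative frechet_derivative f (at y)) (at y)" if "y \<in> S" for y
  using Ck_on_SucD(1)[OF S, of 0 f] f that by simp
 have c: "continuous_on (cball x e) (%y. \<Sum>b\<in>Basis. \<bar>frechet_derivative f (at y) b\<bar>)"
  using Ck_on_SucD(2)[OF S, of 0 f] f e
  by (intro continuous_intros) (auto simp: Ck_on_0 intro: continuous_on_subset)
 have "compact ((%y. \<Sum>b\<in>Basis. \<bar>frechet_derivative f (at y) b\<bar>) ` cball x e)"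
  by (intro compact_continuous_image c) simp
 then obtain B where B: "!!y. y \<in> cball x e ==> (\<Sum>b\<in>Basis. \<bar>frechet_derivative f (at y) b\<bar>) <= B"
  using bounded_imp_bdd_above[OF compact_imp_bounded] unfolding bdd_above_def by fastforce
 show ?thesis
 proof (rule that[of "max B 0"])
  fix y z assume yz: "y \<in> cball x e" "z \<in> cball x e"
  have "norm (f y - f z) <= max B 0 * norm (y - z)"
  proof (rule differentiable_bound[of "cball x e" f "%y. frechet_derivative f (at y)"])
   fix w assume w: "w \<in> cball x e"
   then have wS: "w \<in> S" using e by blast
   show "(f has_derivative frechet_derivative f (at w)) (at w within cball x e)"
    using d[OF wS] by (rule has_derivative_at_withinI)
   show "onorm (frechet_derivative f (at w)) <= max B 0"
   proof (rule onorm_bound)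
    fix v
    have "frechet_derivative f (at w) v = (\<Sum>b\<in>Basis. (v \<bullet> b) * frechet_derivative f (at w) b)"
     using linear_basis_expansion[OF has_derivative_linear[OF d[OF wS]], of v] by simp
    also have "\<bar>...\<bar> <= (\<Sum>b\<in>Basis. norm v * \<bar>frechet_derivative f (at w) b\<bar>)"
     by (rule order.trans[OF sum_abs sum_mono]) (simp add: abs_mult mult_right_mono Basis_le_norm)
    also have "... <= norm v * max B 0"
     using B[OF w] by (simp flip: sum_distrib_left add: mult_left_mono le_max_iff_disj)
    finally show "norm (frechet_derivative f (at w) v) <= max B 0 * norm v" by (simp add: mult.commute)
   qed simp
  qed (use yz in auto)
  then show "\<bar>f y - f z\<bar> <= max B 0 * dist y z" by (simp add: dist_norm)
 qed simp
qed

lemma grad_expansion_cball: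
 fixes q :: "real^'n => real"
 assumes S: "open S" and q: "Ck_on 2 S q" and e: "cball x e <= S"
 obtains C where "C >= 0" "!!y w. y \<in> cball x e ==> w \<in> cball x e ==>
   \<bar>q w - q y - grad q y \<bullet> (w - y)\<bar> <= C * (norm (w - y))^2"
proof -
 have "\<exists>L\<ge>0. \<forall>y\<in>cball x e. \<forall>z\<in>cball x e. \<bar>grad q y $ i - grad q z $ i\<bar> <= L * dist y z" for i
  unfolding grad_nth using C1_lipschitz_cball[OF S C2_dir_deriv[OF S q] e] by metis
 then obtain L where L: "!!i. L i >= 0"
  "!!i y z. y \<in> cball x e ==> z \<in> cball x e ==> \<bar>grad q y $ i - grad q z $ i\<bar> <= L i * dist y z"
  by metis
 define C where "C = sum L UNIV"
 show ?thesis
 proof (rule that[of C])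
  show "C >= 0" unfolding C_def using L(1) by (intro sum_nonneg) auto
  fix y w assume yw: "y \<in> cball x e" "w \<in> cball x e"
  define v where "v = w - y"
  have seg: "y + s *\<^sub>R v \<in> cball x e" if "0 <= s" "s <= 1" for s
  proof -
   have "(1 - s) *\<^sub>R y + s *\<^sub>R w \<in> cball x e"
    using convexD[OF convex_cball yw, of "1 - s" s] that by simp
   then show ?thesis by (simp add: v_def algebra_simps)
  qed
  have d: "((%s. q (y + s *\<^sub>R v)) has_derivative (%h. h * (grad q (y + s *\<^sub>R v) \<bullet> v))) (at s)"
   if "0 <= s" "s <= 1" for s
  proof -
   have z: "y + s *\<^sub>R v \<in> S" using seg[OF that] e by blast
   have "((%s. y + s *\<^sub>R v) has_derivative (%h. h *\<^sub>R v)) (at s)"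
    by (auto intro!: derivative_eq_intros)
   from diff_chain_at[OF this C2_has_derivative[OF S q z]]
   show ?thesis by (simp add: o_def dir_deriv_eq_grad[OF S q z])
  qed
  have "\<exists>s\<in>{0<..<1}. q (y + 1 *\<^sub>R v) - q (y + 0 *\<^sub>R v) = (1 - 0) * (grad q (y + s *\<^sub>R v) \<bullet> v)"
   by (rule mvt_simple) (auto intro: has_derivative_at_withinI d)
  then obtain s where s: "0 < s" "s < 1" "q w - q y = grad q (y + s *\<^sub>R v) \<bullet> v"
   by (auto simp: v_def)
  have "norm (grad q (y + s *\<^sub>R v) - grad q y) <= (\<Sum>i\<in>UNIV. \<bar>(grad q (y + s *\<^sub>R v) - grad q y) $ i\<bar>)"
   by (rule norm_le_l1_cart)
  also have "... <= (\<Sum>i\<in>UNIV. L i * norm v)"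
  proof (rule sum_mono)
   fix i
   have "\<bar>(grad q (y + s *\<^sub>R v) - grad q y) $ i\<bar> <= L i * dist (y + s *\<^sub>R v) y"
    using L(2)[of "y + s *\<^sub>R v" y i] seg[of s] s yw by simp
   also have "... <= L i * norm v"
    using s L(1)[of i] by (intro mult_left_mono) (auto simp: dist_norm mult_left_le_one_le)
   finally show "\<bar>(grad q (y + s *\<^sub>R v) - grad q y) $ i\<bar> <= L i * norm v" .
  qed
  also have "... = C * norm v" by (simp add: C_def sum_distrib_right)
  finally have "norm (grad q (y + s *\<^sub>R v) - grad q y) * norm v <= C * norm v * norm v"
   by (intro mult_right_mono) auto
  moreover have "q w - q y - grad q y \<bullet> (w - y) = (grad q (y + s *\<^sub>R v) - grad q y) \<bullet> v"
   using s(3) by (simp add: v_def inner_diff_left)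
  ultimately show "\<bar>q w - q y - grad q y \<bullet> (w - y)\<bar> <= C * (norm (w - y))^2"
   using Cauchy_Schwarz_ineq2[of "grad q (y + s *\<^sub>R v) - grad q y" v]
   by (simp add: v_def power2_eq_square)
 qed
qed

lemma sgn_field_has_derivative:
 fixes g :: "'a::real_inner => 'a"
 assumes "(g has_derivative G) (at x)" "g x ~= 0"
 shows "((%y. - sgn (g y)) has_derivative (%v. - (1 / norm (g x)) *\<^sub>R tangent_proj (- sgn (g x)) (G v))) (at x)"
proof -
 have "(norm has_derivative (%h. h \<bullet> sgn (g x))) (at (g x))"
  using assms(2) by (rule has_derivative_norm)
 from diff_chain_at[OF assms(1) this]
 have "((%y. norm (g y)) has_derivative (%v. G v \<bullet> sgn (g x))) (at x)" by (simp add: o_def)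
 from Deriv.has_derivative_inverse[OF _ this]
 have "((%y. inverse (norm (g y))) has_derivative
   (%v. - (inverse (norm (g x)) * (G v \<bullet> sgn (g x)) * inverse (norm (g x))))) (at x)"
  using assms(2) by simp
 from has_derivative_minus[OF has_derivative_scaleR[OF this assms(1)]]
 have "((%y. - sgn (g y)) has_derivative (%v. - (inverse (norm (g x)) *\<^sub>R G v +
   (- (inverse (norm (g x)) * (G v \<bullet> sgn (g x)) * inverse (norm (g x)))) *\<^sub>R g x))) (at x)"
  by (simp add: sgn_div_norm)
 moreover have "- (inverse (norm (g x)) *\<^sub>R G v +
   (- (inverse (norm (g x)) * (G v \<bullet> sgn (g x)) * inverse (norm (g x)))) *\<^sub>R g x) =
   - (1 / norm (g x)) *\<^sub>R tangent_proj (- sgn (g x)) (G v)" for v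
  by (simp add: tangent_proj_def sgn_div_norm inner_commute algebra_simps divide_inverse)
 ultimately show ?thesis by (simp add: fun_eq_iff)
qed

text \<open>Weingarten map of the superlevel set, extended by 0 in the normal direction. The left
  projection comes from differentiating a unit field, the right one from the derivative of the
  nearest point map.\<close>

definition shape_map :: "(real^'n => real) => real^'n => real^'n => real^'n" where
 "shape_map q x v = - (1 / norm (grad q x)) *\<^sub>R
   tangent_proj (- sgn (grad q x)) (hess_map q x (tangent_proj (- sgn (grad q x)) v))"

text \<open>One radius \<open>R\<close> serves all \<open>x\<close> near \<open>x0\<close>, each
  with the superlevel set through \<open>x\<close> itself; this uniformity is what allows
  \<open>n\<close> and \<open>x\<close> to be sent to their limits together.\<close>

lemma level_set_geometry:
 fixes q :: "real^'n => real"
 assumes S: "open S" and q: "Ck_on 2 S q" and x0: "x0 \<in> S" and ne: "grad q x0 ~= 0"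
 obtains R \<rho> where "R > 0" "\<rho> > 0" "ball x0 \<rho> <= S"
  "!!x. x \<in> ball x0 \<rho> ==> grad q x ~= 0"
  "!!x E. x \<in> ball x0 \<rho> ==> (!!w. w \<in> S ==> w \<in> E \<longleftrightarrow> q w >= q x) ==>
   outer_normal E x = - sgn (grad q x) & D_normal x E = matrix (shape_map q x) &
   (\<forall>r. 0 < r & r <= R --> infdist (x - r *\<^sub>R sgn (grad q x)) E = r &
     infdist (x + r *\<^sub>R sgn (grad q x)) (- E) = r)"
proof -
 obtain e where e: "e > 0" "cball x0 e <= S" using S x0 open_contains_cball by blast
 obtain C where C: "C >= 0" "!!y w. y \<in> cball x0 e ==> w \<in> cball x0 e ==>
   \<bar>q w - q y - grad q y \<bullet> (w - y)\<bar> <= C * (norm (w - y))^2"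
  using grad_expansion_cball[OF S q e(2)] by metis
 define m where "m = norm (grad q x0) / 2"
 have m: "m > 0" using ne by (simp add: m_def)
 have "isCont (grad q) x0" using grad_has_derivative[OF S q x0] by (rule has_derivative_continuous)
 then have "isCont (%x. norm (grad q x)) x0" by (rule continuous_norm)
 then have "\<forall>\<^sub>F y in nhds x0. m < norm (grad q y)"
  using m iffD1[OF tendsto_at_iff_tendsto_nhds, of "%x. norm (grad q x)" x0]
  by (intro order_tendstoD(1)[of _ "norm (grad q x0)"]) (auto simp: m_def isCont_def)
 then obtain d where d: "d > 0" "!!y. dist y x0 < d ==> m < norm (grad q y)"
  unfolding eventually_nhds_metric by blast
 define \<rho> where "\<rho> = min e d / 2"
 have \<rho>: "\<rho> > 0" using e d by (simp add: \<rho>_def)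
 define R where "R = min (m / (2 * C + 1)) (\<rho> / 4)"
 have gm: "m <= norm (grad q y)" if "dist y x0 < 2 * \<rho>" for y
  using d(2)[of y] that by (simp add: \<rho>_def)
 have inS: "y \<in> cball x0 e" if "dist y x0 < 2 * \<rho>" for y
  using that by (simp add: \<rho>_def dist_commute)
 show ?thesis
 proof (rule that[of R \<rho>])
  show "R > 0" using \<rho> C m by (simp add: R_def)
  show "ball x0 \<rho> <= S" using inS e(2) \<rho> by (fastforce simp: dist_commute)
  show "grad q x ~= 0" if "x \<in> ball x0 \<rho>" for x
   using gm[of x] that m \<rho> by (auto simp: dist_commute)
  fix x E assume x: "x \<in> ball x0 \<rho>" and E: "!!w. w \<in> S ==> w \<in> E \<longleftrightarrow> q w >= q x"
  have near: "dist y x0 < 2 * \<rho>" if "y \<in> ball x \<rho>" for y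
   using that x dist_triangle[of y x0 x] by (simp add: dist_commute)
  have ex: "\<bar>q w - q y - grad q y \<bullet> (w - y)\<bar> <= C * (norm (w - y))^2"
   if "y \<in> ball x \<rho>" "w \<in> ball x \<rho>" for y w using that by (intro C(2) inS near)
  have g_ge: "m <= norm (grad q y)" if "y \<in> ball x \<rho>" for y using that by (intro gm near)
  have Eb: "w \<in> E \<longleftrightarrow> q w >= q x" if "w \<in> ball x \<rho>" for w
   using that near[of w] inS[of w] e(2) by (intro E) blast
  note ctx = \<rho> C(1) m ex g_ge Eb
  have xS: "x \<in> S" using x \<open>ball x0 \<rho> <= S\<close> by blast
  have gx: "grad q x ~= 0" using g_ge[of x] m \<rho> by auto
  note sd = sgn_field_has_derivative[OF grad_has_derivative[OF S q xS] gx]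
  note od = outer_normal_has_derivative[OF ctx refl sd]
  have "outer_normal E x = - sgn (grad q x)" by (rule od(1))
  moreover have "D_normal x E = matrix (shape_map q x)"
   using frechet_derivative_at[OF od(2)] unfolding jacobian_def shape_map_def[abs_def] by simp
  moreover have "infdist (x - r *\<^sub>R sgn (grad q x)) E = r & infdist (x + r *\<^sub>R sgn (grad q x)) (- E) = r"
   if "0 < r" "r <= R" for r
   using infdist_touching[OF ctx _ refl that(1), of x] that(2) \<rho> by (simp add: R_def)
  ultimately show "outer_normal E x = - sgn (grad q x) & D_normal x E = matrix (shape_map q x) &
   (\<forall>r. 0 < r & r <= R --> infdist (x - r *\<^sub>R sgn (grad q x)) E = r &
     infdist (x + r *\<^sub>R sgn (grad q x)) (- E) = r)" by blast
 qed (rule \<rho>)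
qed

definition regular_level :: "(real^'n => real) => real => bool" where
 "regular_level q a \<longleftrightarrow> smooth_on UNIV q & compact {x. q x = a} & (\<forall>x. q x = a --> grad q x ~= 0)"

lemma regular_level_uminus: "regular_level q a ==> regular_level (%x. - q x) (- a)"
proof -
 have "grad (%x. - q x) x = - grad q x" if "smooth_on UNIV q" for x
  using grad_eqI[of "%x. - q x" "- grad q x" x]
   has_derivative_minus[OF C2_has_derivative[OF open_UNIV smooth_onD[OF that], of x]]
  by (simp add: dir_deriv_eq_grad[OF open_UNIV smooth_onD[OF that]] inner_commute)
 then show "regular_level q a ==> regular_level (%x. - q x) (- a)"
  by (auto simp: regular_level_def intro: smooth_on_uminus)
qed

lemma smooth_loc_holder:
 fixes f :: "'a::euclidean_space => real"
 assumes S: "open S" and f: "smooth_on S f" and \<beta>: "0 <= \<beta>" "\<beta> <= 1"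
 shows "loc_holder_on \<beta> S f" unfolding loc_holder_on_def
proof (intro conjI ballI)
 show "continuous_on S f" using f by (rule smooth_on_imp_continuous_on)
 fix x assume "x \<in> S"
 then obtain e where e: "e > 0" "cball x e <= S" using S open_contains_cball by blast
 obtain L where L: "L >= 0" "!!y z. y \<in> cball x e ==> z \<in> cball x e ==> \<bar>f y - f z\<bar> <= L * dist y z"
  using C1_lipschitz_cball[OF S smooth_onD[OF f] e(2)] by metis
 \<comment> \<open>Two points of this ball have distance at most 1, where a Lipschitz bound implies
   a Holder bound of exponent at most 1.\<close>
 let ?d = "min e (1/2)"
 have "norm (f y - f z) <= L * dist y z powr \<beta>" if "y \<in> ball x ?d Int S" "z \<in> ball x ?d Int S" for y z
 proof -
  have "dist y z <= 1" using that dist_triangle[of y z x] by (simp add: dist_commute)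
  then have "dist y z <= dist y z powr \<beta>"
   using powr_mono'[of \<beta> 1 "dist y z"] \<beta> by (cases "y = z") auto
  then have "L * dist y z <= L * dist y z powr \<beta>" using L(1) by (rule mult_left_mono)
  then show ?thesis using L(2)[of y z] that by auto
 qed
 then show "\<exists>e>0. \<exists>C. \<forall>y\<in>ball x e Int S. \<forall>z\<in>ball x e Int S. norm (f y - f z) <= C * dist y z powr \<beta>"
  using e(1) by (intro exI[of _ ?d] conjI exI[of _ L] ballI) auto
qed

lemma derivatives_satisfy_smooth:
 assumes S: "open S" and P: "!!f. smooth_on S f ==> P S f" and f: "smooth_on S f"
 shows "derivatives_satisfy P k S f" using f
proof (induction k arbitrary: f)
 case (Suc k)
 have "Ck_on (Suc m) S f" for m using Suc.prems by (rule smooth_onD)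
 then show ?case using Suc.IH unfolding derivatives_satisfy.simps smooth_on_def Ck_on_Suc by blast
qed (simp add: P)

text \<open>A nonzero derivative excludes a local extremum at \<open>x\<close>.\<close>

lemma level_approx:
 fixes q :: "real^'n => real"
 assumes "regular_level q a" "q x = a"
 shows "x \<in> closure {y. q y > a}" "x \<in> closure {y. q y < a}"
proof -
 have q: "smooth_on UNIV q" and g: "grad q x ~= 0" using assms by (auto simp: regular_level_def)
 have d: "(q has_derivative (%v. grad q x \<bullet> v)) (at x)"
  by (rule has_derivative_eq_rhs[OF C2_has_derivative[OF open_UNIV smooth_onD[OF q]]])
   (simp_all add: fun_eq_iff dir_deriv_eq_grad[OF open_UNIV smooth_onD[OF q]])
 have nz: "(%v. grad q x \<bullet> v) ~= (%v. 0)" using g by (metis inner_eq_zero_iff)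
 have *: "~ (\<forall>y\<in>ball x e. q y <= q x) & ~ (\<forall>y\<in>ball x e. q x <= q y)" if "e > 0" for e
  using differential_zero_maxmin[OF _ _ d, of "ball x e"] nz that by auto
 have "\<exists>y. dist y x < e & q y > a" "\<exists>y. dist y x < e & q y < a" if "e > 0" for e
  using *[OF that] assms(2) by (auto simp: not_le dist_commute)
 then show "x \<in> closure {y. q y > a}" "x \<in> closure {y. q y < a}"
  unfolding closure_approachable by blast+
qed

lemma superlevel_closure:
 fixes q :: "real^'n => real"
 assumes "regular_level q a"
 shows "closure {y. q y > a} = {y. q y >= a}" "frontier {y. q y >= a} = {y. q y = a}"
proof -
 have c: "continuous_on UNIV q" using assms smooth_on_imp_continuous_on by (auto simp: regular_level_def)
 have cl: "closed {y. q y >= a}" "open {y. q y > a}" "open {y. q y < a}"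
  using c by (auto intro!: closed_Collect_le open_Collect_less continuous_on_const)
 show "closure {y. q y > a} = {y. q y >= a}"
 proof
  show "closure {y. q y > a} <= {y. q y >= a}" by (rule closure_minimal[OF _ cl(1)]) auto
  show "{y. q y >= a} <= closure {y. q y > a}"
   using level_approx(1)[OF assms] closure_subset[of "{y. q y > a}"] by (auto simp: le_less)
 qed
 have "interior {y. q y >= a} = {y. q y > a}"
 proof
  show "interior {y. q y >= a} <= {y. q y > a}"
  proof
   fix y assume y: "y \<in> interior {y. q y >= a}"
   have "q y ~= a"
   proof
    assume "q y = a"
    from level_approx(2)[OF assms this] y
    have "interior {y. q y >= a} Int {y. q y < a} ~= {}"
     using open_Int_closure_eq_empty[OF open_interior, of "{y. q y >= a}" "{y. q y < a}"] by blast
    then show False using interior_subset[of "{y. q y >= a}"] by auto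
   qed
   moreover have "q y >= a" using y interior_subset by blast
   ultimately show "y \<in> {y. q y > a}" by simp
  qed
  show "{y. q y > a} <= interior {y. q y >= a}" by (rule interior_maximal[OF _ cl(2)]) auto
 qed
 note int = this
 show "frontier {y. q y >= a} = {y. q y = a}" unfolding frontier_def closure_closed[OF cl(1)] int by auto
qed

lemma regular_level_in_class:
 fixes q :: "real^'n => real"
 assumes q: "regular_level q a" and \<beta>: "0 <= \<beta>" "\<beta> <= 1"
 shows "{y. q y >= a} \<in> regular_class l \<beta>"
proof -
 let ?E = "{y. q y >= a}"
 have sm: "smooth_on UNIV q" using q by (simp add: regular_level_def)
 have c: "continuous_on UNIV q" using smooth_on_imp_continuous_on[OF sm] .
 have 1: "\<exists>U. open U & ?E = closure U"
  using c by (intro exI[of _ "{y. q y > a}"]) (auto simp: superlevel_closure(1)[OF q]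
    intro!: open_Collect_less continuous_on_const)
 have 2: "compact (frontier ?E)" using q by (simp add: superlevel_closure(2) regular_level_def)
 have cg: "continuous_on UNIV (grad q)" by (rule continuous_on_grad[OF open_UNIV smooth_onD[OF sm]])
 have 3: "\<exists>N \<phi>. open N & x \<in> N & Ck_holder_on l \<beta> N \<phi> & (\<forall>y\<in>N. grad \<phi> y ~= 0) & ?E Int N = {y\<in>N. \<phi> y <= 0}"
  if "x \<in> frontier ?E" for x
 proof (intro exI[of _ "{y. grad q y ~= 0}"] exI[of _ "%y. a - q y"] conjI)
  show N: "open {y. grad q y ~= 0}" using cg by (intro open_Collect_neq continuous_on_const)
  show "x \<in> {y. grad q y ~= 0}" using that q by (auto simp: superlevel_closure(2) regular_level_def)
  have "smooth_on {y. grad q y ~= 0} (%y. a - q y)"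
   by (intro smooth_on_diff smooth_on_const N smooth_on_subset[OF sm]) auto
  then show "Ck_holder_on l \<beta> {y. grad q y ~= 0} (%y. a - q y)" unfolding Ck_holder_on_def
   by (intro derivatives_satisfy_smooth[OF N] smooth_loc_holder[OF N _ \<beta>])
  have "grad (%y. a - q y) y = - grad q y" for y
  proof (rule grad_eqI)
   have "((%y. a - q y) has_derivative (%v. 0 - dir_deriv q y v)) (at y)"
    by (intro has_derivative_diff has_derivative_const C2_has_derivative[OF open_UNIV smooth_onD[OF sm]]) simp
   then show "((%y. a - q y) has_derivative (%v. v \<bullet> - grad q y)) (at y)"
    by (simp add: dir_deriv_eq_grad[OF open_UNIV smooth_onD[OF sm]] inner_commute)
  qed
  then show "\<forall>y\<in>{y. grad q y ~= 0}. grad (%y. a - q y) y ~= 0" by simp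
 qed auto
 show ?thesis using 1 2 3 unfolding regular_class_def by blast
qed

section \<open>Consistency of the curvatures\<close>

text \<open>At noncritical points this is \<open>|Dq| div (Dq / |Dq|)\<close>.\<close>

definition level_op :: "(real^'n => real) => real^'n => real" where
 "level_op q x = (\<Sum>i\<in>UNIV. dir_deriv2 q x (axis i 1) (axis i 1))
   - dir_deriv2 q x (sgn (grad q x)) (sgn (grad q x))"

lemma tangent_proj_adjoint: "tangent_proj \<nu> u \<bullet> v = u \<bullet> tangent_proj \<nu> v"
 by (simp add: tangent_proj_def inner_diff_left inner_diff_right inner_commute)

lemma tangent_proj_uminus: "tangent_proj (- \<nu>) = tangent_proj \<nu>"
 by (simp add: tangent_proj_def fun_eq_iff)

lemma trace_shape_map:
 fixes q :: "real^'n => real"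
 assumes S: "open S" and q: "Ck_on 2 S q" and x: "x \<in> S" and g: "grad q x ~= 0"
 shows "trace (matrix (shape_map q x)) = - level_op q x / norm (grad q x)"
proof -
 define \<nu> where "\<nu> = sgn (grad q x)"
 have n1: "norm \<nu> = 1" using g by (simp add: \<nu>_def norm_sgn)
 let ?H = "hess_map q x" and ?e = "%i. axis i 1 :: real^'n"
 have lin: "linear ?H" by (rule linear_hess_map[OF S q x])
 have exp1: "(\<Sum>i\<in>UNIV. \<nu> $ i *\<^sub>R ?e i) = \<nu>"
  using basis_expansion[of \<nu>] by (simp add: scalar_mult_eq_scaleR)
 have "(\<Sum>i\<in>UNIV. tangent_proj \<nu> (?e i) \<bullet> ?H (tangent_proj \<nu> (?e i))) =
   (\<Sum>i\<in>UNIV. ?e i \<bullet> ?H (?e i) - (\<nu> $ i *\<^sub>R ?e i) \<bullet> ?H \<nu> - \<nu> \<bullet> ?H (\<nu> $ i *\<^sub>R ?e i) + (\<nu> $ i)^2 * (\<nu> \<bullet> ?H \<nu>))"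
  by (intro sum.cong refl)
   (simp add: tangent_proj_def inner_axis linear_diff[OF lin] linear_scale[OF lin]
    inner_diff_left inner_diff_right power2_eq_square algebra_simps)
 also have "... = (\<Sum>i\<in>UNIV. ?e i \<bullet> ?H (?e i)) - \<nu> \<bullet> ?H \<nu> - \<nu> \<bullet> ?H \<nu> + (\<Sum>i\<in>UNIV. (\<nu> $ i)\<^sup>2) * (\<nu> \<bullet> ?H \<nu>)"
  unfolding sum.distrib sum_subtractf sum_distrib_right[symmetric] inner_sum_left[symmetric]
   inner_sum_right[symmetric] linear_sum[OF lin, symmetric] exp1 ..
 also have "(\<Sum>i\<in>UNIV. (\<nu> $ i)\<^sup>2) = 1"
  using n1 by (simp add: norm_eq_1 inner_vec_def power2_eq_square)
 finally have *: "(\<Sum>i\<in>UNIV. tangent_proj \<nu> (?e i) \<bullet> ?H (tangent_proj \<nu> (?e i))) = level_op q x"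
  by (simp add: level_op_def dir_deriv2_eq_hess[OF S q x] \<nu>_def)
 have "trace (matrix (shape_map q x)) = (\<Sum>i\<in>UNIV. shape_map q x (?e i) $ i)"
  by (simp add: trace_def matrix_def)
 also have "... = (\<Sum>i\<in>UNIV. ?e i \<bullet> shape_map q x (?e i))" by (simp add: inner_axis')
 also have "... = (\<Sum>i\<in>UNIV. - (1 / norm (grad q x)) * (tangent_proj \<nu> (?e i) \<bullet> ?H (tangent_proj \<nu> (?e i))))"
  by (simp add: shape_map_def tangent_proj_uminus tangent_proj_adjoint \<nu>_def)
 also have "... = - (1 / norm (grad q x)) * level_op q x" by (simp only: sum_distrib_left[symmetric] *)
 finally show ?thesis by simp
qed

lemma tendsto_hess_map:
 fixes q :: "real^'n => real"
 assumes q: "smooth_on UNIV q" and x: "(x \<longlongrightarrow> x0) F" and w: "(w \<longlongrightarrow> w0) F"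
 shows "((%n. hess_map q (x n) (w n)) \<longlongrightarrow> hess_map q x0 w0) F"
proof (rule vec_tendstoI)
 fix i
 have expand: "hess_map q y v $ i = (\<Sum>j\<in>UNIV. dir_deriv2 q y (axis i 1) (axis j 1) * v $ j)" for y v
  using cart_linear_expansion[OF C2_linear2[OF open_UNIV smooth_onD[OF q]], of y "axis i 1" v]
  by (simp add: hess_map_def inner_vec_def)
 have "continuous_on UNIV (%y. dir_deriv2 q y v v')" for v v'
  by (rule C2_continuous_dir_deriv2[OF open_UNIV smooth_onD[OF q]])
 then have d: "((%n. dir_deriv2 q (x n) v v') \<longlongrightarrow> dir_deriv2 q x0 v v') F" for v v'
  using isCont_tendsto_compose[OF _ x, of "%y. dir_deriv2 q y v v'"] by (simp add: continuous_on_eq_continuous_at)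
 show "((%n. hess_map q (x n) (w n) $ i) \<longlongrightarrow> hess_map q x0 w0 $ i) F"
  unfolding expand by (intro tendsto_sum tendsto_mult d) (rule tendsto_vec_nth[OF w])
qed

lemma tendsto_shape_matrix:
 fixes q :: "real^'n => real"
 assumes q: "smooth_on UNIV q" and g: "grad q x0 ~= 0" and x: "(x \<longlongrightarrow> x0) F"
 shows "((%n. matrix (shape_map q (x n))) \<longlongrightarrow> matrix (shape_map q x0)) F"
proof -
 have "isCont (grad q) x0"
  using grad_has_derivative[OF open_UNIV smooth_onD[OF q]] has_derivative_continuous by blast
 then have g': "((%n. grad q (x n)) \<longlongrightarrow> grad q x0) F"
  using x by (rule isCont_tendsto_compose)
 have "((%n. shape_map q (x n) v) \<longlongrightarrow> shape_map q x0 v) F" for v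
  unfolding shape_map_def tangent_proj_def
  using g by (intro tendsto_intros tendsto_hess_map[OF q x] g' tendsto_sgn) auto
 then show ?thesis unfolding matrix_def by (intro vec_tendstoI) (simp add: tendsto_vec_nth)
qed

section \<open>First order expansion of the determinant at the identity\<close>

lemma det_has_derivative_1: "(det has_derivative trace) (at (mat 1 :: real^'n^'n))"
proof -
 have entry: "((%A::real^'n^'n. A $ i $ j) has_derivative (%H. H $ i $ j)) (at A)" for i j A
  by (intro bounded_linear_imp_has_derivative bounded_linear_compose[OF bounded_linear_vec_nth bounded_linear_vec_nth])
 let ?U = "UNIV :: 'n set"
 let ?D = "%H::real^'n^'n. \<Sum>p | p permutes ?U. of_int (sign p) * (\<Sum>i\<in>?U. H $ i $ p i * (\<Prod>j\<in>?U - {i}. (mat 1 :: real^'n^'n) $ j $ p j))"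
 have "(det has_derivative ?D) (at (mat 1))" unfolding det_def[abs_def]
  by (intro has_derivative_sum has_derivative_mult_right has_derivative_prod entry)
 moreover have "?D H = trace H" for H
 proof -
  \<comment> \<open>A permutation other than \<open>id\<close> moves at least two indices, so after
    one factor has been differentiated an off-diagonal entry of the identity remains in the
    product.\<close>
  have "(\<Sum>i\<in>?U. H $ i $ p i * (\<Prod>j\<in>?U - {i}. (mat 1 :: real^'n^'n) $ j $ p j)) = 0"
   if p: "p permutes ?U" "p ~= id" for p
  proof (intro sum.neutral ballI)
   fix i
   obtain j where j: "p j ~= j" using p(2) by (auto simp: fun_eq_iff)
   have "\<exists>k\<in>?U - {i}. p k ~= k"
   proof (cases "j = i")
    case True
    have "p (p i) ~= p i" using j True permutes_inj[OF p(1)] by (auto dest: injD)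
    then show ?thesis using j True by auto
   qed (use j in auto)
   then obtain k where "k \<in> ?U - {i}" "p k ~= k" by blast
   then have "k \<in> ?U - {i}" "(mat 1 :: real^'n^'n) $ k $ p k = 0" by (auto simp: mat_def)
   then have "(\<Prod>j\<in>?U - {i}. (mat 1 :: real^'n^'n) $ j $ p j) = 0" by (intro prod_zero) auto
   then show "H $ i $ p i * (\<Prod>j\<in>?U - {i}. (mat 1 :: real^'n^'n) $ j $ p j) = 0" by simp
  qed
  then have "?D H = (\<Sum>p\<in>{id}. of_int (sign p) * (\<Sum>i\<in>?U. H $ i $ p i * (\<Prod>j\<in>?U - {i}. (mat 1 :: real^'n^'n) $ j $ p j)))"
   by (intro sum.mono_neutral_right) (auto simp: finite_permutations permutes_id)
  also have "... = trace H" by (simp add: trace_def mat_def)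
  finally show ?thesis .
 qed
 ultimately show ?thesis by (simp add: fun_eq_iff[symmetric] ext)
qed

lemma det_expansion:
 assumes "e > 0"
 obtains d where "d > 0"
  "!!H :: real^'n^'n. norm H < d ==> \<bar>det (mat 1 + H) - 1 - trace H\<bar> <= e * norm H"
proof -
 obtain d where d: "d > 0" "!!A :: real^'n^'n. norm (A - mat 1) < d ==>
   norm (det A - det (mat 1 :: real^'n^'n) - trace (A - mat 1)) <= e * norm (A - mat 1)"
  using det_has_derivative_1 assms unfolding has_derivative_at_alt by blast
 show ?thesis
 proof (rule that[OF d(1)])
  fix H :: "real^'n^'n" assume "norm H < d"
  then show "\<bar>det (mat 1 + H) - 1 - trace H\<bar> <= e * norm H" using d(2)[of "mat 1 + H"] by simp
 qed
qed

lemma bounded_linear_trace: "bounded_linear (trace :: real^'n^'n => real)"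
 using det_has_derivative_1 by (rule has_derivative_bounded_linear)

lemma continuous_on_det: "continuous_on S (%x. det (A x :: real^'n^'n))" if "continuous_on S A" for A :: "'a::topological_space => _"
 unfolding det_def by (intro continuous_intros that)

text \<open>Near 0 the expansion gives the linear bound, away from 0 compactness does. In the
  estimate for balls the scaled curvature matrices are bounded but not small.\<close>

lemma det_linear_bound:
 obtains L where "L >= 0" "!!H :: real^'n^'n. norm H <= M ==> \<bar>det (mat 1 + H) - 1\<bar> <= L * norm H"
proof -
 obtain d where d: "d > 0"
  "!!H :: real^'n^'n. norm H < d ==> \<bar>det (mat 1 + H) - 1 - trace H\<bar> <= 1 * norm H"
  using det_expansion[of 1, where 'n='n] by auto
 obtain K where K: "K > 0" "!!H :: real^'n^'n. \<bar>trace H\<bar> <= norm H * K"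
  using bounded_linear.pos_bounded[OF bounded_linear_trace] by auto
 have "compact ((%H::real^'n^'n. \<bar>det (mat 1 + H) - 1\<bar>) ` cball 0 M)"
  by (intro compact_continuous_image continuous_intros continuous_on_det) auto
 then obtain B where "\<forall>H\<in>cball 0 M. \<bar>det (mat 1 + H :: real^'n^'n) - 1\<bar> <= B"
  using bounded_imp_bdd_above[OF compact_imp_bounded] unfolding bdd_above_def by fastforce
 then have B: "\<bar>det (mat 1 + H :: real^'n^'n) - 1\<bar> <= max B 0" if "norm H <= M" for H
  using that by (auto simp: le_max_iff_disj)
 show ?thesis
 proof (rule that[of "max (K + 1) (max B 0 / d)"])
  fix H :: "real^'n^'n" assume H: "norm H <= M"
  show "\<bar>det (mat 1 + H) - 1\<bar> <= max (K + 1) (max B 0 / d) * norm H"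
  proof (cases "norm H < d")
   case True
   have "\<bar>det (mat 1 + H) - 1\<bar> <= (K + 1) * norm H"
    using d(2)[OF True] K(2)[of H] by (simp add: algebra_simps)
   also have "... <= max (K + 1) (max B 0 / d) * norm H" by (intro mult_right_mono) auto
   finally show ?thesis .
  next
   case False
   have "max B 0 = max B 0 / d * d" using d(1) by simp
   also have "... <= max (K + 1) (max B 0 / d) * norm H"
    using False d(1) by (intro mult_mono) (auto simp: le_max_iff_disj)
   finally show ?thesis by (rule order.trans[OF B[OF H]])
  qed
 qed (use K in auto)
qed

text \<open>The interface to the curvatures: oddness under complementation, a lower bound on
  complements of balls that is uniform in \<open>n\<close> once the radius is bounded below, and
  consistency along \<open>n\<close> and \<open>x\<close> jointly. The constant sequence of the
  limit curvature satisfies it as well.\<close>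

definition curvature_family :: "real => (nat => real^'n => (real^'n) set => real) => bool" where
 "curvature_family c H \<longleftrightarrow> c >= 0 &
  (\<forall>n q a x. regular_level q a & q x = a --> H n x {y. q y <= a} = - H n x {y. q y >= a}) &
  (\<forall>D>0. \<exists>C. \<forall>n x1 x. D <= dist x x1 --> - C <= dist x x1 * H n x (- ball x1 (dist x x1))) &
  (\<forall>q x0. smooth_on UNIV q --> grad q x0 ~= 0 --> (\<forall>\<^sub>F x in nhds x0. regular_level q (q x)) -->
   ((%(n, x). H n x {y. q y >= q x}) \<longlongrightarrow> - c * level_op q x0 / norm (grad q x0)) (sequentially \<times>\<^sub>F nhds x0))"

lemma regular_level_geometry:
 fixes q :: "real^'n => real"
 assumes q: "regular_level q a" and x: "q x = a"
 shows "outer_normal {y. q y >= a} x = - sgn (grad q x)"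
  "D_normal x {y. q y >= a} = matrix (shape_map q x)"
  "mean_curvature x {y. q y >= a} = - level_op q x / norm (grad q x)"
proof -
 have sm: "Ck_on 2 UNIV q" and g: "grad q x ~= 0" using assms by (auto simp: regular_level_def smooth_onD)
 obtain R \<rho> where "\<rho> > 0" and *: "!!y E. y \<in> ball x \<rho> ==> (!!w. w \<in> UNIV ==> w \<in> E \<longleftrightarrow> q w >= q y) ==>
   outer_normal E y = - sgn (grad q y) & D_normal y E = matrix (shape_map q y)"
  using level_set_geometry[OF open_UNIV sm UNIV_I g] by metis
 have "outer_normal {y. q y >= a} x = - sgn (grad q x) & D_normal x {y. q y >= a} = matrix (shape_map q x)"
  using \<open>\<rho> > 0\<close> x by (intro *) auto
 then show "outer_normal {y. q y >= a} x = - sgn (grad q x)" "D_normal x {y. q y >= a} = matrix (shape_map q x)"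
  "mean_curvature x {y. q y >= a} = - level_op q x / norm (grad q x)"
  by (simp_all add: mean_curvature_def trace_shape_map[OF open_UNIV sm UNIV_I g])
qed

lemma grad_uminus: "smooth_on UNIV q ==> grad (%x. - q x) x = - grad q x"
 using grad_eqI[of "%x. - q x" "- grad q x" x]
  has_derivative_minus[OF C2_has_derivative[OF open_UNIV smooth_onD, of q x]]
 by (simp add: dir_deriv_eq_grad[OF open_UNIV smooth_onD] inner_commute)

lemma hess_map_uminus:
 assumes "smooth_on UNIV q"
 shows "hess_map (%x. - q x) x w = - hess_map q x w"
proof -
 have "((%x. - grad q x) has_derivative (%w. - hess_map q x w)) (at x)"
  by (intro has_derivative_minus grad_has_derivative[OF open_UNIV smooth_onD[OF assms]]) simp
 then have "(grad (%x. - q x) has_derivative (%w. - hess_map q x w)) (at x)"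
  using grad_uminus[OF assms] by presburger
 from has_derivative_unique[OF this grad_has_derivative[OF open_UNIV smooth_onD[OF smooth_on_uminus[OF open_UNIV assms]]]]
 show ?thesis by (simp add: fun_eq_iff)
qed

lemma shape_map_uminus:
 assumes "smooth_on UNIV q"
 shows "shape_map (%x. - q x) x v = - shape_map q x v"
proof -
 have *: "tangent_proj \<nu> (- u) = - tangent_proj \<nu> u" for \<nu> u :: "real^'n"
  by (simp add: tangent_proj_def)
 show ?thesis
  by (simp add: shape_map_def grad_uminus[OF assms] hess_map_uminus[OF assms] sgn_minus tangent_proj_uminus *)
qed

lemma sublevel_frontier:
 assumes "regular_level q a" "q x = a" "0 <= \<beta>" "\<beta> <= 1"
 shows "on_regular l \<beta> H x {y. q y >= a} = H x {y. q y >= a}"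
  "on_regular l \<beta> H x {y. q y <= a} = H x {y. q y <= a}"
 using assms regular_level_in_class[OF assms(1,3,4)] superlevel_closure(2)[OF assms(1)]
  regular_level_in_class[OF regular_level_uminus[OF assms(1)] assms(3,4)]
  superlevel_closure(2)[OF regular_level_uminus[OF assms(1)]] by (simp_all add: on_regular_def)

text \<open>The two sets in each equation differ by the level set, which lies in the closure of the
  open one.\<close>

lemma infdist_Compl_sublevel:
 assumes "regular_level q a"
 shows "infdist z {y. q y <= a} = infdist z (- {y. q y >= a})"
  "infdist z (- {y. q y <= a}) = infdist z {y. q y >= a}"
proof -
 have "- {y. q y >= a} = {y. - q y > - a}" "- {y. q y <= a} = {y. q y > a}" by auto
 then show "infdist z {y. q y <= a} = infdist z (- {y. q y >= a})"
  "infdist z (- {y. q y <= a}) = infdist z {y. q y >= a}"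
  using superlevel_closure(1)[OF regular_level_uminus[OF assms]] superlevel_closure(1)[OF assms]
   infdist_closure[of z "{y. - q y > - a}"] infdist_closure[of z "{y. q y > a}"] by simp_all
qed

lemma regular_level_antisym:
 fixes q :: "real^'n => real"
 assumes q: "regular_level q a" and x: "q x = a"
 shows "outer_normal {y. q y <= a} x = - outer_normal {y. q y >= a} x"
  "D_normal x {y. q y <= a} = - D_normal x {y. q y >= a}"
proof -
 have sm: "smooth_on UNIV q" using q by (simp add: regular_level_def)
 have "{y. q y <= a} = {y. - q y >= - a}" by auto
 then show "outer_normal {y. q y <= a} x = - outer_normal {y. q y >= a} x"
  "D_normal x {y. q y <= a} = - D_normal x {y. q y >= a}"
  using regular_level_geometry(1,2)[OF regular_level_uminus[OF q], of x] regular_level_geometry(1,2)[OF q x] x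
  by (simp_all add: grad_uminus[OF sm] sgn_minus shape_map_uminus[OF sm] matrix_def vec_eq_iff)
qed

text \<open>Passing to the complementary side exchanges \<open>kappa_ou\<close> and
  \<open>kappa_in\<close> with a change of sign.\<close>

lemma kappa_f_antisym:
 assumes q: "regular_level q a" and x: "q x = a"
 shows "kappa_f f r x {y. q y <= a} = - kappa_f f r x {y. q y >= a}"
proof -
 have "kappa_ou s x {y. q y <= a} = - kappa_in s x {y. q y >= a}"
  "kappa_in s x {y. q y <= a} = - kappa_ou s x {y. q y >= a}" for s
  unfolding kappa_ou_def kappa_in_def regular_level_antisym[OF q x] infdist_Compl_sublevel[OF q] by simp_all
 then show ?thesis unfolding kappa_f_def by (subst integral_neg[symmetric]) (simp add: algebra_simps)
qed

lemma mean_curvature_antisym: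
 assumes q: "regular_level q a" and x: "q x = a"
 shows "mean_curvature x {y. q y <= a} = - mean_curvature x {y. q y >= a}"
 unfolding mean_curvature_def regular_level_antisym[OF q x] by (simp add: trace_def sum_negf)

subsection \<open>Balls and spheres\<close>

lemma sphere_level:
 fixes x1 :: "real^'n"
 defines "q \<equiv> %y. (y - x1) \<bullet> (y - x1)"
 assumes "D > 0"
 shows "regular_level q (D^2)" "- ball x1 D = {y. q y >= D^2}"
  "grad q x = 2 *\<^sub>R (x - x1)" "dir_deriv2 q x v w = 2 * (v \<bullet> w)"
proof -
 have eq: "q y = (norm (y - x1))^2" for y by (simp add: q_def power2_norm_eq_inner)
 have sm: "smooth_on UNIV q"
  using smooth_on_compose_affine[of UNIV UNIV "%x. x" "- x1", OF _ _ bounded_linear_ident _ smooth_on_inner_self]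
  by (simp add: q_def)
 have d: "(q has_derivative (%v. 2 * (v \<bullet> (y - x1)))) (at y)" for y
  unfolding q_def by (auto intro!: derivative_eq_intros simp: inner_commute)
 show g: "grad q x = 2 *\<^sub>R (x - x1)" for x using d by (intro grad_eqI) simp
 have "((%y. 2 * (v \<bullet> (y - x1))) has_derivative (%w. 2 * (v \<bullet> w))) (at x)"
  by (auto intro!: derivative_eq_intros)
 then show "dir_deriv2 q x v w = 2 * (v \<bullet> w)" using dir_deriv2_eqI[OF d, of v] by simp
 have sph: "{x. q x = D^2} = sphere x1 D" using assms(2) by (auto simp: eq dist_norm norm_minus_commute)
 show "regular_level q (D^2)"
  unfolding regular_level_def using sm g assms(2) by (auto simp: sph) (auto simp: q_def)
 have "D^2 <= (norm (y - x1))^2 \<longleftrightarrow> ~ dist x1 y < D" for y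
  using assms(2) by (simp add: dist_norm norm_minus_commute abs_le_square_iff[symmetric] not_less)
 then show "- ball x1 D = {y. q y >= D^2}" unfolding eq set_eq_iff by simp
qed

lemma ball_compl_geometry:
 fixes x x1 :: "real^'n"
 assumes \<rho>: "dist x x1 = \<rho>" "\<rho> > 0"
 defines "\<nu> \<equiv> (1 / \<rho>) *\<^sub>R (x1 - x)"
 shows "outer_normal (- ball x1 \<rho>) x = \<nu>"
  "D_normal x (- ball x1 \<rho>) = - (1 / \<rho>) *\<^sub>R matrix (tangent_proj \<nu>)"
  "mean_curvature x (- ball x1 \<rho>) = - (real CARD('n) - 1) / \<rho>"
  "x \<in> frontier (- ball x1 \<rho>)"
proof -
 define q :: "real^'n => real" where "q = (%y. (y - x1) \<bullet> (y - x1))"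
 have sl: "regular_level q (\<rho>^2)" "- ball x1 \<rho> = {y. q y >= \<rho>^2}"
  "grad q x = 2 *\<^sub>R (x - x1)" "dir_deriv2 q x v w = 2 * (v \<bullet> w)" for v w
  using sphere_level[OF \<rho>(2), of x1] unfolding q_def by blast+
 have qx: "q x = \<rho>^2" using \<rho>(1) by (simp add: q_def dist_norm flip: power2_norm_eq_inner)
 note geo = regular_level_geometry[OF sl(1) qx, folded sl(2)]
 have n1: "norm \<nu> = 1" using \<rho> by (simp add: \<nu>_def dist_norm norm_minus_commute)
 have gq: "grad q x = (- (2 * \<rho>)) *\<^sub>R \<nu>"
  using \<rho>(2) by (simp add: sl(3) \<nu>_def algebra_simps)
 have "sgn \<nu> = \<nu>" using n1 by (simp add: sgn_div_norm)
 then have sg: "sgn (grad q x) = - \<nu>" using \<rho>(2) unfolding gq sgn_scaleR by (simp add: sgn_if)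
 have ng: "norm (grad q x) = 2 * \<rho>" using \<rho>(2) n1 unfolding gq by simp
 show "outer_normal (- ball x1 \<rho>) x = \<nu>" using geo(1) sg by simp
 have hess: "hess_map q x w = 2 *\<^sub>R w" for w by (simp add: hess_map_def sl(4) vec_eq_iff inner_axis')
 have pp: "tangent_proj \<nu> (2 *\<^sub>R tangent_proj \<nu> v) = 2 *\<^sub>R tangent_proj \<nu> v" for v
  using n1 by (simp add: tangent_proj_def norm_eq_1 inner_diff_right algebra_simps)
 have "shape_map q x v = - (1 / \<rho>) *\<^sub>R tangent_proj \<nu> v" for v
  using \<rho>(2) by (simp add: shape_map_def sg ng hess tangent_proj_uminus pp)
 then show "D_normal x (- ball x1 \<rho>) = - (1 / \<rho>) *\<^sub>R matrix (tangent_proj \<nu>)"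
  unfolding geo(2) by (simp add: matrix_def vec_eq_iff)
 have "level_op q x = 2 * (real CARD('n) - 1)"
  unfolding level_op_def sl(4) sg using n1 by (simp add: norm_eq_1 inner_axis_axis)
 then show "mean_curvature x (- ball x1 \<rho>) = - (real CARD('n) - 1) / \<rho>"
  unfolding geo(3) ng using \<rho>(2) by (simp add: field_simps)
 show "x \<in> frontier (- ball x1 \<rho>)" unfolding sl(2) superlevel_closure(2)[OF sl(1)] using qx by simp
qed

text \<open>The outer normal of the complement points into the ball: the exterior touching condition
  is restricted by the radius, while the interior one holds at every scale.\<close>

lemma ball_compl_infdist:
 fixes x x1 :: "real^'n"
 assumes \<rho>: "dist x x1 = \<rho>" "\<rho> > 0" and r: "r > 0"
 defines "\<nu> \<equiv> (1 / \<rho>) *\<^sub>R (x1 - x)"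
 shows "r <= \<rho> ==> infdist (x + r *\<^sub>R \<nu>) (- ball x1 \<rho>) = r"
  "infdist (x - r *\<^sub>R \<nu>) (ball x1 \<rho>) = r"
proof -
 have n1: "norm \<nu> = 1" using \<rho> by (simp add: \<nu>_def dist_norm norm_minus_commute)
 have x: "x1 - x = \<rho> *\<^sub>R \<nu>" using \<rho>(2) by (simp add: \<nu>_def)
 have dx: "dist (x + s *\<^sub>R \<nu>) x = \<bar>s\<bar>" "dist (x + s *\<^sub>R \<nu>) x1 = \<bar>\<rho> - s\<bar>" for s
 proof -
  show "dist (x + s *\<^sub>R \<nu>) x = \<bar>s\<bar>" using n1 by (simp add: dist_norm)
  have "x1 - (x + s *\<^sub>R \<nu>) = (\<rho> - s) *\<^sub>R \<nu>" using x by (simp add: algebra_simps)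
  then show "dist (x + s *\<^sub>R \<nu>) x1 = \<bar>\<rho> - s\<bar>" using n1 by (simp add: dist_norm norm_minus_commute)
 qed
 show "infdist (x + r *\<^sub>R \<nu>) (- ball x1 \<rho>) = r" if "r <= \<rho>"
 proof (rule antisym)
  have "x \<in> - ball x1 \<rho>" using \<rho> by (simp add: dist_commute)
  then have "infdist (x + r *\<^sub>R \<nu>) (- ball x1 \<rho>) <= dist (x + r *\<^sub>R \<nu>) x" by (rule infdist_le)
  then show "infdist (x + r *\<^sub>R \<nu>) (- ball x1 \<rho>) <= r" using dx(1)[of r] r by simp
  show "r <= infdist (x + r *\<^sub>R \<nu>) (- ball x1 \<rho>)"
  proof (rule infdist_geI)
   show "- ball x1 \<rho> ~= {}" using \<open>x \<in> - ball x1 \<rho>\<close> by blast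
   fix w assume "w \<in> - ball x1 \<rho>"
   then show "r <= dist (x + r *\<^sub>R \<nu>) w"
    using dist_triangle[of x1 w "x + r *\<^sub>R \<nu>"] dx(2)[of r] that by (simp add: dist_commute)
  qed
 qed
 have "infdist (x + (- r) *\<^sub>R \<nu>) (ball x1 \<rho>) = r"
 proof (rule antisym)
  have "x \<in> closure (ball x1 \<rho>)" using \<rho> by (simp add: dist_commute)
  then have "infdist (x + (- r) *\<^sub>R \<nu>) (closure (ball x1 \<rho>)) <= dist (x + (- r) *\<^sub>R \<nu>) x"
   by (rule infdist_le)
  then show "infdist (x + (- r) *\<^sub>R \<nu>) (ball x1 \<rho>) <= r"
   unfolding infdist_closure dx(1) using r by simp
  show "r <= infdist (x + (- r) *\<^sub>R \<nu>) (ball x1 \<rho>)"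
  proof (rule infdist_geI)
   show "ball x1 \<rho> ~= {}" using \<rho>(2) by simp
   fix w assume "w \<in> ball x1 \<rho>"
   then show "r <= dist (x + (- r) *\<^sub>R \<nu>) w"
    using dist_triangle[of "x + (- r) *\<^sub>R \<nu>" x1 w] dx(2)[of "- r"] \<rho>(2) r by (simp add: dist_commute)
  qed
 qed
 then show "infdist (x - r *\<^sub>R \<nu>) (ball x1 \<rho>) = r" by simp
qed

lemma norm_tangent_matrix:
 fixes \<nu> :: "real^'n"
 assumes "norm \<nu> = 1"
 shows "norm (matrix (tangent_proj \<nu>)) <= 2 * real CARD('n)"
proof -
 have "norm (matrix (tangent_proj \<nu>)) <= (\<Sum>i\<in>UNIV. norm (matrix (tangent_proj \<nu>) $ i))"
  unfolding norm_vec_def[of "matrix (tangent_proj \<nu>)"] by (rule L2_set_le_sum) simp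
 also have "... <= (\<Sum>i\<in>(UNIV::'n set). 2)"
 proof (rule sum_mono)
  fix i
  have "matrix (tangent_proj \<nu>) $ i = tangent_proj \<nu> (axis i 1)"
   by (simp add: vec_eq_iff matrix_def tangent_proj_def inner_axis) (simp add: axis_def mult.commute)
  also have "norm ... <= norm (axis i 1 :: real^'n) + norm ((\<nu> \<bullet> axis i 1) *\<^sub>R \<nu>)"
   unfolding tangent_proj_def by (rule norm_triangle_ineq4)
  also have "norm ((\<nu> \<bullet> axis i 1) *\<^sub>R \<nu>) <= 1"
   using Cauchy_Schwarz_ineq2[of \<nu> "axis i 1"] assms by simp
  finally show "norm (matrix (tangent_proj \<nu>) $ i) <= 2" by simp
 qed
 finally show ?thesis by simp
qed

section \<open>Estimates for the nonlocal curvatures\<close>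

locale bump =
 fixes f :: "real => real"
 assumes f_nonneg: "!!s. f s >= 0" and f_smooth: "smooth_on UNIV f" and f_mono: "antimono_on {0..} f"
  and f_supp: "closure {s. f s ~= 0} <= {-1..1}"
begin

lemma f_deriv: "(f has_real_derivative deriv f s) (at s)"
proof -
 have "f differentiable (at s)"
  using smooth_on_has_derivative[OF open_UNIV f_smooth UNIV_I] by (auto simp: differentiable_def)
 then show ?thesis by (simp add: DERIV_deriv_iff_real_differentiable)
qed

lemma f_deriv_continuous: "continuous_on S (deriv f)"
proof -
 have "frechet_derivative f (at s) 1 = deriv f s" for s
  using frechet_derivative_at[OF f_deriv[of s, unfolded has_field_derivative_def]] by (metis mult.right_neutral)
 then show ?thesis using smooth_on_imp_continuous_on[OF smooth_on_frechet[OF open_UNIV f_smooth, of 1]]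
  by (auto intro: continuous_on_subset)
qed

lemma f_deriv_nonpos: "s >= 0 ==> deriv f s <= 0"
proof (rule ccontr)
 assume s: "s >= 0" "~ deriv f s <= 0"
 then obtain d where d: "d > 0" "!!h. 0 < h ==> h < d ==> f s < f (s + h)"
  using DERIV_pos_inc_right[OF f_deriv[of s]] by auto
 have "f s < f (s + d / 2)" using d by auto
 moreover have "f (s + d / 2) <= f s" using s d(1) by (intro monotone_onD[OF f_mono]) auto
 ultimately show False by simp
qed

lemma f_1: "f 1 = 0"
proof (rule ccontr)
 assume "f 1 ~= 0"
 moreover have "isCont f 1" using f_deriv by (rule DERIV_isCont)
 ultimately obtain d where d: "d > 0" "!!y. dist y 1 < d ==> f y ~= 0"
  using continuous_at_avoid[of 1 f 0] by (auto simp: dist_commute)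
 have "1 + d / 2 \<in> closure {s. f s ~= 0}"
  using d by (intro subsetD[OF closure_subset]) (simp add: dist_real_def)
 then show False using f_supp d(1) by auto
qed

lemma integral_deriv: "((%s. - s * deriv f s) has_integral integral {0..1} f) {0..1}"
proof -
 have c: "continuous_on {0..1} f" using smooth_on_imp_continuous_on[OF f_smooth] by (rule continuous_on_subset) simp
 have "((%s. f s + s * deriv f s) has_integral 1 * f 1 - 0 * f 0) {0..1}"
 proof (rule fundamental_theorem_of_calculus)
  fix s
  have "((%s. s * f s) has_real_derivative f s + s * deriv f s) (at s)"
   using DERIV_mult[OF DERIV_ident f_deriv, of s] by (simp add: algebra_simps)
  then show "((%s. s * f s) has_vector_derivative f s + s * deriv f s) (at s within {0..1})"
   by (simp add: has_real_derivative_iff_has_vector_derivative has_vector_derivative_at_within)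
 qed simp
 from has_integral_diff[OF integrable_integral[OF integrable_continuous_real[OF c]] this]
 show ?thesis by (simp add: f_1)
qed

lemma integral_nonneg': "integral {0..1} f >= 0"
 using smooth_on_imp_continuous_on[OF f_smooth]
 by (intro integral_nonneg integrable_continuous_real) (auto intro: continuous_on_subset f_nonneg)

text \<open>Within the touching range both curvatures are present, and their sum is a symmetric
  difference quotient of \<open>det\<close> at the identity, close to \<open>trace A\<close>. The
  weight \<open>- s * deriv f s\<close> has the total mass \<open>integral {0..1} f\<close>, by
  parts.\<close>

lemma kappa_f_estimate:
 fixes A :: "real^'n^'n"
 assumes r: "r > 0" and A: "D_normal x E = A"
  and touch: "!!s. 0 < s ==> s <= 1 ==> infdist (x + (r * s) *\<^sub>R outer_normal E x) E = r * s"
   "!!s. 0 < s ==> s <= 1 ==> infdist (x - (r * s) *\<^sub>R outer_normal E x) (- E) = r * s"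
  and det: "!!H. norm H <= r * norm A ==> \<bar>det (mat 1 + H) - 1 - trace H\<bar> <= e * norm (H :: real^'n^'n)"
 shows "\<bar>kappa_f f r x E - integral {0..1} f * trace A\<bar> <= integral {0..1} f * (e * norm A)"
proof -
 let ?g = "%s. - s * deriv f s"
 let ?h = "%s. - deriv f s * (det (mat 1 + (r * s) *\<^sub>R A) - det (mat 1 - (r * s) *\<^sub>R A)) / (2 * r)"
 let ?k = "%s. ?g s * (kappa_ou (r * s) x E + kappa_in (r * s) x E)"
 have kh: "?k s = ?h s" if "s \<in> {0..1}" for s
 proof (cases "s = 0")
  case False
  then have s: "0 < s" "s <= 1" using that by auto
  show ?thesis unfolding kappa_ou_def kappa_in_def touch[OF s] A using r s by (simp add: field_simps)
 qed simp
 have "?h integrable_on {0..1}"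
  using r by (intro integrable_continuous_real continuous_intros f_deriv_continuous continuous_on_det) auto
 then have int: "?k integrable_on {0..1}" by (rule integrable_eq) (rule kh[symmetric])
 have tr: "trace (t *\<^sub>R A) = t * trace A" for t
  using linear_scale[OF bounded_linear.linear[OF bounded_linear_trace], of t A] by simp
 have bound: "\<bar>?k s - ?g s * trace A\<bar> <= ?g s * (e * norm A)" if s: "s \<in> {0..1}" for s
 proof (cases "s = 0")
  case False
  then have s0: "s > 0" "s <= 1" using s by auto
  have le: "norm ((r * s) *\<^sub>R A) <= r * norm A" using s0 r by (simp add: mult_left_le mult_right_mono)
  have "\<bar>det (mat 1 + (r * s) *\<^sub>R A) - det (mat 1 - (r * s) *\<^sub>R A) - 2 * (r * s) * trace A\<bar> <= 2 * (r * s) * (e * norm A)"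
   using det[OF le] det[of "(- (r * s)) *\<^sub>R A"] le s0 r unfolding tr by (simp add: abs_le_iff algebra_simps)
  then have "\<bar>(det (mat 1 + (r * s) *\<^sub>R A) - det (mat 1 - (r * s) *\<^sub>R A) - 2 * (r * s) * trace A) / (2 * (r * s))\<bar> <= e * norm A"
   using s0 r by (simp add: abs_divide pos_divide_le_eq mult_ac)
  then have "?g s * \<bar>(det (mat 1 + (r * s) *\<^sub>R A) - det (mat 1 - (r * s) *\<^sub>R A) - 2 * (r * s) * trace A) / (2 * (r * s))\<bar> <= ?g s * (e * norm A)"
   using f_deriv_nonpos[of s] s0 by (intro mult_left_mono) (auto simp: mult_nonneg_nonpos)
  moreover have "?k s - ?g s * trace A = ?g s * ((det (mat 1 + (r * s) *\<^sub>R A) - det (mat 1 - (r * s) *\<^sub>R A) - 2 * (r * s) * trace A) / (2 * (r * s)))"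
   unfolding kh[OF s] using s0 r by (simp add: field_simps)
  ultimately show ?thesis using f_deriv_nonpos[of s] s0 by (simp add: abs_mult)
 qed simp
 have i1: "(%s. ?g s * trace A) integrable_on {0..1}" "(%s. ?g s * (e * norm A)) integrable_on {0..1}"
  using has_integral_mult_left[OF integral_deriv] unfolding integrable_on_def by blast+
 have "norm (integral {0..1} (%s. ?k s - ?g s * trace A)) <= integral {0..1} (%s. ?g s * (e * norm A))"
  using bound by (intro integral_norm_bound_integral integrable_diff int i1) auto
 moreover have "integral {0..1} (%s. ?k s - ?g s * trace A) = kappa_f f r x E - integral {0..1} f * trace A"
  unfolding kappa_f_def by (subst integral_diff[OF int i1(1)])
   (simp only: integral_unique[OF has_integral_mult_left[OF integral_deriv]])
 moreover have "integral {0..1} (%s. ?g s * (e * norm A)) = integral {0..1} f * (e * norm A)"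
  by (rule integral_unique[OF has_integral_mult_left[OF integral_deriv]])
 ultimately show ?thesis by simp
qed

lemma kappa_f_family:
 fixes r :: "nat => real"
 assumes \<beta>: "0 <= \<beta>" "\<beta> <= 1" and r: "!!n. r n > 0" "r \<longlonglongrightarrow> 0"
 shows "curvature_family (integral {0..1} f)
  (%n. on_regular l \<beta> (kappa_f f (r n)) :: real^'n => (real^'n) set => real)"
 unfolding curvature_family_def
proof (intro conjI allI impI)
 show "integral {0..1} f >= 0" by (rule integral_nonneg')
next
 fix n q a and x :: "real^'n" assume "regular_level q a & q x = a"
 then show "on_regular l \<beta> (kappa_f f (r n)) x {y. q y <= a} = - on_regular l \<beta> (kappa_f f (r n)) x {y. a <= q y}"
  by (simp add: sublevel_frontier[OF _ _ \<beta>] kappa_f_antisym)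
next
 fix D :: real assume D: "D > 0"
 obtain rmax where rmax: "!!n. r n <= rmax"
  using convergent_imp_bounded[OF r(2)] r(1) unfolding bounded_iff by (metis abs_le_D1 rangeI real_norm_def)
 have rm: "rmax > 0" using r(1)[of 0] rmax[of 0] by simp
 define N where "N = 2 * real CARD('n)"
 define hm where "hm = rmax / D"
 have hm: "hm > 0" using rm D by (simp add: hm_def)
 obtain L where L: "L >= 0" "!!H :: real^'n^'n. norm H <= hm * N ==> \<bar>det (mat 1 + H) - 1\<bar> <= L * norm H"
  using det_linear_bound[of "hm * N", where 'n='n] by metis
 \<comment> \<open>\<open>L * N\<close> bounds the combined terms when
   \<open>t \<le> \<rho>\<close>, and \<open>1 + L * (hm * N)\<close> bounds a single determinant
   when \<open>t > \<rho>\<close>.\<close>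
 define C1 where "C1 = L * N + 1 + L * (hm * N)"
 have N: "N >= 0" by (simp add: N_def)
 have C1: "C1 >= 0" using L hm N by (simp add: C1_def)
 let ?I = "integral {0..1} f"
 show "\<exists>C. \<forall>n x1 (x::real^'n). D <= dist x x1 -->
   - C <= dist x x1 * on_regular l \<beta> (kappa_f f (r n)) x (- ball x1 (dist x x1))"
 proof (intro exI[of _ "C1 * ?I"] allI impI)
  fix n and x1 x :: "real^'n" assume "D <= dist x x1"
  define \<rho> where "\<rho> = dist x x1"
  have \<rho>: "\<rho> >= D" "\<rho> > 0" using \<open>D <= dist x x1\<close> D by (auto simp: \<rho>_def)
  let ?E = "- ball x1 \<rho>"
  define \<nu> where "\<nu> = (1 / \<rho>) *\<^sub>R (x1 - x)"
  note geo = ball_compl_geometry[OF \<rho>_def[symmetric] \<rho>(2), folded \<nu>_def]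
  note inf = ball_compl_infdist[OF \<rho>_def[symmetric] \<rho>(2), folded \<nu>_def]
  have n1: "norm \<nu> = 1" using \<rho>(2) by (simp add: \<nu>_def \<rho>_def dist_norm norm_minus_commute)
  define Q where "Q = matrix (tangent_proj \<nu>)"
  have nP: "norm Q <= N" unfolding Q_def N_def by (rule norm_tangent_matrix[OF n1])
  have reg: "?E \<in> regular_class l \<beta>"
   using regular_level_in_class[OF sphere_level(1)[OF \<rho>(2), of x1] \<beta>] unfolding sphere_level(2)[OF \<rho>(2), of x1] .
  have K: "- C1 / \<rho> <= kappa_ou t x ?E + kappa_in t x ?E" if t: "0 < t" "t <= rmax" for t
  proof -
   define h where "h = t / \<rho>"
   have h: "h > 0" "h <= hm" using t \<rho> D rm by (auto simp: h_def hm_def intro!: frac_le)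
   have th: "t = h * \<rho>" using \<rho>(2) by (simp add: h_def)
   have bd: "\<bar>det (mat 1 + (\<sigma> * h) *\<^sub>R Q) - 1\<bar> <= L * (h * N)" if "\<bar>\<sigma>\<bar> = 1" for \<sigma>
   proof -
    have n: "norm ((\<sigma> * h) *\<^sub>R Q) <= h * N" using that h nP by (simp add: abs_mult mult_left_mono)
    also have "... <= hm * N" using h N by (intro mult_right_mono)
    finally show ?thesis using L(2)[of "(\<sigma> * h) *\<^sub>R Q"] mult_left_mono[OF n L(1)] by linarith
   qed
   have D: "mat 1 + t *\<^sub>R D_normal x ?E = mat 1 + ((-1) * h) *\<^sub>R Q"
    "mat 1 - t *\<^sub>R D_normal x ?E = mat 1 + (1 * h) *\<^sub>R Q"
    by (simp_all add: geo(2) Q_def h_def)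
   have kin: "kappa_in t x ?E = - (1 / (2 * t)) * det (mat 1 + (1 * h) *\<^sub>R Q)"
    unfolding kappa_in_def D geo(1) using inf(2)[OF t(1)] by simp
   show ?thesis
   \<comment> \<open>For \<open>t \<le> \<rho>\<close> each term is of order \<open>1 / t\<close>,
     but the leading parts cancel. For \<open>t > \<rho>\<close> the outer term may be absent and
     nothing cancels, but then \<open>1 / t < 1 / \<rho>\<close> bounds each term
     separately.\<close>
   proof (cases "t <= \<rho>")
    case True
    have kou: "kappa_ou t x ?E = 1 / (2 * t) * det (mat 1 + ((-1) * h) *\<^sub>R Q)"
     unfolding kappa_ou_def D geo(1) using inf(1)[OF t(1) True] by simp
    have "det (mat 1 + ((-1) * h) *\<^sub>R Q) - det (mat 1 + (1 * h) *\<^sub>R Q) >= - (2 * (L * (h * N)))"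
     using bd[of "-1"] bd[of 1] by (simp add: abs_le_iff)
    then have "1 / (2 * t) * (det (mat 1 + ((-1) * h) *\<^sub>R Q) - det (mat 1 + (1 * h) *\<^sub>R Q)) >= 1 / (2 * t) * - (2 * (L * (h * N)))"
     using t by (intro mult_left_mono) auto
    also have "1 / (2 * t) * - (2 * (L * (h * N))) = - (L * N) / \<rho>"
     using h \<rho>(2) unfolding th by simp
    also have "- (L * N) / \<rho> >= - C1 / \<rho>"
     using mult_nonneg_nonneg[OF L(1) mult_nonneg_nonneg[of hm N]] hm N \<rho>(2)
     by (intro divide_right_mono) (auto simp: C1_def)
    finally show ?thesis unfolding kin kou by (simp add: algebra_simps)
   next
    case False
    have hN: "L * (h * N) <= L * (hm * N)" using h L N by (intro mult_left_mono mult_right_mono)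
    have d1: "\<bar>det (mat 1 + (\<sigma> * h) *\<^sub>R Q)\<bar> <= C1" if "\<bar>\<sigma>\<bar> = 1" for \<sigma>
     using bd[OF that] hN L N unfolding C1_def by (smt (verit) mult_nonneg_nonneg)
    have "1 / (2 * t) * d >= - (C1 / (2 * \<rho>))" if "\<bar>d\<bar> <= C1" for d
    proof -
     have "1 / (2 * t) * (- d) <= 1 / (2 * \<rho>) * C1"
     proof (rule order.trans[OF mult_left_mono])
      show "1 / (2 * t) * C1 <= 1 / (2 * \<rho>) * C1"
       using False \<rho>(2) C1 by (intro mult_right_mono divide_left_mono) auto
     qed (use that t in auto)
     then show ?thesis by simp
    qed
    note half = this
    have "kappa_ou t x ?E >= - (C1 / (2 * \<rho>))"
     unfolding kappa_ou_def D using half[OF d1[of "-1"]] C1 \<rho>(2) by auto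
    moreover have "kappa_in t x ?E >= - (C1 / (2 * \<rho>))"
     unfolding kin using half[of "- det (mat 1 + (1 * h) *\<^sub>R Q)"] d1[of 1] by simp
    ultimately show ?thesis by (simp add: field_simps)
   qed
  qed
  have "- C1 / \<rho> * ?I <= kappa_f f (r n) x ?E"
  proof (cases "(%s. - s * deriv f s * (kappa_ou (r n * s) x ?E + kappa_in (r n * s) x ?E)) integrable_on {0..1}")
   case True
   have hi: "((%s. - s * deriv f s * (- C1 / \<rho>)) has_integral ?I * (- C1 / \<rho>)) {0..1}"
    by (rule has_integral_mult_left[OF integral_deriv])
   have "?I * (- C1 / \<rho>) <= integral {0..1} (%s. - s * deriv f s * (kappa_ou (r n * s) x ?E + kappa_in (r n * s) x ?E))"
   proof (rule has_integral_le[OF hi integrable_integral[OF True]])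
    fix s :: real assume s: "s \<in> {0..1}"
    show "- s * deriv f s * (- C1 / \<rho>) <= - s * deriv f s * (kappa_ou (r n * s) x ?E + kappa_in (r n * s) x ?E)"
    proof (cases "s = 0")
     case False
     have "r n * s <= rmax * 1" using s rmax[of n] r(1)[of n] by (intro mult_mono) auto
     then show ?thesis using False s f_deriv_nonpos[of s] K[of "r n * s"] r(1)[of n]
      by (intro mult_left_mono) (auto simp: mult_nonneg_nonpos)
    qed simp
   qed
   then show ?thesis unfolding kappa_f_def by (simp add: mult.commute)
  next
   \<comment> \<open>By convention the integral of a nonintegrable function is 0, which satisfies
     the bound.\<close>
   case False
   then show ?thesis
    unfolding kappa_f_def not_integrable_integral[OF False] using C1 \<rho>(2) integral_nonneg' by simp
  qed
  then have "\<rho> * (- C1 / \<rho> * ?I) <= \<rho> * kappa_f f (r n) x ?E"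
   using \<rho>(2) by (intro mult_left_mono) auto
  then show "- (C1 * ?I) <= dist x x1 * on_regular l \<beta> (kappa_f f (r n)) x (- ball x1 (dist x x1))"
   unfolding \<rho>_def[symmetric] using \<rho>(2) reg geo(4) by (simp add: on_regular_def)
 qed
next
 fix q and x0 :: "real^'n"
 assume sm: "smooth_on UNIV q" and g: "grad q x0 ~= 0" and reg: "\<forall>\<^sub>F x in nhds x0. regular_level q (q x)"
 let ?A = "%x. matrix (shape_map q x)" and ?I = "integral {0..1} f"
 let ?F = "sequentially \<times>\<^sub>F nhds x0"
 let ?H = "%n x. on_regular l \<beta> (kappa_f f (r n)) x {y. q x <= q y}"
 obtain R \<rho> where R: "R > 0" "\<rho> > 0"
  "!!x E. x \<in> ball x0 \<rho> ==> (!!w. w \<in> UNIV ==> w \<in> E \<longleftrightarrow> q w >= q x) ==>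
   outer_normal E x = - sgn (grad q x) & D_normal x E = ?A x &
   (\<forall>r. 0 < r & r <= R --> infdist (x - r *\<^sub>R sgn (grad q x)) E = r &
     infdist (x + r *\<^sub>R sgn (grad q x)) (- E) = r)"
  using level_set_geometry[OF open_UNIV smooth_onD[OF sm] UNIV_I g] by metis
 have snd0: "((%p. snd p) \<longlongrightarrow> x0) ?F" by (rule filterlim_snd)
 have rn: "((%p. r (fst p)) \<longlongrightarrow> 0) ?F" using filterlim_compose[OF r(2) filterlim_fst] .
 have A: "((%p. ?A (snd p)) \<longlongrightarrow> ?A x0) ?F" by (rule tendsto_shape_matrix[OF sm g snd0])
 have tr: "((%p. trace (?A (snd p))) \<longlongrightarrow> trace (?A x0)) ?F"
  by (rule bounded_linear.tendsto[OF bounded_linear_trace A])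
 have "((%p. ?H (fst p) (snd p) - ?I * trace (?A (snd p))) \<longlongrightarrow> 0) ?F"
 proof (rule tendstoI)
  fix e :: real assume e: "e > 0"
  define B where "B = norm (?A x0) + 1"
  define e1 where "e1 = e / (?I * B + 1) / 2"
  have IB: "?I * B >= 0" using integral_nonneg' by (simp add: B_def)
  have e1: "e1 > 0" using e IB by (simp add: e1_def)
  obtain d where d: "d > 0" "!!H :: real^'n^'n. norm H < d ==> \<bar>det (mat 1 + H) - 1 - trace H\<bar> <= e1 * norm H"
   using det_expansion[OF e1, where 'n='n] by metis
  have B: "B > 0" unfolding B_def using norm_ge_zero[of "?A x0"] by linarith
  have "\<forall>\<^sub>F p in ?F. norm (?A (snd p)) < B"
   using tendsto_norm[OF A] by (rule order_tendstoD(2)) (simp add: B_def)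
  moreover have "\<forall>\<^sub>F p in ?F. r (fst p) < min R (d / B)"
   using rn R(1) d(1) B by (intro order_tendstoD(2)) auto
  moreover have "\<forall>\<^sub>F p in ?F. snd p \<in> ball x0 \<rho>"
   using topological_tendstoD[OF snd0 open_ball] R(2) by simp
  moreover have "\<forall>\<^sub>F p in ?F. regular_level q (q (snd p))"
   using eventually_compose_filterlim[OF reg filterlim_snd] .
  ultimately show "\<forall>\<^sub>F p in ?F. dist (?H (fst p) (snd p) - ?I * trace (?A (snd p))) 0 < e"
  proof eventually_elim
   case (elim p)
   define n x where "n = fst p" and "x = snd p"
   note el = elim[folded n_def x_def]
   let ?E = "{y. q x <= q y}"
   have geo: "outer_normal ?E x = - sgn (grad q x) & D_normal x ?E = ?A x &
     (\<forall>r. 0 < r & r <= R --> infdist (x - r *\<^sub>R sgn (grad q x)) ?E = r &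
      infdist (x + r *\<^sub>R sgn (grad q x)) (- ?E) = r)" using el(3) by (intro R(3)) auto
   have rs: "0 < r n * s & r n * s <= R" if "0 < s" "s <= 1" for s
   proof
    show "0 < r n * s" using that r(1)[of n] by simp
    have "r n * s <= r n * 1" using that r(1)[of n] by (intro mult_left_mono) auto
    then show "r n * s <= R" using el(2) by simp
   qed
   have "r n * norm (?A x) <= r n * B" using el(1) r(1)[of n] by (intro mult_left_mono) auto
   also have "... < d" using el(2) B by (simp add: pos_less_divide_eq)
   finally have rd: "r n * norm (?A x) < d" .
   have "\<bar>kappa_f f (r n) x ?E - ?I * trace (?A x)\<bar> <= ?I * (e1 * norm (?A x))"
    using geo rs rd by (intro kappa_f_estimate r(1) d(2)) auto
   also have "... <= ?I * (e1 * B)" using el(1) e1 integral_nonneg' by (intro mult_left_mono) auto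
   also have "... = e * (?I * B / (?I * B + 1)) / 2" unfolding e1_def by simp
   also have "... < e"
   proof -
    have "?I * B / (?I * B + 1) <= 1" using IB by simp
    then have "e * (?I * B / (?I * B + 1)) / 2 <= e * 1 / 2"
     using e by (intro divide_right_mono mult_left_mono) auto
    also have "... < e" using e by simp
    finally show ?thesis .
   qed
   finally have "\<bar>kappa_f f (r n) x ?E - ?I * trace (?A x)\<bar> < e" .
   then show ?case using sublevel_frontier(1)[OF el(4) refl \<beta>, of l "kappa_f f (r n)"]
    by (simp add: n_def x_def)
  qed
 qed
 from tendsto_add[OF this tendsto_mult_left[OF tr, of ?I]]
 have "((%p. ?H (fst p) (snd p)) \<longlongrightarrow> ?I * trace (?A x0)) ?F" by simp
 then show "((%(n, x). ?H n x) \<longlongrightarrow> - ?I * level_op q x0 / norm (grad q x0)) ?F"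
  by (simp add: case_prod_unfold trace_shape_map[OF open_UNIV smooth_onD[OF sm] UNIV_I g])
qed

end

text \<open>As a constant sequence the limit curvature falls under the same results, which gives its
  oddness and the uniqueness of the limit solution.\<close>

lemma mean_curvature_family:
 assumes \<beta>: "0 <= \<beta>" "\<beta> <= 1" and c: "c >= 0"
 shows "curvature_family c (%n. on_regular l \<beta> (%x E. c * mean_curvature x E)
  :: real^'n => (real^'n) set => real)" unfolding curvature_family_def
proof (intro conjI allI impI)
 fix q a and x :: "real^'n" assume "regular_level q a & q x = a"
 then show "on_regular l \<beta> (%x E. c * mean_curvature x E) x {y. q y <= a} =
   - on_regular l \<beta> (%x E. c * mean_curvature x E) x {y. a <= q y}"
  by (simp add: sublevel_frontier[OF _ _ \<beta>] mean_curvature_antisym)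
next
 fix D :: real assume D: "D > 0"
 show "\<exists>C. \<forall>n x1 (x::real^'n). D <= dist x x1 -->
   - C <= dist x x1 * on_regular l \<beta> (%x E. c * mean_curvature x E) x (- ball x1 (dist x x1))"
 proof (intro exI[of _ "c * (real CARD('n) - 1)"] allI impI)
  fix x1 x :: "real^'n" assume "D <= dist x x1"
  then have \<rho>: "dist x x1 > 0" using D by linarith
  have "- ball x1 (dist x x1) \<in> regular_class l \<beta>"
   using regular_level_in_class[OF sphere_level(1)[OF \<rho>, of x1] \<beta>] unfolding sphere_level(2)[OF \<rho>, of x1] .
  then have "dist x x1 * on_regular l \<beta> (%x E. c * mean_curvature x E) x (- ball x1 (dist x x1)) =
    dist x x1 * (c * (- (real CARD('n) - 1) / dist x x1))"
   using ball_compl_geometry(3,4)[OF refl \<rho>] by (simp add: on_regular_def)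
  also have "... = - (c * (real CARD('n) - 1))"
   using \<rho> by (metis (no_types, opaque_lifting) less_irrefl mult.left_commute mult_minus_right nonzero_mult_div_cancel_left times_divide_eq_right)
  finally show "- (c * (real CARD('n) - 1)) <= dist x x1 * on_regular l \<beta> (%x E. c * mean_curvature x E) x (- ball x1 (dist x x1))"
   by simp
 qed
next
 fix q and x0 :: "real^'n"
 assume sm: "smooth_on UNIV q" and g: "grad q x0 ~= 0" and reg: "\<forall>\<^sub>F x in nhds x0. regular_level q (q x)"
 let ?F = "(sequentially :: nat filter) \<times>\<^sub>F nhds x0"
 have "((%p. c * trace (matrix (shape_map q (snd p)))) \<longlongrightarrow> c * trace (matrix (shape_map q x0))) ?F"
  by (intro tendsto_mult_left bounded_linear.tendsto[OF bounded_linear_trace] tendsto_shape_matrix[OF sm g] filterlim_snd)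
 moreover have "\<forall>\<^sub>F p in ?F. c * trace (matrix (shape_map q (snd p))) =
   on_regular l \<beta> (%x E. c * mean_curvature x E) (snd p) {y. q (snd p) <= q y}"
  using eventually_compose_filterlim[OF reg filterlim_snd]
 proof eventually_elim
  case (elim p)
  then show ?case
   using regular_level_geometry(2)[OF elim refl] sublevel_frontier(1)[OF elim refl \<beta>, of l]
   by (simp add: mean_curvature_def)
 qed
 ultimately show "((%(n, x). on_regular l \<beta> (%x E. c * mean_curvature x E) x {y. q x <= q y}) \<longlongrightarrow>
   - c * level_op q x0 / norm (grad q x0)) ?F"
  by (simp add: case_prod_unfold trace_shape_map[OF open_UNIV smooth_onD[OF sm] UNIV_I g] tendsto_cong)
qed (rule c)

section \<open>Semicontinuous functions\<close>

lemma usc_on_openin: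
 assumes "usc_on S u"
 shows "openin (top_of_set S) {w \<in> S. u w < c}"
proof (subst openin_subopen, intro ballI)
 fix z assume z: "z \<in> {w \<in> S. u w < c}"
 then have "\<forall>\<^sub>F w in at z within S. u w < c" using assms by (auto simp: usc_on_def)
 then obtain T where T: "open T" "z \<in> T" "!!w. w \<in> T ==> w ~= z ==> w \<in> S ==> u w < c"
  unfolding eventually_at_topological by blast
 then have "S Int T <= {w \<in> S. u w < c}" using z by blast
 then show "\<exists>T. openin (top_of_set S) T & z \<in> T & T <= {w \<in> S. u w < c}"
  using T z openin_open_Int[OF T(1), of S] by blast
qed

lemma usc_on_subset: "usc_on S u ==> T <= S ==> usc_on T u"
 unfolding usc_on_def using filter_leD[OF at_le] by (metis subsetD)

lemma usc_on_diff:
 assumes "usc_on S u" "continuous_on S \<phi>"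
 shows "usc_on S (%w. u w - \<phi> w)" unfolding usc_on_def
proof (intro ballI allI impI)
 fix z c assume z: "z \<in> S" "c > u z - \<phi> z"
 define e where "e = (c - (u z - \<phi> z)) / 2"
 have e: "e > 0" using z by (simp add: e_def)
 have "\<forall>\<^sub>F w in at z within S. u w < u z + e" using assms(1) z e unfolding usc_on_def by auto
 moreover have "\<forall>\<^sub>F w in at z within S. \<phi> z - e < \<phi> w"
  using assms(2) z e by (intro order_tendstoD(1)[of \<phi> "\<phi> z"]) (auto simp: continuous_on_def)
 ultimately show "\<forall>\<^sub>F w in at z within S. u w - \<phi> w < c"
  by eventually_elim (simp add: e_def field_simps)
qed

text \<open>Without a maximum the relatively open sets \<open>u < u v\<close>, with \<open>v\<close>
  in \<open>K\<close>, would cover \<open>K\<close>; the largest of the finitely many values of a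
  subcover refutes this.\<close>

lemma usc_attains_sup:
 assumes "compact K" "K ~= {}" "usc_on K u"
 obtains z where "z \<in> K" "!!w. w \<in> K ==> u w <= u z"
proof (rule ccontr)
 assume "~ thesis"
 then have *: "~ (\<exists>z\<in>K. \<forall>w\<in>K. u w <= u z)" using that by blast
 have ex: "\<exists>w\<in>K. u z < u w" if "z \<in> K" for z using * that by (meson not_le)
 have "\<exists>T. open T & {w \<in> K. u w < c} = K Int T" for c
  using usc_on_openin[OF assms(3), of c] unfolding openin_open .
 then obtain T where T: "!!c. open (T c)" "!!c. {w \<in> K. u w < c} = K Int T c" by metis
 have "K <= (\<Union>v\<in>K. T (u v))" using ex T(2) by blast
 then obtain V where V: "V <= K" "finite V" "K <= (\<Union>v\<in>V. T (u v))"
  using compactE_image[OF assms(1), of K "%v. T (u v)"] T(1) by blast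
 have "V ~= {}" using V(3) assms(2) by auto
 then have "Max (u ` V) \<in> u ` V" using V(2) by simp
 then obtain v where v: "v \<in> V" "u v = Max (u ` V)" by auto
 then obtain v' where v': "v' \<in> V" "v \<in> T (u v')" using V by blast
 then have "u v < u v'" using T(2)[of "u v'"] V(1) v(1) by blast
 moreover have "u v' <= Max (u ` V)" using V(2) v'(1) by (intro Max_ge) auto
 ultimately show False using v(2) by simp
qed

lemma usc_on_sequentially:
 assumes "usc_on S u" "!!n. z n \<in> S" "z \<longlonglongrightarrow> z0" "z0 \<in> S" "c > u z0"
 shows "\<forall>\<^sub>F n in sequentially. u (z n) < c"
proof -
 obtain T where T: "open T" "{w \<in> S. u w < c} = S Int T"
  using usc_on_openin[OF assms(1), of c] unfolding openin_open by blast
 have "\<forall>\<^sub>F n in sequentially. z n \<in> T"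
  using topological_tendstoD[OF assms(3) T(1)] T(2) assms(4,5) by blast
 then show ?thesis by eventually_elim (use T(2) assms(2) in blast)
qed

lemma const_outside_ball:
 fixes u :: "(real^'n) * real => real"
 assumes "const_outside_compact {0..} u" "0 <= T"
 obtains R where "R > 0" "!!t (x::real^'n) y. 0 <= t ==> t < T ==> norm x > R ==> norm y > R ==> u (x, t) = u (y, t)"
proof -
 obtain K where K: "compact K" "!!t. 0 <= t ==> t < T ==> \<exists>c. \<forall>x. x ~: K --> u (x, t) = c"
  using assms unfolding const_outside_compact_def by (metis Int_iff atLeastLessThan_iff atLeast_iff)
 obtain B where B: "B > 0" "!!x. x \<in> K ==> norm x <= B"
  using compact_imp_bounded[OF K(1)] unfolding bounded_pos by blast
 show ?thesis
 proof (rule that[OF B(1)])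
  fix t and x y :: "real^'n" assume "0 <= t" "t < T" "norm x > B" "norm y > B"
  then show "u (x, t) = u (y, t)" using K(2)[of t] B(2) by (metis not_less)
 qed
qed

lemma max_attained:
 fixes u \<phi> :: "(real^'n) * real => real"
 assumes u: "usc_on space_time u" "const_outside_compact {0..} u"
  and ab: "0 <= a" "a <= b" and \<phi>: "continuous_on (UNIV \<times> {a..b}) \<phi>"
  and R: "!!t x y. t \<in> {a..b} ==> norm x > R ==> norm y > R ==> \<phi> (x, t) = \<phi> (y, t)"
 obtains z where "snd z \<in> {a..b}" "!!w. w \<in> UNIV \<times> {a..b} ==> u w - \<phi> w <= u z - \<phi> z"
proof -
 obtain R' where R': "R' > 0" "!!t x y. 0 <= t ==> t < b + 1 ==> norm x > R' ==> norm y > R' ==> u (x, t) = u (y, t)"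
  using const_outside_ball[OF u(2), of "b + 1"] ab by auto
 define B where "B = max R R' + 1"
 \<comment> \<open>Beyond both radii \<open>u\<close> and \<open>\<phi>\<close> depend on time only,
   so the single point \<open>p\<close> represents all far points.\<close>
 obtain p :: "real^'n" where p: "norm p = B" using vector_choose_size[of B] R' by (auto simp: B_def)
 let ?C = "cball 0 B \<times> {a..b} :: ((real^'n) * real) set"
 have C: "compact ?C" by (intro compact_Times) auto
 have ne: "?C ~= {}" using p ab by auto
 have "usc_on ?C (%w. u w - \<phi> w)"
  using u(1) ab by (intro usc_on_diff usc_on_subset[OF u(1)] continuous_on_subset[OF \<phi>]) auto
 then obtain z where z: "z \<in> ?C" "!!w. w \<in> ?C ==> u w - \<phi> w <= u z - \<phi> z"
  using usc_attains_sup[OF C ne] by blast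
 show ?thesis
 proof (rule that[of z])
  fix w :: "(real^'n) * real" assume w: "w \<in> UNIV \<times> {a..b}"
  obtain x t where xt: "w = (x, t)" by fastforce
  have t: "a <= t" "t <= b" using w xt by auto
  show "u w - \<phi> w <= u z - \<phi> z"
  proof (cases "norm x <= B")
   case True
   then show ?thesis using z(2)[of w] xt t by simp
  next
   case False
   then have "u w - \<phi> w = u (p, t) - \<phi> (p, t)"
    using R'(2)[of t x p] R[of t x p] xt t ab p by (simp add: B_def)
   then show ?thesis using z(2)[of "(p, t)"] p t by simp
  qed
 qed (use z in auto)
qed

lemma bounded_above_on_slab:
 fixes u :: "(real^'n) * real => real"
 assumes "usc_on space_time u" "const_outside_compact {0..} u"
 obtains M where "!!x t. 0 <= t ==> t <= T ==> u (x, t) <= M"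
proof (cases "0 <= T")
 case True
 obtain z where "snd z \<in> {0..T}" "!!w. w \<in> UNIV \<times> {0..T} ==> u w - 0 <= u z - 0"
  using max_attained[OF assms, of 0 T "%_. 0" 0] True by auto
 then show ?thesis using that[of "u z"] by auto
qed (use that in auto)

section \<open>Barriers\<close>

lemma smooth_on_exp: "smooth_on UNIV (exp :: real => real)"
proof -
 have "smooth_on UNIV ((%_::nat. exp :: real => real) 0)"
 proof (rule smooth_on_real_family)
  show "(exp has_real_derivative (\<Sum>i<(1::nat). 1 * exp x)) (at x)" for x :: real
   using DERIV_exp by simp
 qed
 then show ?thesis .
qed

lemma smooth_on_snd_compose:
 fixes \<theta> :: "real => real"
 assumes "smooth_on UNIV \<theta>"
 shows "smooth_on UNIV (%z::'a::real_normed_vector \<times> real. \<theta> (snd z))"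
 using smooth_on_compose_affine[of UNIV UNIV snd 0, OF _ _ bounded_linear_snd _ assms] by simp

lemma exp_quadratic_error: "\<bar>exp y - 1 - y\<bar> <= exp \<bar>y\<bar> * y^2" for y :: real
proof -
 obtain t where t: "\<bar>t\<bar> <= \<bar>y\<bar>" "exp y = (\<Sum>m<2. y ^ m / fact m) + exp t / fact 2 * y ^ 2"
  using Maclaurin_exp_le[of y 2] by blast
 have "\<bar>exp y - 1 - y\<bar> = exp t / 2 * y^2" using t(2) by (simp add: numeral_2_eq_2)
 also have "... <= exp \<bar>y\<bar> * y^2"
 proof (rule mult_right_mono)
  have "exp t <= exp \<bar>y\<bar>" using t(1) by simp
  then show "exp t / 2 <= exp \<bar>y\<bar>" using exp_ge_zero[of t] by linarith
 qed simp
 finally show ?thesis .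
qed

lemma time_derivI: "((%s. \<phi> (x, s)) has_real_derivative D) (at t) ==> time_deriv \<phi> (x, t) = D"
 by (simp add: time_deriv_def DERIV_imp_deriv)

lemma space_gradI: "((%y. \<phi> (y, t)) has_derivative (%v. v \<bullet> p)) (at x) ==> space_grad \<phi> (x, t) = p"
 by (simp add: space_grad_def grad_eqI)

lemma subsolutionD:
 assumes "subsolution \<gamma> H u0 u" "admissible_at \<gamma> a b (x, t) \<phi>" "smooth_on UNIV \<phi>"
  "!!w. w \<in> UNIV \<times> {a..b} ==> u w - \<phi> w <= u (x, t) - \<phi> (x, t)"
 shows "space_grad \<phi> (x, t) = 0 ==> time_deriv \<phi> (x, t) <= 0"
  "noncritical_level \<phi> (x, t) ==>
   time_deriv \<phi> (x, t) + norm (space_grad \<phi> (x, t)) * H x (superlevel \<phi> (x, t)) <= 0"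
proof -
 have op: "open (UNIV \<times> {a<..<b} :: ((real^'n) * real) set)" by (intro open_Times) auto
 have "smooth_on (UNIV \<times> {a<..<b}) \<phi>" by (rule smooth_on_subset[OF assms(3) open_UNIV op]) simp
 then have "(space_grad \<phi> (x, t) = 0 --> time_deriv \<phi> (x, t) <= 0) &
   (noncritical_level \<phi> (x, t) -->
     time_deriv \<phi> (x, t) + norm (space_grad \<phi> (x, t)) * H x (superlevel \<phi> (x, t)) <= 0)"
  using assms(1,2,4) unfolding subsolution_def by (metis fst_conv)
 then show "space_grad \<phi> (x, t) = 0 ==> time_deriv \<phi> (x, t) <= 0"
  "noncritical_level \<phi> (x, t) ==>
   time_deriv \<phi> (x, t) + norm (space_grad \<phi> (x, t)) * H x (superlevel \<phi> (x, t)) <= 0" by auto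
qed

lemma smooth_on_fst_compose:
 assumes "smooth_on UNIV q"
 shows "smooth_on UNIV (%z::'a::real_normed_vector \<times> 'b::real_normed_vector. q (fst z) :: real)"
 using smooth_on_compose_affine[of UNIV UNIV fst 0, OF _ _ bounded_linear_fst _ assms] by simp

lemma admissible_smooth:
 fixes \<phi> :: "(real^'n) * real => real"
 assumes sm: "smooth_on UNIV \<phi>" and ab: "0 <= a" "a < t" "t < b"
  and far: "!!s. s \<in> {a..b} ==> \<exists>c. \<forall>y. y ~: cball x0 R --> \<phi> (y, s) = c"
  and zero: "space_grad \<phi> (x, t) = 0 ==> \<exists>g\<in>test_profiles \<gamma>. \<exists>\<omega>. smooth_on {0..} \<omega> & \<omega> 0 = 0 &
   half_line_deriv \<omega> 0 = 0 & (\<forall>r>0. \<omega> r > 0) &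
   (\<forall>y. \<forall>s\<in>{a<..<b}. \<bar>\<phi> (y, s) - \<phi> (x, t) - time_deriv \<phi> (x, t) * (s - t)\<bar> <= g (norm (y - x)) + \<omega> \<bar>s - t\<bar>)"
 shows "admissible_at \<gamma> a b (x, t) \<phi>" unfolding admissible_at_def fst_conv snd_conv
proof (intro conjI impI zero)
 show "continuous_on (UNIV \<times> {a..b}) \<phi>"
  using smooth_on_imp_continuous_on[OF sm] by (rule continuous_on_subset) simp
 have op: "open (UNIV \<times> {a<..<b} :: ((real^'n) * real) set)" by (intro open_Times) auto
 show "\<exists>N. open N & (x, t) \<in> N & N <= UNIV \<times> {a<..<b} & Ck_on 2 N \<phi>"
  by (rule exI[of _ "UNIV \<times> {a<..<b}"]) (use ab op Ck_on_subset[OF smooth_onD[OF sm] open_UNIV op] in auto)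
 show "const_outside_compact {a..b} \<phi>"
  unfolding const_outside_compact_def using far by (intro ballI exI[of _ "cball x0 R"]) auto
qed (use ab in auto)

locale profile_test =
 fixes q :: "real^'n => real" and F F1 \<theta> \<theta>' \<eta> \<eta>' :: "real => real"
 assumes q: "smooth_on UNIV q" and F: "smooth_on UNIV F" "!!v. (F has_real_derivative F1 v) (at v)"
  and \<theta>: "smooth_on UNIV \<theta>" "!!t. (\<theta> has_real_derivative \<theta>' t) (at t)"
  and \<eta>: "smooth_on UNIV \<eta>" "!!t. (\<eta> has_real_derivative \<eta>' t) (at t)"
begin

definition tst :: "(real^'n) * real => real" where
 "tst w = \<theta> (snd w) + F (q (fst w) + \<eta> (snd w))"

lemma tst_smooth: "smooth_on UNIV tst"
 unfolding tst_def[abs_def]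
 by (intro smooth_on_add smooth_on_snd_compose[OF \<theta>(1)] smooth_on_snd_compose[OF \<eta>(1)]
   smooth_on_compose_real[OF _ F(1)] smooth_on_fst_compose[OF q] open_UNIV)

lemma tst_time_deriv: "time_deriv tst (x, t) = \<theta>' t + F1 (q x + \<eta> t) * \<eta>' t"
proof (rule time_derivI)
 have "((%s. q x + \<eta> s) has_real_derivative 0 + \<eta>' t) (at t)" by (intro DERIV_add DERIV_const \<eta>(2))
 from DERIV_add[OF \<theta>(2) DERIV_chain2[OF F(2) this]]
 show "((%s. tst (x, s)) has_real_derivative \<theta>' t + F1 (q x + \<eta> t) * \<eta>' t) (at t)" by (simp add: tst_def)
qed

lemma tst_space_grad: "space_grad tst (y, t) = F1 (q y + \<eta> t) *\<^sub>R grad q y"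
proof (rule space_gradI)
 have "(q has_derivative (%v. grad q y \<bullet> v)) (at y)"
  by (rule has_derivative_eq_rhs[OF C2_has_derivative[OF open_UNIV smooth_onD[OF q]]])
   (simp_all add: fun_eq_iff dir_deriv_eq_grad[OF open_UNIV smooth_onD[OF q]])
 then have "((%y. q y + \<eta> t) has_derivative (%v. grad q y \<bullet> v + 0)) (at y)"
  by (intro has_derivative_add has_derivative_const)
 from diff_chain_at[OF this F(2)[unfolded has_field_derivative_def]]
 have "((%y. F (q y + \<eta> t)) has_derivative (%v. F1 (q y + \<eta> t) * (grad q y \<bullet> v))) (at y)" by (simp add: o_def)
 from has_derivative_add[OF has_derivative_const[of "\<theta> t"] this]
 show "((%y. tst (y, t)) has_derivative (%v. v \<bullet> F1 (q y + \<eta> t) *\<^sub>R grad q y)) (at y)"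
  by (simp add: tst_def inner_commute)
qed

lemma tst_noncritical:
 assumes sub: "subsolution \<gamma> H u0 u" and adm: "space_grad tst (x, t) ~= 0 ==> admissible_at \<gamma> a b (x, t) tst"
  and mx: "!!w. w \<in> UNIV \<times> {a..b} ==> u w - tst w <= u (x, t) - tst (x, t)"
  and pos: "F1 (q x + \<eta> t) > 0" and lev: "!!v. F v >= F (q x + \<eta> t) \<longleftrightarrow> v >= q x + \<eta> t"
  and inj: "!!v. F v = F (q x + \<eta> t) ==> v = q x + \<eta> t" and reg: "!!y. q y = q x ==> grad q y ~= 0"
 shows "\<theta>' t + F1 (q x + \<eta> t) * (\<eta>' t + norm (grad q x) * H x {y. q y >= q x}) <= 0"
proof -
 have "noncritical_level tst (x, t)"
  unfolding noncritical_level_def snd_conv tst_space_grad using inj pos reg by (fastforce simp: tst_def)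
 moreover have "superlevel tst (x, t) = {y. q y >= q x}" by (simp add: superlevel_def tst_def lev)
 moreover have "space_grad tst (x, t) ~= 0" using pos reg by (simp add: tst_space_grad)
 ultimately have "time_deriv tst (x, t) + norm (space_grad tst (x, t)) * H x {y. q y >= q x} <= 0"
  using subsolutionD(2)[OF sub adm tst_smooth mx] by simp
 then show ?thesis using pos by (simp add: tst_time_deriv tst_space_grad algebra_simps)
qed

end

text \<open>The barrier is \<open>A\<close> plus a small time-dependent term inside a shrinking ball and large outside it;
 where its gradient does not vanish its superlevel sets are complements of balls of radius at least
 \<open>D / 2\<close>.\<close>

lemma barrier:
 fixes u :: "(real^'n) * real => real"
 assumes sub: "subsolution \<gamma> H u0 u" and \<gamma>: "antimono_on {0<..} \<gamma>"
  and D: "D > 0" and C: "C >= 0"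
  and H: "!!x. D / 2 <= dist x x1 ==> - C <= dist x x1 * H x (- ball x1 (dist x x1))"
  and t1: "t1 >= 0" and A: "!!x. x \<in> cball x1 (2 * D) ==> u (x, t1) <= A"
  and t: "t1 <= ts" "ts <= t1 + D^2 / (4 * (2 * C + 1))"
 shows "u (x1, ts) <= A"
proof (rule ccontr)
 assume "~ ?thesis"
 then have big: "u (x1, ts) > A" by simp
 define \<epsilon> where "\<epsilon> = u (x1, ts) - A"
 have \<epsilon>: "\<epsilon> > 0" using big by (simp add: \<epsilon>_def)
 have ts: "ts > t1" using t(1) A[of x1] big D by (cases "ts = t1") auto
 \<comment> \<open>At distance \<open>\<rho>\<close> the norm of \<open>grad q\<close> is
   \<open>2 * \<rho>\<close>, so the curvature term is at least \<open>- 2 * C\<close>; the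
   additional 1 makes the final inequality strict.\<close>
 define C' where "C' = 2 * C + 1"
 have C': "C' >= 1" "C' > 0" using C by (auto simp: C'_def)
 \<comment> \<open>Twice the permitted time, so that \<open>ts\<close> is not the end point; up to
   \<open>b\<close> the squared radius drops by at most \<open>D^2 / 2\<close>, which keeps it above
   \<open>(D / 2)^2\<close>.\<close>
 define b where "b = t1 + 2 * (D^2 / (4 * C'))"
 have D2: "D^2 / (4 * C') > 0" using D C' by simp
 have b: "ts < b" using t(2) D2 unfolding b_def C'_def by linarith
 have Cb: "C' * (t - t1) <= D^2 / 2" if "t <= b" for t
 proof -
  have "C' * (t - t1) <= C' * (2 * (D^2 / (4 * C')))" using that C' by (intro mult_left_mono) (auto simp: b_def)
  then show ?thesis using C' by simp
 qed
 note usc = sub[unfolded subsolution_def, THEN conjunct1]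
  and coc = sub[unfolded subsolution_def, THEN conjunct2, THEN conjunct1]
 obtain M where M: "!!x t. 0 <= t ==> t <= b ==> u (x, t) <= M"
  using bounded_above_on_slab[OF usc coc] by metis
 \<comment> \<open>High enough that no positive value of \<open>u - tst\<close> occurs where the
   step has reached its full height.\<close>
 define S where "S = \<bar>M - A\<bar> + 1"
 have S: "S > 0" "A + S >= M + 1" by (auto simp: S_def)
 \<comment> \<open>Makes \<open>\<theta>\<close> grow from \<open>\<epsilon> / 2\<close> at
   \<open>ts\<close> to at least \<open>S\<close> at \<open>b\<close>: small at the point to be
   refuted, prohibitive at the final time.\<close>
 define k where "k = S / (\<epsilon> / 2) / (b - ts)"
 have k: "k > 0" using S \<epsilon> b by (simp add: k_def)
 define \<theta> where "\<theta> t = \<epsilon> / 2 * exp (k * (t - ts))" for t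
 have \<theta>0: "\<theta> t > 0" for t using \<epsilon> by (simp add: \<theta>_def)
 have \<theta>s: "\<theta> ts < \<epsilon>" using \<epsilon> by (simp add: \<theta>_def)
 have \<theta>b: "\<theta> b >= S"
 proof -
  have "S / (\<epsilon> / 2) = k * (b - ts)" using b by (simp add: k_def)
  also have "... <= exp (k * (b - ts))" using exp_ge_add_one_self[of "k * (b - ts)"] by linarith
  finally show ?thesis using \<epsilon> by (simp add: \<theta>_def field_simps)
 qed
 have \<theta>': "(\<theta> has_real_derivative k * \<theta> t) (at t)" for t
  unfolding \<theta>_def by (auto intro!: derivative_eq_intros)
 have sm_\<theta>: "smooth_on UNIV (%t. A + \<theta> t)"
 proof -
  have "smooth_on UNIV (%t. A + \<epsilon> / 2 * exp (k * (t + - ts)))"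
   by (intro smooth_on_cmult smooth_on_compose_real[OF _ smooth_on_exp] smooth_on_add smooth_on_const
     smooth_on_bounded_linear bounded_linear_ident open_UNIV)
  then show ?thesis by (rule smooth_on_cong) (simp add: \<theta>_def)
 qed
 \<comment> \<open>For the splitting of \<open>G (arg (x, t))\<close> below: \<open>c * n\<close>
   exceeds \<open>2 * (n * (2 * D + 1) / D^2)\<close>, and \<open>c \<ge> 1\<close> covers
   displacements of at least 1.\<close>
 define c where "c = 2 * (2 * D + 1) / D^2 + 1"
 have c: "c > 0" "c >= 1" using D by (auto simp: c_def intro: add_pos_nonneg)
 obtain G G1 :: "real => real" where G: "smooth_on UNIV G" "!!s. (G has_real_derivative G1 s) (at s)"
  "!!s. s <= 0 ==> G s = 0 & G1 s = 0" "!!s. s >= 1 ==> G s = 1"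
  "!!s. 0 < s ==> s < 1 ==> G1 s > 0" "!!s. s < 1 ==> G s < 1" "mono G"
  "!!s. G s >= 0" "!!s. s > 0 ==> G s > 0"
  "!!s t. 0 < s ==> s < 1 ==> G t >= G s \<longleftrightarrow> t >= s"
  "(%\<rho>. S * G (c * \<rho>)) \<in> test_profiles \<gamma>"
  by (rule flat_step[OF \<gamma> S(1) c(1)]) (rule that, blast+)
 define q where "q y = (y - x1) \<bullet> (y - x1)" for y
 define F F1 where "F v = S * G (v / D^2)" and "F1 v = S * (G1 (v / D^2) / D^2)" for v
 define \<Theta> \<eta> where "\<Theta> t = A + \<theta> t" and "\<eta> t = C' * (t + - t1) - D^2" for t
 define arg where "arg z = (q (fst z) + \<eta> (snd z)) / D^2" for z
 interpret profile_test q F F1 \<Theta> "%t. k * \<theta> t" \<eta> "%t. C'"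
 proof
  show "smooth_on UNIV q"
   using smooth_on_compose_affine[of UNIV UNIV "%y. y" "- x1", OF _ _ bounded_linear_ident _ smooth_on_inner_self]
   by (simp add: q_def[abs_def])
  have "smooth_on UNIV (%v. S * G (1 / D^2 * v))"
   by (intro smooth_on_cmult smooth_on_compose_real[OF _ G(1)] smooth_on_bounded_linear bounded_linear_ident open_UNIV)
  then show "smooth_on UNIV F" by (rule smooth_on_cong) (simp add: F_def)
  show "smooth_on UNIV \<Theta>" unfolding \<Theta>_def[abs_def] by (rule sm_\<theta>)
  show "smooth_on UNIV \<eta>" unfolding \<eta>_def[abs_def]
   by (intro smooth_on_diff smooth_on_cmult smooth_on_add smooth_on_const smooth_on_bounded_linear bounded_linear_ident open_UNIV)
  show "(F has_real_derivative F1 v) (at v)" for v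
  proof -
   have "((%v. v / D^2) has_real_derivative 1 / D^2) (at v)" by (rule DERIV_cdivide) simp
   from DERIV_cmult[OF DERIV_chain2[OF G(2) this], of S] show ?thesis by (simp add: F_def[abs_def] F1_def)
  qed
  show "(\<Theta> has_real_derivative k * \<theta> t) (at t)" for t
   using DERIV_add[OF DERIV_const \<theta>'] by (simp add: \<Theta>_def[abs_def])
  show "(\<eta> has_real_derivative C') (at t)" for t unfolding \<eta>_def by (auto intro!: derivative_eq_intros)
 qed
 note sm = tst_smooth
 have tst_eq: "tst z = A + \<theta> (snd z) + S * G (arg z)" for z by (simp add: tst_def arg_def \<Theta>_def F_def)
 have arg_eq: "arg (x, t) = ((dist x x1)^2 - D^2 + C' * (t - t1)) / D^2" for x t
  by (simp add: arg_def q_def \<eta>_def dist_norm power2_norm_eq_inner)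
 have far: "arg (x, t) >= 1" if "dist x x1 > 2 * D" "t >= t1" for x t
 proof -
  have four_D: "(2 * D)^2 = 4 * D^2" by (simp add: power_mult_distrib)
  have "(dist x x1)^2 >= (2 * D)^2" using that D by (intro power_mono) auto
  moreover have "C' * (t - t1) >= 0" using that C' by simp
  ultimately have "(dist x x1)^2 - D^2 + C' * (t - t1) >= D^2" using zero_le_power2[of D] four_D by linarith
  then show ?thesis using D by (simp add: arg_eq)
 qed
 obtain z where z: "snd z \<in> {t1..b}" "!!w. w \<in> UNIV \<times> {t1..b} ==> u w - tst w <= u z - tst z"
 proof (rule max_attained[OF usc coc t1, of b tst "2 * D + norm x1"])
  show "t1 <= b" using ts b by simp
  show "continuous_on (UNIV \<times> {t1..b}) tst"
   using smooth_on_imp_continuous_on[OF sm] by (rule continuous_on_subset) simp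
  fix t and x y :: "real^'n" assume "t \<in> {t1..b}" "norm x > 2 * D + norm x1" "norm y > 2 * D + norm x1"
  then have "dist x x1 > 2 * D" "dist y x1 > 2 * D" "t >= t1"
   using norm_triangle_ineq2[of x x1] norm_triangle_ineq2[of y x1] by (auto simp: dist_norm)
  then show "tst (x, t) = tst (y, t)" using far[of x t] far[of y t] by (simp add: tst_eq G(4))
 qed blast
 obtain xh th where zz: "z = (xh, th)" by fastforce
 have th: "t1 <= th" "th <= b" using z(1) zz by auto
 have pos: "u (xh, th) > tst (xh, th)"
 proof -
  have "arg (x1, ts) <= 0"
  proof -
   have "C' * (ts - t1) <= D^2" using Cb[of ts] b zero_le_power2[of D] by linarith
   then show ?thesis by (simp add: arg_eq divide_le_0_iff)
  qed
  then have "tst (x1, ts) = A + \<theta> ts" using G(3) by (simp add: tst_eq)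
  then have "u (x1, ts) - tst (x1, ts) > 0" using \<theta>s by (simp add: \<epsilon>_def)
  then show ?thesis using z(2)[of "(x1, ts)"] ts b zz by simp
 qed
 have uM: "u (xh, th) <= M" using M th t1 by simp
 have arg1: "arg (xh, th) < 1"
 proof (rule ccontr)
  assume "~ ?thesis"
  then have "tst (xh, th) = A + \<theta> th + S" using G(4) by (simp add: tst_eq)
  then show False using pos uM S(2) \<theta>0[of th] by simp
 qed
 have ge: "tst (xh, th) >= A + \<theta> th" using G(8) S(1) by (simp add: tst_eq)
 have "th ~= t1"
 proof
  assume eq: "th = t1"
  have "xh \<in> cball x1 (2 * D)" using far[of xh th] arg1 th by (force simp: dist_commute)
  then have "u (xh, th) <= A" using A eq by simp
  then show False using pos ge \<theta>0[of th] by simp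
 qed
 moreover have "th ~= b" using pos ge \<theta>b uM S(2) by auto
 ultimately have th': "t1 < th" "th < b" using th by auto
 have grad_q: "grad q y = 2 *\<^sub>R (y - x1)" for y
  unfolding q_def[abs_def] by (rule grad_eqI) (auto intro!: derivative_eq_intros simp: inner_commute)
 have td: "time_deriv tst (xh, th) = k * \<theta> th + S * (G1 (arg (xh, th)) * (C' / D^2))"
  by (simp add: tst_time_deriv arg_def F1_def)
 have sg: "space_grad tst (y, th) = (S * G1 (arg (y, th)) * (2 / D^2)) *\<^sub>R (y - x1)" for y
  by (simp add: tst_space_grad arg_def grad_q F1_def)
 \<comment> \<open>A vanishing gradient is accepted only in the flat part
   \<open>arg \<le> 0\<close>; there the profile \<open>S * G (c * \<rho>)\<close> controls the test
   function in space and \<open>\<omega>\<close> in time.\<close>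
 have adm: "admissible_at \<gamma> t1 b (xh, th) tst"
  if zero: "space_grad tst (xh, th) = 0 ==> arg (xh, th) <= 0"
 proof (rule admissible_smooth[OF sm t1 th', of x1 "2 * D"])
  fix s assume "s \<in> {t1..b}"
  then have "arg (x, s) >= 1" if "x ~: cball x1 (2 * D)" for x
   using that by (intro far) (auto simp: dist_commute)
  then show "\<exists>c. \<forall>x. x ~: cball x1 (2 * D) --> tst (x, s) = c"
   by (intro exI[of _ "A + \<theta> s + S"]) (auto simp: tst_eq G(4))
 next
  assume "space_grad tst (xh, th) = 0"
  then have a0: "arg (xh, th) <= 0" by (rule zero)
  define C0 where "C0 = \<theta> th * (exp (k * (b - t1)) * k^2)"
  have C0: "C0 > 0" using \<theta>0[of th] k by (simp add: C0_def)
  define \<omega> where "\<omega> s = C0 * s^2 + S * G (2 * C' / D^2 * s)" for s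
  have "smooth_on UNIV \<omega>" unfolding \<omega>_def[abs_def]
   by (intro smooth_on_add smooth_on_cmult smooth_on_power smooth_on_compose_real[OF _ G(1)]
     smooth_on_bounded_linear bounded_linear_ident open_UNIV)
  then have w1: "smooth_on {0..} \<omega>" by (rule smooth_on_half_line)
  have "((%s. G (2 * C' / D^2 * s)) has_real_derivative G1 (2 * C' / D^2 * 0) * (2 * C' / D^2)) (at 0)"
   by (rule DERIV_chain2[OF G(2) DERIV_cmult_Id])
  then have "(\<omega> has_real_derivative 0) (at 0)"
   unfolding \<omega>_def using G(3)[of 0] by (auto intro!: derivative_eq_intros)
  then have w2: "half_line_deriv \<omega> 0 = 0" by (rule half_line_deriv_eq) simp
  have bound: "\<bar>tst (x, t) - tst (xh, th) - time_deriv tst (xh, th) * (t - th)\<bar>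
    <= S * G (c * norm (x - xh)) + \<omega> \<bar>t - th\<bar>" if t: "t \<in> {t1<..<b}" for x t
  proof -
   have G0: "G (arg (xh, th)) = 0" "G1 (arg (xh, th)) = 0" using G(3)[OF a0] by auto
   have dxh: "dist xh x1 <= D"
   proof (rule ccontr)
    assume "~ ?thesis"
    then have "(dist xh x1)^2 > D\<^sup>2" using D by (intro power_strict_mono) auto
    moreover have "C' * (th - t1) >= 0" using C' th by simp
    ultimately have "arg (xh, th) > 0" unfolding arg_eq using D by (intro divide_pos_pos) auto
    then show False using a0 by simp
   qed
   let ?y = "k * (t - th)"
   have "\<theta> t = \<theta> th * exp ?y" by (simp add: \<theta>_def algebra_simps flip: exp_add)
   then have "\<theta> t - \<theta> th - k * \<theta> th * (t - th) = \<theta> th * (exp ?y - 1 - ?y)" by (simp add: algebra_simps)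
   then have "\<bar>\<theta> t - \<theta> th - k * \<theta> th * (t - th)\<bar> = \<theta> th * \<bar>exp ?y - 1 - ?y\<bar>"
    using \<theta>0[of th] by (simp add: abs_mult)
   also have "... <= \<theta> th * (exp \<bar>?y\<bar> * ?y^2)"
    using \<theta>0[of th] exp_quadratic_error[of ?y] by (intro mult_left_mono) auto
   also have "... <= \<theta> th * (exp (k * (b - t1)) * ?y^2)"
    using \<theta>0[of th] k t th' by (intro mult_left_mono mult_right_mono) (auto simp: abs_mult)
   also have "... = C0 * \<bar>t - th\<bar>^2" by (simp add: C0_def power_mult_distrib)
   finally have 1: "\<bar>\<theta> t - \<theta> th - k * \<theta> th * (t - th)\<bar> <= C0 * \<bar>t - th\<bar>^2" .
   have 2: "G (arg (x, t)) <= G (c * norm (x - xh)) + G (2 * C' / D^2 * \<bar>t - th\<bar>)"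
   proof (cases "norm (x - xh) >= 1")
    case True
    then have "c * norm (x - xh) >= 1" using c mult_mono[of 1 c 1 "norm (x - xh)"] by simp
    moreover have "G (arg (x, t)) <= 1"
     using G(4)[of "max 1 (arg (x, t))"] monoD[OF G(7), of "arg (x, t)" "max 1 (arg (x, t))"] by simp
    ultimately show ?thesis using G(4)[of "c * norm (x - xh)"] G(8)[of "2 * C' / D^2 * \<bar>t - th\<bar>"] by simp
   next
    case False
    define n where "n = norm (x - xh)"
    have n: "0 <= n" "n <= 1" using False by (auto simp: n_def)
    have "dist x x1 <= n + dist xh x1" using dist_triangle[of x x1 xh] by (simp add: n_def dist_norm)
    then have "(dist x x1)^2 <= (n + dist xh x1)^2" by (intro power_mono) auto
    also have "... = (dist xh x1)^2 + n * (2 * dist xh x1 + n)" by (simp add: power2_eq_square algebra_simps)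
    also have "... <= (dist xh x1)^2 + n * (2 * D + 1)"
     using n dxh by (intro add_left_mono mult_left_mono) auto
    finally have "(dist x x1)^2 - D^2 + C' * (t - t1) <=
      ((dist xh x1)^2 - D^2 + C' * (th - t1)) + n * (2 * D + 1) + C' * (t - th)"
     by (simp add: algebra_simps)
    then have "arg (x, t) <= arg (xh, th) + n * (2 * D + 1) / D^2 + C' * (t - th) / D^2"
     unfolding arg_eq using D by (simp add: divide_right_mono flip: add_divide_distrib)
    also have "C' * (t - th) / D^2 <= C' * \<bar>t - th\<bar> / D^2"
     using C' by (intro divide_right_mono mult_left_mono) auto
    finally have le: "arg (x, t) <= n * (2 * D + 1) / D^2 + C' * \<bar>t - th\<bar> / D^2" using a0 by simp
    let ?p = "n * (2 * D + 1) / D^2" and ?q = "C' * \<bar>t - th\<bar> / D^2"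
    \<comment> \<open>Bounding the sum by the larger of the doubles separates the dependence on
      space from that on time using only monotonicity and nonnegativity of \<open>G\<close>.\<close>
    have "p + q <= max (2 * p) (2 * q)" for p q :: real by (simp add: max_def)
    then have "arg (x, t) <= max (2 * ?p) (2 * ?q)" using le order.trans by blast
    then have "G (arg (x, t)) <= G (max (2 * ?p) (2 * ?q))" by (rule monoD[OF G(7)])
    also have "... <= G (2 * ?p) + G (2 * ?q)" using G(8)[of "2 * ?p"] G(8)[of "2 * ?q"] by (simp add: max_def)
    also have "G (2 * ?p) <= G (c * n)"
    proof (rule monoD[OF G(7)])
     have "c * n = 2 * ?p + n" by (simp add: c_def algebra_simps)
     then show "2 * ?p <= c * n" using n by simp
    qed
    finally show ?thesis by (simp add: n_def mult_ac)
   qed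
   have "tst (x, t) - tst (xh, th) - time_deriv tst (xh, th) * (t - th) =
     (\<theta> t - \<theta> th - k * \<theta> th * (t - th)) + S * G (arg (x, t))"
    by (simp add: td G0 tst_eq)
   also have "\<bar>...\<bar> <= C0 * \<bar>t - th\<bar>^2 + S * G (arg (x, t))"
    using 1 G(8)[of "arg (x, t)"] S(1) by (simp add: abs_le_iff)
     (smt (verit) mult_nonneg_nonneg)
   also have "S * G (arg (x, t)) <= S * (G (c * norm (x - xh)) + G (2 * C' / D^2 * \<bar>t - th\<bar>))"
    using 2 S(1) by (intro mult_left_mono) auto
   finally show ?thesis by (simp add: \<omega>_def algebra_simps)
  qed
  have w3: "\<forall>r>0. \<omega> r > 0"
   using C0 S(1) G(8) by (auto simp: \<omega>_def intro!: add_pos_nonneg)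
  have w0: "\<omega> 0 = 0" using G(3)[of 0] by (simp add: \<omega>_def)
  show "\<exists>g\<in>test_profiles \<gamma>. \<exists>\<omega>. smooth_on {0..} \<omega> & \<omega> 0 = 0 & half_line_deriv \<omega> 0 = 0 &
     (\<forall>r>0. \<omega> r > 0) &
     (\<forall>x. \<forall>t\<in>{t1<..<b}. \<bar>tst (x, t) - tst (xh, th) - time_deriv tst (xh, th) * (t - th)\<bar>
          <= g (norm (x - xh)) + \<omega> \<bar>t - th\<bar>)"
   by (rule bexI[OF _ G(11)], rule exI[of _ \<omega>]) (use w0 w1 w2 w3 bound in blast)
 qed
 show False
 proof (cases "arg (xh, th) <= 0")
  case True
  then have "space_grad tst (xh, th) = 0" "time_deriv tst (xh, th) = k * \<theta> th"
   using G(3)[OF True] by (auto simp: sg td)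
  then show False
   using subsolutionD(1)[OF sub adm[OF True] sm] z(2) zz k \<theta>0[of th] by (auto simp: mult_le_0_iff)
 next
  case False
  then have a: "0 < arg (xh, th)" "arg (xh, th) < 1" using arg1 by auto
  define \<rho> where "\<rho> = dist xh x1"
  have "D^2 * arg (xh, th) = \<rho>^2 - D^2 + C' * (th - t1)" using D by (simp add: arg_eq \<rho>_def)
  moreover have "D^2 * arg (xh, th) > 0" using a D by simp
  ultimately have "\<rho>^2 > D\<^sup>2 / 2" using Cb[OF th(2)] by linarith
  moreover have "(D / 2)^2 = D^2 / 4" by (simp add: power_divide)
  ultimately have "\<rho>^2 >= (D / 2)^2" using zero_le_power2[of D] by linarith
  then have \<rho>: "\<rho> >= D / 2" by (rule power2_le_imp_le) (simp add: \<rho>_def)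
  then have \<rho>0: "\<rho> > 0" using D by linarith
  have G1p: "G1 (arg (xh, th)) > 0" using G(5) a by simp
  have G_lev: "G v >= G (arg (xh, th)) \<longleftrightarrow> v >= arg (xh, th)" for v by (rule G(10)[OF a])
  have G_inj: "v = arg (xh, th)" if "G v = G (arg (xh, th))" for v
  proof -
   have le: "arg (xh, th) <= v" using G_lev[of v] that by simp
   have "v < 1"
   proof (rule ccontr)
    assume "~ v < 1"
    then have "G (arg (xh, th)) = 1" using that G(4) by simp
    then show False using G(6)[OF a(2)] by simp
   qed
   then show ?thesis using G(10)[of v "arg (xh, th)"] le a that by simp
  qed
  have scale: "v = q xh + \<eta> th \<longleftrightarrow> v / D^2 = arg (xh, th)" "v >= q xh + \<eta> th \<longleftrightarrow> v / D^2 >= arg (xh, th)" for v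
   using D by (auto simp: arg_def divide_le_cancel)
  have F_xh: "F (q xh + \<eta> th) = S * G (arg (xh, th))" by (simp add: F_def arg_def)
  have "q y >= q xh \<longleftrightarrow> dist y x1 >= \<rho>" for y by (simp add: q_def \<rho>_def dist_norm norm_le)
  then have sup: "{y. q y >= q xh} = - ball x1 \<rho>" by (simp add: set_eq_iff dist_commute not_less)
  let ?g = "G1 (arg (xh, th))"
  have F1_xh: "F1 (q xh + \<eta> th) = S * ?g / D^2" by (simp add: F1_def arg_def)
  have "k * \<theta> th + F1 (q xh + \<eta> th) * (C' + norm (grad q xh) * H xh {y. q y >= q xh}) <= 0"
  proof (rule tst_noncritical[OF sub])
   show "admissible_at \<gamma> t1 b (xh, th) tst" if "space_grad tst (xh, th) ~= 0" by (rule adm) (use that in simp)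
   show "F1 (q xh + \<eta> th) > 0" unfolding F1_xh using S G1p D by simp
   show "F v >= F (q xh + \<eta> th) \<longleftrightarrow> v >= q xh + \<eta> th" for v
    unfolding F_xh scale using S(1) G_lev by (simp add: F_def)
   show "v = q xh + \<eta> th" if "F v = F (q xh + \<eta> th)" for v
    unfolding scale using that[unfolded F_xh] S(1) by (intro G_inj) (simp add: F_def)
   show "grad q y ~= 0" if "q y = q xh" for y using that \<rho>0 by (auto simp: grad_q q_def \<rho>_def)
  qed (use z(2) zz in auto)
  moreover have "norm (grad q xh) = 2 * \<rho>" by (simp add: grad_q \<rho>_def dist_norm)
  ultimately have "k * \<theta> th + (S * ?g / D^2 * C' + (S * ?g * (2 / D^2)) * (\<rho> * H xh (- ball x1 \<rho>))) <= 0"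
   unfolding F1_xh sup by (simp add: algebra_simps)
  moreover have "(S * ?g * (2 / D^2)) * (\<rho> * H xh (- ball x1 \<rho>)) >= (S * ?g * (2 / D^2)) * (- C)"
   using H[of xh] \<rho> S G1p by (intro mult_left_mono) (auto simp: \<rho>_def)
  moreover have "S * ?g / D^2 * C' + (S * ?g * (2 / D^2)) * (- C) = S * ?g / D^2"
   unfolding C'_def by (simp add: algebra_simps add_divide_distrib)
  moreover have "S * ?g / D^2 > 0" using S G1p D by simp
  moreover have "k * \<theta> th > 0" using k \<theta>0 by simp
  ultimately show False by linarith
 qed
qed

section \<open>Half-relaxed limits\<close>

text \<open>The upper half-relaxed limit, as \<open>n\<close> tends to infinity and the argument to
  \<open>z\<close>, written as the infimum of eventual bounds near \<open>z\<close>. The infimum is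
  real-valued, so the definition is meaningful under a bound such as the one in the following
  locale.\<close>

definition relaxed_limsup :: "(nat => 'a::metric_space => real) => 'a set => 'a => real" where
 "relaxed_limsup v S z = Inf {c. \<exists>e>0. \<exists>N. \<forall>n\<ge>N. \<forall>w\<in>ball z e Int S. v n w <= c}"

locale bounded_sequence =
 fixes v :: "nat => 'a::metric_space => real" and S :: "'a set" and M :: real
 assumes bound: "!!n z. z \<in> S ==> \<bar>v n z\<bar> <= M"
begin

abbreviation "lim_sup \<equiv> relaxed_limsup v S"

lemma limsup_set_bdd:
 assumes "z \<in> S" "c \<in> {c. \<exists>e>0. \<exists>N. \<forall>n\<ge>N. \<forall>w\<in>ball z e Int S. v n w <= c}"
 shows "- M <= c"
proof -
 obtain e N where "e > 0" "!!n w. n >= N ==> w \<in> ball z e Int S ==> v n w <= c"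
  using assms(2) by blast
 then have "v N z <= c" using assms(1) by simp
 then show ?thesis using bound[OF assms(1), of N] by simp
qed

lemma limsup_set_M: "M \<in> {c. \<exists>e>0. \<exists>N. \<forall>n\<ge>N. \<forall>w\<in>ball z e Int S. v n w <= c}"
proof -
 have "v n w <= M" if "w \<in> S" for n w using bound[OF that, of n] by simp
 then show ?thesis by (auto intro!: exI[of _ 1])
qed

lemma limsup_less:
 assumes "z \<in> S" "lim_sup z < c"
 obtains e N where "e > 0" "!!n w. n >= N ==> w \<in> ball z e Int S ==> v n w <= c"
proof -
 let ?A = "{c. \<exists>e>0. \<exists>N. \<forall>n\<ge>N. \<forall>w\<in>ball z e Int S. v n w <= c}"
 obtain c' where "c' \<in> ?A" "c' < c"
  using cInf_lessD[of ?A c] assms(2) limsup_set_M[of z] unfolding relaxed_limsup_def by blast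
 then show ?thesis using that by (smt (verit) mem_Collect_eq)
qed

lemma limsup_le:
 assumes "z \<in> S" "e > 0" "!!n w. n >= N ==> w \<in> ball z e Int S ==> v n w <= c"
 shows "lim_sup z <= c" unfolding relaxed_limsup_def
proof (rule cInf_lower)
 show "c \<in> {c. \<exists>e>0. \<exists>N. \<forall>n\<ge>N. \<forall>w\<in>ball z e Int S. v n w <= c}" using assms(2,3) by blast
 show "bdd_below {c. \<exists>e>0. \<exists>N. \<forall>n\<ge>N. \<forall>w\<in>ball z e Int S. v n w <= c}"
  using limsup_set_bdd[OF assms(1)] by (rule bdd_belowI)
qed

lemma limsup_greater:
 assumes "z \<in> S" "c < lim_sup z" "e > 0"
 obtains n w where "n >= N" "w \<in> ball z e Int S" "v n w > c"
 using limsup_le[OF assms(1,3), of N c] assms(2) that by (meson not_le)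

lemma limsup_bound: "z \<in> S ==> \<bar>lim_sup z\<bar> <= M"
proof -
 assume z: "z \<in> S"
 have "v n w <= M" if "w \<in> S" for n w using bound[OF that, of n] by simp
 then have "lim_sup z <= M" using z by (intro limsup_le[of z 1 0]) auto
 moreover have "- M <= lim_sup z"
  unfolding relaxed_limsup_def using limsup_set_M[of z] limsup_set_bdd[OF z] by (intro cInf_greatest) blast+
 ultimately show ?thesis by simp
qed

lemma usc_limsup: "usc_on S lim_sup"
 unfolding usc_on_def
proof (intro ballI allI impI)
 fix z c assume z: "z \<in> S" "c > lim_sup z"
 define c' where "c' = (lim_sup z + c) / 2"
 have c': "lim_sup z < c'" "c' < c" using z by (auto simp: c'_def)
 obtain e N where e: "e > 0" "!!n w. n >= N ==> w \<in> ball z e Int S ==> v n w <= c'"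
  using limsup_less[OF z(1) c'(1)] by blast
 have "lim_sup w < c" if "w \<in> S" "dist w z < e / 2" for w
 proof -
  have "ball w (e / 2) <= ball z e"
  proof
   fix y assume "y \<in> ball w (e / 2)"
   then show "y \<in> ball z e" using dist_triangle[of z y w] that by (simp add: dist_commute)
  qed
  then have "lim_sup w <= c'" using e that by (intro limsup_le[of w "e / 2" N]) auto
  then show ?thesis using c' by simp
 qed
 then show "\<forall>\<^sub>F w in at z within S. lim_sup w < c"
  using e(1) unfolding eventually_at by (intro exI[of _ "e / 2"]) auto
qed

text \<open>Strictness at each point leaves room for the continuous \<open>g\<close> in a
  neighbourhood; a finite cover makes the index uniform.\<close>

lemma limsup_compact:
 assumes K: "compact K" "K <= S" and g: "continuous_on K g" and less: "!!z. z \<in> K ==> lim_sup z < g z"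
 obtains N where "!!n w. n >= N ==> w \<in> K ==> v n w < g w"
proof -
 have "\<exists>e N. e > 0 & (\<forall>n\<ge>N. \<forall>w\<in>ball z e Int K. v n w < g w)" if z: "z \<in> K" for z
 proof -
  define c where "c = (lim_sup z + g z) / 2"
  have c: "lim_sup z < c" "c < g z" using less[OF z] by (auto simp: c_def)
  obtain e N where e: "e > 0" "!!n w. n >= N ==> w \<in> ball z e Int S ==> v n w <= c"
   using limsup_less[of z c] c z K(2) by blast
  have "\<forall>\<^sub>F w in at z within K. c < g w"
   using g z c by (intro order_tendstoD(1)[of g "g z"]) (auto simp: continuous_on_def)
  then obtain d where d: "d > 0" "!!w. w \<in> K ==> dist w z < d ==> c < g w"
   unfolding eventually_at using c(2) by metis
  have "v n w < g w" if "n >= N" "w \<in> ball z (min e d) Int K" for n w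
   using e(2)[of n w] d(2)[of w] that K(2) by (force simp: dist_commute)
  then show ?thesis using e(1) d(1) by (intro exI[of _ "min e d"] exI[of _ N]) auto
 qed
 then obtain e N where e: "!!z. z \<in> K ==> e z > 0"
  "!!z n w. z \<in> K ==> n >= N z ==> w \<in> ball z (e z) Int K ==> v n w < g w" by metis
 have "K <= (\<Union>z\<in>K. ball z (e z))" using e(1) by force
 then obtain Z where Z: "Z <= K" "finite Z" "K <= (\<Union>z\<in>Z. ball z (e z))"
  using compactE_image[OF K(1), of K "%z. ball z (e z)"] by (metis open_ball)
 show ?thesis
 proof (rule that[of "Max (insert 0 (N ` Z))"])
  fix n w assume n: "Max (insert 0 (N ` Z)) <= n" and w: "w \<in> K"
  obtain z where z: "z \<in> Z" "w \<in> ball z (e z)" using Z(3) w by blast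
  have "N z <= n" using n Z(2) z(1) by simp
  then show "v n w < g w" using e(2)[of z n w] z w Z(1) by blast
 qed
qed

end

section \<open>Pointwise inequalities for subsolutions of the mean curvature equation\<close>

text \<open>The meeting point of the nonlocal problems, the limit problem and the comparison. At
  vanishing gradient only functions of time serve as tests, which is as much as the barriers give
  for a limit; \<open>local_sub_cubic\<close> enlarges this class. The coefficient \<open>C\<close>
  in time is arbitrary because it does not influence the inequality.\<close>

definition local_sub :: "real => ((real^'n) * real => real) => bool" where
 "local_sub c u \<longleftrightarrow>
  (\<forall>x t a p X C. t > 0 --> p ~= 0 --> transpose X = X -->
   (\<forall>\<^sub>F w in nhds (x, t). u w <= u (x, t) + a * (snd w - t) + p \<bullet> (fst w - x)
     + (fst w - x) \<bullet> (X *v (fst w - x)) / 2 + C * (snd w - t)^2) -->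
   a <= c * (trace X - p \<bullet> (X *v p) / (p \<bullet> p))) &
  (\<forall>x t a C. t > 0 -->
   (\<forall>\<^sub>F w in nhds (x, t). u w <= u (x, t) + a * (snd w - t) + C * (snd w - t)^2) --> a <= 0)"

lemma smooth_on_sum:
 fixes f :: "'i => 'a::real_normed_vector => real"
 shows "open S ==> (!!i. i \<in> I ==> smooth_on S (f i)) ==> smooth_on S (%x. \<Sum>i\<in>I. f i x)"
 by (induction I rule: infinite_finite_induct) (auto intro: smooth_on_const smooth_on_add)

lemma smooth_on_quadratic_form:
 fixes X :: "real^'n^'n"
 shows "smooth_on UNIV (%y. y \<bullet> (X *v y))"
proof -
 have "smooth_on UNIV (%y::real^'n. \<Sum>i\<in>UNIV. y $ i * (X *v y) $ i)"
  by (intro smooth_on_sum smooth_on_mult smooth_on_bounded_linear bounded_linear_vec_nth open_UNIV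
    bounded_linear_compose[OF bounded_linear_vec_nth matrix_vector_mul_bounded_linear])
 then show ?thesis by (simp add: inner_vec_def)
qed

text \<open>The quartic term makes the zero level set of the test function compact and noncritical
 without changing the second order expansion at \<open>x0\<close>.\<close>

definition quartic_test :: "real => real^'n => real^'n^'n => real^'n => real^'n => real" where
 "quartic_test K p X x0 x = p \<bullet> (x - x0) + (x - x0) \<bullet> (X *v (x - x0)) / 2 + K * ((x - x0) \<bullet> (x - x0))^2"

lemma quartic_test:
 fixes x0 :: "real^'n"
 assumes sym: "transpose X = X"
 shows "smooth_on UNIV (quartic_test K p X x0)"
  "grad (quartic_test K p X x0) x = p + X *v (x - x0) + (4 * K * ((x - x0) \<bullet> (x - x0))) *\<^sub>R (x - x0)"
  "dir_deriv2 (quartic_test K p X x0) x0 v w = v \<bullet> (X *v w)"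
proof -
 have "smooth_on UNIV (%x. p \<bullet> (- x0 + x) + (1 / 2) * ((- x0 + x) \<bullet> (X *v (- x0 + x))) + K * ((- x0 + x) \<bullet> (- x0 + x))^2)"
  by (intro smooth_on_compose_affine[of UNIV UNIV "%x. x" "- x0" "%y. p \<bullet> y + (1/2) * (y \<bullet> (X *v y)) + K * (y \<bullet> y)^2"]
    smooth_on_add smooth_on_cmult smooth_on_power smooth_on_quadratic_form smooth_on_inner_self
    smooth_on_bounded_linear bounded_linear_inner_right bounded_linear_ident) auto
 then show "smooth_on UNIV (quartic_test K p X x0)" by (rule smooth_on_cong) (simp add: quartic_test_def)
 have symm: "y \<bullet> (X *v z) = z \<bullet> (X *v y)" for y z
  using sym dot_lmul_matrix[of y X z] by (metis inner_commute transpose_matrix_vector)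
 have lin: "((%x. X *v (x - x0)) has_derivative (%v. X *v v)) (at x)" for x
  by (rule bounded_linear.has_derivative[OF matrix_vector_mul_bounded_linear]) (auto intro!: derivative_eq_intros)
 have d: "(quartic_test K p X x0 has_derivative
   (%v. v \<bullet> (p + X *v (x - x0) + (4 * K * ((x - x0) \<bullet> (x - x0))) *\<^sub>R (x - x0)))) (at x)" for x
 proof -
  have y: "((%x. x - x0) has_derivative (%v. v)) (at x)" by (auto intro!: derivative_eq_intros)
  have d1: "((%x. p \<bullet> (x - x0)) has_derivative (%v. v \<bullet> p)) (at x)"
   using has_derivative_inner_right[OF y, of p] by (simp add: inner_commute)
  have "((%x. (x - x0) \<bullet> (X *v (x - x0)) * (1 / 2)) has_derivative
    (%v. ((x - x0) \<bullet> (X *v v) + v \<bullet> (X *v (x - x0))) * (1 / 2))) (at x)"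
   by (intro has_derivative_mult_left has_derivative_inner y lin)
  then have d2: "((%x. (x - x0) \<bullet> (X *v (x - x0)) / 2) has_derivative (%v. v \<bullet> (X *v (x - x0)))) (at x)"
   by (simp add: symm[of "x - x0"])
  have yy: "((%x. (x - x0) \<bullet> (x - x0)) has_derivative (%v. (x - x0) \<bullet> v + v \<bullet> (x - x0))) (at x)"
   by (intro has_derivative_inner y)
  have d3: "((%x. K * ((x - x0) \<bullet> (x - x0))^2) has_derivative
    (%v. v \<bullet> ((4 * K * ((x - x0) \<bullet> (x - x0))) *\<^sub>R (x - x0)))) (at x)"
   using has_derivative_mult_right[OF has_derivative_power[OF yy, of 2], of K]
   by (auto elim!: has_derivative_eq_rhs simp: fun_eq_iff inner_commute)
  show ?thesis unfolding quartic_test_def[abs_def] inner_add_right by (intro has_derivative_add d1 d2 d3)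
 qed
 show g: "grad (quartic_test K p X x0) x = p + X *v (x - x0) + (4 * K * ((x - x0) \<bullet> (x - x0))) *\<^sub>R (x - x0)" for x
  by (rule grad_eqI[OF d])
 have "((%x. v \<bullet> (p + X *v (x - x0) + (4 * K * ((x - x0) \<bullet> (x - x0))) *\<^sub>R (x - x0))) has_derivative
   (%w. v \<bullet> (X *v w))) (at x0)" by (rule derivative_eq_intros lin refl | simp)+
 then show "dir_deriv2 (quartic_test K p X x0) x0 v w = v \<bullet> (X *v w)"
  using dir_deriv2_eqI[OF d, of v] by simp
qed

lemma matrix_vector_bound:
 fixes X :: "real^'n^'n"
 obtains B where "B > 0" "!!y. norm (X *v y) <= B * norm y"
 using bounded_linear.pos_bounded[OF matrix_vector_mul_bounded_linear[of X]] by (metis mult.commute)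

text \<open>For \<open>n = norm (x - x0) \<ge> s\<close> every lower order term may be multiplied by
  a power of \<open>n / s\<close>, which makes it a multiple of \<open>n ^ 4\<close>;
  \<open>K\<close> is the sum of these multiples. Pairing the gradient with \<open>x - x0\<close>
  multiplies the quartic term by 4 and so excludes critical points.\<close>

lemma quartic_coercive:
 fixes x0 :: "real^'n"
 assumes X: "!!y. norm (X *v y) <= B * norm y" and s: "s > 0" and Q: "Q >= 0" and B: "B > 0"
  and K: "K >= 1 + norm p / s ^ 3 + B / s^2 + Q / s ^ 4" and far: "norm (x - x0) >= s"
 shows "quartic_test K p X x0 x >= norm (x - x0) ^ 4 + Q"
  "transpose X = X ==> grad (quartic_test K p X x0) x ~= 0"
proof -
 define y where "y = x - x0"
 define n where "n = norm y"
 have n: "n >= s" "n > 0" using far s by (auto simp: n_def y_def)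
 have yy: "y \<bullet> y = n^2" by (simp add: n_def power2_norm_eq_inner)
 have r: "n / s >= 1" using n s by simp
 have Xy: "\<bar>y \<bullet> (X *v y)\<bar> <= B * n^2"
  using Cauchy_Schwarz_ineq2[of y "X *v y"] mult_left_mono[OF X[of y], of "norm y"]
  by (simp add: n_def power2_eq_square mult_ac)
 have py: "\<bar>p \<bullet> y\<bar> <= norm p * n" using Cauchy_Schwarz_ineq2[of p y] by (simp add: n_def)
 have 1: "norm p * n <= norm p / s ^ 3 * n ^ 4"
 proof -
  have "1 <= (n / s) ^ 3" using r by (rule one_le_power)
  then have "norm p * n * 1 <= norm p * n * (n / s) ^ 3" using n by (intro mult_left_mono) auto
  then show ?thesis by (simp add: power_divide eval_nat_numeral)
 qed
 have 2: "B * n^2 <= B / s^2 * n ^ 4"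
 proof -
  have "1 <= (n / s) ^ 2" using r by (rule one_le_power)
  then have "B * n^2 * 1 <= B * n^2 * (n / s) ^ 2" using B by (intro mult_left_mono) auto
  then show ?thesis by (simp add: power_divide eval_nat_numeral)
 qed
 have 3: "Q <= Q / s ^ 4 * n ^ 4"
 proof -
  have "1 <= (n / s) ^ 4" using r by (rule one_le_power)
  then have "Q * 1 <= Q * (n / s) ^ 4" using Q by (intro mult_left_mono) auto
  then show ?thesis by (simp add: power_divide)
 qed
 have 4: "(1 + norm p / s ^ 3 + B / s^2 + Q / s ^ 4) * n ^ 4 <= K * n ^ 4"
  using K by (intro mult_right_mono) auto
 have key: "n ^ 4 + norm p * n + B * n^2 + Q <= K * n ^ 4" using 1 2 3 4 by (simp add: distrib_right)
 have "(n^2)^2 = n ^ 4" by simp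
 then show "quartic_test K p X x0 x >= norm (x - x0) ^ 4 + Q"
  using key py Xy unfolding quartic_test_def y_def[symmetric] n_def[symmetric] yy by (simp add: abs_le_iff)
 show "grad (quartic_test K p X x0) x ~= 0" if sym: "transpose X = X"
 proof
  assume "grad (quartic_test K p X x0) x = 0"
  then have "(p + X *v y + (4 * K * (y \<bullet> y)) *\<^sub>R y) \<bullet> y = 0"
   using quartic_test(2)[OF sym, of K p x0 x] by (simp add: y_def)
  then have "p \<bullet> y + y \<bullet> (X *v y) + 4 * (K * n ^ 4) = 0"
   unfolding inner_add_left inner_scaleR_left yy by (simp add: inner_commute eval_nat_numeral algebra_simps)
  moreover have "K * n ^ 4 > 0" using key n B Q zero_less_power[of n 4]
   by (smt (verit) mult_nonneg_nonneg norm_ge_zero zero_le_power2)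
  moreover have "norm p * n + B * n^2 <= K * n ^ 4" using key Q zero_less_power[OF n(2), of 4] by linarith
  ultimately show False using py Xy by (simp add: abs_le_iff)
 qed
qed

text \<open>At a critical point with value 0, eliminating \<open>p \<bullet> y\<close> from the
  value and from the gradient paired with \<open>y\<close> gives \<open>6 * K * n^2 \<le> B\<close>.
  The gradient equation then gives \<open>norm p \<le> 2 * B * n\<close>, against
  \<open>K > B ^ 3 / (norm p)^2\<close>. So 0 is not a critical value, and as the critical set is
  compact, nearby values are not critical either.\<close>

lemma quartic_regular:
 fixes x0 :: "real^'n"
 assumes sym: "transpose X = X" and X: "!!y. norm (X *v y) <= B * norm y" and s: "s > 0" and B: "B > 0"
  and p: "p ~= 0" and K: "K >= 1 + norm p / s ^ 3 + B / s^2" "K > B ^ 3 / (norm p)^2"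
 shows "\<forall>\<^sub>F x in nhds x0. regular_level (quartic_test K p X x0) (quartic_test K p X x0 x)"
proof -
 let ?q = "quartic_test K p X x0"
 have sm: "smooth_on UNIV ?q" by (rule quartic_test(1)[OF sym])
 have qc: "continuous_on UNIV ?q" using sm by (rule smooth_on_imp_continuous_on)
 have gc: "continuous_on UNIV (grad ?q)" by (rule continuous_on_grad[OF open_UNIV smooth_onD[OF sm]])
 have Kp: "K > 0" using K(1) s B by (smt (verit) divide_nonneg_nonneg norm_ge_zero zero_le_power)
 have K': "K >= 1 + norm p / s ^ 3 + B / s^2 + 0 / s ^ 4" using K(1) by simp
 have far: "?q x >= norm (x - x0) ^ 4" "grad ?q x ~= 0" if "norm (x - x0) >= s" for x
  using quartic_coercive(1)[OF X s order.refl B K' that] quartic_coercive(2)[OF X s order.refl B K' that sym] by auto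
 define Z where "Z = {x. grad ?q x = 0}"
 have "closed Z" unfolding Z_def using gc by (intro closed_Collect_eq continuous_on_const)
 moreover have "Z <= ball x0 s"
  using far(2) by (auto simp: Z_def dist_norm norm_minus_commute not_le[symmetric])
 ultimately have Z: "compact Z" using bounded_subset[OF bounded_ball] compact_eq_bounded_closed by blast
 have nz: "?q x ~= 0" if "x \<in> Z" for x
 proof
  assume q0: "?q x = 0"
  define y where "y = x - x0"
  define n where "n = norm y"
  have yy: "y \<bullet> y = n^2" by (simp add: n_def power2_norm_eq_inner)
  have g0: "p + X *v y + (4 * K * n^2) *\<^sub>R y = 0"
   using that quartic_test(2)[OF sym, of K p x0 x] by (simp add: Z_def y_def[symmetric] yy)
  then have "(p + X *v y + (4 * K * n^2) *\<^sub>R y) \<bullet> y = 0" by simp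
  then have e1: "p \<bullet> y + y \<bullet> (X *v y) + 4 * K * n ^ 4 = 0"
   unfolding inner_add_left inner_scaleR_left yy by (simp add: inner_commute eval_nat_numeral algebra_simps)
  have e2: "p \<bullet> y + y \<bullet> (X *v y) / 2 + K * n ^ 4 = 0"
   using q0 unfolding quartic_test_def y_def[symmetric] yy by simp
  have Xy: "\<bar>y \<bullet> (X *v y)\<bar> <= B * n^2"
   using Cauchy_Schwarz_ineq2[of y "X *v y"] mult_left_mono[OF X[of y], of "norm y"]
   by (simp add: n_def power2_eq_square mult_ac)
  have n0: "n > 0"
  proof (rule ccontr)
   assume "~ n > 0"
   then have "y = 0" by (simp add: n_def)
   then show False using g0 p by simp
  qed
  have "6 * K * n ^ 4 <= B * n^2" using e1 e2 Xy by linarith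
  then have "6 * K * n^2 * n^2 <= B * n^2" by (simp add: eval_nat_numeral mult_ac)
  then have Kn: "6 * K * n^2 <= B" using n0 by simp
  have "p = - (X *v y + (4 * K * n^2) *\<^sub>R y)" using g0 by (metis add.assoc eq_neg_iff_add_eq_0)
  then have "norm p <= norm (X *v y) + norm ((4 * K * n^2) *\<^sub>R y)"
   by (metis norm_minus_cancel norm_triangle_ineq)
  also have "... <= B * n + 4 * K * n^2 * n" using X[of y] Kp by (simp add: n_def abs_mult)
  also have "... <= B * n + B * n"
  proof -
   have "K * n^2 >= 0" using Kp by simp
   then have "4 * K * n^2 <= B" using Kn by linarith
   then show ?thesis using n0 by (intro add_left_mono mult_right_mono) auto
  qed
  finally have "norm p <= 2 * B * n" by simp
  then have "(norm p)^2 <= (2 * B * n)^2" by (intro power_mono) auto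
  also have "... = 4 * B^2 * n^2" by (simp add: power_mult_distrib)
  finally have a1: "K * (norm p)^2 <= K * (4 * B^2 * n^2)" using Kp by (intro mult_left_mono) auto
  have "K * (4 * B^2 * n^2) = 4 * B^2 * (K * n^2)" by simp
  also have "... <= 4 * B^2 * (B / 6)" using Kn by (intro mult_left_mono) auto
  also have "... <= B ^ 3" using B by (simp add: eval_nat_numeral)
  finally have "K * (norm p)^2 <= B ^ 3" using a1 by simp
  moreover have "B ^ 3 < K * (norm p)^2" using K(2) p by (simp add: pos_divide_less_eq)
  ultimately show False by simp
 qed
 obtain \<delta> where \<delta>: "\<delta> > 0" "!!x. x \<in> Z ==> \<delta> <= \<bar>?q x\<bar>"
 proof (cases "Z = {}")
  case False
  have "continuous_on Z (%x. \<bar>?q x\<bar>)"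
   by (intro continuous_on_rabs continuous_on_subset[OF qc]) simp
  then obtain z where z: "z \<in> Z" "!!x. x \<in> Z ==> \<bar>?q z\<bar> <= \<bar>?q x\<bar>"
   using continuous_attains_inf[OF Z False] by blast
  then show ?thesis using that[of "\<bar>?q z\<bar>"] nz[of z] by auto
 qed (use that[of 1] in auto)
 have lvl: "compact {x. ?q x = a}" for a
 proof -
  have "closed {x. ?q x = a}" using qc by (intro closed_Collect_eq continuous_on_const)
  moreover have "{x. ?q x = a} <= cball x0 (s + \<bar>a\<bar> + 1)"
  proof
   fix x assume "x \<in> {x. ?q x = a}"
   show "x \<in> cball x0 (s + \<bar>a\<bar> + 1)"
   proof (rule ccontr)
    assume "~ ?thesis"
    then have n: "norm (x - x0) > s + \<bar>a\<bar> + 1" by (simp add: dist_norm norm_minus_commute)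
    then have "norm (x - x0) ^ 4 <= a" using far(1)[of x] \<open>x \<in> _\<close> by simp
    moreover have "norm (x - x0) ^ 4 >= norm (x - x0) ^ 1" using n s by (intro power_increasing) auto
    ultimately show False using n s by simp
   qed
  qed
  ultimately show ?thesis using bounded_subset[OF bounded_cball] compact_eq_bounded_closed by blast
 qed
 have "isCont ?q x0" using qc by (simp add: continuous_on_eq_continuous_at)
 moreover have "?q x0 = 0" by (simp add: quartic_test_def)
 ultimately have "\<forall>\<^sub>F x in nhds x0. \<bar>?q x\<bar> < \<delta>"
  using \<delta>(1) tendstoD[of ?q 0 "nhds x0" \<delta>] iffD1[OF tendsto_at_iff_tendsto_nhds, of ?q x0]
  by (simp add: isCont_def dist_real_def)
 then show ?thesis
 proof eventually_elim
  case (elim x)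
  have "grad ?q y ~= 0" if "?q y = ?q x" for y using \<delta>(2)[of y] elim that by (auto simp: Z_def)
  then show ?case unfolding regular_level_def using sm lvl by blast
 qed
qed

lemma quartic_level_op:
 assumes sym: "transpose X = X" and p: "p ~= 0"
 shows "level_op (quartic_test K p X x0) x0 = trace X - p \<bullet> (X *v p) / (p \<bullet> p)"
  "grad (quartic_test K p X x0) x0 = p"
proof -
 show g: "grad (quartic_test K p X x0) x0 = p" using quartic_test(2)[OF sym, of K p x0 x0] by simp
 have "axis i 1 \<bullet> (X *v axis i 1) = X $ i $ i" for i
  by (simp add: inner_axis' matrix_vector_mul_component inner_axis)
 moreover have "sgn p \<bullet> (X *v sgn p) = p \<bullet> (X *v p) / (p \<bullet> p)"
  by (simp add: sgn_div_norm matrix_vector_mult_scaleR divide_inverse power2_norm_eq_inner[symmetric] power2_eq_square)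
 ultimately show "level_op (quartic_test K p X x0) x0 = trace X - p \<bullet> (X *v p) / (p \<bullet> p)"
  unfolding level_op_def g quartic_test(3)[OF sym] by (simp add: trace_def)
qed

lemma cutoff_le_iff: "v < 1 ==> cutoff v <= cutoff w \<longleftrightarrow> v <= w"
 using cutoff_strict_mono[of w v] cutoff_mono[of v w] by (cases "v <= w") auto

lemma dist_prod_le: "dist (x, t) (y, s) <= dist x y + dist t s"
 by (simp add: dist_Pair_Pair sqrt_sum_squares_le_sum)

text \<open>The truncation is constant far away, which yields admissibility, and strictly increasing
  below height \<open>S\<close>, so the superlevel set is the one of \<open>q\<close>. Its positive
  derivative is a common factor of both terms and cancels.\<close>

lemma truncated_test:
 fixes q :: "real^'n => real"
 assumes sub: "subsolution \<gamma> H u0 u" and q: "smooth_on UNIV q" and S: "S > 0"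
  and \<theta>: "smooth_on UNIV \<theta>" "!!t. (\<theta> has_real_derivative \<theta>' t) (at t)"
  and ab: "0 <= a" "a < t" "t < b"
  and far: "!!y s. s \<in> {a..b} ==> y ~: cball x0 R ==> q y + \<theta> s >= S"
  and reg: "regular_level q (q x)" "q x + \<theta> t < S"
  and max: "!!w. w \<in> UNIV \<times> {a..b} ==> u w - (A + S * cutoff ((q (fst w) + \<theta> (snd w)) / S)) <=
    u (x, t) - (A + S * cutoff ((q x + \<theta> t) / S))"
 shows "\<theta>' t + norm (grad q x) * H x {y. q y >= q x} <= 0"
proof -
 define F F1 where "F v = S * cutoff (v / S)" and "F1 v = exp 1 * flat 2 (1 - v / S)" for v
 interpret profile_test q F F1 "%t. A" "%t. 0" \<theta> \<theta>'
 proof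
  have "smooth_on UNIV (%v. S * cutoff (1 / S * v))"
   by (intro smooth_on_cmult smooth_on_compose_real[OF _ smooth_on_cutoff] smooth_on_bounded_linear bounded_linear_ident open_UNIV)
  then show "smooth_on UNIV F" by (rule smooth_on_cong) (simp add: F_def)
  show "(F has_real_derivative F1 v) (at v)" for v
  proof -
   have "((%v. v / S) has_real_derivative 1 / S) (at v)" by (rule DERIV_cdivide) simp
   from DERIV_cmult[OF DERIV_chain2[OF cutoff_has_derivative this], of S] show ?thesis
    using S by (simp add: F_def[abs_def] F1_def)
  qed
 qed (auto intro: q \<theta> smooth_on_const)
 have tst_eq: "tst w = A + S * cutoff ((q (fst w) + \<theta> (snd w)) / S)" for w by (simp add: tst_def F_def)
 have v1: "(q x + \<theta> t) / S < 1" using reg(2) S by simp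
 have gx: "grad q y ~= 0" if "q y = q x" for y using reg(1) that by (simp add: regular_level_def)
 have "0 + F1 (q x + \<theta> t) * (\<theta>' t + norm (grad q x) * H x {y. q y >= q x}) <= 0"
 proof (rule tst_noncritical[OF sub])
  show pos: "F1 (q x + \<theta> t) > 0" using v1 unfolding F1_def by (intro mult_pos_pos flat_pos) auto
  show "admissible_at \<gamma> a b (x, t) tst" if "space_grad tst (x, t) ~= 0"
  proof (rule admissible_smooth[OF tst_smooth ab, of x0 R])
   fix s assume "s \<in> {a..b}"
   then have "tst (y, s) = A + S" if "y ~: cball x0 R" for y
    using far[of s y] that S by (simp add: tst_eq cutoff_eq_1)
   then show "\<exists>c. \<forall>y. y ~: cball x0 R --> tst (y, s) = c" by blast
  qed (use that in simp)
  show "F v >= F (q x + \<theta> t) \<longleftrightarrow> v >= q x + \<theta> t" for v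
   using cutoff_le_iff[OF v1, of "v / S"] S by (simp add: F_def divide_le_cancel)
  show "v = q x + \<theta> t" if "F v = F (q x + \<theta> t)" for v
  proof (rule antisym)
   show "q x + \<theta> t <= v" using cutoff_le_iff[OF v1, of "v / S"] S that by (simp add: F_def divide_le_cancel)
   show "v <= q x + \<theta> t" using cutoff_strict_mono[of "(q x + \<theta> t) / S" "v / S"] v1 S that
    by (intro leI notI) (simp add: F_def divide_strict_right_mono)
  qed
 qed (use gx max tst_eq in auto)
 moreover have "F1 (q x + \<theta> t) > 0" using v1 unfolding F1_def by (intro mult_pos_pos flat_pos) auto
 ultimately show ?thesis by (simp add: mult_le_0_iff)
qed

locale subsolution_family =
 fixes v :: "nat => (real^'n) * real => real" and \<gamma> :: "nat => real => real"
  and H :: "nat => real^'n => (real^'n) set => real" and u0 :: "real^'n => real" and c :: real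
 assumes sub: "!!n. subsolution (\<gamma> n) (H n) u0 (v n)"
  and \<gamma>: "!!n. antimono_on {0<..} (\<gamma> n)" and fam: "curvature_family c H"
begin

lemma usc_v: "usc_on space_time (v n)" and const_v: "const_outside_compact {0..} (v n)"
 using sub[of n] by (auto simp: subsolution_def)

text \<open>The time \<open>\<tau>\<close> is independent of \<open>n\<close> because the lower
  bound on complements of balls is; the barrier involves radii of at least
  \<open>D / 2\<close>.\<close>

lemma barrier_uniform:
 assumes "D > 0"
 obtains \<tau> where "\<tau> > 0" "!!n x1 t1 A t. t1 >= 0 ==> (!!x. x \<in> cball x1 (2 * D) ==> v n (x, t1) <= A) ==>
  t1 <= t ==> t <= t1 + \<tau> ==> v n (x1, t) <= A"
proof -
 obtain C where C: "!!n x1 x. D / 2 <= dist x x1 ==> - C <= dist x x1 * H n x (- ball x1 (dist x x1))"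
 proof -
  have "\<forall>D>0. \<exists>C. \<forall>n x1 x. D <= dist x x1 --> - C <= dist x x1 * H n x (- ball x1 (dist x x1))"
   using fam by (simp add: curvature_family_def)
  then show ?thesis using that half_gt_zero[OF assms] by blast
 qed
 define C' where "C' = max C 0"
 have C': "C' >= 0" "!!n x1 x. D / 2 <= dist x x1 ==> - C' <= dist x x1 * H n x (- ball x1 (dist x x1))"
 proof -
  show "- C' <= dist x x1 * H n x (- ball x1 (dist x x1))" if "D / 2 <= dist x x1" for n x1 x
   using C[OF that, of n] by (simp add: C'_def)
 qed (simp add: C'_def)
 show ?thesis
 proof (rule that[of "D^2 / (4 * (2 * C' + 1))"])
  show "D^2 / (4 * (2 * C' + 1)) > 0" using assms C'(1) by simp
  show "v n (x1, t) <= A" if "t1 >= 0" "!!x. x \<in> cball x1 (2 * D) ==> v n (x, t1) <= A"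
   "t1 <= t" "t <= t1 + D^2 / (4 * (2 * C' + 1))" for n x1 t1 A t
   by (rule barrier[OF sub \<gamma> assms C'(1) C'(2) that])
 qed
qed

end

locale subsolution_sequence = subsolution_family v \<gamma> H u0 c
 for v :: "nat => (real^'n) * real => real" and \<gamma> H u0 c +
 fixes M :: real
 assumes bnd: "!!n z. z \<in> space_time ==> \<bar>v n z\<bar> <= M"
begin

sublocale bounded_sequence v space_time M by standard (rule bnd)

text \<open>If \<open>a > 0\<close>, then at time \<open>th - h\<close> the limit is below its value
  at the point by a fixed amount on a whole ball. For large \<open>n\<close> the same holds for
  \<open>v n\<close>, and the barrier carries it past time \<open>th\<close>, a
  contradiction.\<close>

lemma limsup_flat:
 assumes t: "th > 0"
  and ev: "\<forall>\<^sub>F w in nhds (xh, th). lim_sup w <= lim_sup (xh, th) + a * (snd w - th) + C * (snd w - th)^2"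
 shows "a <= 0"
proof (rule ccontr)
 assume "~ a <= 0"
 then have a: "a > 0" by simp
 let ?z = "(xh, th)"
 have zS: "?z \<in> space_time" using t by simp
 obtain e where e: "e > 0" "!!w. dist w ?z < e ==> lim_sup w <= lim_sup ?z + a * (snd w - th) + C * (snd w - th)^2"
  using ev unfolding eventually_nhds_metric by blast
 define D where "D = e / 8"
 have D: "D > 0" using e by (simp add: D_def)
 obtain \<tau> where \<tau>: "\<tau> > 0" "!!n x1 t1 A t. t1 >= 0 ==> (!!x. x \<in> cball x1 (2 * D) ==> v n (x, t1) <= A) ==>
  t1 <= t ==> t <= t1 + \<tau> ==> v n (x1, t) <= A" using barrier_uniform[OF D] by metis
 \<comment> \<open>\<open>\<tau> / 2\<close> makes the barrier reach \<open>th + h\<close>,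
   \<open>e / 4\<close> and \<open>th / 2\<close> keep the earlier time in range, and the last bound
   gives \<open>C * h^2 \<le> a * h / 2\<close>.\<close>
 define h where "h = min (min (\<tau> / 2) (e / 4)) (min (th / 2) (a / (2 * (\<bar>C\<bar> + 1))))"
 have h: "h > 0" "h <= \<tau> / 2" "h <= e / 4" "h <= th / 2" "h <= a / (2 * (\<bar>C\<bar> + 1))"
 proof -
  show "h > 0" using \<tau>(1) e(1) t a by (simp add: h_def)
  show "h <= \<tau> / 2" "h <= e / 4" "h <= th / 2" "h <= a / (2 * (\<bar>C\<bar> + 1))"
   unfolding h_def by (meson min.cobounded1 min.cobounded2 order.trans)+
 qed
 define A where "A = lim_sup ?z - a * h / 4"
 have Ch: "C * h^2 <= a * h / 2"
 proof -
  have "(\<bar>C\<bar> + 1) * h <= a / 2" using h(5) by (simp add: field_simps)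
  moreover have "C * h <= (\<bar>C\<bar> + 1) * h" using h(1) by (intro mult_right_mono) auto
  ultimately have "C * h <= a / 2" by linarith
  then have "C * h * h <= a / 2 * h" using h(1) by (intro mult_right_mono) auto
  then show ?thesis by (simp add: power2_eq_square)
 qed
 let ?K = "cball xh (3 * D) \<times> {th - h}"
 have "compact ?K" by (intro compact_Times) auto
 moreover have "?K <= space_time" using h(4) t by auto
 moreover have "lim_sup w < A" if w: "w \<in> ?K" for w
 proof -
  obtain x where x: "w = (x, th - h)" "dist xh x <= 3 * D" using w by auto
  have "dist w ?z <= dist x xh + dist (th - h) th" unfolding x(1) by (rule dist_prod_le)
  also have "... < e" using x(2) h(1,3) e(1) by (simp add: dist_commute D_def dist_real_def)
  finally have "lim_sup w <= lim_sup ?z - a * h + C * h^2" using e(2)[of w] x(1) by simp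
  moreover have "a * h > 0" using a h by simp
  ultimately show ?thesis using Ch unfolding A_def by linarith
 qed
 ultimately obtain N where N: "!!n w. n >= N ==> w \<in> ?K ==> v n w < A"
  using limsup_compact[of ?K "%_. A"] by (metis continuous_on_const)
 have "lim_sup ?z <= A"
 proof (rule limsup_le[OF zS, of "min D h" N])
  show "min D h > 0" using D h by simp
  fix n w assume n: "N <= n" and w: "w \<in> ball ?z (min D h) Int space_time"
  obtain x t where xt: "w = (x, t)" by fastforce
  have dx: "dist xh x < D" using w xt dist_fst_le[of ?z w] by simp
  have dt: "\<bar>th - t\<bar> < h" using w xt dist_snd_le[of ?z w] by (simp add: dist_real_def)
  have "v n (x, t) <= A"
  proof (rule \<tau>(2)[of "th - h"])
   show "0 <= th - h" using h t by simp
   show "v n (y, th - h) <= A" if "y \<in> cball x (2 * D)" for y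
    using N[OF n, of "(y, th - h)"] that dx dist_triangle[of xh y x] by simp
   show "th - h <= t" "t <= th - h + \<tau>" using dt h by linarith+
  qed
  then show "v n w <= A" using xt by simp
 qed
 moreover have "a * h > 0" using a h(1) by simp
 ultimately show False by (simp add: A_def)
qed

text \<open>The paraboloid is made strict, completed and truncated; maximum points of
  \<open>v n - \<phi>\<close> then approach the given point along suitable \<open>n\<close>, and the
  inequality for \<open>v n\<close> contradicts the joint limit of the curvatures.\<close>

lemma limsup_noncritical:
 assumes t: "th > 0" and p: "p ~= 0" and sym: "transpose X = X"
  and ev: "\<forall>\<^sub>F w in nhds (xh, th). lim_sup w <= lim_sup (xh, th) + a * (snd w - th) + p \<bullet> (fst w - xh)
     + (fst w - xh) \<bullet> (X *v (fst w - xh)) / 2 + C * (snd w - th)^2"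
 shows "a <= c * (trace X - p \<bullet> (X *v p) / (p \<bullet> p))"
proof (rule ccontr)
 assume neg: "~ ?thesis"
 let ?z = "(xh, th)" and ?d = "real CARD('n)"
 have c0: "c >= 0" using fam by (simp add: curvature_family_def)
 define L where "L = c * (trace X - p \<bullet> (X *v p) / (p \<bullet> p))"
 have La: "L < a" using neg by (simp add: L_def)
 define E where "E = c * ?d + 1"
 \<comment> \<open>Enlarging \<open>X\<close> by \<open>\<kappa>\<close> makes the maximum strict in
   space and costs at most \<open>E * \<kappa> = (a - L) / 2\<close>, so the strict inequality
   survives.\<close>
 define \<kappa> where "\<kappa> = (a - L) / (2 * E)"
 have cd: "E > 0" using c0 by (simp add: E_def add_nonneg_pos)
 have \<kappa>: "\<kappa> > 0" using La cd by (simp add: \<kappa>_def)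
 define X' where "X' = X + \<kappa> *\<^sub>R mat 1"
 have X'v: "X' *v y = X *v y + \<kappa> *\<^sub>R y" for y
  by (simp add: X'_def matrix_vector_mult_add_rdistrib scaleR_matrix_vector_assoc[symmetric])
 have sym': "transpose X' = X'" using sym by (simp add: X'_def transpose_def mat_def vec_eq_iff)
 have tr: "trace X' = trace X + \<kappa> * ?d" by (simp add: X'_def trace_def mat_def sum.distrib)
 have pp: "p \<bullet> p > 0" using p by simp
 have L': "c * (trace X' - p \<bullet> (X' *v p) / (p \<bullet> p)) < a"
 proof -
  have "c * (trace X' - p \<bullet> (X' *v p) / (p \<bullet> p)) = L + c * (\<kappa> * (?d - 1))"
   using pp by (simp add: tr X'v L_def inner_add_right add_divide_distrib algebra_simps)
  also have "... <= L + E * \<kappa>" using c0 \<kappa> by (simp add: E_def algebra_simps)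
  also have "... < a"
  proof -
   have "E * \<kappa> = (a - L) / 2" using cd by (simp add: \<kappa>_def)
   then show ?thesis using La by (simp add: field_simps)
  qed
  finally show ?thesis .
 qed
 obtain e where e: "e > 0" "!!w. dist w ?z < e ==> lim_sup w <= lim_sup ?z + a * (snd w - th) + p \<bullet> (fst w - xh)
     + (fst w - xh) \<bullet> (X *v (fst w - xh)) / 2 + C * (snd w - th)^2"
  using ev unfolding eventually_nhds_metric by blast
 define s where "s = min (e / 3) (th / 2)"
 have s: "s > 0" "2 * s < e" "s < th" using e t by (auto simp: s_def)
 have zS: "?z \<in> space_time" using t by simp
 have M: "M >= 0" using bnd[OF zS, of 0] by simp
 obtain B where B: "B > 0" "!!y. norm (X' *v y) <= B * norm y" using matrix_vector_bound by blast
 \<comment> \<open>Exceeds the largest possible difference between values of \<open>v n\<close> and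
   of the limit, so the truncation is not felt at a maximum.\<close>
 define S where "S = 2 * M + 1"
 have S: "S > 0" using M by (simp add: S_def)
 define C1 where "C1 = \<bar>C\<bar> + 1"
 \<comment> \<open>The term \<open>\<bar>a\<bar> * s\<close> compensates the linear part of
   \<open>\<theta>\<close>, so that \<open>q + \<theta>\<close> reaches \<open>S\<close> outside the
   ball at all times considered.\<close>
 define Q where "Q = S + \<bar>a\<bar> * s"
 have Q: "Q >= 0" using S s by (simp add: Q_def)
 define K where "K = 1 + norm p / s ^ 3 + B / s^2 + Q / s ^ 4 + B ^ 3 / (norm p)^2"
 have K: "K >= 1 + norm p / s ^ 3 + B / s^2 + Q / s ^ 4" "K >= 1 + norm p / s ^ 3 + B / s^2" "K > B ^ 3 / (norm p)^2" "K > 0"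
  using Q s B by (auto simp: K_def intro!: add_pos_nonneg add_nonneg_nonneg)
 define q where "q = quartic_test K p X' xh"
 define \<theta> where "\<theta> t = a * (t - th) + C1 * (t - th)^2" for t
 define \<phi> where "\<phi> w = lim_sup ?z + S * cutoff ((q (fst w) + \<theta> (snd w)) / S)" for w :: "(real^'n) * real"
 have q_sm: "smooth_on UNIV q" unfolding q_def by (rule quartic_test(1)[OF sym'])
 have \<theta>': "(\<theta> has_real_derivative a + 2 * C1 * (t - th)) (at t)" for t
  unfolding \<theta>_def by (auto intro!: derivative_eq_intros)
 have \<theta>_sm: "smooth_on UNIV \<theta>"
 proof -
  have "smooth_on UNIV (%t. a * (t + - th) + C1 * (t + - th)^2)"
   by (intro smooth_on_add smooth_on_cmult smooth_on_power smooth_on_const smooth_on_bounded_linear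
     bounded_linear_ident open_UNIV)
  then show ?thesis by (rule smooth_on_cong) (simp add: \<theta>_def)
 qed
 have \<phi>_sm: "smooth_on UNIV \<phi>"
 proof -
  have "smooth_on UNIV (%w::(real^'n) * real. lim_sup ?z + S * cutoff ((1 / S) * (q (fst w) + \<theta> (snd w))))"
   by (intro smooth_on_add smooth_on_const smooth_on_cmult smooth_on_compose_real[OF _ smooth_on_cutoff]
     smooth_on_fst_compose[OF q_sm] smooth_on_snd_compose[OF \<theta>_sm] open_UNIV)
  then show ?thesis by (rule smooth_on_cong) (simp add: \<phi>_def)
 qed
 have \<phi>c: "continuous_on A \<phi>" for A
  using smooth_on_imp_continuous_on[OF \<phi>_sm] by (rule continuous_on_subset) simp
 have qz: "q xh = 0" "\<theta> th = 0" by (simp_all add: q_def quartic_test_def \<theta>_def)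
 have \<phi>z: "\<phi> ?z = lim_sup ?z" by (simp add: \<phi>_def qz cutoff_0)
 have \<phi>_ge: "\<phi> w - lim_sup ?z >= min (q (fst w) + \<theta> (snd w)) S" for w
 proof -
  have "min (q (fst w) + \<theta> (snd w)) S = S * min ((q (fst w) + \<theta> (snd w)) / S) 1"
   using S by (simp add: min_def field_simps)
  also have "... <= S * cutoff ((q (fst w) + \<theta> (snd w)) / S)"
   using S by (intro mult_left_mono cutoff_ge_min) auto
  finally show ?thesis by (simp add: \<phi>_def)
 qed
 have far: "q y + \<theta> t >= S" if "t \<in> {th - s..th + s}" "y ~: cball xh s" for y t
 proof -
  have "norm (y - xh) >= s" using that(2) by (simp add: dist_norm norm_minus_commute)
  then have "q y >= norm (y - xh) ^ 4 + Q"
   unfolding q_def by (intro quartic_coercive(1)[OF B(2) s(1) Q B(1) K(1)])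
  then have "q y >= Q" using zero_le_power[OF norm_ge_zero, of "y - xh" 4] by linarith
  moreover have "\<theta> t >= - (\<bar>a\<bar> * s)"
  proof -
   have "\<bar>a * (t - th)\<bar> <= \<bar>a\<bar> * s" unfolding abs_mult using that(1) by (intro mult_left_mono) auto
   moreover have "C1 * (t - th)^2 >= 0" by (simp add: C1_def)
   ultimately show ?thesis unfolding \<theta>_def by linarith
  qed
  ultimately show ?thesis by (simp add: Q_def)
 qed
 have near: "lim_sup w < \<phi> w" if w: "w \<in> cball xh s \<times> {th - s..th + s}" "w ~= ?z" for w
 proof -
  obtain x t where xt: "w = (x, t)" by fastforce
  have dx: "dist xh x <= s" "\<bar>t - th\<bar> <= s" using w xt by auto
  have wS: "w \<in> space_time" using xt dx s by auto
  have "dist w ?z <= dist x xh + dist t th" unfolding xt by (rule dist_prod_le)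
  also have "... < e" using dx s by (simp add: dist_commute dist_real_def)
  finally have le: "lim_sup w <= lim_sup ?z + a * (t - th) + p \<bullet> (x - xh)
     + (x - xh) \<bullet> (X *v (x - xh)) / 2 + C * (t - th)^2" using e(2)[of w] xt by simp
  show ?thesis
  proof (cases "q x + \<theta> t <= S")
   case True
   have "C * (t - th)^2 <= \<bar>C\<bar> * (t - th)^2" by (intro mult_right_mono) auto
   moreover have "\<kappa> * ((x - xh) \<bullet> (x - xh)) / 2 + (t - th)^2 > 0"
   proof (cases "x = xh")
    case True
    then have "t ~= th" using w(2) xt by simp
    then show ?thesis using \<kappa> by (intro add_nonneg_pos) auto
   next
    case False
    then show ?thesis using \<kappa> by (intro add_pos_nonneg) auto
   qed
   moreover have "K * ((x - xh) \<bullet> (x - xh))^2 >= 0" using K(4) by simp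
   moreover have "q x = p \<bullet> (x - xh) + ((x - xh) \<bullet> (X *v (x - xh))) / 2 + \<kappa> * ((x - xh) \<bullet> (x - xh)) / 2
     + K * ((x - xh) \<bullet> (x - xh))^2"
    unfolding q_def quartic_test_def X'v inner_add_right inner_scaleR_right add_divide_distrib by simp
   moreover have "\<theta> t = a * (t - th) + \<bar>C\<bar> * (t - th)^2 + (t - th)^2"
    unfolding \<theta>_def C1_def distrib_right by simp
   ultimately have "lim_sup w - lim_sup ?z < q x + \<theta> t" using le by linarith
   then show ?thesis using \<phi>_ge[of w] True xt by simp
  next
   case False
   then have "\<phi> w - lim_sup ?z >= S" using \<phi>_ge[of w] xt by simp
   then show ?thesis using limsup_bound[OF wS] limsup_bound[OF zS] by (simp add: S_def abs_le_iff)
  qed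
 qed
 let ?F = "(sequentially :: nat filter) \<times>\<^sub>F nhds ?z"
 have reg: "\<forall>\<^sub>F x in nhds xh. regular_level q (q x)"
  unfolding q_def by (rule quartic_regular[OF sym' B(2) s(1) B(1) p K(2,3)])
 have gq: "grad q xh = p" unfolding q_def by (rule quartic_level_op(2)[OF sym' p])
 have lo: "level_op q xh = trace X' - p \<bullet> (X' *v p) / (p \<bullet> p)"
  unfolding q_def by (rule quartic_level_op(1)[OF sym' p])
 have lf: "filterlim (%y. (fst y, fst (snd y))) (sequentially \<times>\<^sub>F nhds xh) ?F"
 proof (intro filterlim_Pair filterlim_fst)
  have "((%y::nat \<times> (real^'n) * real. snd y) \<longlongrightarrow> ?z) ?F" by (rule filterlim_snd)
  from tendsto_fst[OF this] show "filterlim (%y. fst (snd y)) (nhds xh) ?F" by simp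
 qed
 have z_lim: "((%y::nat \<times> (real^'n) * real. snd y) \<longlongrightarrow> ?z) ?F" by (rule filterlim_snd)
 have x_lim: "((%y::nat \<times> (real^'n) * real. fst (snd y)) \<longlongrightarrow> xh) ?F" using tendsto_fst[OF z_lim] by simp
 have t_lim: "((%y::nat \<times> (real^'n) * real. snd (snd y)) \<longlongrightarrow> th) ?F" using tendsto_snd[OF z_lim] by simp
 have "((%(n, x). H n x {y. q y >= q x}) \<longlongrightarrow> - c * level_op q xh / norm (grad q xh)) (sequentially \<times>\<^sub>F nhds xh)"
  using fam q_sm reg p gq unfolding curvature_family_def by blast
 from filterlim_compose[OF this lf]
 have Hlim: "((%y. H (fst y) (fst (snd y)) {y'. q y' >= q (fst (snd y))}) \<longlongrightarrow> - c * level_op q xh / norm p) ?F"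
  by (simp add: gq case_prod_unfold)
 have "isCont (grad q) xh"
  using grad_has_derivative[OF open_UNIV smooth_onD[OF q_sm]] has_derivative_continuous by blast
 from isCont_tendsto_compose[OF this x_lim]
 have glim: "((%y. grad q (fst (snd y))) \<longlongrightarrow> p) ?F" by (simp add: gq)
 have "((%y. a + 2 * C1 * (snd (snd y) - th) + norm (grad q (fst (snd y))) * H (fst y) (fst (snd y)) {y'. q y' >= q (fst (snd y))})
   \<longlongrightarrow> a + 2 * C1 * (th - th) + norm p * (- c * level_op q xh / norm p)) ?F"
  by (intro tendsto_intros t_lim tendsto_norm glim Hlim)
 moreover have "a + 2 * C1 * (th - th) + norm p * (- c * level_op q xh / norm p) > 0"
  using L' p by (simp add: lo)
 ultimately have ev1: "\<forall>\<^sub>F y in ?F. a + 2 * C1 * (snd (snd y) - th) + norm (grad q (fst (snd y))) * H (fst y) (fst (snd y)) {y'. q y' >= q (fst (snd y))} > 0"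
  by (rule order_tendstoD(1))
 have ev2: "\<forall>\<^sub>F y in ?F. regular_level q (q (fst (snd y)))"
  using eventually_compose_filterlim[OF reg x_lim] .
 have "isCont q xh" "isCont \<theta> th"
  using smooth_on_imp_continuous_on[OF q_sm] smooth_on_imp_continuous_on[OF \<theta>_sm]
  by (auto simp: continuous_on_eq_continuous_at)
 then have "((%y. q (fst (snd y)) + \<theta> (snd (snd y))) \<longlongrightarrow> q xh + \<theta> th) ?F"
  by (intro tendsto_add isCont_tendsto_compose[OF _ x_lim] isCont_tendsto_compose[OF _ t_lim])
 then have ev3: "\<forall>\<^sub>F y in ?F. q (fst (snd y)) + \<theta> (snd (snd y)) < S"
  using S qz by (intro order_tendstoD(2)) auto
 from eventually_conj[OF ev1 eventually_conj[OF ev2 ev3]]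
 obtain P1 P2 where P: "eventually P1 sequentially" "eventually P2 (nhds ?z)"
  "!!n w. P1 n ==> P2 w ==> a + 2 * C1 * (snd w - th) + norm (grad q (fst w)) * H n (fst w) {y'. q y' >= q (fst w)} > 0 &
    regular_level q (q (fst w)) & q (fst w) + \<theta> (snd w) < S"
  unfolding eventually_prod_filter by force
 obtain N1 where N1: "!!n. n >= N1 ==> P1 n" using P(1) unfolding eventually_sequentially by blast
 obtain e1 where e1: "e1 > 0" "!!w. dist w ?z < e1 ==> P2 w" using P(2) unfolding eventually_nhds_metric by blast
 define \<epsilon> where "\<epsilon> = min e1 s"
 have \<epsilon>: "\<epsilon> > 0" "\<epsilon> <= e1" "\<epsilon> <= s" using e1 s by (auto simp: \<epsilon>_def)
 \<comment> \<open>Here, away from the point, \<open>lim_sup - \<phi>\<close> has a negative upper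
   bound. So for large \<open>n\<close> the maximum of \<open>v n - \<phi>\<close>, which exceeds
   \<open>- \<eta>\<close>, is attained within \<open>\<epsilon>\<close> of the point.\<close>
 let ?K = "cball xh s \<times> {th - s..th + s} - ball ?z \<epsilon>"
 have Kc: "compact ?K" by (intro compact_diff compact_Times) auto
 have KS: "?K <= space_time" using s by auto
 obtain \<eta> where \<eta>: "\<eta> > 0" "\<eta> < 1" "!!w. w \<in> ?K ==> lim_sup w < \<phi> w - \<eta>"
 proof (cases "?K = {}")
  case True
  then show ?thesis by (intro that[of "1/2"]) (simp, simp, blast)
 next
  case False
  have "usc_on ?K (%w. lim_sup w - \<phi> w)" by (intro usc_on_diff usc_on_subset[OF usc_limsup KS] \<phi>c)
  then obtain z' where z': "z' \<in> ?K" "!!w. w \<in> ?K ==> lim_sup w - \<phi> w <= lim_sup z' - \<phi> z'"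
   using usc_attains_sup[OF Kc False] by blast
  have "z' ~= ?z" using z'(1) \<epsilon>(1) by auto
  then have neg: "lim_sup z' - \<phi> z' < 0" using near[of z'] z'(1) by simp
  define \<eta> where "\<eta> = min (1/2) ((\<phi> z' - lim_sup z') / 2)"
  have \<eta>0: "\<eta> > 0" "\<eta> < 1" using neg by (auto simp: \<eta>_def)
  moreover have "lim_sup w < \<phi> w - \<eta>" if "w \<in> ?K" for w
  proof -
   have "\<eta> <= (\<phi> z' - lim_sup z') / 2" unfolding \<eta>_def by (rule min.cobounded2)
   then have "\<eta> * 2 <= \<phi> z' - lim_sup z'" by simp
   then show ?thesis using z'(2)[OF that] \<eta>0(1) by linarith
  qed
  ultimately show ?thesis using that by blast
 qed
 obtain N2 where N2: "!!n w. n >= N2 ==> w \<in> ?K ==> v n w < \<phi> w - \<eta>"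
  using limsup_compact[OF Kc KS, of "%w. \<phi> w - \<eta>"] \<eta>(3) continuous_on_diff[OF \<phi>c continuous_on_const] by metis
 have "isCont \<phi> ?z" using \<phi>c[of UNIV] by (simp add: continuous_on_eq_continuous_at)
 then have "\<forall>\<^sub>F w in nhds ?z. \<phi> w < lim_sup ?z + \<eta> / 2"
  using \<eta>(1) \<phi>z iffD1[OF tendsto_at_iff_tendsto_nhds, of \<phi> ?z]
  by (intro order_tendstoD(2)[of \<phi> "\<phi> ?z"]) (auto simp: isCont_def)
 then obtain e2 where e2: "e2 > 0" "!!w. dist w ?z < e2 ==> \<phi> w < lim_sup ?z + \<eta> / 2"
  unfolding eventually_nhds_metric by blast
 obtain n w where nw: "n >= max N1 N2" "w \<in> ball ?z (min e2 s) Int space_time" "v n w > lim_sup ?z - \<eta> / 2"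
  using limsup_greater[OF zS, of "lim_sup ?z - \<eta> / 2" "min e2 s" "max N1 N2"] \<eta>(1) e2(1) s(1) by auto
 have w_slab: "w \<in> UNIV \<times> {th - s..th + s}"
  using nw(2) dist_snd_le[of ?z w] by (auto simp: mem_Times_iff dist_real_def)
 have big: "v n w - \<phi> w > - \<eta>" using nw e2(2)[of w] by (force simp: dist_commute)
 obtain z' where z': "snd z' \<in> {th - s..th + s}"
  "!!w. w \<in> UNIV \<times> {th - s..th + s} ==> v n w - \<phi> w <= v n z' - \<phi> z'"
 proof (rule max_attained[OF usc_v[of n] const_v[of n], of "th - s" "th + s" \<phi> "s + norm xh"])
  show "continuous_on (UNIV \<times> {th - s..th + s}) \<phi>" by (rule \<phi>c)
  fix t and x y :: "real^'n" assume "t \<in> {th - s..th + s}" "norm x > s + norm xh" "norm y > s + norm xh"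
  then have "x ~: cball xh s" "y ~: cball xh s" "t \<in> {th - s..th + s}"
   using norm_triangle_ineq2[of x xh] norm_triangle_ineq2[of y xh] by (auto simp: dist_norm norm_minus_commute)
  then show "\<phi> (x, t) = \<phi> (y, t)"
   using far[of t x] far[of t y] S by (simp add: \<phi>_def cutoff_eq_1)
 qed (use s in auto)
 obtain x t' where xt: "z' = (x, t')" by fastforce
 have zbig: "v n z' - \<phi> z' > - \<eta>" using z'(2)[OF w_slab] big by simp
 have "z' \<in> ball ?z \<epsilon>"
 proof (rule ccontr)
  assume out: "z' ~: ball ?z \<epsilon>"
  show False
  proof (cases "x \<in> cball xh s")
   case True
   then have "z' \<in> ?K" using out xt z'(1) by auto
   then show False using N2[of n z'] nw(1) zbig by simp
  next
   case False
   have "\<phi> z' = lim_sup ?z + S" using far[OF _ False, of t'] z'(1) xt S by (simp add: \<phi>_def cutoff_eq_1)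
   moreover have "v n z' <= M" using bnd[of z' n] z'(1) xt s by simp
   ultimately show False using limsup_bound[OF zS] zbig \<eta>(2) by (simp add: S_def abs_le_iff)
  qed
 qed
 then have dz: "dist z' ?z < \<epsilon>" by (simp add: dist_commute)
 then have P3: "a + 2 * C1 * (t' - th) + norm (grad q x) * H n x {y'. q y' >= q x} > 0"
  "regular_level q (q x)" "q x + \<theta> t' < S"
  using P(3)[of n z'] N1[of n] e1(2)[of z'] nw(1) \<epsilon> xt by auto
 have "\<bar>t' - th\<bar> < s" using dz \<epsilon>(3) dist_snd_le[of z' ?z] xt by (simp add: dist_real_def)
 then have "a + 2 * C1 * (t' - th) + norm (grad q x) * H n x {y'. q y' >= q x} <= 0" using z'(2) xt s far
  by (intro truncated_test[OF sub[of n] q_sm S \<theta>_sm \<theta>', of "th - s" t' "th + s" xh s x "lim_sup ?z"] P3)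
   (auto simp: \<phi>_def)
 then show False using P3(1) by simp
qed

lemma local_sub_limsup: "local_sub c lim_sup"
 unfolding local_sub_def using limsup_flat limsup_noncritical by blast

end

lemma local_sub_quadratic:
 "local_sub c u ==> t > 0 ==> p ~= 0 ==> transpose X = X ==>
  \<forall>\<^sub>F w in nhds (x, t). u w <= u (x, t) + a * (snd w - t) + p \<bullet> (fst w - x)
     + (fst w - x) \<bullet> (X *v (fst w - x)) / 2 + C * (snd w - t)^2 ==>
   a <= c * (trace X - p \<bullet> (X *v p) / (p \<bullet> p))" unfolding local_sub_def by blast

lemma local_sub_time:
 "local_sub c u ==> t > 0 ==>
  \<forall>\<^sub>F w in nhds (x, t). u w <= u (x, t) + a * (snd w - t) + C * (snd w - t)^2 ==> a <= 0"
 unfolding local_sub_def by blast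

text \<open>The second order coefficient is proportional to \<open>norm y0\<close>, so close to its
  centre a cubic test produces an arbitrarily small curvature term.\<close>

lemma norm_cube_expansion:
 fixes y0 h :: "'a::real_inner"
 assumes "norm h <= norm y0"
 shows "norm (y0 + h) ^ 3 <= norm y0 ^ 3 + 3 * norm y0 * (y0 \<bullet> h) + 4 * norm y0 * (norm h)^2"
proof -
 define \<rho> s where "\<rho> = norm y0" and "s = norm (y0 + h)"
 have s2: "s^2 = \<rho>^2 + 2 * (y0 \<bullet> h) + (norm h)^2"
  unfolding s_def \<rho>_def power2_norm_eq_inner by (simp add: inner_add_left inner_add_right inner_commute)
 \<comment> \<open>Expressed through \<open>s^2\<close> the first order part is exact, and the
   remainder is quadratic in \<open>s - \<rho>\<close>.\<close>
 have "s ^ 3 = \<rho> ^ 3 + 3 / 2 * \<rho> * (s^2 - \<rho>^2) + (s - \<rho>)^2 * (s + \<rho> / 2)"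
  by (simp add: power2_eq_square power3_eq_cube field_simps)
 also have "(s - \<rho>)^2 * (s + \<rho> / 2) <= (norm h)^2 * (5 / 2 * \<rho>)"
 proof (rule mult_mono)
  have "\<bar>s - \<rho>\<bar> <= norm h" using norm_triangle_ineq3[of "y0 + h" y0] by (simp add: s_def \<rho>_def)
  then show "(s - \<rho>)^2 <= (norm h)^2" by (metis abs_ge_zero power2_abs power_mono)
  have "s <= \<rho> + norm h" unfolding s_def \<rho>_def by (rule norm_triangle_ineq)
  then show "s + \<rho> / 2 <= 5 / 2 * \<rho>" using assms by (simp add: \<rho>_def)
 qed (auto simp: s_def \<rho>_def)
 also have "\<rho> ^ 3 + 3 / 2 * \<rho> * (s^2 - \<rho>^2) + (norm h)^2 * (5 / 2 * \<rho>) =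
   \<rho> ^ 3 + 3 * \<rho> * (y0 \<bullet> h) + 4 * \<rho> * (norm h)^2"
  unfolding s2 by (simp add: field_simps)
 finally show ?thesis by (simp add: \<rho>_def s_def)
qed

text \<open>If the test function is perturbed by moving the centre of the cubic term, either the maximum is
 attained where the gradient does not vanish, or the perturbed maximum does not depend on the centre.\<close>

lemma local_sub_cubic:
 fixes u :: "(real^'n) * real => real"
 assumes ls: "local_sub c u" and usc: "usc_on space_time u" and c: "c >= 0" and th: "th > 0"
  and ev: "\<forall>\<^sub>F w in nhds (xh, th). u w <= u (xh, th) + a * (snd w - th) + C * norm (fst w - xh) ^ 3 + C * (snd w - th)^2"
 shows "a <= 0"
proof (rule ccontr)
 assume "~ a <= 0"
 then have a: "a > 0" by simp
 let ?z = "(xh, th)" and ?d = "real CARD('n)"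
 obtain e where e: "e > 0" "!!w. dist w ?z < e ==> u w <= u ?z + a * (snd w - th) + C * norm (fst w - xh) ^ 3 + C * (snd w - th)^2"
  using ev unfolding eventually_nhds_metric by blast
 define s where "s = min (e / 3) (th / 2)"
 have s: "s > 0" "2 * s < e" "s < th" using e th by (auto simp: s_def)
 define C' where "C' = \<bar>C\<bar> + 1"
 have C': "C' >= 1" "C <= C' - 1" by (auto simp: C'_def)
 \<comment> \<open>\<open>E * r / 2\<close> bounds the curvature term of the shifted cubic within
   distance \<open>2 * r\<close> of its centre; \<open>r \<le> a / E\<close> makes it at most
   \<open>a / 2\<close>.\<close>
 define E where "E = 32 * (c * ?d + 1) * C'"
 have E: "E > 0" using c C' by (auto simp: E_def intro!: mult_pos_pos add_nonneg_pos)
 define r where "r = min (min (s / 2) (a / (4 * C'))) (a / E)"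
 have r: "r > 0" "r <= s / 2" "r <= a / (4 * C')" "r <= a / E"
 proof -
  show "r > 0" using s a C' E by (simp add: r_def)
  show "r <= s / 2" "r <= a / (4 * C')" "r <= a / E"
   unfolding r_def by (meson min.cobounded1 min.cobounded2 order.trans)+
 qed
 define Bx where "Bx = cball xh s \<times> {th - s..th + s}"
 have Bx: "compact Bx" "Bx ~= {}" "Bx <= space_time" "?z \<in> Bx"
  using s by (auto simp: Bx_def intro!: compact_Times)
 define \<Phi> where "\<Phi> \<xi> w = u w - (C' * norm (fst w - xh - \<xi>) ^ 3 + a * (snd w - th) + C' * (snd w - th)^2)"
  for \<xi> :: "real^'n" and w
 have "\<exists>w\<in>Bx. \<forall>w'\<in>Bx. \<Phi> \<xi> w' <= \<Phi> \<xi> w" for \<xi>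
 proof -
  have "usc_on Bx (\<Phi> \<xi>)"
   unfolding \<Phi>_def[abs_def] using usc_on_subset[OF usc Bx(3)] by (intro usc_on_diff continuous_intros) auto
  then show ?thesis using usc_attains_sup[OF Bx(1,2)] by metis
 qed
 then obtain W where W: "!!\<xi>. W \<xi> \<in> Bx" "!!\<xi> w. w \<in> Bx ==> \<Phi> \<xi> w <= \<Phi> \<xi> (W \<xi>)" by metis
 have \<Phi>0: "\<Phi> 0 w <= u ?z - norm (fst w - xh) ^ 3 - (snd w - th)^2" if "w \<in> Bx" for w
 proof -
  obtain x t where xt: "w = (x, t)" by fastforce
  have "dist w ?z <= dist x xh + dist t th" unfolding xt by (rule dist_prod_le)
  also have "... < e" using that s xt by (auto simp: Bx_def dist_commute dist_real_def)
  finally have "u w <= u ?z + a * (t - th) + C * norm (x - xh) ^ 3 + C * (t - th)^2" using e(2)[of w] xt by simp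
  moreover have "C * norm (x - xh) ^ 3 <= (C' - 1) * norm (x - xh) ^ 3" "C * (t - th)^2 <= (C' - 1) * (t - th)^2"
   using C' by (auto intro: mult_right_mono)
  ultimately show ?thesis by (simp add: \<Phi>_def xt algebra_simps)
 qed
 \<comment> \<open>So small a shift of the centre changes the test function by less than the
   strictness gained from \<open>C' = \<bar>C\<bar> + 1\<close> at distance \<open>r\<close>, hence
   the maximum stays within \<open>r\<close>.\<close>
 define \<delta> where "\<delta> = min (min r 1) (min (r ^ 3) (r^2) / (2 * (C' + 12 * C' * s^2)))"
 have pos: "C' + 12 * C' * s^2 > 0" using C' by (intro add_pos_nonneg) auto
 have \<delta>: "\<delta> > 0" "\<delta> <= r" "\<delta> <= 1" "(C' + 12 * C' * s^2) * \<delta> < min (r ^ 3) (r^2)"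
 proof -
  show "\<delta> > 0" using r pos by (simp add: \<delta>_def)
  show "\<delta> <= r" "\<delta> <= 1" unfolding \<delta>_def by (meson min.cobounded1 min.cobounded2 order.trans)+
  have "\<delta> <= min (r ^ 3) (r^2) / (2 * (C' + 12 * C' * s^2))" unfolding \<delta>_def by (rule min.cobounded2)
  then have "2 * (C' + 12 * C' * s^2) * \<delta> <= min (r ^ 3) (r^2)"
   using pos by (simp add: pos_le_divide_eq mult.commute)
  moreover have "(C' + 12 * C' * s^2) * \<delta> > 0" using pos \<open>\<delta> > 0\<close> by simp
  ultimately show "(C' + 12 * C' * s^2) * \<delta> < min (r ^ 3) (r^2)" by linarith
 qed
 have loc: "norm (fst (W \<xi>) - xh) < r & \<bar>snd (W \<xi>) - th\<bar> < r" if \<xi>: "norm \<xi> <= \<delta>" for \<xi>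
 proof -
  define x t where "x = fst (W \<xi>)" and "t = snd (W \<xi>)"
  have xs: "norm (x - xh) <= s" using W(1)[of \<xi>] by (auto simp: Bx_def x_def mem_Times_iff dist_norm norm_minus_commute)
  let ?A = "norm (x - xh)" and ?B = "norm (x - xh - \<xi>)"
  have AB: "\<bar>?A - ?B\<bar> <= norm \<xi>" using norm_triangle_ineq3[of "x - xh" "x - xh - \<xi>"] by simp
  have B2: "?B <= 2 * s" using AB xs \<xi> \<delta>(2) r(2) s(1) by simp
  have "?A ^ 3 - ?B ^ 3 = (?A - ?B) * (?A^2 + ?A * ?B + ?B^2)"
   by (simp add: power2_eq_square power3_eq_cube algebra_simps)
  also have "... <= norm \<xi> * (12 * s^2)"
  proof (rule mult_mono)
   have "?A^2 <= s^2" "?B^2 <= (2 * s)^2" using xs B2 by (intro power_mono; simp)+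
   moreover have "?A * ?B <= s * (2 * s)" using xs B2 s(1) by (intro mult_mono) auto
   moreover have "s * (2 * s) = 2 * (s * s)" "2 * s * (2 * s) = 4 * (s * s)" by simp_all
   ultimately show "?A^2 + ?A * ?B + ?B^2 <= 12 * s^2"
    unfolding power2_eq_square using zero_le_square[of s] by linarith
  qed (use AB in auto)
  finally have cube: "?A ^ 3 - ?B ^ 3 <= norm \<xi> * (12 * s^2)" .
  have "u ?z - C' * norm \<xi> ^ 3 = \<Phi> \<xi> ?z" by (simp add: \<Phi>_def)
  also have "... <= \<Phi> \<xi> (W \<xi>)" by (rule W(2)[OF Bx(4)])
  also have "... = \<Phi> 0 (W \<xi>) + C' * (?A ^ 3 - ?B ^ 3)"
   by (simp add: \<Phi>_def x_def algebra_simps)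
  also have "... <= (u ?z - ?A ^ 3 - (t - th)^2) + C' * (norm \<xi> * (12 * s^2))"
   using \<Phi>0[OF W(1)[of \<xi>]] cube C'(1) by (intro add_mono mult_left_mono) (auto simp: x_def t_def)
  finally have "?A ^ 3 + (t - th)^2 <= C' * norm \<xi> ^ 3 + C' * (norm \<xi> * (12 * s^2))" by simp
  also have "norm \<xi> ^ 3 <= norm \<xi>"
   using power_decreasing[of 1 3 "norm \<xi>"] \<xi> \<delta>(3) by simp
  also have "C' * norm \<xi> + C' * (norm \<xi> * (12 * s^2)) = (C' + 12 * C' * s^2) * norm \<xi>"
   by (simp add: algebra_simps)
  also have "... <= (C' + 12 * C' * s^2) * \<delta>" using \<xi> pos by (intro mult_left_mono) auto
  finally have le: "?A ^ 3 + (t - th)^2 < min (r ^ 3) (r^2)" using \<delta>(4) C'(1) by simp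
  have "?A ^ 3 < r ^ 3" using le zero_le_power2[of "t - th"] by linarith
  then have 1: "?A < r" using r(1) by (rule power_less_imp_less_base[OF _ less_imp_le])
  have "?A ^ 3 >= 0" by simp
  then have "\<bar>t - th\<bar>^2 < r^2" using le unfolding power2_abs by linarith
  then have "\<bar>t - th\<bar> < r" using r(1) by (rule power_less_imp_less_base[OF _ less_imp_le])
  with 1 show ?thesis by (simp add: x_def t_def)
 qed
 \<comment> \<open>Off the centre the gradient is nonzero and the noncritical inequality gives
   \<open>a' \<le> a / 2\<close>, while the time derivative \<open>a'\<close> of the test function
   there exceeds \<open>a / 2\<close>.\<close>
 have centre: "fst (W \<xi>) = xh + \<xi>" if \<xi>: "norm \<xi> <= \<delta>" for \<xi>
 proof (rule ccontr)
  assume ne: "fst (W \<xi>) ~= xh + \<xi>"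
  define x t where "x = fst (W \<xi>)" and "t = snd (W \<xi>)"
  define y0 where "y0 = x - xh - \<xi>"
  have y0: "y0 ~= 0" using ne by (auto simp: y0_def x_def algebra_simps)
  note lc = loc[OF \<xi>, folded x_def t_def]
  have t0: "t > 0" using lc r(2) s by linarith
  define \<rho> where "\<rho> = norm y0"
  have \<rho>: "\<rho> > 0" "\<rho> <= 2 * r"
   using y0 norm_triangle_ineq4[of "x - xh" \<xi>] lc \<xi> \<delta>(2) by (auto simp: \<rho>_def y0_def)
  define a' where "a' = a + 2 * C' * (t - th)"
  define p where "p = (3 * C' * \<rho>) *\<^sub>R y0"
  define X where "X = (8 * C' * \<rho>) *\<^sub>R (mat 1 :: real^'n^'n)"
  have p: "p ~= 0" using y0 \<rho> C' by (simp add: p_def)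
  have Xv: "X *v y = (8 * C' * \<rho>) *\<^sub>R y" for y
   by (simp add: X_def scaleR_matrix_vector_assoc[symmetric])
  have sym: "transpose X = X" by (simp add: X_def transpose_def mat_def vec_eq_iff)
  have "open (ball xh s \<times> {th - s<..<th + s})" by (intro open_Times) auto
  moreover have "(x, t) \<in> ball xh s \<times> {th - s<..<th + s}"
   using lc r(1,2) by (auto simp: dist_norm norm_minus_commute)
  ultimately have "\<forall>\<^sub>F w in nhds (x, t). w \<in> ball xh s \<times> {th - s<..<th + s}"
   by (rule eventually_nhds_in_open)
  moreover have "\<forall>\<^sub>F w in nhds (x, t). dist w (x, t) < \<rho>"
   using \<rho>(1) by (auto simp: eventually_nhds_metric)
  ultimately have "\<forall>\<^sub>F w in nhds (x, t). u w <= u (x, t) + a' * (snd w - t) + p \<bullet> (fst w - x)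
     + (fst w - x) \<bullet> (X *v (fst w - x)) / 2 + C' * (snd w - t)^2"
  proof eventually_elim
   case (elim w)
   obtain x' t' where w: "w = (x', t')" by fastforce
   have "w \<in> Bx" using elim(1) by (auto simp: Bx_def)
   from W(2)[OF this, of \<xi>]
   have "u w <= u (x, t) + C' * (norm (x' - xh - \<xi>) ^ 3 - norm y0 ^ 3)
     + (a * (t' - t) + C' * ((t' - th)^2 - (t - th)^2))"
    by (simp add: \<Phi>_def w x_def t_def y0_def algebra_simps)
   also have "a * (t' - t) + C' * ((t' - th)^2 - (t - th)^2) = a' * (t' - t) + C' * (t' - t)^2"
    by (simp add: a'_def power2_eq_square algebra_simps)
   also have "norm (x' - xh - \<xi>) ^ 3 - norm y0 ^ 3 <= 3 * \<rho> * (y0 \<bullet> (x' - x)) + 4 * \<rho> * (norm (x' - x))^2"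
   proof -
    have "norm (x' - x) <= norm y0"
     using dist_fst_le[of w "(x, t)"] elim(2) w by (simp add: \<rho>_def dist_norm)
    from norm_cube_expansion[OF this] show ?thesis by (simp add: \<rho>_def y0_def algebra_simps)
   qed
   finally have "u w <= u (x, t) + C' * (3 * \<rho> * (y0 \<bullet> (x' - x)) + 4 * \<rho> * (norm (x' - x))^2)
     + (a' * (t' - t) + C' * (t' - t)^2)" using C'(1) by simp
   then show ?case by (simp add: w p_def Xv power2_norm_eq_inner distrib_left mult_ac)
  qed
  from local_sub_quadratic[OF ls t0 p sym this]
  have "a' <= c * (trace X - p \<bullet> (X *v p) / (p \<bullet> p))" .
  also have "trace X - p \<bullet> (X *v p) / (p \<bullet> p) = 8 * C' * \<rho> * (?d - 1)"
   using p by (simp add: Xv) (simp add: X_def trace_def mat_def algebra_simps)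
  also have "c * (8 * C' * \<rho> * (?d - 1)) <= (c * ?d + 1) * (8 * C') * (2 * r)"
  proof -
   have "c * (?d - 1) * (8 * C' * \<rho>) <= (c * ?d + 1) * (8 * C' * (2 * r))"
    using c C'(1) \<rho> by (intro mult_mono) (auto simp: algebra_simps)
   then show ?thesis by (simp add: mult_ac)
  qed
  also have "... = E * r / 2" by (simp add: E_def)
  also have "... <= a / 2" using r(4) E by (simp add: pos_le_divide_eq mult.commute)
  finally have "a' <= a / 2" .
  moreover have "a' > a / 2"
  proof -
   have "4 * (C' * r) <= a" using r(3) C'(1) by (simp add: pos_le_divide_eq mult_ac)
   moreover have "C' * (t - th) > C' * (- r)" using lc C'(1) by (intro mult_strict_left_mono) auto
   ultimately have "4 * (C' * (t - th)) > - a" by linarith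
   then show ?thesis by (simp add: a'_def algebra_simps)
  qed
  ultimately show False by simp
 qed
 \<comment> \<open>The maximum for \<open>\<xi>\<close> sits at the centre, so its value seen from
   another centre drops only by a cube; hence \<open>m\<close> has derivative 0 and is constant.
   Centring the test at the spatial position of a given point then removes the cubic term at that
   point and leaves a function of time.\<close>
 define m where "m \<xi> = \<Phi> \<xi> (W \<xi>)" for \<xi>
 have m_le: "m \<xi> <= m \<xi>' + C' * norm (\<xi> - \<xi>') ^ 3" if "norm \<xi> <= \<delta>" for \<xi> \<xi>'
 proof -
  have "m \<xi> - C' * norm (\<xi> - \<xi>') ^ 3 = \<Phi> \<xi>' (W \<xi>)"
   by (simp add: m_def \<Phi>_def centre[OF that])
  also have "... <= m \<xi>'" unfolding m_def by (rule W(2)[OF W(1)])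
  finally show ?thesis by simp
 qed
 have "m \<xi> = m 0" if "\<xi> \<in> ball 0 \<delta>" for \<xi>
 proof (rule has_derivative_zero_unique[of "ball 0 \<delta>" m])
  fix \<xi> :: "real^'n" assume \<xi>: "\<xi> \<in> ball 0 \<delta>"
  have "(m has_derivative (%h. 0)) (at \<xi>)"
  proof (rule has_derivative_quadratic_error[where K = "C'" and d = "min 1 (\<delta> - norm \<xi>)"])
   fix \<xi>' assume y: "norm (\<xi>' - \<xi>) < min 1 (\<delta> - norm \<xi>)"
   have n': "norm \<xi>' <= \<delta>" using y norm_triangle_ineq[of "\<xi>' - \<xi>" \<xi>] by simp
   have "norm (\<xi>' - \<xi>) ^ 3 <= norm (\<xi>' - \<xi>) ^ 2" using y by (intro power_decreasing) auto
   then have "C' * norm (\<xi>' - \<xi>) ^ 3 <= C' * norm (\<xi>' - \<xi>) ^ 2" using C'(1) by (intro mult_left_mono) auto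
   then show "norm (m \<xi>' - m \<xi> - 0) <= C' * (norm (\<xi>' - \<xi>))^2"
    using m_le[OF n', of \<xi>] m_le[of \<xi> \<xi>'] \<xi> by (simp add: norm_minus_commute abs_le_iff)
  qed (use \<xi> in auto)
  then show "(m has_derivative (%h. 0)) (at \<xi> within ball 0 \<delta>)" by (rule has_derivative_at_withinI)
 qed (use that \<delta>(1) in auto)
 moreover have "m 0 <= u ?z"
  using \<Phi>0[OF W(1)[of 0]] unfolding m_def by (smt (verit) norm_ge_zero zero_le_power zero_le_power2)
 ultimately have m: "m \<xi> <= u ?z" if "norm \<xi> < \<delta>" for \<xi> using that by simp
 have "\<forall>\<^sub>F w in nhds ?z. u w <= u ?z + a * (snd w - th) + C' * (snd w - th)^2"
  unfolding eventually_nhds_metric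
 proof (intro exI[of _ "min \<delta> s"] conjI allI impI)
  fix w assume d: "dist w ?z < min \<delta> s"
  obtain x t where w: "w = (x, t)" by fastforce
  have x: "norm (x - xh) < \<delta>" "norm (x - xh) < s" "\<bar>t - th\<bar> < s"
   using d dist_fst_le[of w ?z] dist_snd_le[of w ?z] w by (auto simp: dist_norm)
  then have "w \<in> Bx" by (auto simp: Bx_def w dist_norm norm_minus_commute)
  then have "\<Phi> (x - xh) w <= u ?z" using W(2) m[OF x(1)] unfolding m_def by (meson order.trans)
  then show "u w <= u ?z + a * (snd w - th) + C' * (snd w - th)^2" by (simp add: \<Phi>_def w)
 qed (use \<delta>(1) s in simp)
 from local_sub_time[OF ls th this] show False using a by simp
qed

text \<open>A second order expansion lies below a paraboloid after an arbitrarily small increase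
  \<open>\<kappa>\<close> of the spatial part. The mixed space-time terms are absorbed in that
  increase and in the free time coefficient.\<close>

lemma local_sub_C2:
 fixes u \<phi> :: "(real^'n) * real => real"
 assumes ls: "local_sub c u" and c: "c >= 0" and t: "t > 0" and p: "p ~= 0"
  and L: "!!y \<tau>. L (y, \<tau>) = p \<bullet> y + a * \<tau>"
  and H: "!!v. linear (H v)" "!!w. linear (%v. H v w)" and se: "second_expansion \<phi> (x, t) L H"
  and max: "\<forall>\<^sub>F w in nhds (x, t). u w - \<phi> w <= u (x, t) - \<phi> (x, t)"
 shows "a <= c * ((\<Sum>i\<in>UNIV. H (axis i 1, 0) (axis i 1, 0)) - H (sgn p, 0) (sgn p, 0))"
proof (rule field_le_epsilon)
 fix \<epsilon> :: real assume \<epsilon>: "\<epsilon> > 0"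
 let ?d = "real CARD('n)"
 define G where "G y z = H (y, 0) (z, 0)" for y z :: "real^'n"
 have embed: "linear (%y::real^'n. (y, 0::real))" by (intro linearI) auto
 have Gl: "linear (G y)" "linear (%y. G y z)" for y z
 proof -
  show "linear (G y)" using linear_compose[OF embed H(1)[of "(y, 0)"]] by (simp add: G_def[abs_def] o_def)
  show "linear (%y. G y z)" using linear_compose[OF embed H(2)[of "(z, 0)"]] by (simp add: G_def o_def)
 qed
 define \<kappa> where "\<kappa> = \<epsilon> / (4 * (c * ?d + 1))"
 have cd: "c * ?d + 1 > 0" using c by (simp add: add_nonneg_pos)
 have \<kappa>: "\<kappa> > 0" using \<epsilon> cd by (simp add: \<kappa>_def)
 \<comment> \<open>The quadratic form of \<open>G\<close> sees only its symmetric part, and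
   \<open>local_sub\<close> is stated for symmetric matrices.\<close>
 define X :: "real^'n^'n" where "X = (\<chi> i j. (G (axis i 1) (axis j 1) + G (axis j 1) (axis i 1)) / 2)"
 define X' where "X' = X + (4 * \<kappa>) *\<^sub>R mat 1"
 have Gexp: "G y z = (\<Sum>i\<in>UNIV. \<Sum>j\<in>UNIV. y $ i * z $ j * G (axis i 1) (axis j 1))" for y z
 proof -
  have "G y z = (\<Sum>i\<in>UNIV. G (axis i 1) z * y $ i)"
   using cart_linear_expansion[OF Gl(2), of y z] by (simp add: inner_vec_def)
  also have "... = (\<Sum>i\<in>UNIV. (\<Sum>j\<in>UNIV. G (axis i 1) (axis j 1) * z $ j) * y $ i)"
   using cart_linear_expansion[OF Gl(1), of _ z] by (simp add: inner_vec_def)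
  finally show ?thesis by (simp add: sum_distrib_right sum_distrib_left mult_ac)
 qed
 have yXy: "y \<bullet> (X *v y) = G y y" for y
 proof -
  have "y \<bullet> (X *v y) = (\<Sum>i\<in>UNIV. \<Sum>j\<in>UNIV. y $ i * y $ j * G (axis i 1) (axis j 1) / 2)
    + (\<Sum>i\<in>UNIV. \<Sum>j\<in>UNIV. y $ i * y $ j * G (axis j 1) (axis i 1) / 2)"
   by (simp add: inner_vec_def matrix_vector_mult_def X_def sum_distrib_left sum.distrib[symmetric] field_simps)
  also have "(\<Sum>i\<in>UNIV. \<Sum>j\<in>UNIV. y $ i * y $ j * G (axis j 1) (axis i 1) / 2) =
    (\<Sum>i\<in>UNIV. \<Sum>j\<in>UNIV. y $ i * y $ j * G (axis i 1) (axis j 1) / 2)"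
   by (subst sum.swap) (simp add: mult_ac)
  finally show ?thesis unfolding Gexp[of y y] by (simp add: sum_divide_distrib[symmetric])
 qed
 have X'v: "X' *v y = X *v y + (4 * \<kappa>) *\<^sub>R y" for y
  by (simp add: X'_def matrix_vector_mult_add_rdistrib scaleR_matrix_vector_assoc[symmetric])
 have sym: "transpose X' = X'" by (simp add: X'_def X_def transpose_def mat_def vec_eq_iff add.commute)
 have pp: "p \<bullet> p > 0" using p by simp
 define N where "N y = H (y, 0) (0, 1) + H (0, 1) (y, 0)" for y :: "real^'n"
 have "linear N"
  using linear_compose_add[OF linear_compose[OF embed H(2)[of "(0, 1)"]] linear_compose[OF embed H(1)[of "(0, 1)"]]]
  by (simp add: N_def[abs_def] o_def)
 then obtain B where B: "B > 0" "!!y. \<bar>N y\<bar> <= B * norm y"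
  using linear_bounded_pos by (metis real_norm_def)
 define h where "h = H (0, 1) (0, 1)"
 have Hexp: "H (y, \<tau>) (y, \<tau>) = G y y + \<tau> * N y + \<tau>^2 * h" for y \<tau>
 proof -
  have "(y, \<tau>) = (y, 0) + \<tau> *\<^sub>R (0, 1)" by simp
  then have "H (y, \<tau>) (y, \<tau>) = H ((y, 0) + \<tau> *\<^sub>R (0, 1)) ((y, 0) + \<tau> *\<^sub>R (0, 1))" by metis
  also have "... = H (y, 0) (y, 0) + \<tau> * H (y, 0) (0, 1) + (\<tau> * H (0, 1) (y, 0) + \<tau> * (\<tau> * H (0, 1) (0, 1)))"
   unfolding linear_add[OF H(1)] linear_scale[OF H(1)] linear_add[OF H(2)] linear_scale[OF H(2)]
   by (simp add: algebra_simps)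
  finally show ?thesis by (simp add: G_def N_def h_def power2_eq_square algebra_simps)
 qed
 \<comment> \<open>\<open>B^2 / \<kappa>\<close> is the time share of the mixed term
   \<open>\<tau> * N y\<close>, whose other share is \<open>\<kappa>\<close> in space; the remaining
   summands come from the expansion error and from \<open>h\<close>.\<close>
 define C where "C = \<kappa> + \<bar>h\<bar> / 2 + B^2 / \<kappa>"
 have "\<forall>\<^sub>F w in nhds (x, t). \<bar>\<phi> w - \<phi> (x, t) - L (w - (x, t)) - H (w - (x, t)) (w - (x, t)) / 2\<bar> <= \<kappa> * (norm (w - (x, t)))^2"
  using se \<kappa> unfolding second_expansion_def by blast
 with max have "\<forall>\<^sub>F w in nhds (x, t). u w <= u (x, t) + a * (snd w - t) + p \<bullet> (fst w - x)
     + (fst w - x) \<bullet> (X' *v (fst w - x)) / 2 + C * (snd w - t)^2"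
 proof eventually_elim
  case (elim w)
  define y \<tau> where "y = fst w - x" and "\<tau> = snd w - t"
  have wz: "w - (x, t) = (y, \<tau>)" by (simp add: y_def \<tau>_def prod_eq_iff)
  have n2: "(norm (y, \<tau>))^2 = y \<bullet> y + \<tau>^2" by (simp add: norm_Pair power2_norm_eq_inner)
  have "u w <= u (x, t) + (p \<bullet> y + a * \<tau>) + (G y y + \<tau> * N y + \<tau>^2 * h) / 2 + \<kappa> * (y \<bullet> y + \<tau>^2)"
   using elim unfolding wz L Hexp n2 by (simp add: abs_le_iff)
  moreover have "\<tau> * N y <= \<kappa> * (y \<bullet> y) + B^2 / \<kappa> * \<tau>^2"
  proof -
   have "\<tau> * N y <= \<bar>\<tau>\<bar> * (B * norm y)"
    using mult_left_mono[OF B(2)[of y], of "\<bar>\<tau>\<bar>"] abs_ge_self[of "\<tau> * N y"] by (simp add: abs_mult)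
   also have "... <= \<kappa> * (norm y)^2 + B^2 / \<kappa> * \<tau>^2"
   proof -
    have "0 <= (\<kappa> * norm y - B * \<bar>\<tau>\<bar>)^2" by simp
    then have "2 * (\<kappa> * norm y * (B * \<bar>\<tau>\<bar>)) <= \<kappa>^2 * (norm y)^2 + B^2 * \<tau>^2"
     by (simp add: power2_diff power_mult_distrib)
    moreover have "\<kappa> * norm y * (B * \<bar>\<tau>\<bar>) >= 0" using \<kappa> B(1) by simp
    ultimately have "\<kappa> * norm y * (B * \<bar>\<tau>\<bar>) <= \<kappa>^2 * (norm y)^2 + B^2 * \<tau>^2" by linarith
    then show ?thesis using \<kappa> by (simp add: field_simps power2_eq_square)
   qed
   finally show ?thesis by (simp add: power2_norm_eq_inner)
  qed
  moreover have "h * \<tau>^2 <= \<bar>h\<bar> * \<tau>^2" by (intro mult_right_mono) auto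
  moreover have "y \<bullet> (X' *v y) = G y y + 4 * \<kappa> * (y \<bullet> y)" by (simp add: X'v inner_add_right yXy)
  moreover have "C * \<tau>^2 = \<kappa> * \<tau>^2 + \<bar>h\<bar> * \<tau>^2 / 2 + B^2 / \<kappa> * \<tau>^2"
   by (simp add: C_def algebra_simps)
  moreover have "B^2 / \<kappa> * \<tau>^2 >= 0" "\<kappa> * (y \<bullet> y) >= 0" using \<kappa> by auto
  ultimately show ?case unfolding y_def[symmetric] \<tau>_def[symmetric] by (simp add: field_simps)
 qed
 from local_sub_quadratic[OF ls t p sym this]
 have "a <= c * (trace X' - p \<bullet> (X' *v p) / (p \<bullet> p))" .
 also have "trace X' = (\<Sum>i\<in>UNIV. G (axis i 1) (axis i 1)) + 4 * \<kappa> * ?d"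
  by (simp add: trace_def X'_def X_def mat_def sum.distrib)
 also have "p \<bullet> (X' *v p) / (p \<bullet> p) = G (sgn p) (sgn p) + 4 * \<kappa>"
 proof -
  have "G (sgn p) (sgn p) = G p p / (p \<bullet> p)"
   unfolding sgn_div_norm linear_scale[OF Gl(1)] linear_scale[OF Gl(2)]
   by (simp add: power2_norm_eq_inner[symmetric] power2_eq_square divide_inverse)
  then show ?thesis using pp by (simp add: X'v inner_add_right yXy add_divide_distrib)
 qed
 finally have "a <= c * ((\<Sum>i\<in>UNIV. G (axis i 1) (axis i 1)) - G (sgn p) (sgn p)) + c * (4 * \<kappa> * (?d - 1))"
  by (simp add: algebra_simps)
 also have "c * (4 * \<kappa> * (?d - 1)) <= 4 * (c * ?d + 1) * \<kappa>" using c \<kappa> by (simp add: algebra_simps)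
 also have "4 * (c * ?d + 1) * \<kappa> = \<epsilon>" using cd unfolding \<kappa>_def by (simp add: field_simps)
 finally show "a <= c * ((\<Sum>i\<in>UNIV. H (axis i 1, 0) (axis i 1, 0)) - H (sgn p, 0) (sgn p, 0)) + \<epsilon>"
  by (simp add: G_def)
qed

section \<open>From local subsolutions to viscosity solutions\<close>

lemma smooth_half_line_derivative:
 fixes g :: "real => real"
 assumes "smooth_on {0..} g"
 shows "!!x. x >= 0 ==> (g has_vector_derivative half_line_deriv g x) (at x within {0..})"
  and "smooth_on {0..} (half_line_deriv g)"
proof -
 have d: "g differentiable (at x within {0..})" if "x >= 0" for x
  using smooth_onD[OF assms, of 1] that by (simp add: Ck_on_Suc)
 then show "!!x. x >= 0 ==> (g has_vector_derivative half_line_deriv g x) (at x within {0..})"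
  by (rule half_line_derivative(1))
 have "smooth_on {0..} (%x. frechet_derivative g (at x within {0..}) 1)"
  using smooth_onD[OF assms, of "Suc _"] unfolding Ck_on_Suc by (intro smooth_onI) blast
 then show "smooth_on {0..} (half_line_deriv g)"
  by (rule smooth_on_cong) (simp add: half_line_derivative(2)[OF d])
qed

text \<open>One application of the mean value inequality on \<open>{0..r}\<close>; each vanishing
  derivative at 0 thus gains one power of \<open>r\<close>.\<close>

lemma half_line_order:
 fixes g :: "real => real"
 assumes g: "smooth_on {0..} g" "g 0 = 0" and b: "!!r. 0 <= r ==> r <= 1 ==> \<bar>half_line_deriv g r\<bar> <= C * r ^ k"
  and r: "0 <= r" "r <= 1"
 shows "\<bar>g r\<bar> <= C * r ^ Suc k"
proof -
 have C: "C >= 0" using b[of 1] by simp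
 have "norm (g r - g 0) <= C * r ^ k * norm (r - 0)"
 proof (rule differentiable_bound[of "{0..r}" g "%x h. h * half_line_deriv g x"])
  fix x assume x: "x \<in> {0..r}"
  have "(g has_vector_derivative half_line_deriv g x) (at x within {0..r})"
   using smooth_half_line_derivative(1)[OF g(1), of x] x by (auto intro: has_vector_derivative_within_subset)
  then show "(g has_derivative (%h. h * half_line_deriv g x)) (at x within {0..r})"
   by (simp add: has_vector_derivative_def)
  have "x ^ k <= r ^ k" using x by (intro power_mono) auto
  then have "\<bar>half_line_deriv g x\<bar> <= C * r ^ k"
   using b[of x] mult_left_mono[OF _ C, of "x ^ k" "r ^ k"] x r by auto
  then have "norm (h * half_line_deriv g x) <= C * r ^ k * norm h" for h
   using mult_right_mono[of "\<bar>half_line_deriv g x\<bar>" "C * r ^ k" "\<bar>h\<bar>"] by (simp add: abs_mult mult.commute)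
  then show "onorm (%h. h * half_line_deriv g x) <= C * r ^ k" by (rule onorm_le)
 qed (use r in auto)
 then show ?thesis using r g(2) by (simp add: mult_ac)
qed

lemma smooth_half_line_bounded:
 fixes g :: "real => real"
 assumes "smooth_on {0..} g"
 obtains C where "!!r. 0 <= r ==> r <= 1 ==> \<bar>g r\<bar> <= C * r ^ 0"
proof -
 have "continuous_on {0..} g" using smooth_onD[OF assms, of 0] by (simp add: Ck_on_0)
 then have "continuous_on {0..1} g" by (rule continuous_on_subset) auto
 then have "compact (g ` {0..1})" by (rule compact_continuous_image) simp
 then obtain C where "!!y. y \<in> g ` {0..1} ==> norm y <= C" using compact_imp_bounded bounded_iff by metis
 then show ?thesis using that[of C] by auto
qed

lemma half_line_quadratic:
 fixes g :: "real => real"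
 assumes g: "smooth_on {0..} g" "g 0 = 0" "half_line_deriv g 0 = 0"
 obtains C where "!!r. 0 <= r ==> r <= 1 ==> \<bar>g r\<bar> <= C * r^2"
proof -
 note s1 = smooth_half_line_derivative(2)[OF g(1)]
 obtain C where "!!r. 0 <= r ==> r <= 1 ==> \<bar>half_line_deriv (half_line_deriv g) r\<bar> <= C * r ^ 0"
  using smooth_half_line_bounded[OF smooth_half_line_derivative(2)[OF s1]] by metis
 from half_line_order[OF g(1,2) half_line_order[OF s1 g(3) this]] show ?thesis
  using that[of C] by (simp add: numeral_2_eq_2)
qed

text \<open>The three vanishing derivatives of a profile make it of cubic order, whatever
  \<open>\<gamma>\<close> is; this reduces admissible tests at critical points to
  \<open>local_sub_cubic\<close>.\<close>

lemma half_line_cubic: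
 fixes g :: "real => real"
 assumes g: "smooth_on {0..} g" "g 0 = 0" "half_line_deriv g 0 = 0" "half_line_deriv (half_line_deriv g) 0 = 0"
 obtains C where "!!r. 0 <= r ==> r <= 1 ==> \<bar>g r\<bar> <= C * r ^ 3"
proof -
 obtain C where "!!r. 0 <= r ==> r <= 1 ==> \<bar>half_line_deriv g r\<bar> <= C * r^2"
  using half_line_quadratic[OF smooth_half_line_derivative(2)[OF g(1)] g(3,4)] by metis
 from half_line_order[OF g(1,2) this] show ?thesis
  using that[of C] by (simp add: numeral_3_eq_3 numeral_2_eq_2)
qed

section \<open>Slices of a smooth test function in space and in time\<close>

context
 fixes \<phi> :: "(real^'n) * real => real" and a b :: real
 assumes sm: "smooth_on (UNIV \<times> {a<..<b}) \<phi>"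
begin

private lemma strip_open: "open (UNIV \<times> {a<..<b} :: ((real^'n) * real) set)"
 by (intro open_Times) auto

lemma strip_has_derivative:
 assumes "t \<in> {a<..<b}"
 shows "(\<phi> has_derivative dir_deriv \<phi> (x, t)) (at (x, t))"
 using C2_has_derivative[OF strip_open smooth_onD[OF sm]] assms by auto

lemma slice_smooth:
 assumes "t \<in> {a<..<b}"
 shows "smooth_on UNIV (%y. \<phi> (y, t))"
proof -
 have "bounded_linear (%y::real^'n. (y, 0::real))" by (intro bounded_linear_Pair bounded_linear_ident bounded_linear_zero)
 from smooth_on_compose_affine[OF strip_open open_UNIV this _ sm, of "(0, t)"] assms show ?thesis by simp
qed

lemma slice_dir_deriv:
 assumes "t \<in> {a<..<b}"
 shows "dir_deriv (%y. \<phi> (y, t)) x v = dir_deriv \<phi> (x, t) (v, 0)"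
proof -
 have "((%y. (y, t)) has_derivative (%v. (v, 0))) (at x)" by (auto intro!: derivative_eq_intros)
 from has_derivative_compose[OF this strip_has_derivative[OF assms]]
 have "((%y. \<phi> (y, t)) has_derivative (%v. dir_deriv \<phi> (x, t) (v, 0))) (at x)" .
 from dir_deriv_eqI[OF this] show ?thesis by simp
qed

lemma slice_dir_deriv2:
 assumes "t \<in> {a<..<b}"
 shows "dir_deriv2 (%y. \<phi> (y, t)) x v w = dir_deriv2 \<phi> (x, t) (v, 0) (w, 0)"
proof -
 have "((%z. dir_deriv \<phi> z (v, 0)) has_derivative dir_deriv2 \<phi> (x, t) (v, 0)) (at (x, t))"
  using C2_has_derivative2[OF strip_open smooth_onD[OF sm]] assms by auto
 moreover have "((%y. (y, t)) has_derivative (%v. (v, 0))) (at x)" by (auto intro!: derivative_eq_intros)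
 ultimately have "((%y. dir_deriv \<phi> (y, t) (v, 0)) has_derivative (%w. dir_deriv2 \<phi> (x, t) (v, 0) (w, 0))) (at x)"
  using has_derivative_compose by blast
 from dir_deriv_eqI[OF this] show ?thesis unfolding dir_deriv2_def slice_dir_deriv[OF assms] by simp
qed

lemma strip_space_grad:
 assumes "t \<in> {a<..<b}"
 shows "space_grad \<phi> (x, t) = grad (%y. \<phi> (y, t)) x"
  "space_grad \<phi> (x, t) \<bullet> v = dir_deriv \<phi> (x, t) (v, 0)"
 using dir_deriv_eq_grad[OF open_UNIV smooth_onD[OF slice_smooth[OF assms]]]
 by (simp_all add: space_grad_def slice_dir_deriv[OF assms, symmetric])

lemma strip_time_deriv:
 assumes "t \<in> {a<..<b}"
 shows "((%s. \<phi> (x, s)) has_real_derivative dir_deriv \<phi> (x, t) (0, 1)) (at t)"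
  "time_deriv \<phi> (x, t) = dir_deriv \<phi> (x, t) (0, 1)"
proof -
 have "((%s. (x, s)) has_derivative (%h. (0, h))) (at t)" by (auto intro!: derivative_eq_intros)
 from has_derivative_compose[OF this strip_has_derivative[OF assms]]
 have A: "((%s. \<phi> (x, s)) has_derivative (%h. dir_deriv \<phi> (x, t) (0, h))) (at t)" .
 have **: "dir_deriv \<phi> (x, t) (0, h) = dir_deriv \<phi> (x, t) (0, 1) * h" for h
  using linear_scale[OF has_derivative_linear[OF strip_has_derivative[OF assms]], of x h "(0, 1)"] by simp
 have "(%h. dir_deriv \<phi> (x, t) (0, h)) = (*) (dir_deriv \<phi> (x, t) (0, 1))" using ** by (rule ext)
 from A this show *: "((%s. \<phi> (x, s)) has_real_derivative dir_deriv \<phi> (x, t) (0, 1)) (at t)"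
  unfolding has_field_derivative_def by (rule back_subst[of "%D. ((%s. \<phi> (x, s)) has_derivative D) (at t)"])
 from time_derivI[OF this] show "time_deriv \<phi> (x, t) = dir_deriv \<phi> (x, t) (0, 1)" .
qed

lemma strip_total_derivative:
 assumes "t \<in> {a<..<b}"
 shows "dir_deriv \<phi> (x, t) (y, \<tau>) = space_grad \<phi> (x, t) \<bullet> y + time_deriv \<phi> (x, t) * \<tau>"
proof -
 have l: "linear (dir_deriv \<phi> (x, t))" using has_derivative_linear[OF strip_has_derivative[OF assms]] .
 have "dir_deriv \<phi> (x, t) (y, \<tau>) = dir_deriv \<phi> (x, t) ((y, 0) + \<tau> *\<^sub>R (0, 1))" by simp
 also have "... = dir_deriv \<phi> (x, t) (y, 0) + \<tau> * dir_deriv \<phi> (x, t) (0, 1)"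
  unfolding linear_add[OF l] linear_scale[OF l] by simp
 finally show ?thesis by (simp add: strip_space_grad(2)[OF assms] strip_time_deriv(2)[OF assms])
qed

text \<open>The constant value outside a compact set cannot be the level in question, as the
  gradient vanishes there; so the level set is compact.\<close>

lemma noncritical_regular:
 assumes t: "t \<in> {a<..<b}" and nc: "noncritical_level \<phi> (x, t)" and co: "const_outside_compact {a..b} \<phi>"
  and a: "0 <= a"
 shows "regular_level (%y. \<phi> (y, t)) (\<phi> (x, t))"
proof -
 let ?q = "%y. \<phi> (y, t)"
 have nc': "grad ?q y ~= 0" if "?q y = \<phi> (x, t)" for y
  using nc that t by (auto simp: noncritical_level_def strip_space_grad(1))
 have cont: "continuous_on UNIV ?q" by (rule smooth_on_imp_continuous_on[OF slice_smooth[OF t]])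
 \<comment> \<open>The compact set belonging to time \<open>b\<close> serves all earlier times of
   the interval, and \<open>t < b\<close>.\<close>
 have "b \<in> {a..b}" using t by simp
 then obtain K where K: "compact K" "\<forall>t'\<in>{a..b} Int {0..<b}. \<exists>c. \<forall>x. x ~: K --> \<phi> (x, t') = c"
  using co unfolding const_outside_compact_def by blast
 moreover have "t \<in> {a..b} Int {0..<b}" using t a by auto
 ultimately obtain c where c: "!!y. y ~: K ==> ?q y = c" by meson
 have "c ~= \<phi> (x, t)"
 proof
  assume eq: "c = \<phi> (x, t)"
  obtain y where y: "y ~: K" using compact_imp_bounded[OF K(1)] not_bounded_UNIV by (metis UNIV_I bounded_subset subsetI)
  have "(?q has_derivative (%v. v \<bullet> 0)) (at y)"
  proof (rule has_derivative_transform_within_open[of "%_. c" _ _ UNIV "- K"])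
   show "open (- K)" using K(1) by (simp add: compact_imp_closed open_Compl)
  qed (use y c in auto)
  from grad_eqI[OF this] show False using nc'[of y] c[OF y] eq by simp
 qed
 then have sub: "{y. ?q y = \<phi> (x, t)} <= K" using c by auto
 have "closed {y. ?q y = \<phi> (x, t)}" by (intro closed_Collect_eq cont continuous_on_const)
 then have "compact {y. ?q y = \<phi> (x, t)}" using sub K(1) by (metis compact_Int_closed inf.absorb_iff2)
 then show ?thesis using nc' slice_smooth[OF t] by (simp add: regular_level_def)
qed

end

text \<open>Tests with vanishing gradient are of cubic order in space and quadratic in time and fall
  under \<open>local_sub_cubic\<close>. Noncritical ones fall under \<open>local_sub_C2\<close>, and
  \<open>level_op\<close> of the slice expresses the mean curvature of its superlevel set.\<close>

lemma local_sub_imp_subsolution: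
 fixes u :: "(real^'n) * real => real"
 assumes ls: "local_sub c u" and usc: "usc_on space_time u" and co: "const_outside_compact {0..} u"
  and init: "!!x. u (x, 0) <= u0 x" and c: "c >= 0" and \<beta>: "0 <= \<beta>" "\<beta> <= 1"
 shows "subsolution \<gamma> (on_regular l \<beta> (%x E. c * mean_curvature x E)) u0 u"
 unfolding subsolution_def
proof (intro conjI usc co allI impI; (elim conjE)?)
 show "u (x, 0) <= u0 x" for x by (rule init)
 fix a b z \<phi>
 assume ad: "admissible_at \<gamma> a b z \<phi>" and sm: "smooth_on (UNIV \<times> {a<..<b}) \<phi>"
  and mx: "\<forall>w\<in>UNIV \<times> {a..b}. u w - \<phi> w <= u z - \<phi> z"
 obtain x t where z: "z = (x, t)" by fastforce
 have t: "t \<in> {a<..<b}" "t > 0" "0 <= a" using ad by (auto simp: admissible_at_def z)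
 have op: "open (UNIV \<times> {a<..<b} :: ((real^'n) * real) set)" by (intro open_Times) auto
 have "\<forall>\<^sub>F w in nhds (x, t). w \<in> UNIV \<times> {a<..<b}"
  by (rule eventually_nhds_in_open[OF op]) (use t in auto)
 then have near: "\<forall>\<^sub>F w in nhds (x, t). snd w \<in> {a<..<b} & u w - \<phi> w <= u (x, t) - \<phi> (x, t)"
  by eventually_elim (use mx z in auto)
 {
  assume "space_grad \<phi> z = 0"
  then obtain g \<omega> where g: "g \<in> test_profiles \<gamma>"
   and \<omega>: "smooth_on {0..} \<omega>" "\<omega> 0 = 0" "half_line_deriv \<omega> 0 = 0"
   and b: "!!y s. s \<in> {a<..<b} ==>
    \<bar>\<phi> (y, s) - \<phi> z - time_deriv \<phi> z * (s - snd z)\<bar> <= g (norm (y - fst z)) + \<omega> \<bar>s - snd z\<bar>"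
   using ad unfolding admissible_at_def by blast
  obtain C1 where C1: "!!r. 0 <= r ==> r <= 1 ==> \<bar>g r\<bar> <= C1 * r ^ 3"
   using half_line_cubic[of g] g by (auto simp: test_profiles_def)
  obtain C2 where C2: "!!r. 0 <= r ==> r <= 1 ==> \<bar>\<omega> r\<bar> <= C2 * r^2"
   using half_line_quadratic[OF \<omega>] by metis
  define C where "C = max C1 C2"
  have "\<forall>\<^sub>F w in nhds (x, t). dist w (x, t) < 1" by (auto simp: eventually_nhds_metric intro: exI[of _ 1])
  with near have "\<forall>\<^sub>F w in nhds (x, t). u w <= u (x, t) + time_deriv \<phi> z * (snd w - t)
    + C * norm (fst w - x) ^ 3 + C * (snd w - t)^2"
  proof eventually_elim
   case (elim w)
   obtain y s where w: "w = (y, s)" by fastforce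
   have n: "norm (y - x) <= 1" "\<bar>s - t\<bar> <= 1"
    using elim(2) dist_fst_le[of w "(x, t)"] dist_snd_le[of w "(x, t)"] w by (auto simp: dist_norm)
   have "g (norm (y - x)) <= C1 * norm (y - x) ^ 3" using C1[of "norm (y - x)"] n by simp
   also have "... <= C * norm (y - x) ^ 3" by (intro mult_right_mono) (auto simp: C_def)
   finally have 1: "g (norm (y - x)) <= C * norm (y - x) ^ 3" .
   have "\<omega> \<bar>s - t\<bar> <= C2 * (s - t)^2" using C2[of "\<bar>s - t\<bar>"] n by simp
   also have "... <= C * (s - t)^2" by (intro mult_right_mono) (auto simp: C_def)
   finally have 2: "\<omega> \<bar>s - t\<bar> <= C * (s - t)^2" .
   show ?case using b[of s y] 1 2 elim(1) by (auto simp: w z)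
  qed
  from local_sub_cubic[OF ls usc c t(2) this] show "time_deriv \<phi> z <= 0" .
 next
  assume nc: "noncritical_level \<phi> z"
  let ?q = "%y. \<phi> (y, t)" and ?p = "space_grad \<phi> z"
  have p: "?p ~= 0" using nc z by (auto simp: noncritical_level_def)
  have reg: "regular_level ?q (\<phi> (x, t))"
   using noncritical_regular[OF sm t(1) _ _ t(3)] nc ad z by (auto simp: admissible_at_def)
  note S = op smooth_onD[OF sm]
  have zS: "(x, t) \<in> UNIV \<times> {a<..<b}" using t by simp
  have pg: "?p = grad ?q x" using strip_space_grad(1)[OF sm t(1)] z by simp
  have L: "dir_deriv \<phi> (x, t) (y, \<tau>) = ?p \<bullet> y + time_deriv \<phi> z * \<tau>" for y \<tau>
   using strip_total_derivative[OF sm t(1)] z by simp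
  have ev: "\<forall>\<^sub>F w in nhds (x, t). u w - \<phi> w <= u (x, t) - \<phi> (x, t)"
   using near by eventually_elim simp
  have "time_deriv \<phi> z <= c * ((\<Sum>i\<in>UNIV. dir_deriv2 \<phi> (x, t) (axis i 1, 0) (axis i 1, 0))
    - dir_deriv2 \<phi> (x, t) (sgn ?p, 0) (sgn ?p, 0))"
   by (rule local_sub_C2[OF ls c t(2) p L C2_linear2[OF S zS] C2_linear1[OF S zS] C2_second_expansion[OF S zS] ev])
  also have "... = c * level_op ?q x" by (simp add: level_op_def slice_dir_deriv2[OF sm t(1)] pg)
  finally have le: "time_deriv \<phi> z <= c * level_op ?q x" .
  have "on_regular l \<beta> (%x E. c * mean_curvature x E) x (superlevel \<phi> z) = c * (- level_op ?q x / norm ?p)"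
   using sublevel_frontier(1)[OF reg refl \<beta>] regular_level_geometry(3)[OF reg refl]
   by (simp add: superlevel_def z pg[unfolded z])
  then show "time_deriv \<phi> z + norm ?p * on_regular l \<beta> (%x E. c * mean_curvature x E) (fst z) (superlevel \<phi> z) <= 0"
   using le p by (simp add: z)
 }
qed

section \<open>Duality\<close>

lemma const_outside_compact_uminus:
 "const_outside_compact A h ==> const_outside_compact A (%z. - h z)"
 unfolding const_outside_compact_def by metis

lemma test_uminus:
 fixes \<phi> :: "(real^'n) * real => real"
 assumes ad: "admissible_at \<gamma> a b z \<phi>" and sm: "smooth_on (UNIV \<times> {a<..<b}) \<phi>"
  and anti: "\<forall>q a x. regular_level q a & q x = a --> H x {y. q y <= a} = - H x {y. q y >= a}"
 shows "admissible_at \<gamma> a b z (%w. - \<phi> w)" "smooth_on (UNIV \<times> {a<..<b}) (%w. - \<phi> w)"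
  "time_deriv (%w. - \<phi> w) z = - time_deriv \<phi> z" "space_grad (%w. - \<phi> w) z = - space_grad \<phi> z"
  "noncritical_level (%w. - \<phi> w) z \<longleftrightarrow> noncritical_level \<phi> z"
  "noncritical_level \<phi> z ==> H (fst z) (superlevel (%w. - \<phi> w) z) = - H (fst z) (superlevel \<phi> z)"
proof -
 obtain x t where z: "z = (x, t)" by fastforce
 have t: "t \<in> {a<..<b}" "0 <= a" using ad by (auto simp: admissible_at_def z)
 have op: "open (UNIV \<times> {a<..<b} :: ((real^'n) * real) set)" by (intro open_Times) auto
 show sm': "smooth_on (UNIV \<times> {a<..<b}) (%w. - \<phi> w)" using op sm by (rule smooth_on_uminus)
 show td: "time_deriv (%w. - \<phi> w) z = - time_deriv \<phi> z" unfolding z strip_time_deriv(2)[OF sm t(1)]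
  by (rule time_derivI) (intro DERIV_minus strip_time_deriv(1)[OF sm t(1)])
 have sg': "space_grad (%w. - \<phi> w) (y, t) = - space_grad \<phi> (y, t)" for y
  unfolding strip_space_grad(1)[OF sm t(1)] strip_space_grad(1)[OF sm' t(1)]
  by (rule grad_uminus[OF slice_smooth[OF sm t(1)]])
 then show sg: "space_grad (%w. - \<phi> w) z = - space_grad \<phi> z" by (simp add: z)
 show "noncritical_level (%w. - \<phi> w) z \<longleftrightarrow> noncritical_level \<phi> z"
  by (simp add: noncritical_level_def z sg')
 have zN: "\<exists>N. open N & z \<in> N & N <= UNIV \<times> {a<..<b} & Ck_on 2 N (%w. - \<phi> w)"
  using op smooth_onD[OF sm', of 2] t by (intro exI[of _ "UNIV \<times> {a<..<b}"]) (auto simp: z)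
 have abs: "\<bar>- \<phi> w - - \<phi> z - - time_deriv \<phi> z * s\<bar> = \<bar>\<phi> w - \<phi> z - time_deriv \<phi> z * s\<bar>" for w s by linarith
 show "admissible_at \<gamma> a b z (%w. - \<phi> w)" using ad zN unfolding admissible_at_def td sg abs
  by (auto intro: continuous_on_minus const_outside_compact_uminus)
 show "H (fst z) (superlevel (%w. - \<phi> w) z) = - H (fst z) (superlevel \<phi> z)" if nc: "noncritical_level \<phi> z"
 proof -
  have "regular_level (%y. \<phi> (y, t)) (\<phi> (x, t))"
   using noncritical_regular[OF sm t(1) _ _ t(2)] nc ad z by (auto simp: admissible_at_def)
  then have "H x {y. \<phi> (y, t) <= \<phi> (x, t)} = - H x {y. \<phi> (y, t) >= \<phi> (x, t)}" using anti by fastforce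
  then show ?thesis by (simp add: superlevel_def z)
 qed
qed

lemma usc_on_uminus: "usc_on S (%z. - u z) \<longleftrightarrow> lsc_on S u"
 unfolding usc_on_def lsc_on_def
proof (intro ball_cong refl iffI allI impI)
 fix z c assume "\<forall>c>- u z. \<forall>\<^sub>F w in at z within S. - u w < c" "c < u z"
 then have "\<forall>\<^sub>F w in at z within S. - u w < - c" by (metis neg_less_iff_less)
 then show "\<forall>\<^sub>F w in at z within S. c < u w" by simp
next
 fix z c assume "\<forall>c<u z. \<forall>\<^sub>F w in at z within S. c < u w" "- u z < c"
 then have "\<forall>\<^sub>F w in at z within S. - c < u w" by (metis neg_less_iff_less minus_minus)
 then show "\<forall>\<^sub>F w in at z within S. - u w < c" by eventually_elim simp
qed

text \<open>The superlevel set of \<open>- \<phi>\<close> is the sublevel set of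
  \<open>\<phi>\<close>, so negating the test functions requires the oddness of \<open>H\<close>.
  All facts about supersolutions are drawn from subsolutions through this equivalence.\<close>

lemma supersolution_iff_subsolution_uminus:
 fixes u :: "(real^'n) * real => real"
 assumes anti: "\<forall>q a x. regular_level q a & q x = a --> H x {y. q y <= a} = - H x {y. q y >= a}"
 shows "supersolution \<gamma> H u0 u \<longleftrightarrow> subsolution \<gamma> H (%x. - u0 x) (%z. - u z)"
proof -
 let ?T = "%a b z \<phi>. admissible_at \<gamma> a b z \<phi> & smooth_on (UNIV \<times> {a<..<b}) \<phi>"
 let ?sub = "%z \<phi>. (space_grad \<phi> z = 0 --> time_deriv \<phi> z <= 0) & (noncritical_level \<phi> z -->
   time_deriv \<phi> z + norm (space_grad \<phi> z) * H (fst z) (superlevel \<phi> z) <= 0)"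
 let ?super = "%z \<phi>. (space_grad \<phi> z = 0 --> time_deriv \<phi> z >= 0) & (noncritical_level \<phi> z -->
   time_deriv \<phi> z + norm (space_grad \<phi> z) * H (fst z) (superlevel \<phi> z) >= 0)"
 let ?max = "%a b z \<phi>. \<forall>w\<in>UNIV \<times> {a..b}. - u w - \<phi> w <= - u z - \<phi> z"
 let ?min = "%a b z \<phi>. \<forall>w\<in>UNIV \<times> {a..b}. u w - \<phi> w >= u z - \<phi> z"
 have neg: "?T a b z (%w. - \<phi> w)" "?sub z (%w. - \<phi> w) \<longleftrightarrow> ?super z \<phi>" "?super z (%w. - \<phi> w) \<longleftrightarrow> ?sub z \<phi>"
  if "?T a b z \<phi>" for a b z \<phi>
  using test_uminus[where H = H, OF that[THEN conjunct1] that[THEN conjunct2] anti] by auto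
 have mm: "?max a b z (%w. - \<phi> w) \<longleftrightarrow> ?min a b z \<phi>" "?min a b z (%w. - \<phi> w) \<longleftrightarrow> ?max a b z \<phi>" for a b z \<phi>
  by (intro ball_cong refl; linarith)+
 have "(\<forall>a b z \<phi>. ?T a b z \<phi> & ?min a b z \<phi> --> ?super z \<phi>) \<longleftrightarrow> (\<forall>a b z \<phi>. ?T a b z \<phi> & ?max a b z \<phi> --> ?sub z \<phi>)"
  (is "?L \<longleftrightarrow> ?R")
 proof
  assume L: ?L
  show ?R
  proof (intro allI impI; elim conjE)
   fix a b z \<phi> assume T: "admissible_at \<gamma> a b z \<phi>" "smooth_on (UNIV \<times> {a<..<b}) \<phi>" and mx: "?max a b z \<phi>"
   have "?T a b z (%w. - \<phi> w) & ?min a b z (%w. - \<phi> w) --> ?super z (%w. - \<phi> w)"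
    by (rule L[THEN spec, THEN spec, THEN spec, THEN spec])
   then show "?sub z \<phi>" unfolding mm neg(3)[OF conjI[OF T]] using neg(1)[OF conjI[OF T]] mx by blast
  qed
 next
  assume R: ?R
  show ?L
  proof (intro allI impI; elim conjE)
   fix a b z \<phi> assume T: "admissible_at \<gamma> a b z \<phi>" "smooth_on (UNIV \<times> {a<..<b}) \<phi>" and mx: "?min a b z \<phi>"
   have "?T a b z (%w. - \<phi> w) & ?max a b z (%w. - \<phi> w) --> ?sub z (%w. - \<phi> w)"
    by (rule R[THEN spec, THEN spec, THEN spec, THEN spec])
   then show "?super z \<phi>" unfolding mm neg(2)[OF conjI[OF T]] using neg(1)[OF conjI[OF T]] mx by blast
  qed
 qed
 moreover have "const_outside_compact {0..} u \<longleftrightarrow> const_outside_compact {0..} (%z. - u z)"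
  using const_outside_compact_uminus[of "{0..}" u] const_outside_compact_uminus[of "{0..}" "%z. - u z"] by auto
 ultimately show ?thesis unfolding supersolution_def subsolution_def usc_on_uminus by (simp add: conj_assoc)
qed

section \<open>Harmonic polynomials\<close>

text \<open>Summed over all of \<open>Basis\<close>; on space-time, where it will be applied, this
  includes the time direction.\<close>

definition laplacian :: "('a::euclidean_space => real) => 'a => real" where
 "laplacian q x = (\<Sum>b\<in>Basis. dir_deriv2 q x b b)"

lemma smooth_dir_deriv: "smooth_on UNIV q ==> smooth_on UNIV (%x. dir_deriv q x v)"
 unfolding dir_deriv_def by (rule smooth_on_frechet) auto

context
 fixes p q :: "'a::euclidean_space => real"
 assumes p: "smooth_on UNIV p" and q: "smooth_on UNIV q"
begin

private lemma hd: "(p has_derivative dir_deriv p x) (at x)" "(q has_derivative dir_deriv q x) (at x)"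
 using C2_has_derivative[OF open_UNIV smooth_onD[OF p]] C2_has_derivative[OF open_UNIV smooth_onD[OF q]] by auto

lemma dir_deriv_add: "dir_deriv (%x. p x + q x) x v = dir_deriv p x v + dir_deriv q x v"
 using dir_deriv_eqI[OF has_derivative_add[OF hd]] by metis

lemma dir_deriv_mult: "dir_deriv (%x. p x * q x) x v = p x * dir_deriv q x v + dir_deriv p x v * q x"
 using dir_deriv_eqI[OF has_derivative_mult[OF hd]] by metis

end

lemma dir_deriv_inner: "dir_deriv (%x. x \<bullet> a) x v = v \<bullet> a"
 by (subst dir_deriv_eqI[where D = "%v. v \<bullet> a"]) (auto intro!: derivative_eq_intros)

lemma dir_deriv_const: "dir_deriv (%x. c) x v = 0"
 by (subst dir_deriv_eqI[where D = "%v. 0"]) auto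

lemma smooth_on_inner: "smooth_on UNIV (%x::'a::euclidean_space. x \<bullet> a)"
 by (rule smooth_on_bounded_linear) (auto intro: bounded_linear_inner_left)

lemma dir_deriv_basis:
 assumes "smooth_on UNIV q"
 shows "(\<Sum>b\<in>Basis. (v \<bullet> b) * dir_deriv q x b) = dir_deriv q x v"
 using linear_basis_expansion[OF C2_linear[OF open_UNIV smooth_onD[OF assms] UNIV_I], of x v] by simp

lemma laplacian_add:
 assumes "smooth_on UNIV p" "smooth_on UNIV q"
 shows "laplacian (%x. p x + q x) x = laplacian p x + laplacian q x"
 unfolding laplacian_def dir_deriv2_def dir_deriv_add[OF assms]
 by (simp add: dir_deriv_add[OF smooth_dir_deriv smooth_dir_deriv, OF assms] sum.distrib)

lemma laplacian_mult:
 assumes "smooth_on UNIV p" "smooth_on UNIV q"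
 shows "laplacian (%x. p x * q x) x =
  p x * laplacian q x + 2 * (\<Sum>b\<in>Basis. dir_deriv p x b * dir_deriv q x b) + laplacian p x * q x"
proof -
 note sd = assms smooth_dir_deriv[OF assms(1)] smooth_dir_deriv[OF assms(2)]
 have "dir_deriv2 (%x. p x * q x) x b b =
   p x * dir_deriv2 q x b b + 2 * (dir_deriv p x b * dir_deriv q x b) + dir_deriv2 p x b b * q x" for b
  unfolding dir_deriv2_def dir_deriv_mult[OF assms]
  by (subst dir_deriv_add[OF smooth_on_mult smooth_on_mult]; simp add: sd dir_deriv_mult algebra_simps)
 then show ?thesis by (simp add: laplacian_def sum.distrib sum_distrib_left sum_distrib_right)
qed

lemma laplacian_cmult:
 assumes "smooth_on UNIV q"
 shows "laplacian (%x. c * q x) x = c * laplacian q x"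
 using laplacian_mult[OF smooth_on_const[OF open_UNIV, of c] assms, of x]
 by (simp add: dir_deriv_const) (simp add: laplacian_def dir_deriv2_def dir_deriv_const)

text \<open>Generated by arbitrary linear factors rather than by coordinate monomials, so that
  products, derivatives and Euler's identity follow by rule induction.\<close>

inductive homogeneous_poly :: "nat => ('a::euclidean_space => real) => bool" where
 const: "homogeneous_poly 0 (%x. c)"
| inner: "homogeneous_poly m p ==> homogeneous_poly (Suc m) (%x. (x \<bullet> v) * p x)"
| add: "homogeneous_poly m p ==> homogeneous_poly m q ==> homogeneous_poly m (%x. p x + q x)"

lemma homogeneous_poly_zero: "homogeneous_poly m (%x::'a::euclidean_space. 0)"
proof (induction m)
 case 0
 then show ?case by (rule homogeneous_poly.const)
next
 case (Suc m)
 then show ?case using homogeneous_poly.inner[of m "%x::'a. 0" 0] by simp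
qed

lemma homogeneous_poly_sum:
 "(!!i. i \<in> I ==> homogeneous_poly m (p i)) ==> homogeneous_poly m (%x. \<Sum>i\<in>I. p i x)"
 by (induction I rule: infinite_finite_induct) (auto intro: homogeneous_poly.add homogeneous_poly_zero)

lemma homogeneous_poly_mult:
 assumes "homogeneous_poly m p" "homogeneous_poly k q"
 shows "homogeneous_poly (m + k) (%x. p x * q x)" using assms(1)
proof induction
 case (const c)
 show ?case using assms(2)
 proof induction
  case (inner m p v)
  then show ?case using homogeneous_poly.inner[of m "%x. c * p x" v] by (simp add: mult.left_commute)
 next
  case (add m p q)
  then show ?case using homogeneous_poly.add by (fastforce simp: distrib_left)
 qed (simp add: homogeneous_poly.const)
next
 case (inner m p v)
 then show ?case using homogeneous_poly.inner[of "m + k" "%x. p x * q x" v] by (simp add: mult.assoc)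
next
 case (add m p p')
 then show ?case using homogeneous_poly.add[OF add.IH] by (simp add: distrib_right)
qed

lemma homogeneous_poly_cmult: "homogeneous_poly m p ==> homogeneous_poly m (%x. c * p x)"
 using homogeneous_poly_mult[OF homogeneous_poly.const] by fastforce

lemma homogeneous_poly_smooth: "homogeneous_poly m p ==> smooth_on UNIV p"
 by (induction rule: homogeneous_poly.induct)
  (auto intro: smooth_on_const smooth_on_mult smooth_on_add smooth_on_inner)

lemma homogeneous_poly_dir_deriv:
 assumes "homogeneous_poly m p"
 shows "case m of 0 => (%x. dir_deriv p x v) = (%x. 0) | Suc k => homogeneous_poly k (%x. dir_deriv p x v)"
 using assms
proof induction
 case (const c)
 then show ?case by (simp add: dir_deriv_const)
next
 case (inner m p w)
 have eq: "dir_deriv (%x. (x \<bullet> w) * p x) x v = (v \<bullet> w) * p x + (x \<bullet> w) * dir_deriv p x v" for x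
  by (subst dir_deriv_mult[OF smooth_on_inner homogeneous_poly_smooth[OF inner(1)]]) (simp add: dir_deriv_inner)
 have "homogeneous_poly m (%x. (x \<bullet> w) * dir_deriv p x v)"
 proof (cases m)
  case 0
  then have "dir_deriv p x v = 0" for x using inner.IH by (auto dest: fun_cong)
  then show ?thesis using homogeneous_poly_zero[of m, where 'a = 'a] by simp
 next
  case (Suc k)
  then show ?thesis using inner.IH by (auto intro: homogeneous_poly.inner)
 qed
 from homogeneous_poly.add[OF homogeneous_poly_cmult[OF inner(1), of "v \<bullet> w"] this] show ?case by (simp add: eq)
next
 case (add m p q)
 have "dir_deriv (%x. p x + q x) x v = dir_deriv p x v + dir_deriv q x v" for x
  by (rule dir_deriv_add) (use add.hyps homogeneous_poly_smooth in auto)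
 note eq = this
 show ?case
 proof (cases m)
  case 0
  then have "dir_deriv p x v = 0" "dir_deriv q x v = 0" for x using add.IH by (auto dest: fun_cong)
  then show ?thesis using 0 by (simp add: eq)
 next
  case (Suc k)
  then show ?thesis using add.IH by (simp add: eq homogeneous_poly.add)
 qed
qed

lemma homogeneous_poly_euler:
 assumes "homogeneous_poly m p"
 shows "dir_deriv p x x = real m * p x" using assms
proof induction
 case (const c)
 then show ?case by (simp add: dir_deriv_const)
next
 case (inner m p w)
 show ?case by (subst dir_deriv_mult[OF smooth_on_inner homogeneous_poly_smooth[OF inner(1)]])
   (simp add: dir_deriv_inner inner.IH algebra_simps)
next
 case (add m p q)
 then show ?case using dir_deriv_add[OF add(1,2)[THEN homogeneous_poly_smooth]] by (simp add: algebra_simps)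
qed

text \<open>Natural subtraction sends the degrees 0 and 1 to 0; the second claim records that the
  Laplacian then vanishes and is not just some constant.\<close>

lemma homogeneous_poly_laplacian:
 assumes "homogeneous_poly m p"
 shows "homogeneous_poly (m - 2) (laplacian p)" "m < 2 ==> laplacian p = (%x. 0)"
proof -
 have *: "if m < 2 then (%x. dir_deriv2 p x v v) = (%x. 0) else homogeneous_poly (m - 2) (%x. dir_deriv2 p x v v)" for v
 proof (cases m)
  case 0
  then have "(%x. dir_deriv p x v) = (%x. 0)" using homogeneous_poly_dir_deriv[OF assms, of v] by simp
  then show ?thesis using 0 by (simp add: dir_deriv2_def dir_deriv_const)
 next
  case (Suc k)
  then have "homogeneous_poly k (%x. dir_deriv p x v)" using homogeneous_poly_dir_deriv[OF assms, of v] by simp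
  from homogeneous_poly_dir_deriv[OF this, of v] show ?thesis
   using Suc by (cases k) (auto simp: dir_deriv2_def)
 qed
 have l: "laplacian p = (%x. \<Sum>b\<in>Basis. dir_deriv2 p x b b)" by (simp add: laplacian_def fun_eq_iff)
 show z: "laplacian p = (%x. 0)" if "m < 2" using * that unfolding l by (auto simp: fun_eq_iff)
 show "homogeneous_poly (m - 2) (laplacian p)"
 proof (cases "m < 2")
  case True
  show ?thesis unfolding z[OF True] by (rule homogeneous_poly_zero)
 next
  case False
  then show ?thesis unfolding l using * by (intro homogeneous_poly_sum) simp
 qed
qed

lemma homogeneous_poly_radial: "homogeneous_poly (2 * j) (%x::'a::euclidean_space. (x \<bullet> x) ^ j)"
proof (induction j)
 case 0
 show ?case using homogeneous_poly.const[of 1, where 'a = 'a] by simp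
next
 case (Suc j)
 have "homogeneous_poly 2 (%x::'a. \<Sum>b\<in>Basis. (x \<bullet> b) * (x \<bullet> b))"
 proof (rule homogeneous_poly_sum)
  fix b :: 'a
  show "homogeneous_poly 2 (%x. (x \<bullet> b) * (x \<bullet> b))"
   using homogeneous_poly.inner[OF homogeneous_poly.inner[OF homogeneous_poly.const[of 1], of b], of b]
   by (simp add: numeral_2_eq_2)
 qed
 then have "homogeneous_poly 2 (%x::'a. x \<bullet> x)" by (simp add: euclidean_inner[symmetric])
 from homogeneous_poly_mult[OF this Suc] show ?case by simp
qed

lemma dir_deriv_radial:
 "dir_deriv (%x::'a::euclidean_space. (x \<bullet> x) ^ Suc j) x v = 2 * real (Suc j) * (x \<bullet> v) * (x \<bullet> x) ^ j"
proof -
 have "((%x. (x \<bullet> x) ^ Suc j) has_derivative (%v. 2 * real (Suc j) * (x \<bullet> v) * (x \<bullet> x) ^ j)) (at x)"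
  by (rule has_derivative_eq_rhs[OF has_derivative_power[OF has_derivative_inner[OF has_derivative_ident has_derivative_ident]]])
   (simp add: inner_commute fun_eq_iff)
 from dir_deriv_eqI[OF this] show ?thesis by metis
qed

lemma laplacian_radial:
 "laplacian (%x::'a::euclidean_space. (x \<bullet> x) ^ Suc j) x = 2 * real (Suc j) * (real DIM('a) + 2 * real j) * (x \<bullet> x) ^ j"
proof -
 let ?R = "%x::'a. (x \<bullet> x) ^ j"
 have sR: "smooth_on UNIV ?R" by (rule homogeneous_poly_smooth[OF homogeneous_poly_radial])
 have "dir_deriv2 (%x::'a. (x \<bullet> x) ^ Suc j) x b b = 2 * real (Suc j) * ((x \<bullet> b) * dir_deriv ?R x b + (b \<bullet> b) * ?R x)" for b
 proof -
  have "dir_deriv (%y. (2 * real (Suc j)) * ((y \<bullet> b) * ?R y)) x b = 2 * real (Suc j) * ((x \<bullet> b) * dir_deriv ?R x b + (b \<bullet> b) * ?R x)"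
   by (subst dir_deriv_mult[OF smooth_on_const smooth_on_mult[OF _ smooth_on_inner sR]])
    (auto simp: dir_deriv_const dir_deriv_mult[OF smooth_on_inner sR] dir_deriv_inner)
  then show ?thesis unfolding dir_deriv2_def dir_deriv_radial by (simp add: mult.assoc)
 qed
 then have "laplacian (%x::'a. (x \<bullet> x) ^ Suc j) x =
   (\<Sum>b\<in>Basis. 2 * real (Suc j) * ((x \<bullet> b) * dir_deriv ?R x b + ?R x))"
  by (simp add: laplacian_def)
 also have "... = 2 * real (Suc j) * ((\<Sum>b\<in>Basis. (x \<bullet> b) * dir_deriv ?R x b) + real DIM('a) * ?R x)"
  by (simp add: sum_distrib_left[symmetric] sum.distrib)
 also have "(\<Sum>b\<in>Basis. (x \<bullet> b) * dir_deriv ?R x b) = real (2 * j) * ?R x"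
  unfolding dir_deriv_basis[OF sR] by (rule homogeneous_poly_euler[OF homogeneous_poly_radial])
 finally show ?thesis by (simp add: algebra_simps)
qed

text \<open>Euler's identity evaluates the cross term of the product rule as a multiple of
  \<open>q\<close>, with a positive total coefficient.\<close>

lemma laplacian_radial_mult:
 fixes q :: "'a::euclidean_space => real"
 assumes "homogeneous_poly m q"
 shows "laplacian (%x. (x \<bullet> x) ^ Suc j * q x) x =
  (x \<bullet> x) ^ Suc j * laplacian q x + 2 * real (Suc j) * (real DIM('a) + 2 * real j + 2 * real m) * (x \<bullet> x) ^ j * q x"
proof -
 have sq: "smooth_on UNIV q" by (rule homogeneous_poly_smooth[OF assms])
 have "(\<Sum>b\<in>Basis. dir_deriv (%x. (x \<bullet> x) ^ Suc j) x b * dir_deriv q x b) =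
   2 * real (Suc j) * (x \<bullet> x) ^ j * (\<Sum>b\<in>Basis. (x \<bullet> b) * dir_deriv q x b)"
  unfolding dir_deriv_radial by (simp add: sum_distrib_left mult_ac)
 also have "... = 2 * real (Suc j) * (x \<bullet> x) ^ j * (real m * q x)"
  unfolding dir_deriv_basis[OF sq] homogeneous_poly_euler[OF assms] ..
 finally show ?thesis
  unfolding laplacian_mult[OF homogeneous_poly_smooth[OF homogeneous_poly_radial] sq] laplacian_radial
  by (simp add: algebra_simps)
qed

text \<open>The choice \<open>q = \<beta> * r\<close>, with \<open>\<beta>\<close> the inverse of
  the coefficient in \<open>laplacian_radial_mult\<close>, leaves the error
  \<open>\<beta> * laplacian r\<close> with one more radial factor. This is the same problem for
  \<open>Suc j\<close> in degree \<open>m - 2\<close>, so induction on the degree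
  terminates.\<close>

lemma laplacian_radial_solve:
 fixes r :: "'a::euclidean_space => real"
 assumes "homogeneous_poly m r"
 obtains q where "homogeneous_poly m q" "!!x. laplacian (%x. (x \<bullet> x) ^ Suc j * q x) x = (x \<bullet> x) ^ j * r x"
proof -
 have "\<exists>q. homogeneous_poly m q & (\<forall>x. laplacian (%x. (x \<bullet> x) ^ Suc j * q x) x = (x \<bullet> x) ^ j * r x)"
  using assms
 proof (induction m arbitrary: r j rule: less_induct)
  case (less m)
  define \<beta> where "\<beta> = 1 / (2 * real (Suc j) * (real DIM('a) + 2 * real j + 2 * real m))"
  have pos: "2 * real (Suc j) * (real DIM('a) + 2 * real j + 2 * real m) > 0"
   by (intro mult_pos_pos add_pos_nonneg) auto
  have hr: "homogeneous_poly m (%x. \<beta> * r x)" by (rule homogeneous_poly_cmult[OF less.prems])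
  have lr: "laplacian (%x. \<beta> * r x) x = \<beta> * laplacian r x" for x
   by (rule laplacian_cmult[OF homogeneous_poly_smooth[OF less.prems]])
  have l: "laplacian (%x. (x \<bullet> x) ^ Suc j * (\<beta> * r x)) x =
    (x \<bullet> x) ^ Suc j * (\<beta> * laplacian r x) + (x \<bullet> x) ^ j * r x" for x
   proof -
   have "2 * real (Suc j) * (real DIM('a) + 2 * real j + 2 * real m) * (x \<bullet> x) ^ j * (\<beta> * r x) =
     (2 * real (Suc j) * (real DIM('a) + 2 * real j + 2 * real m) * \<beta>) * ((x \<bullet> x) ^ j * r x)"
    by (simp only: mult_ac)
   also have "2 * real (Suc j) * (real DIM('a) + 2 * real j + 2 * real m) * \<beta> = 1"
    using pos unfolding \<beta>_def by (metis less_irrefl nonzero_eq_divide_eq mult.commute)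
   finally show ?thesis unfolding laplacian_radial_mult[OF hr] lr by simp
  qed
  show ?case
  proof (cases "m < 2")
   case True
   then have "laplacian r x = 0" for x using homogeneous_poly_laplacian(2)[OF less.prems] by simp
   then show ?thesis using hr l by (intro exI[of _ "%x. \<beta> * r x"]) simp
  next
   case False
   have "homogeneous_poly (m - 2) (%x. - \<beta> * laplacian r x)"
    by (rule homogeneous_poly_cmult[OF homogeneous_poly_laplacian(1)[OF less.prems]])
   then obtain q' where q': "homogeneous_poly (m - 2) q'"
    "!!x. laplacian (%x. (x \<bullet> x) ^ Suc (Suc j) * q' x) x = (x \<bullet> x) ^ Suc j * (- \<beta> * laplacian r x)"
    using less.IH[of "m - 2" "%x. - \<beta> * laplacian r x" "Suc j"] False by auto
   have h2: "homogeneous_poly m (%x. (x \<bullet> x) ^ 1 * q' x)"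
    using homogeneous_poly_mult[OF homogeneous_poly_radial[of 1] q'(1)] False by (simp add: numeral_2_eq_2 Suc_diff_Suc)
   show ?thesis
   proof (intro exI[of _ "%x. \<beta> * r x + (x \<bullet> x) ^ 1 * q' x"] conjI allI)
    show "homogeneous_poly m (%x. \<beta> * r x + (x \<bullet> x) ^ 1 * q' x)" by (rule homogeneous_poly.add[OF hr h2])
    fix x
    have "laplacian (%x. (x \<bullet> x) ^ Suc j * (\<beta> * r x) + (x \<bullet> x) ^ Suc (Suc j) * q' x) x = (x \<bullet> x) ^ j * r x"
     by (subst laplacian_add)
      (auto simp: l q'(2) intro!: smooth_on_mult homogeneous_poly_smooth[OF hr] homogeneous_poly_smooth[OF q'(1)]
       homogeneous_poly_smooth[OF homogeneous_poly_radial] simp del: power_Suc)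
    then show "laplacian (%x. (x \<bullet> x) ^ Suc j * (\<beta> * r x + (x \<bullet> x) ^ 1 * q' x)) x = (x \<bullet> x) ^ j * r x"
     by (simp add: algebra_simps)
   qed
  qed
 qed
 then show ?thesis using that by blast
qed

text \<open>If the Laplacian of \<open>|x|^2 q\<close> is that of \<open>p\<close>, then
  \<open>p - |x|^2 q\<close> is harmonic and equals \<open>p - q\<close> on the unit sphere; since
  \<open>q\<close> has degree \<open>m - 2\<close>, its harmonic extension can be added by
  induction.\<close>

lemma harmonic_on_sphere_homogeneous:
 fixes p :: "'a::euclidean_space => real"
 assumes "homogeneous_poly m p"
 shows "\<exists>h. smooth_on UNIV h & (\<forall>x. laplacian h x = 0) & (\<forall>x. norm x = 1 --> h x = p x)"
 using assms
proof (induction m arbitrary: p rule: less_induct)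
 case (less m)
 note sp = homogeneous_poly_smooth[OF less.prems]
 show ?case
 proof (cases "m < 2")
  case True
  then show ?thesis using sp homogeneous_poly_laplacian(2)[OF less.prems] by (intro exI[of _ p]) simp
 next
  case False
  obtain q where q: "homogeneous_poly (m - 2) q"
   "!!x. laplacian (%x. (x \<bullet> x) ^ Suc 0 * q x) x = (x \<bullet> x) ^ 0 * laplacian p x"
   by (rule laplacian_radial_solve[OF homogeneous_poly_laplacian(1)[OF less.prems]]) blast
  note sq = homogeneous_poly_smooth[OF q(1)]
  obtain h where h: "smooth_on UNIV h" "!!x. laplacian h x = 0" "!!x. norm x = 1 ==> h x = q x"
   using less.IH[OF _ q(1)] False by (metis diff_less gr0I less_numeral_extra(3) not_less zero_less_numeral)
  have sR: "smooth_on UNIV (%x::'a. (x \<bullet> x) ^ Suc 0)" by (rule homogeneous_poly_smooth[OF homogeneous_poly_radial])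
  have s1: "smooth_on UNIV (%x. (x \<bullet> x) ^ Suc 0 * q x)" by (rule smooth_on_mult[OF open_UNIV sR sq])
  have s2: "smooth_on UNIV (%x. - 1 * ((x \<bullet> x) ^ Suc 0 * q x))"
   by (rule smooth_on_mult[OF open_UNIV smooth_on_const[OF open_UNIV] s1])
  have s3: "smooth_on UNIV (%x. p x + - 1 * ((x \<bullet> x) ^ Suc 0 * q x))" by (rule smooth_on_add[OF open_UNIV sp s2])
  show ?thesis
  proof (intro exI[of _ "%x. (p x + - 1 * ((x \<bullet> x) ^ Suc 0 * q x)) + h x"] conjI allI impI)
   show "smooth_on UNIV (%x. (p x + - 1 * ((x \<bullet> x) ^ Suc 0 * q x)) + h x)"
    by (rule smooth_on_add[OF open_UNIV s3 h(1)])
   show "laplacian (%x. (p x + - 1 * ((x \<bullet> x) ^ Suc 0 * q x)) + h x) x = 0" for x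
    unfolding laplacian_add[OF s3 h(1)] laplacian_add[OF sp s2] laplacian_cmult[OF s1] q(2) h(2) by simp
   fix x :: 'a assume x: "norm x = 1"
   then have "x \<bullet> x = 1" by (simp add: power2_norm_eq_inner[symmetric])
   then show "(p x + - 1 * ((x \<bullet> x) ^ Suc 0 * q x)) + h x = p x" using h(3)[OF x] by simp
  qed
 qed
qed

inductive poly_sum :: "('a::euclidean_space => real) => bool" where
 hom: "homogeneous_poly m p ==> poly_sum p"
| add: "poly_sum p ==> poly_sum q ==> poly_sum (%x. p x + q x)"

lemma poly_sum_mult:
 assumes "poly_sum p" "poly_sum q"
 shows "poly_sum (%x. p x * q x)" using assms(1)
proof induction
 case (hom m p)
 show ?case using assms(2)
 proof induction
  case (hom k q)
  then show ?case using homogeneous_poly_mult[OF \<open>homogeneous_poly m p\<close>] poly_sum.hom by blast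
 next
  case (add q q')
  then show ?case using poly_sum.add[of "%x. p x * q x"] by (simp add: distrib_left)
 qed
next
 case (add p p')
 then show ?case using poly_sum.add[of "%x. p x * q x"] by (simp add: distrib_right)
qed

lemma real_polynomial_poly_sum:
 fixes p :: "'a::euclidean_space => real"
 shows "real_polynomial_function p ==> poly_sum p"
proof (induction rule: real_polynomial_function.induct)
 case (linear f)
 have "f x = (x \<bullet> (\<Sum>b\<in>Basis. f b *\<^sub>R b)) * 1" for x
  using linear_basis_expansion[OF bounded_linear.linear[OF linear], of x] by (simp add: inner_sum_right mult.commute)
 then have "f = (%x. (x \<bullet> (\<Sum>b\<in>Basis. f b *\<^sub>R b)) * 1)" by (rule ext)
 then show ?case using homogeneous_poly.inner[OF homogeneous_poly.const] poly_sum.hom by metis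
next
 case (const c)
 then show ?case using homogeneous_poly.const poly_sum.hom by blast
qed (auto intro: poly_sum.add poly_sum_mult)

text \<open>The Stone-Weierstrass theorem followed by harmonic extension of polynomials from the
  sphere; it takes the place of solving a Dirichlet problem.\<close>

lemma harmonic_approximation:
 fixes f :: "'a::euclidean_space => real"
 assumes "continuous_on (sphere 0 1) f" "e > 0"
 obtains h where "smooth_on UNIV h" "!!x. laplacian h x = 0" "!!x. norm x = 1 ==> \<bar>h x - f x\<bar> < e"
proof -
 obtain p where p: "real_polynomial_function p" "!!x. x \<in> sphere 0 1 ==> \<bar>f x - p x\<bar> < e"
  using Stone_Weierstrass_real_polynomial_function[OF compact_sphere assms] by metis
 have "\<exists>h. smooth_on UNIV h & (\<forall>x. laplacian h x = 0) & (\<forall>x. norm x = 1 --> h x = p x)"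
  using real_polynomial_poly_sum[OF p(1)]
 proof induction
  case (hom m p)
  then show ?case by (rule harmonic_on_sphere_homogeneous)
 next
  case (add p q)
  then obtain h k where "smooth_on UNIV h" "smooth_on UNIV k" "\<forall>x. laplacian h x = 0" "\<forall>x. laplacian k x = 0"
   "\<forall>x. norm x = 1 --> h x = p x" "\<forall>x. norm x = 1 --> k x = q x" by metis
  then show ?case by (intro exI[of _ "%x. h x + k x"]) (simp add: laplacian_add smooth_on_add)
 qed
 then show ?thesis using that p(2) by (metis abs_minus_commute dist_0_norm mem_sphere)
qed

section \<open>Blow-up at a point of differentiability\<close>

text \<open>Scales by \<open>\<sigma>\<close> orthogonally to \<open>e\<close> in space and by
  \<open>s\<close> along \<open>e\<close> and in time (for a unit vector \<open>e\<close>): the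
  directions in which the limit operator degenerates get their own factor.\<close>

definition frame :: "real => real => real^'n => (real^'n) * real => (real^'n) * real" where
 "frame \<sigma> s e z = (\<sigma> *\<^sub>R fst z + ((s - \<sigma>) * (e \<bullet> fst z)) *\<^sub>R e, s * snd z)"

lemma linear_frame: "linear (frame \<sigma> s e)"
 by (intro linearI) (simp_all add: frame_def inner_add_right algebra_simps)

lemma frame_uminus: "frame \<sigma> s (- e) = frame \<sigma> s e"
 by (simp add: frame_def fun_eq_iff)

lemma frame_inverse:
 assumes "norm e = 1" "\<sigma> ~= 0" "s ~= 0"
 shows "frame (1 / \<sigma>) (1 / s) e (frame \<sigma> s e z) = z" "frame \<sigma> s e (frame (1 / \<sigma>) (1 / s) e z) = z"
proof -
 have e: "e \<bullet> e = 1" using assms(1) by (simp add: power2_norm_eq_inner[symmetric])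
 have *: "frame \<sigma> s e (frame (1 / \<sigma>) (1 / s) e z) = z" if "\<sigma> ~= 0" "s ~= 0" for \<sigma> s
 proof -
  have "\<sigma> *\<^sub>R ((1 / \<sigma>) *\<^sub>R fst z + ((1 / s - 1 / \<sigma>) * (e \<bullet> fst z)) *\<^sub>R e) +
    ((s - \<sigma>) * (e \<bullet> ((1 / \<sigma>) *\<^sub>R fst z + ((1 / s - 1 / \<sigma>) * (e \<bullet> fst z)) *\<^sub>R e))) *\<^sub>R e
   = fst z + (\<sigma> * (1 / s - 1 / \<sigma>) + (s - \<sigma>) * (1 / \<sigma>) + (s - \<sigma>) * (1 / s - 1 / \<sigma>)) *\<^sub>R ((e \<bullet> fst z) *\<^sub>R e)"
   using that by (simp add: inner_add_right e algebra_simps)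
  also have "\<sigma> * (1 / s - 1 / \<sigma>) + (s - \<sigma>) * (1 / \<sigma>) + (s - \<sigma>) * (1 / s - 1 / \<sigma>) = 0"
   using that by (simp add: field_simps)
  finally show ?thesis using that by (simp add: frame_def prod_eq_iff)
 qed
 show "frame \<sigma> s e (frame (1 / \<sigma>) (1 / s) e z) = z" using *[OF assms(2,3)] .
 show "frame (1 / \<sigma>) (1 / s) e (frame \<sigma> s e z) = z" using *[of "1 / \<sigma>" "1 / s"] assms by simp
qed

lemma sum_Basis_space_time:
 fixes f :: "(real^'n) * real => real"
 shows "(\<Sum>b\<in>Basis. f b) = (\<Sum>i\<in>UNIV. f (axis i 1, 0)) + f (0, 1)"
proof -
 have inj: "inj_on (%u::real^'n. (u, 0::real)) Basis" by (auto simp: inj_on_def)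
 have inj2: "inj (%i::'n. axis i (1::real))" by (auto simp: inj_on_def axis_eq_axis)
 have B: "(Basis :: (real^'n) set) = (%i. axis i 1) ` UNIV" by (auto simp: Basis_vec_def)
 have "(\<Sum>b\<in>Basis. f b) = (\<Sum>b\<in>(%u::real^'n. (u, 0::real)) ` Basis. f b) + (\<Sum>b\<in>{(0, 1)}. f b)"
  unfolding Basis_prod_def by (subst sum.union_disjoint) auto
 also have "(\<Sum>b\<in>(%u::real^'n. (u, 0::real)) ` Basis. f b) = (\<Sum>i\<in>UNIV. f (axis i 1, 0))"
  unfolding sum.reindex[OF inj] o_def unfolding B sum.reindex[OF inj2] o_def ..
 finally show ?thesis by simp
qed

text \<open>With \<open>\<sigma>^2 - s^2 = c\<close> and \<open>s^2 = \<kappa>\<close> the Laplacian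
  in the new coordinates becomes the limit operator plus \<open>\<kappa>\<close> times the full
  Laplacian.\<close>

lemma frame_trace:
 fixes H :: "(real^'n) * real => (real^'n) * real => real"
 assumes H: "!!v. linear (H v)" "!!w. linear (%v. H v w)" and e: "norm e = 1"
 shows "(\<Sum>b\<in>Basis. H (frame \<sigma> s e b) (frame \<sigma> s e b)) =
  (\<sigma>^2 - s^2) * ((\<Sum>i\<in>UNIV. H (axis i 1, 0) (axis i 1, 0)) - H (e, 0) (e, 0)) + s^2 * (\<Sum>b\<in>Basis. H b b)"
proof -
 have e2: "(\<Sum>i\<in>UNIV. e $ i * e $ i) = 1" using e by (simp add: norm_eq_1 inner_vec_def)
 have ev: "(\<Sum>i\<in>UNIV. e $ i *\<^sub>R (axis i 1, 0)) = (e, 0)"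
  using basis_expansion[of e] by (simp add: prod_eq_iff fst_sum snd_sum scalar_mult_eq_scaleR)
 define k where "k = s - \<sigma>"
 have f: "frame \<sigma> s e (axis i 1, 0) = \<sigma> *\<^sub>R (axis i 1, 0) + (k * e $ i) *\<^sub>R (e, 0)" for i
  by (simp add: frame_def k_def inner_axis)
 have "H (frame \<sigma> s e (axis i 1, 0)) (frame \<sigma> s e (axis i 1, 0)) =
   \<sigma>\<^sup>2 * H (axis i 1, 0) (axis i 1, 0) + \<sigma> * k * (e $ i * H (axis i 1, 0) (e, 0)) +
   \<sigma> * k * (e $ i * H (e, 0) (axis i 1, 0)) + k^2 * H (e, 0) (e, 0) * (e $ i * e $ i)" for i
  unfolding f linear_add[OF H(1)] linear_scale[OF H(1)] linear_add[OF H(2)] linear_scale[OF H(2)]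
  by (simp add: power2_eq_square algebra_simps)
 then have "(\<Sum>i\<in>UNIV. H (frame \<sigma> s e (axis i 1, 0)) (frame \<sigma> s e (axis i 1, 0))) =
   \<sigma>\<^sup>2 * (\<Sum>i\<in>UNIV. H (axis i 1, 0) (axis i 1, 0)) + \<sigma> * k * (\<Sum>i\<in>UNIV. e $ i * H (axis i 1, 0) (e, 0)) +
   \<sigma> * k * (\<Sum>i\<in>UNIV. e $ i * H (e, 0) (axis i 1, 0)) + k^2 * H (e, 0) (e, 0) * (\<Sum>i\<in>UNIV. e $ i * e $ i)"
  by (simp only: sum.distrib sum_distrib_left)
 also have "(\<Sum>i\<in>UNIV. e $ i * H (axis i 1, 0) (e, 0)) = H (e, 0) (e, 0)"
  using linear_sum[OF H(2), of "%i. e $ i *\<^sub>R (axis i 1, 0)" UNIV "(e, 0)"] unfolding ev linear_scale[OF H(2)] by simp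
 also have "(\<Sum>i\<in>UNIV. e $ i * H (e, 0) (axis i 1, 0)) = H (e, 0) (e, 0)"
  using linear_sum[OF H(1), of "(e, 0)" "%i. e $ i *\<^sub>R (axis i 1, 0)" UNIV] unfolding ev linear_scale[OF H(1)] by simp
 finally have 1: "(\<Sum>i\<in>UNIV. H (frame \<sigma> s e (axis i 1, 0)) (frame \<sigma> s e (axis i 1, 0))) =
   \<sigma>\<^sup>2 * (\<Sum>i\<in>UNIV. H (axis i 1, 0) (axis i 1, 0)) + (s^2 - \<sigma>^2) * H (e, 0) (e, 0)"
  unfolding e2 by (simp add: k_def power2_eq_square algebra_simps)
 have "frame \<sigma> s e (0, 1) = s *\<^sub>R (0, 1)" by (simp add: frame_def)
 then have "H (frame \<sigma> s e (0, 1)) (frame \<sigma> s e (0, 1)) = s * (s * H (0, 1) (0, 1))"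
  using linear_scale[OF H(1), of "s *\<^sub>R (0, 1)" s "(0, 1)"] linear_scale[OF H(2), of s "(0, 1)" "(0, 1)"] by simp
 then have "H (frame \<sigma> s e (0, 1)) (frame \<sigma> s e (0, 1)) = s^2 * H (0, 1) (0, 1)"
  by (simp add: power2_eq_square)
 with 1 show ?thesis unfolding sum_Basis_space_time by (simp add: algebra_simps)
qed

text \<open>Adding the inequalities at \<open>z + t v\<close> and \<open>z - t v\<close> cancels all
  first order terms.\<close>

lemma second_expansion_lower:
 fixes \<phi> :: "'a::real_inner => real"
 assumes se: "second_expansion \<phi> z L H" and L: "linear L" and H: "!!v. linear (H v)" "!!w. linear (%v. H v w)"
  and low: "\<forall>\<^sub>F w in nhds z. \<phi> w >= \<phi> z + P \<bullet> (w - z) - C * (norm (w - z))^2"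
 shows "H v v >= - 2 * C * (norm v)^2"
proof (rule field_le_epsilon)
 fix \<epsilon> :: real assume \<epsilon>: "\<epsilon> > 0"
 define e where "e = \<epsilon> / (2 * ((norm v)^2 + 1))"
 have n: "(norm v)^2 + 1 > 0" by (simp add: add_nonneg_pos)
 have e: "e > 0" using \<epsilon> n by (simp add: e_def)
 have "\<forall>\<^sub>F w in nhds z. \<phi> w >= \<phi> z + P \<bullet> (w - z) - C * (norm (w - z))^2 &
   \<bar>\<phi> w - \<phi> z - L (w - z) - H (w - z) (w - z) / 2\<bar> <= e * (norm (w - z))^2"
  using low se e unfolding second_expansion_def by (intro eventually_conj) auto
 then obtain d where d: "d > 0" "!!w. dist w z < d ==> \<phi> w >= \<phi> z + P \<bullet> (w - z) - C * (norm (w - z))^2 &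
   \<bar>\<phi> w - \<phi> z - L (w - z) - H (w - z) (w - z) / 2\<bar> <= e * (norm (w - z))^2"
  unfolding eventually_nhds_metric by blast
 define t where "t = d / (2 * (norm v + 1))"
 have nv: "norm v + 1 > 0" by (simp add: add_nonneg_pos)
 have t: "t > 0" using d(1) nv by (simp add: t_def)
 have tv: "t * norm v < d"
 proof -
  have "t * norm v <= t * (norm v + 1)" using t by (intro mult_left_mono) auto
  also have "t * (norm v + 1) = d / 2" using nv unfolding t_def by (simp add: field_simps)
  finally show ?thesis using d(1) by simp
 qed
 have *: "k * (P \<bullet> v) - C * (k^2 * (norm v)^2) <= k * L v + k^2 * H v v / 2 + e * (k^2 * (norm v)^2)" if "\<bar>k\<bar> = t" for k
 proof -
  have "dist (z + k *\<^sub>R v) z < d" using tv that by (simp add: dist_norm)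
  from d(2)[OF this] show ?thesis
   by (simp add: linear_scale[OF L] linear_scale[OF H(1)] linear_scale[OF H(2)] power_mult_distrib abs_le_iff)
    (simp add: power2_eq_square)
 qed
 from *[of t] *[of "- t"] t
 have "t^2 * (- 2 * C * (norm v)^2) <= t^2 * (H v v + 2 * e * (norm v)^2)" by (simp add: algebra_simps)
 then have "- 2 * C * (norm v)^2 <= H v v + 2 * e * (norm v)^2" by (rule mult_left_le_imp_le) (use t in simp)
 moreover have "2 * e * (norm v)^2 <= 2 * e * ((norm v)^2 + 1)" using e by (intro mult_left_mono) auto
 moreover have "2 * e * ((norm v)^2 + 1) = \<epsilon>" using n unfolding e_def by (simp add: field_simps)
 ultimately show "- 2 * C * (norm v)^2 <= H v v + \<epsilon>" by linarith
qed

text \<open>The factors \<open>\<rho>^2\<close> outside and \<open>1 / \<rho>\<close> inside leave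
  the Hessian independent of \<open>\<rho>\<close>, while the deviation of the gradient from
  \<open>P\<close> is of order \<open>\<rho>\<close>.\<close>

lemma second_expansion_blow_up:
 fixes q :: "'b::real_normed_vector => real" and T :: "'a::real_inner => 'b"
 assumes se: "second_expansion q y1 L H" and L: "linear L" and H: "!!v. linear (H v)" "!!w. linear (%v. H v w)"
  and T: "linear T" and b: "b > 0" "!!v. norm (T v) <= b * norm v" and \<rho>: "\<rho> > 0" and z1: "T (z1 - z0) = \<rho> *\<^sub>R y1"
 shows "second_expansion (%z. P \<bullet> (z - z0) + \<rho>^2 * q ((1 / \<rho>) *\<^sub>R T (z - z0))) z1
  (%v. P \<bullet> v + \<rho> * L (T v)) (%v w. H (T v) (T w))" unfolding second_expansion_def
proof (intro allI impI)
 fix e :: real assume e: "e > 0"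
 define e' where "e' = e / b^2"
 have e': "e' > 0" using e b by (simp add: e'_def)
 let ?Y = "%z. (1 / \<rho>) *\<^sub>R T (z - z0)"
 have bl: "bounded_linear T"
  by (rule bounded_linear_intro[where K = b]) (auto simp: linear_add[OF T] linear_scale[OF T] b(2) mult.commute)
 have "continuous_on UNIV ?Y" by (intro continuous_intros bounded_linear.continuous_on[OF bl])
 then have "(?Y \<longlongrightarrow> ?Y z1) (nhds z1)"
  by (simp add: continuous_on_eq_continuous_at isCont_def tendsto_nhds_iff)
 moreover have Y1: "?Y z1 = y1" using \<rho> z1 by simp
 ultimately have "(?Y \<longlongrightarrow> y1) (nhds z1)" by simp
 moreover have "\<forall>\<^sub>F y in nhds y1. \<bar>q y - q y1 - L (y - y1) - H (y - y1) (y - y1) / 2\<bar> <= e' * (norm (y - y1))^2"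
  using se e' unfolding second_expansion_def by blast
 ultimately have "\<forall>\<^sub>F z in nhds z1. \<bar>q (?Y z) - q y1 - L (?Y z - y1) - H (?Y z - y1) (?Y z - y1) / 2\<bar> <= e' * (norm (?Y z - y1))^2"
  unfolding filterlim_iff by blast
 then show "\<forall>\<^sub>F z in nhds z1. \<bar>P \<bullet> (z - z0) + \<rho>^2 * q (?Y z) - (P \<bullet> (z1 - z0) + \<rho>^2 * q (?Y z1)) -
   (P \<bullet> (z - z1) + \<rho> * L (T (z - z1))) - H (T (z - z1)) (T (z - z1)) / 2\<bar> <= e * (norm (z - z1))^2"
 proof eventually_elim
  case (elim z)
  have d: "?Y z - y1 = (1 / \<rho>) *\<^sub>R T (z - z1)"
  proof -
   have "T (z - z1) = T (z - z0) - T (z1 - z0)" using linear_diff[OF T, of "z - z0" "z1 - z0"] by simp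
   then show ?thesis using \<rho> z1 by (simp add: scaleR_diff_right)
  qed
  have TY: "T (z - z1) = \<rho> *\<^sub>R (?Y z - y1)" unfolding d using \<rho> by simp
  have "P \<bullet> (z - z0) + \<rho>^2 * q (?Y z) - (P \<bullet> (z1 - z0) + \<rho>^2 * q (?Y z1)) -
   (P \<bullet> (z - z1) + \<rho> * L (T (z - z1))) - H (T (z - z1)) (T (z - z1)) / 2 =
   \<rho>\<^sup>2 * (q (?Y z) - q y1 - L (?Y z - y1) - H (?Y z - y1) (?Y z - y1) / 2)"
   unfolding TY linear_scale[OF L] linear_scale[OF H(1)] linear_scale[OF H(2)] Y1
   by (simp add: inner_diff_right power2_eq_square algebra_simps)
  also have "\<bar>...\<bar> <= \<rho>^2 * (e' * (norm (?Y z - y1))^2)"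
   unfolding abs_mult using elim by (simp add: mult_left_mono)
  also have "... = e' * (norm (T (z - z1)))^2" unfolding d using \<rho> by (simp add: power_divide)
  also have "... <= e' * (b * norm (z - z1))^2" using e' b by (intro mult_left_mono power_mono) auto
  also have "... = e * (norm (z - z1))^2" using b by (simp add: e'_def power_mult_distrib)
  finally show ?case .
 qed
qed

lemma smooth_derivative_bounds:
 fixes q :: "'a::euclidean_space => real"
 assumes q: "smooth_on UNIV q"
 obtains B where "B > 0" "!!y v. y \<in> cball 0 1 ==> \<bar>dir_deriv q y v\<bar> <= B * norm v"
  "!!y v w. y \<in> cball 0 1 ==> \<bar>dir_deriv2 q y v w\<bar> <= B * norm v * norm w"
proof -
 have first: "\<exists>B. \<forall>y\<in>cball 0 1. \<forall>v. \<bar>dir_deriv p y v\<bar> <= B * norm v" if p: "smooth_on UNIV p" for p :: "'a => real"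
 proof -
  have "continuous_on (cball 0 1) (%y. \<Sum>b\<in>Basis. \<bar>dir_deriv p y b\<bar>)"
   by (intro continuous_intros continuous_on_subset[OF smooth_on_imp_continuous_on[OF smooth_dir_deriv[OF p]]]) auto
  then have "compact ((%y. \<Sum>b\<in>Basis. \<bar>dir_deriv p y b\<bar>) ` cball 0 1)"
   by (rule compact_continuous_image) simp
  then obtain B where B: "!!y. y \<in> cball 0 1 ==> (\<Sum>b\<in>Basis. \<bar>dir_deriv p y b\<bar>) <= B"
   using compact_imp_bounded[THEN bounded_iff[THEN iffD1]] by (fastforce simp: abs_le_iff)
  have "\<bar>dir_deriv p y v\<bar> <= B * norm v" if y: "y \<in> cball 0 1" for y v
  proof -
   have "\<bar>dir_deriv p y v\<bar> = \<bar>\<Sum>b\<in>Basis. (v \<bullet> b) * dir_deriv p y b\<bar>" by (simp add: dir_deriv_basis[OF p])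
   also have "... <= (\<Sum>b\<in>Basis. norm v * \<bar>dir_deriv p y b\<bar>)"
    by (rule order.trans[OF sum_abs sum_mono]) (simp add: abs_mult mult_right_mono Basis_le_norm)
   also have "... = norm v * (\<Sum>b\<in>Basis. \<bar>dir_deriv p y b\<bar>)" by (simp add: sum_distrib_left)
   also have "... <= norm v * B" using B[OF y] by (intro mult_left_mono) auto
   finally show ?thesis by (simp add: mult.commute)
  qed
  then show ?thesis by blast
 qed
 obtain B1 where B1: "!!y v. y \<in> cball 0 1 ==> \<bar>dir_deriv q y v\<bar> <= B1 * norm v" using first[OF q] by blast
 have "\<exists>B. \<forall>y\<in>cball 0 1. \<forall>w. \<bar>dir_deriv2 q y b w\<bar> <= B * norm w" for b
  unfolding dir_deriv2_def by (rule first[OF smooth_dir_deriv[OF q]])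
 then obtain B2 where B2: "!!b y w. y \<in> cball 0 1 ==> \<bar>dir_deriv2 q y b w\<bar> <= B2 b * norm w" by metis
 define B where "B = \<bar>B1\<bar> + (\<Sum>b\<in>Basis. \<bar>B2 b\<bar>) + 1"
 have Bs: "B > 0" "B1 <= B" "(\<Sum>b\<in>Basis. \<bar>B2 b\<bar>) <= B"
  using sum_nonneg[of Basis "%b::'a. \<bar>B2 b\<bar>"] abs_ge_self[of B1] abs_ge_zero[of B1] unfolding B_def by linarith+
 show ?thesis
 proof (rule that[of B])
  show "B > 0" by (rule Bs)
  show "\<bar>dir_deriv q y v\<bar> <= B * norm v" if "y \<in> cball 0 1" for y v
   using B1[OF that, of v] mult_right_mono[OF Bs(2), of "norm v"] by simp
  show "\<bar>dir_deriv2 q y v w\<bar> <= B * norm v * norm w" if y: "y \<in> cball 0 1" for y v w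
  proof -
   have "dir_deriv2 q y v w = (\<Sum>b\<in>Basis. (v \<bullet> b) * dir_deriv2 q y b w)"
    using linear_basis_expansion[OF C2_linear1[OF open_UNIV smooth_onD[OF q] UNIV_I], of y v w] by simp
   also have "\<bar>...\<bar> <= (\<Sum>b\<in>Basis. norm v * (\<bar>B2 b\<bar> * norm w))"
   proof (rule order.trans[OF sum_abs sum_mono])
    fix b :: 'a assume b: "b \<in> Basis"
    have "\<bar>dir_deriv2 q y b w\<bar> <= \<bar>B2 b\<bar> * norm w"
     using B2[OF y, of b w] mult_right_mono[OF abs_ge_self[of "B2 b"], of "norm w"] by simp
    then show "\<bar>(v \<bullet> b) * dir_deriv2 q y b w\<bar> <= norm v * (\<bar>B2 b\<bar> * norm w)"
     unfolding abs_mult using Basis_le_norm[OF b, of v] by (intro mult_mono) auto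
   qed
   also have "... = (\<Sum>b\<in>Basis. \<bar>B2 b\<bar>) * (norm v * norm w)" by (simp add: sum_distrib_left sum_distrib_right mult_ac)
   also have "... <= B * (norm v * norm w)" using Bs(3) by (intro mult_right_mono) auto
   finally show ?thesis by (simp add: mult.assoc)
  qed
 qed
qed

text \<open>The conclusion of \<open>local_sub_C2\<close> as a property of \<open>U\<close> near a
  point, in a form that the sup-convolution inherits.\<close>

definition tested :: "real => ((real^'n) * real => real) => ((real^'n) * real) set => bool" where
 "tested c U N \<longleftrightarrow> (\<forall>z1\<in>N. \<forall>\<phi> p a L H. p ~= 0 --> (\<forall>y \<tau>. L (y, \<tau>) = p \<bullet> y + a * \<tau>) -->
   (\<forall>v. linear (H v)) --> (\<forall>w. linear (%v. H v w)) --> second_expansion \<phi> z1 L H -->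
   (\<forall>\<^sub>F w in nhds z1. U w - \<phi> w <= U z1 - \<phi> z1) -->
   a <= c * ((\<Sum>i\<in>UNIV. H (axis i 1, 0) (axis i 1, 0)) - H (sgn p, 0) (sgn p, 0)))"

text \<open>Formulated by supporting paraboloids of one opening, which survive rescaling and bound
  slopes directly.\<close>

definition semiconvex :: "real => ('a::real_inner => real) => 'a set => bool" where
 "semiconvex C U N \<longleftrightarrow> (\<forall>z\<in>N. \<exists>P. \<forall>w\<in>N. U w >= U z + P \<bullet> (w - z) - C * (norm (w - z))^2)"

text \<open>Removing the affine part and dividing by \<open>\<rho>^2\<close> retains the second
  order behaviour. Time is scaled like space because the bounds on \<open>U\<close> near
  \<open>z0\<close> are quadratic in space-time.\<close>

definition blow_up ::
  "('a::real_inner => real) => 'a => 'a => ('a => 'a) => real => 'a => real" where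
 "blow_up U z0 P S \<rho> y = (U (z0 + \<rho> *\<^sub>R S y) - U z0 - \<rho> * (P \<bullet> S y)) / \<rho>^2"

text \<open>Undoing the scaling turns the touching function into tests of \<open>U\<close> with
  gradients tending to \<open>P\<close>. Its Laplacian \<open>l\<close> exceeds the limit operator
  by \<open>\<kappa>\<close> times the full trace of the Hessian, and semiconvexity bounds that
  trace from below.\<close>

lemma blow_up_touching:
 fixes U :: "(real^'n) * real => real"
 assumes ts: "tested c U (ball z0 r)" and sc: "semiconvex C U (ball z0 r)" and r: "r > 0"
  and c: "c >= 0" and P: "fst P ~= 0" and \<kappa>: "\<kappa> > 0"
  and q: "smooth_on UNIV q" "!!y. laplacian q y = l"
  and \<rho>: "!!n. \<rho> n > 0" "\<rho> \<longlonglongrightarrow> 0"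
  and S: "S = frame (sqrt (c + \<kappa>)) (sqrt \<kappa>) (sgn (fst P))"
  and touch: "\<forall>\<^sub>F n in sequentially. \<exists>y\<in>ball 0 1. \<forall>y'\<in>cball 0 1.
   blow_up U z0 P S (\<rho> n) y' - q y' <= blow_up U z0 P S (\<rho> n) y - q y"
 shows "snd P <= l + \<kappa> * (2 * C * real DIM((real^'n) * real))"
proof -
 let ?N = "real DIM((real^'n) * real)"
 define e where "e = sgn (fst P)"
 have e: "norm e = 1" using P by (simp add: e_def norm_sgn)
 define \<sigma> s where "\<sigma> = sqrt (c + \<kappa>)" and "s = sqrt \<kappa>"
 have \<sigma>s: "\<sigma> ~= 0" "s ~= 0" "\<sigma>^2 - s^2 = c" "s^2 = \<kappa>" using \<kappa> c by (auto simp: \<sigma>_def s_def)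
 define T where "T = frame (1 / \<sigma>) (1 / s) e"
 have ST: "S (T v) = v" "T (S v) = v" for v
  using frame_inverse[OF e \<sigma>s(1,2)] by (simp_all add: S T_def e_def \<sigma>_def s_def)
 have lin: "linear S" "linear T" by (simp_all add: S T_def linear_frame)
 obtain bS where bS: "bS > 0" "!!v. norm (S v) <= bS * norm v" using linear_bounded_pos[OF lin(1)] by blast
 obtain bT where bT: "bT > 0" "!!v. norm (T v) <= bT * norm v" using linear_bounded_pos[OF lin(2)] by blast
 obtain B where B: "B > 0" "!!y v. y \<in> cball 0 1 ==> \<bar>dir_deriv q y v\<bar> <= B * norm v"
  "!!y v w. y \<in> cball 0 1 ==> \<bar>dir_deriv2 q y v w\<bar> <= B * norm v * norm w"
  using smooth_derivative_bounds[OF q(1)] by blast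
 \<comment> \<open>For each \<open>n\<close> the unscaled test has a gradient at distance
   \<open>O(\<rho> n)\<close> from \<open>P\<close> and a Hessian bounded independently of
   \<open>n\<close>; the error terms vanish in the limit.\<close>
 have step: "\<exists>p. norm (p - fst P) <= \<rho> n * (real CARD('n) * (B * bT)) & (p ~= 0 -->
   snd P - \<rho> n * (B * bT) <= l + \<kappa> * (2 * C * ?N) + c * (2 * (B * bT^2) * norm (sgn p - e)))"
  if small: "\<rho> n * bS < r" and tn: "\<exists>y\<in>ball 0 1. \<forall>y'\<in>cball 0 1.
   blow_up U z0 P S (\<rho> n) y' - q y' <= blow_up U z0 P S (\<rho> n) y - q y" for n
 proof -
  obtain y1 where y1: "y1 \<in> ball 0 1" "!!y'. y' \<in> cball 0 1 ==>
   blow_up U z0 P S (\<rho> n) y' - q y' <= blow_up U z0 P S (\<rho> n) y1 - q y1" using tn by blast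
  define k where "k = \<rho> n"
  have k: "k > 0" using \<rho>(1) by (simp add: k_def)
  have y1c: "y1 \<in> cball 0 1" using y1(1) by simp
  define z1 where "z1 = z0 + k *\<^sub>R S y1"
  define L0 H0 where "L0 = dir_deriv q y1" and "H0 = dir_deriv2 q y1"
  note C2 = open_UNIV smooth_onD[OF q(1)] UNIV_I
  have L0: "linear L0" unfolding L0_def by (rule C2_linear[OF C2])
  have H0: "linear (H0 v)" "linear (%v. H0 v w)" for v w
   unfolding H0_def by (rule C2_linear2[OF C2], rule C2_linear1[OF C2])
  define \<phi> where "\<phi> z = P \<bullet> (z - z0) + k^2 * q ((1 / k) *\<^sub>R T (z - z0))" for z
  define L where "L v = P \<bullet> v + k * L0 (T v)" for v
  define H where "H v w = H0 (T v) (T w)" for v w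
  have "T (z1 - z0) = k *\<^sub>R y1" by (simp add: z1_def linear_scale[OF lin(2)] ST)
  then have se: "second_expansion \<phi> z1 L H" unfolding \<phi>_def[abs_def] L_def[abs_def] H_def[abs_def]
   using second_expansion_blow_up[OF C2_second_expansion[OF C2, of y1, folded L0_def H0_def] L0 H0 lin(2) bT k] by blast
  have linL: "linear L" unfolding L_def[abs_def]
   by (intro linearI) (simp_all add: inner_add_right linear_add[OF lin(2)] linear_add[OF L0] linear_scale[OF lin(2)] linear_scale[OF L0] algebra_simps)
  have linH: "linear (H v)" "linear (%v. H v w)" for v w
   using linear_compose[OF lin(2) H0(1)] linear_compose[OF lin(2) H0(2)] by (simp_all add: H_def[abs_def] o_def)
  have z1b: "z1 \<in> ball z0 r"
  proof -
   have "bS * norm y1 <= bS * 1" using y1(1) bS(1) by (intro mult_left_mono) auto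
   then have "norm (S y1) <= bS" using bS(2)[of y1] by simp
   then have "k * norm (S y1) <= k * bS" using k by simp
   also have "... < r" using small by (simp add: k_def)
   finally show ?thesis using k by (simp add: z1_def dist_norm)
  qed
  have Ueq: "U z - \<phi> z = U z0 + k^2 * (blow_up U z0 P S k ((1 / k) *\<^sub>R T (z - z0)) - q ((1 / k) *\<^sub>R T (z - z0)))" for z
  proof -
   have "k *\<^sub>R S ((1 / k) *\<^sub>R T (z - z0)) = z - z0" using k by (simp add: linear_scale[OF lin(1)] ST)
   then have "k^2 * blow_up U z0 P S k ((1 / k) *\<^sub>R T (z - z0)) = U z - U z0 - P \<bullet> (z - z0)"
    unfolding blow_up_def inner_scaleR_right[symmetric] using k by (simp del: inner_scaleR_right)
   then show ?thesis by (simp add: \<phi>_def algebra_simps)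
  qed
  have max: "\<forall>\<^sub>F z in nhds z1. U z - \<phi> z <= U z1 - \<phi> z1"
  proof -
   have bl: "bounded_linear T" by (rule linear_conv_bounded_linear[THEN iffD1, OF lin(2)])
   have "continuous_on UNIV (%z. (1 / k) *\<^sub>R T (z - z0))"
    by (intro continuous_intros bounded_linear.continuous_on[OF bl])
   then have "open ((%z. (1 / k) *\<^sub>R T (z - z0)) -` ball 0 1)" by (intro open_vimage) auto
   moreover have y1e: "(1 / k) *\<^sub>R T (z1 - z0) = y1" using k by (simp add: z1_def linear_scale[OF lin(2)] ST)
   ultimately have "\<forall>\<^sub>F z in nhds z1. (1 / k) *\<^sub>R T (z - z0) \<in> ball 0 1"
    using y1(1) eventually_nhds_in_open[of "(%z. (1 / k) *\<^sub>R T (z - z0)) -` ball 0 1" z1] by simp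
   then show ?thesis
   proof eventually_elim
    case (elim z)
    then have "(1 / k) *\<^sub>R T (z - z0) \<in> cball 0 1" by simp
    from y1(2)[OF this] show ?case unfolding Ueq y1e using k by (simp add: k_def)
   qed
  qed
  obtain P' where P': "!!w. w \<in> ball z0 r ==> U w >= U z1 + P' \<bullet> (w - z1) - C * (norm (w - z1))^2"
   using sc z1b unfolding semiconvex_def by blast
  have "\<forall>\<^sub>F z in nhds z1. z \<in> ball z0 r" by (rule eventually_nhds_in_open[OF open_ball z1b])
  with max have low: "\<forall>\<^sub>F z in nhds z1. \<phi> z >= \<phi> z1 + P' \<bullet> (z - z1) - C * (norm (z - z1))^2"
   by eventually_elim (use P' in fastforce)
  \<comment> \<open>Touching a semiconvex function from above bounds the Hessian of the test
    function from below.\<close>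
  have Hlow: "H v v >= - 2 * C * (norm v)^2" for v by (rule second_expansion_lower[OF se linL linH low])
  define p where "p = (\<chi> i. L (axis i 1, 0))"
  define a where "a = L (0, 1)"
  have Lp: "L (y, \<tau>) = p \<bullet> y + a * \<tau>" for y \<tau>
  proof -
   have emb: "linear (%y::real^'n. (y, 0::real))" by (intro linearI) auto
   have "L (y, \<tau>) = L ((y, 0) + \<tau> *\<^sub>R (0, 1))" by simp
   also have "... = L (y, 0) + \<tau> * a" unfolding linear_add[OF linL] linear_scale[OF linL] a_def by simp
   also have "L (y, 0) = p \<bullet> y"
    using cart_linear_expansion[OF linear_compose[OF emb linL], of y] by (simp add: p_def o_def)
   finally show ?thesis by (simp add: mult.commute)
  qed
  have L0b: "\<bar>L0 (T v)\<bar> <= B * bT * norm v" for v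
  proof -
   have "\<bar>L0 (T v)\<bar> <= B * norm (T v)" unfolding L0_def by (rule B(2)[OF y1c])
   also have "... <= B * (bT * norm v)" using B(1) bT(2) by simp
   finally show ?thesis by (simp add: mult.assoc)
  qed
  have Hb: "\<bar>H v w\<bar> <= B * bT^2 * norm v * norm w" for v w
  proof -
   have "\<bar>H v w\<bar> <= B * (norm (T v) * norm (T w))" unfolding H_def H0_def using B(3)[OF y1c] by (simp add: mult.assoc)
   also have "... <= B * ((bT * norm v) * (bT * norm w))" using B(1) bT by (intro mult_left_mono mult_mono) auto
   finally show ?thesis by (simp add: power2_eq_square mult_ac)
  qed
  have pP: "norm (p - fst P) <= k * (real CARD('n) * (B * bT))"
  proof -
   have "norm (p - fst P) <= (\<Sum>i\<in>UNIV. \<bar>(p - fst P) $ i\<bar>)" by (rule norm_le_l1_cart)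
   also have "... <= (\<Sum>i\<in>(UNIV::'n set). k * (B * bT))"
   proof (rule sum_mono)
    fix i :: 'n
    have "(p - fst P) $ i = k * L0 (T (axis i 1, 0))" by (simp add: p_def L_def inner_Pair_0 inner_axis)
    then show "\<bar>(p - fst P) $ i\<bar> <= k * (B * bT)"
     using L0b[of "(axis i 1, 0)"] k by (simp add: abs_mult norm_Pair)
   qed
   finally show ?thesis by (simp add: mult_ac)
  qed
  moreover have "snd P - k * (B * bT) <= l + \<kappa> * (2 * C * ?N) + c * (2 * (B * bT^2) * norm (sgn p - e))" if p0: "p ~= 0"
  proof -
   have "a <= c * ((\<Sum>i\<in>UNIV. H (axis i 1, 0) (axis i 1, 0)) - H (sgn p, 0) (sgn p, 0))"
    using ts z1b p0 Lp linH se max unfolding tested_def by blast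
   moreover have "a >= snd P - k * (B * bT)"
   proof -
    have "a = snd P + k * L0 (T (0, 1))" by (simp add: a_def L_def inner_Pair_0 inner_prod_def)
    moreover have "\<bar>L0 (T (0, 1))\<bar> <= B * bT" using L0b[of "(0, 1)"] by (simp add: norm_Pair)
    ultimately show ?thesis using k mult_left_mono[of "- L0 (T (0, 1))" "B * bT" k] by (simp add: abs_le_iff)
   qed
   moreover have "H (e, 0) (e, 0) - H (sgn p, 0) (sgn p, 0) <= 2 * (B * bT^2) * norm (sgn p - e)"
   proof -
    have "(e, 0) - (sgn p, 0) = (e - sgn p, 0::real)" by simp
    then have "H (e, 0) (e, 0) - H (sgn p, 0) (sgn p, 0) = H (e - sgn p, 0) (e, 0) + H (sgn p, 0) (e - sgn p, 0)"
     using linear_diff[OF linH(2), of "(e, 0)" "(sgn p, 0)"] linear_diff[OF linH(1), of _ "(e, 0)" "(sgn p, 0)"] by simp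
    also have "... <= B * bT^2 * norm (sgn p - e) + B * bT^2 * norm (sgn p - e)"
     using Hb[of "(e - sgn p, 0)" "(e, 0)"] Hb[of "(sgn p, 0)" "(e - sgn p, 0)"] e p0
     by (intro add_mono) (auto simp: norm_Pair norm_sgn norm_minus_commute)
    finally show ?thesis by simp
   qed
   \<comment> \<open>By \<open>frame_trace\<close>, \<open>l\<close> is the limit operator applied
     to \<open>H\<close> plus \<open>\<kappa>\<close> times the full trace, and every diagonal entry
     is at least \<open>- 2 * C\<close>.\<close>
   moreover have "c * ((\<Sum>i\<in>UNIV. H (axis i 1, 0) (axis i 1, 0)) - H (e, 0) (e, 0)) <= l + \<kappa> * (2 * C * ?N)"
   proof -
    have "l = (\<Sum>b\<in>Basis. H (frame \<sigma> s e b) (frame \<sigma> s e b))"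
     using q(2)[of y1] ST(2) by (simp add: laplacian_def H_def H0_def S \<sigma>_def s_def e_def)
    also have "... = c * ((\<Sum>i\<in>UNIV. H (axis i 1, 0) (axis i 1, 0)) - H (e, 0) (e, 0)) + \<kappa> * (\<Sum>b\<in>Basis. H b b)"
     unfolding frame_trace[OF linH e] \<sigma>s(3) unfolding \<sigma>s(4) ..
    finally have "l = c * ((\<Sum>i\<in>UNIV. H (axis i 1, 0) (axis i 1, 0)) - H (e, 0) (e, 0)) + \<kappa> * (\<Sum>b\<in>Basis. H b b)" .
    moreover have "(\<Sum>b\<in>Basis. H b b) >= (\<Sum>b\<in>(Basis::((real^'n) * real) set). - 2 * C)"
     using Hlow by (intro sum_mono) (metis mult.right_neutral norm_Basis one_power2)
    then have "\<kappa> * (\<Sum>b\<in>Basis. H b b) >= \<kappa> * (- (2 * C * ?N))"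
     using \<kappa> by (intro mult_left_mono) (simp_all add: mult.commute)
    ultimately show ?thesis by simp
   qed
   ultimately show ?thesis
    using mult_left_mono[OF _ c, of "H (e, 0) (e, 0) - H (sgn p, 0) (sgn p, 0)" "2 * (B * bT^2) * norm (sgn p - e)"]
    by (simp add: algebra_simps)
  qed
  ultimately show ?thesis unfolding k_def by blast
 qed
 have lim0: "(%n. \<rho> n * x) \<longlonglongrightarrow> 0" for x using tendsto_mult_right[OF \<rho>(2), of x] by simp
 have "\<forall>\<^sub>F n in sequentially. \<rho> n * bS < r" using lim0[of bS] r by (rule order_tendstoD(2))
 then have "\<forall>\<^sub>F n in sequentially. \<exists>p. norm (p - fst P) <= \<rho> n * (real CARD('n) * (B * bT)) & (p ~= 0 -->
   snd P - \<rho> n * (B * bT) <= l + \<kappa> * (2 * C * ?N) + c * (2 * (B * bT^2) * norm (sgn p - e)))"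
  using touch by eventually_elim (rule step)
 then obtain p where p: "\<forall>\<^sub>F n in sequentially. norm (p n - fst P) <= \<rho> n * (real CARD('n) * (B * bT)) & (p n ~= 0 -->
   snd P - \<rho> n * (B * bT) <= l + \<kappa> * (2 * C * ?N) + c * (2 * (B * bT^2) * norm (sgn (p n) - e)))"
  unfolding eventually_sequentially by metis
 have "(%n. p n - fst P) \<longlonglongrightarrow> 0"
  by (rule Lim_null_comparison[OF _ lim0[of "real CARD('n) * (B * bT)"]]) (use p in eventually_elim, simp)
 then have plim: "p \<longlonglongrightarrow> fst P" by (simp add: LIM_zero_iff)
 have "(%n. norm (sgn (p n) - e)) \<longlonglongrightarrow> norm (e - e)"
  unfolding e_def by (intro tendsto_intros plim P)
 then have "(%n. l + \<kappa> * (2 * C * ?N) + c * (2 * (B * bT^2) * norm (sgn (p n) - e))) \<longlonglongrightarrow> l + \<kappa> * (2 * C * ?N) + c * (2 * (B * bT^2) * 0)"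
  by (intro tendsto_intros) simp
 moreover have "(%n. snd P - \<rho> n * (B * bT)) \<longlonglongrightarrow> snd P - 0" by (intro tendsto_intros lim0)
 moreover have "\<forall>\<^sub>F n in sequentially. snd P - \<rho> n * (B * bT) <= l + \<kappa> * (2 * C * ?N) + c * (2 * (B * bT^2) * norm (sgn (p n) - e))"
  using p tendsto_imp_eventually_ne[OF plim P] by eventually_elim blast
 ultimately have "snd P - 0 <= l + \<kappa> * (2 * C * ?N) + c * (2 * (B * bT^2) * 0)"
  by (rule tendsto_le[OF trivial_limit_sequentially])
 then show ?thesis by simp
qed

text \<open>The supporting paraboloid at \<open>y\<close>, evaluated one unit beyond
  \<open>y\<close> in the direction away from \<open>y'\<close>, bounds the slope towards
  \<open>y'\<close>; this is why bounds on the ball of radius 2 give a Lipschitz constant on the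
  unit ball.\<close>

lemma semiconvex_lipschitz:
 fixes V :: "'a::real_inner => real"
 assumes sc: "semiconvex C V (cball 0 2)" and b: "!!y. y \<in> cball 0 2 ==> \<bar>V y\<bar> <= M" and C: "C >= 0"
  and y: "y \<in> cball 0 1" "y' \<in> cball 0 1"
 shows "\<bar>V y - V y'\<bar> <= (2 * M + 3 * C) * norm (y - y')"
proof -
 have one: "V y - V y' <= (2 * M + 3 * C) * norm (y - y')" if y: "y \<in> cball 0 1" "y' \<in> cball 0 1" for y y'
 proof (cases "y = y'")
  case False
  have sub: "y \<in> cball 0 2" "y' \<in> cball 0 2" using y by auto
  obtain g where g: "!!w. w \<in> cball 0 2 ==> V w >= V y + g \<bullet> (w - y) - C * (norm (w - y))^2"
   using sc sub(1) unfolding semiconvex_def by blast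
  define d where "d = norm (y - y')"
  have d: "d > 0" using False by (simp add: d_def)
  have d2: "d <= 2" using norm_triangle_ineq4[of y y'] y by (simp add: d_def)
  define v where "v = sgn (y - y')"
  have v: "norm v = 1" "y - y' = d *\<^sub>R v" using False d by (auto simp: v_def norm_sgn sgn_div_norm d_def)
  have yv: "y + v \<in> cball 0 2" using norm_triangle_ineq[of y v] y v by simp
  have "g \<bullet> v <= V (y + v) - V y + C" using g[OF yv] v by simp
  also have "... <= 2 * M + C" using b[OF yv] b[OF sub(1)] by linarith
  finally have gv: "g \<bullet> v <= 2 * M + C" .
  have "y' - y = - (d *\<^sub>R v)" using v(2) by (simp add: algebra_simps)
  then have "g \<bullet> (y' - y) = - (d * (g \<bullet> v))" by simp
  then have "V y - V y' <= d * (g \<bullet> v) + C * d^2"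
   using g[OF sub(2)] unfolding d_def norm_minus_commute[of y y'] by simp
  also have "... <= d * (2 * M + C) + C * (2 * d)"
   using gv d d2 C by (intro add_mono mult_left_mono) (auto simp: power2_eq_square)
  finally show ?thesis by (simp add: d_def algebra_simps)
 qed simp
 show ?thesis using one[OF y] one[OF y(2,1)] by (simp add: norm_minus_commute)
qed

text \<open>The division by \<open>\<rho>^2\<close> exactly compensates the scaling of the
  paraboloids, so the constant does not depend on \<open>\<rho>\<close>.\<close>

lemma blow_up_semiconvex:
 fixes U :: "'a::euclidean_space => real"
 assumes sc: "semiconvex C U (ball z0 r)" and S: "linear S" "!!v. norm (S v) <= b * norm v"
  and \<rho>: "\<rho> > 0" "\<rho> * (2 * b) < r" and C: "C >= 0" and b: "b > 0"
 shows "semiconvex (C * b^2) (blow_up U z0 P S \<rho>) (cball 0 2)" unfolding semiconvex_def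
proof
 have inb: "z0 + \<rho> *\<^sub>R S y \<in> ball z0 r" if "y \<in> cball 0 2" for y
 proof -
  have "\<rho> * norm (S y) <= \<rho> * (b * norm y)" using S(2) \<rho> by simp
  also have "... <= \<rho> * (b * 2)" using that b \<rho> by simp
  finally have "\<rho> * norm (S y) < r" using \<rho>(2) by linarith
  then show ?thesis using \<rho> by (simp add: dist_norm)
 qed
 fix y :: 'a assume y: "y \<in> cball 0 2"
 obtain P' where P': "!!w. w \<in> ball z0 r ==> U w >= U (z0 + \<rho> *\<^sub>R S y) + P' \<bullet> (w - (z0 + \<rho> *\<^sub>R S y)) - C * (norm (w - (z0 + \<rho> *\<^sub>R S y)))^2"
  using sc inb[OF y] unfolding semiconvex_def by blast
 show "\<exists>Q. \<forall>w\<in>cball 0 2. blow_up U z0 P S \<rho> w >= blow_up U z0 P S \<rho> y + Q \<bullet> (w - y) - C * b^2 * (norm (w - y))^2"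
 proof (intro exI[of _ "adjoint S ((1 / \<rho>) *\<^sub>R (P' - P))"] ballI)
  fix w :: 'a assume w: "w \<in> cball 0 2"
  have e: "z0 + \<rho> *\<^sub>R S w - (z0 + \<rho> *\<^sub>R S y) = \<rho> *\<^sub>R S (w - y)" by (simp add: linear_diff[OF S(1)] algebra_simps)
  have a: "adjoint S ((1 / \<rho>) *\<^sub>R (P' - P)) \<bullet> (w - y) = (1 / \<rho>) * ((P' - P) \<bullet> S (w - y))"
   using adjoint_works[OF S(1), of "w - y" "(1 / \<rho>) *\<^sub>R (P' - P)"] by (simp add: inner_commute)
  have "C * (\<rho>^2 * (norm (S (w - y)))^2) <= C * (\<rho>^2 * (b * norm (w - y))^2)"
   using C S(2) by (intro mult_left_mono power_mono) auto
  then have A: "U (z0 + \<rho> *\<^sub>R S w) >= U (z0 + \<rho> *\<^sub>R S y) + \<rho> * (P' \<bullet> S (w - y)) - \<rho>^2 * (C * b^2 * (norm (w - y))^2)"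
   using P'[OF inb[OF w]] \<rho> unfolding e by (simp add: power_mult_distrib mult_ac)
  then have *: "\<rho>^2 * (blow_up U z0 P S \<rho> y + (1 / \<rho>) * ((P' - P) \<bullet> S (w - y)) - C * b^2 * (norm (w - y))^2) <= \<rho>^2 * blow_up U z0 P S \<rho> w"
  proof -
   have bw: "\<rho>^2 * blow_up U z0 P S \<rho> v = U (z0 + \<rho> *\<^sub>R S v) - U z0 - \<rho> * (P \<bullet> S v)" for v
    using \<rho> by (simp add: blow_up_def)
   have "\<rho>^2 * ((1 / \<rho>) * ((P' - P) \<bullet> S (w - y))) = \<rho> * (P' \<bullet> S (w - y)) - \<rho> * (P \<bullet> S w) + \<rho> * (P \<bullet> S y)"
    using \<rho> by (simp add: power2_eq_square linear_diff[OF S(1)] inner_diff_left inner_diff_right algebra_simps)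
   with A show ?thesis unfolding distrib_left right_diff_distrib bw by linarith
  qed    from * show "blow_up U z0 P S \<rho> w >= blow_up U z0 P S \<rho> y + adjoint S ((1 / \<rho>) *\<^sub>R (P' - P)) \<bullet> (w - y) - C * b^2 * (norm (w - y))^2"
   unfolding a using \<rho> by simp
 qed
qed

lemma blow_up_bound:
 fixes U :: "'a::euclidean_space => real"
 assumes lo: "!!z. z \<in> ball z0 r ==> U z >= U z0 + P \<bullet> (z - z0) - C * (norm (z - z0))^2"
  and hi: "!!z. z \<in> ball z0 r ==> U z <= U z0 + P \<bullet> (z - z0) + C * (norm (z - z0))^2"
  and S: "!!v. norm (S v) <= b * norm v"
  and \<rho>: "\<rho> > 0" "\<rho> * (2 * b) < r" and C: "C >= 0" and b: "b > 0" and y: "y \<in> cball 0 2"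
 shows "\<bar>blow_up U z0 P S \<rho> y\<bar> <= C * (2 * b)^2"
proof -
 have "b * norm y <= b * 2" using y b by (intro mult_left_mono) auto
 then have Sy: "norm (S y) <= 2 * b" using S[of y] by linarith
 have "\<rho> * norm (S y) <= \<rho> * (2 * b)" using Sy \<rho> by simp
 then have "\<rho> * norm (S y) < r" using \<rho>(2) by linarith
 then have z: "z0 + \<rho> *\<^sub>R S y \<in> ball z0 r" using \<rho> by (simp add: dist_norm)
 have "C * (\<rho>^2 * (norm (S y))^2) <= C * (\<rho>^2 * (2 * b)^2)"
  using C Sy by (intro mult_left_mono power_mono) auto
 then have "\<bar>\<rho>^2 * blow_up U z0 P S \<rho> y\<bar> <= \<rho>^2 * (C * (2 * b)^2)"
  using lo[OF z] hi[OF z] \<rho> by (simp add: blow_up_def power_mult_distrib abs_le_iff mult_ac)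
 then show ?thesis using \<rho> by (simp add: abs_mult)
qed

lemma interior_maximum:
 fixes V :: "'a::euclidean_space => real"
 assumes "continuous_on (cball 0 1) V" "!!y. norm y = 1 ==> V y < V 0"
 shows "\<exists>y\<in>ball 0 1. \<forall>y'\<in>cball 0 1. V y' <= V y"
proof -
 obtain y where y: "y \<in> cball 0 1" "!!y'. y' \<in> cball 0 1 ==> V y' <= V y"
  using continuous_attains_sup[OF compact_cball _ assms(1)] by (metis cball_eq_empty less_numeral_extra(1) not_one_less_zero)
 have "norm y ~= 1" using assms(2)[of y] y(2)[of 0] by auto
 then have "y \<in> ball 0 1" using y(1) by simp
 then show ?thesis using y(2) by blast
qed

text \<open>The upper bound for the sum makes the blow-ups of \<open>U\<close> precompact. A harmonic function that is close to
 their limit on the unit sphere, corrected by a multiple of the squared distance, touches the blow-ups of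
 \<open>U\<close> or of \<open>W\<close> from above in the interior of the ball, according to its sign at the centre.\<close>

lemma blow_up_contradiction:
 fixes U W :: "(real^'n) * real => real"
 assumes tU: "tested c U (ball z0 r)" and tW: "tested c W (ball z0 r)"
  and sU: "semiconvex C U (ball z0 r)" and sW: "semiconvex C W (ball z0 r)"
  and lU: "!!z. z \<in> ball z0 r ==> U z >= U z0 + P \<bullet> (z - z0) - C * (norm (z - z0))^2"
  and lW: "!!z. z \<in> ball z0 r ==> W z >= W z0 + Q \<bullet> (z - z0) - C * (norm (z - z0))^2"
  and mx: "!!z. z \<in> ball z0 r ==> U z + W z <= U z0 + W z0 + \<alpha> * (snd z - snd z0) + C * (snd z - snd z0)^2"
  and C: "C >= 0" and r: "r > 0" and c: "c >= 0" and \<alpha>: "\<alpha> > 0"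
  and PQ: "P + Q = (0, \<alpha>)" and P: "fst P ~= 0"
 shows False
proof -
 let ?N = "real DIM((real^'n) * real)"
 have N: "?N >= 1" by simp
 have Q: "fst Q = - fst P" "snd P + snd Q = \<alpha>" using PQ by (auto simp: prod_eq_iff eq_neg_iff_add_eq_0 add.commute)
 have PQi: "P \<bullet> v + Q \<bullet> v = \<alpha> * snd v" for v
  using PQ by (metis inner_add_left inner_Pair_0(1) fst_conv snd_conv inner_zero_left add_0 inner_prod_def inner_real_def)
 \<comment> \<open>Makes both the artificial diffusion \<open>\<kappa> * (2 * C * N)\<close>, with
   \<open>N\<close> the space-time dimension, and the error \<open>C * \<kappa>\<close> in the sum
   of the blow-ups at most \<open>\<alpha> / (16 * N)\<close>.\<close>
 define \<kappa> where "\<kappa> = \<alpha> / (16 * ?N * (2 * C * ?N + C + 1))"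
 have den: "2 * C * ?N + C + 1 >= 1" using C by simp
 have \<kappa>: "\<kappa> > 0" using \<alpha> den N by (simp add: \<kappa>_def)
 have \<kappa>eq: "\<kappa> * (2 * C * ?N + C + 1) = \<alpha> / (16 * ?N)"
  using den N unfolding \<kappa>_def by (metis (no_types, lifting) divide_divide_eq_left mult.commute nonzero_eq_divide_eq not_one_le_zero)
 have \<kappa>1: "\<kappa> * (2 * C * ?N) <= \<alpha> / (16 * ?N)" "\<kappa> * C <= \<alpha> / (16 * ?N)"
  unfolding \<kappa>eq[symmetric] using \<kappa> C by (auto intro!: mult_left_mono)
 have \<kappa>2: "\<alpha> / (16 * ?N) <= \<alpha> / 16" using \<alpha> N by (intro divide_left_mono) auto
 define S where "S = frame (sqrt (c + \<kappa>)) (sqrt \<kappa>) (sgn (fst P))"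
 \<comment> \<open>The spatial gradients of \<open>U\<close> and \<open>W\<close> are opposite, and
   \<open>frame\<close> depends on its unit vector only up to sign, so one change of variables
   serves both.\<close>
 have SQ: "S = frame (sqrt (c + \<kappa>)) (sqrt \<kappa>) (sgn (fst Q))"
  by (simp add: S_def Q sgn_minus frame_uminus)
 have lin: "linear S" by (simp add: S_def linear_frame)
 obtain b where b: "b > 0" "!!v. norm (S v) <= b * norm v" using linear_bounded_pos[OF lin] by blast
 define \<rho> where "\<rho> n = r / (4 * b) * inverse (real (Suc n))" for n
 have \<rho>: "\<rho> n > 0" "\<rho> n * (2 * b) < r" for n
 proof -
  show "\<rho> n > 0" using r b by (simp add: \<rho>_def)
  have "\<rho> n * (2 * b) = r / 2 * inverse (real (Suc n))" using b by (simp add: \<rho>_def)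
  also have "... <= r / 2 * 1" using r by (intro mult_left_mono) (auto simp: inverse_le_1_iff)
  finally show "\<rho> n * (2 * b) < r" using r by simp
 qed
 have \<rho>0: "\<rho> \<longlonglongrightarrow> 0"
  using tendsto_mult_left[OF LIMSEQ_inverse_real_of_nat, of "r / (4 * b)"] unfolding \<rho>_def[abs_def] mult_zero_right .
 have snd2: "C * (snd z - snd z0)^2 <= C * (norm (z - z0))^2" for z :: "(real^'n) * real"
 proof -
  have "\<bar>snd z - snd z0\<bar> <= norm (z - z0)" using dist_snd_le[of z z0] by (simp add: dist_norm)
  then have "\<bar>snd z - snd z0\<bar>\<^sup>2 <= (norm (z - z0))^2" by (rule power_mono) simp
  then show ?thesis using C by (intro mult_left_mono) auto
 qed
 \<comment> \<open>The upper bound for the sum minus the lower bound for \<open>W\<close> bounds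
   \<open>U\<close> from above: both functions are squeezed between paraboloids with the same affine
   part.\<close>
 have hU: "U z <= U z0 + P \<bullet> (z - z0) + 2 * C * (norm (z - z0))^2" if "z \<in> ball z0 r" for z
  using mx[OF that] lW[OF that] PQi[of "z - z0"] snd2[of z] by simp
 have hW: "W z <= W z0 + Q \<bullet> (z - z0) + 2 * C * (norm (z - z0))^2" if "z \<in> ball z0 r" for z
  using mx[OF that] lU[OF that] PQi[of "z - z0"] snd2[of z] by simp
 have nn: "C * (norm (z - z0))^2 >= 0" for z using C by simp
 have lU': "U z >= U z0 + P \<bullet> (z - z0) - 2 * C * (norm (z - z0))^2" if "z \<in> ball z0 r" for z
  using lU[OF that] nn[of z] by simp
 have lW': "W z >= W z0 + Q \<bullet> (z - z0) - 2 * C * (norm (z - z0))^2" if "z \<in> ball z0 r" for z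
  using lW[OF that] nn[of z] by simp
 have C2: "2 * C >= 0" using C by simp
 define M where "M = 2 * C * (2 * b)^2"
 define K where "K = 2 * M + 3 * (C * b^2)"
 let ?u = "%n. blow_up U z0 P S (\<rho> n)" and ?w = "%n. blow_up W z0 Q S (\<rho> n)"
 have bU: "\<bar>?u n y\<bar> <= M" if "y \<in> cball 0 2" for n y
  unfolding M_def by (rule blow_up_bound[OF lU' hU b(2) \<rho> C2 b(1) that])
 have bW: "\<bar>?w n y\<bar> <= M" if "y \<in> cball 0 2" for n y
  unfolding M_def by (rule blow_up_bound[OF lW' hW b(2) \<rho> C2 b(1) that])
 have Cb: "C * b^2 >= 0" using C by simp
 have LU: "\<bar>?u n y - ?u n y'\<bar> <= K * norm (y - y')" if "y \<in> cball 0 1" "y' \<in> cball 0 1" for n y y'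
  unfolding K_def by (rule semiconvex_lipschitz[OF blow_up_semiconvex[OF sU lin b(2) \<rho> C b(1)] bU Cb that])
 have LW: "\<bar>?w n y - ?w n y'\<bar> <= K * norm (y - y')" if "y \<in> cball 0 1" "y' \<in> cball 0 1" for n y y'
  unfolding K_def by (rule semiconvex_lipschitz[OF blow_up_semiconvex[OF sW lin b(2) \<rho> C b(1)] bW Cb that])
 have K: "K >= 0" using C by (simp add: K_def M_def)
 have equi: "\<exists>d>0. \<forall>y'. y' \<in> cball 0 1 & norm (y - y') < d --> K * norm (y - y') < e" if "e > 0" for y :: "(real^'n) * real" and e
 proof (intro exI[of _ "e / (K + 1)"] conjI allI impI)
  show "e / (K + 1) > 0" using that K by simp
  fix y' :: "(real^'n) * real" assume "y' \<in> cball 0 1 & norm (y - y') < e / (K + 1)"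
  then have "(K + 1) * norm (y - y') < e" using K by (simp add: pos_less_divide_eq mult.commute)
  moreover have "(K + 1) * norm (y - y') = K * norm (y - y') + norm (y - y')" by (simp add: algebra_simps)
  ultimately show "K * norm (y - y') < e" using norm_ge_zero[of "y - y'"] by linarith
 qed
 have cont: "continuous_on (cball 0 1) (?u n)" "continuous_on (cball 0 1) (?w n)" for n
 proof -
  have "K-lipschitz_on (cball 0 1) (?u n)" "K-lipschitz_on (cball 0 1) (?w n)"
   using LU LW K by (auto simp: lipschitz_on_def dist_norm)
  then show "continuous_on (cball 0 1) (?u n)" "continuous_on (cball 0 1) (?w n)"
   by (auto intro: lipschitz_on_continuous_on)
 qed
 have sph: "y \<in> cball 0 1" "y \<in> cball 0 2" if "y \<in> sphere 0 1" for y :: "(real^'n) * real" using that by auto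
 \<comment> \<open>The limit is taken on the unit sphere only: a maximum is forced into the interior
   by comparing boundary values with the centre, where every blow-up vanishes.\<close>
 obtain g k where g: "continuous_on (sphere 0 1) g" and k: "strict_mono (k :: nat => nat)"
  and gk: "!!e. 0 < e ==> \<exists>N. \<forall>n x. n >= N & x \<in> sphere 0 1 --> norm (?u (k n) x - g x) < e"
 proof (rule Arzela_Ascoli[of "sphere 0 1" "%n. ?u n" M])
  show "compact (sphere (0::(real^'n) * real) 1)" by simp
  show "norm (?u n y) <= M" if "y \<in> sphere 0 1" for n y using bU[OF sph(2)[OF that]] by simp
  fix y :: "(real^'n) * real" and e :: real assume y: "y \<in> sphere 0 1" and e: "0 < e"
  obtain d where d: "d > 0" "!!y'. y' \<in> cball 0 1 ==> norm (y - y') < d ==> K * norm (y - y') < e"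
   using equi[OF e, of y] by blast
  have "norm (?u n y - ?u n y') < e" if "y' \<in> sphere 0 1" "norm (y - y') < d" for n y'
   using LU[OF sph(1)[OF y] sph(1)[OF that(1)], of n] d(2)[OF sph(1)[OF that(1)] that(2)] by simp
  then show "\<exists>d. 0 < d & (\<forall>n y'. y' \<in> sphere 0 1 & norm (y - y') < d --> norm (?u n y - ?u n y') < e)"
   using d(1) by blast
 qed blast
 define \<delta> where "\<delta> = \<alpha> / (64 * ?N)"
 have \<delta>: "\<delta> > 0" using \<alpha> N by (simp add: \<delta>_def)
 obtain h where h: "smooth_on UNIV h" "!!y. laplacian h y = 0" "!!y. norm y = 1 ==> \<bar>h y - g y\<bar> < \<delta>"
  using harmonic_approximation[OF g \<delta>] by blast
 have \<rho>k: "\<rho> (k n) > 0" "(%n. \<rho> (k n)) \<longlonglongrightarrow> 0" for n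
  using \<rho>(1) LIMSEQ_subseq_LIMSEQ[OF \<rho>0 k] by (auto simp: o_def)
 have close: "\<forall>\<^sub>F n in sequentially. \<forall>y. norm y = 1 --> \<bar>?u (k n) y - h y\<bar> < 2 * \<delta>"
 proof -
  obtain N where N: "!!n x. n >= N ==> x \<in> sphere 0 1 ==> norm (?u (k n) x - g x) < \<delta>" using gk[OF \<delta>] by blast
  have "\<bar>?u (k n) y - h y\<bar> < 2 * \<delta>" if "n >= N" "norm y = 1" for n y
   using N[OF that(1), of y] h(3)[OF that(2)] that(2) by (simp add: abs_less_iff)
  then show ?thesis unfolding eventually_sequentially by blast
 qed
 \<comment> \<open>The corresponding quadratics have Laplacian \<open>snd P - \<alpha> / 4\<close>
   and \<open>snd Q - \<alpha> / 4\<close>, so touching either blow-up from above is contradictory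
   once the \<open>\<kappa>\<close> term is below \<open>\<alpha> / 4\<close>. Their sum is still
   positive, since \<open>snd P + snd Q = \<alpha>\<close>.\<close>
 define \<beta> \<beta>' where "\<beta> = (snd P - \<alpha> / 4) / (2 * ?N)" and "\<beta>' = (snd Q - \<alpha> / 4) / (2 * ?N)"
 have \<beta>s: "\<beta> + \<beta>' = \<alpha> / (4 * ?N)"
 proof -
  have "\<beta> + \<beta>' = (snd P + snd Q - \<alpha> / 2) / (2 * ?N)" by (simp add: \<beta>_def \<beta>'_def add_divide_distrib[symmetric])
  then show ?thesis unfolding Q by simp
 qed
 have N\<beta>: "2 * ?N * \<beta> = snd P - \<alpha> / 4" "2 * ?N * \<beta>' = snd Q - \<alpha> / 4"
  using N unfolding \<beta>_def \<beta>'_def by simp_all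
 have sq: "smooth_on UNIV (%y::(real^'n) * real. (y \<bullet> y) ^ Suc 0)"
  by (rule homogeneous_poly_smooth[OF homogeneous_poly_radial])
 have quad: "smooth_on UNIV (%y. s * h y + t * (y \<bullet> y) ^ Suc 0)" "laplacian (%y. s * h y + t * (y \<bullet> y) ^ Suc 0) y = 2 * ?N * t" for s t y
 proof -
  note sm = smooth_on_cmult[OF open_UNIV h(1), of s] smooth_on_cmult[OF open_UNIV sq, of t]
  show "smooth_on UNIV (%y. s * h y + t * (y \<bullet> y) ^ Suc 0)" by (rule smooth_on_add[OF open_UNIV sm])
  show "laplacian (%y. s * h y + t * (y \<bullet> y) ^ Suc 0) y = 2 * ?N * t"
   unfolding laplacian_add[OF sm] laplacian_cmult[OF h(1)] laplacian_cmult[OF sq] laplacian_radial h(2) by simp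
 qed
 have cq: "continuous_on (cball 0 1) (%y. s * h y + t * (y \<bullet> y) ^ Suc 0)" for s t
  by (rule continuous_on_subset[OF smooth_on_imp_continuous_on[OF quad(1)]]) auto
 have zero: "?u n 0 = 0" "?w n 0 = 0" for n by (simp_all add: blow_up_def linear_0[OF lin])
 have yy: "(y \<bullet> y) ^ Suc 0 = 1" if "norm y = 1" for y :: "(real^'n) * real"
  using that by (simp add: power2_norm_eq_inner[symmetric])
 \<comment> \<open>The bound on the sum has an error in time only, and \<open>S\<close> scales time
   by \<open>sqrt \<kappa>\<close>; hence up to \<open>C * \<kappa>\<close> the blow-ups of
   \<open>W\<close> lie below the negatives of those of \<open>U\<close>, and \<open>- h\<close> can
   be used for \<open>W\<close>.\<close>
 have sum: "?u n y + ?w n y <= C * \<kappa>" if y: "norm y = 1" for n y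
 proof -
  have "norm (S y) <= b" using b(2)[of y] y by simp
  then have "\<rho> n * norm (S y) <= \<rho> n * (2 * b)" using \<rho>(1)[of n] b(1) by (intro mult_left_mono) auto
  then have "\<rho> n * norm (S y) < r" using \<rho>(2)[of n] by linarith
  then have z: "z0 + \<rho> n *\<^sub>R S y \<in> ball z0 r" using \<rho>(1)[of n] by (simp add: dist_norm)
  have "\<rho> n * (P \<bullet> S y) + \<rho> n * (Q \<bullet> S y) = \<alpha> * (\<rho> n * snd (S y))"
   using PQi[of "S y"] by (metis distrib_left mult.left_commute)
  then have "(\<rho> n)^2 * (?u n y + ?w n y) <= C * (\<rho> n * snd (S y))^2"
   using mx[OF z] \<rho>(1)[of n] by (simp add: blow_up_def add_divide_distrib[symmetric])
  also have "... = (\<rho> n)^2 * (C * (\<kappa> * (snd y)^2))"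
   using \<kappa> by (simp add: S_def frame_def power_mult_distrib)
  finally have "?u n y + ?w n y <= C * (\<kappa> * (snd y)^2)" using \<rho>(1)[of n] by simp
  also have "... <= C * (\<kappa> * 1)"
  proof -
   have "\<bar>snd y\<bar> <= 1" using dist_snd_le[of y 0] y by simp
   then have "(snd y)^2 <= 1" by (simp add: abs_square_le_1)
   then show ?thesis using C \<kappa> by (intro mult_left_mono) auto
  qed
  finally show ?thesis by simp
 qed
 have \<delta>4: "4 * \<delta> = \<alpha> / (16 * ?N)" using N unfolding \<delta>_def by (simp add: field_simps)
 have quarter: "\<alpha> / (4 * ?N) = 4 * (\<alpha> / (16 * ?N))" using N by (simp add: field_simps)
 have pos16: "\<alpha> / (16 * ?N) > 0" using \<alpha> N by simp
 \<comment> \<open>If both failed, adding them would give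
   \<open>\<beta> + \<beta>' \<le> 4 * \<delta> + C * \<kappa>\<close>, but the left side is four
   times \<open>\<alpha> / (16 * N)\<close> and the right side at most twice that.\<close>
 consider "- h 0 > 2 * \<delta> - \<beta>" | "h 0 > 2 * \<delta> + C * \<kappa> - \<beta>'"
  using \<beta>s \<delta>4 \<kappa>1(2) quarter pos16 by (smt (verit) mult.commute)
 then show False
 proof cases
  case 1
  have "\<forall>\<^sub>F n in sequentially. \<exists>y\<in>ball 0 1. \<forall>y'\<in>cball 0 1.
    ?u (k n) y' - (1 * h y' + \<beta> * (y' \<bullet> y') ^ Suc 0) <= ?u (k n) y - (1 * h y + \<beta> * (y \<bullet> y) ^ Suc 0)"
   using close
  proof eventually_elim
   case (elim n)
   show ?case
   proof (rule interior_maximum)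
    show "continuous_on (cball 0 1) (%y. ?u (k n) y - (1 * h y + \<beta> * (y \<bullet> y) ^ Suc 0))"
     by (intro continuous_on_diff cont cq)
    fix y :: "(real^'n) * real" assume y: "norm y = 1"
    have "\<bar>?u (k n) y - h y\<bar> < 2 * \<delta>" using elim y by blast
    then show "?u (k n) y - (1 * h y + \<beta> * (y \<bullet> y) ^ Suc 0) < ?u (k n) 0 - (1 * h 0 + \<beta> * (0 \<bullet> 0) ^ Suc 0)"
     unfolding yy[OF y] zero using 1 by simp
   qed
  qed
  from blow_up_touching[OF tU sU r c P \<kappa> quad \<rho>k S_def this]
  have "snd P <= 2 * ?N * \<beta> + \<kappa> * (2 * C * ?N)" .
  then show False using N\<beta>(1) \<kappa>1(1) \<kappa>2 \<alpha> by linarith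
 next
  case 2
  have "\<forall>\<^sub>F n in sequentially. \<exists>y\<in>ball 0 1. \<forall>y'\<in>cball 0 1.
    ?w (k n) y' - (- 1 * h y' + \<beta>' * (y' \<bullet> y') ^ Suc 0) <= ?w (k n) y - (- 1 * h y + \<beta>' * (y \<bullet> y) ^ Suc 0)"
   using close
  proof eventually_elim
   case (elim n)
   show ?case
   proof (rule interior_maximum)
    show "continuous_on (cball 0 1) (%y. ?w (k n) y - (- 1 * h y + \<beta>' * (y \<bullet> y) ^ Suc 0))"
     by (intro continuous_on_diff cont cq)
    fix y :: "(real^'n) * real" assume y: "norm y = 1"
    have "\<bar>?u (k n) y - h y\<bar> < 2 * \<delta>" using elim y by blast
    then show "?w (k n) y - (- 1 * h y + \<beta>' * (y \<bullet> y) ^ Suc 0) < ?w (k n) 0 - (- 1 * h 0 + \<beta>' * (0 \<bullet> 0) ^ Suc 0)"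
     unfolding yy[OF y] zero using 2 sum[OF y, of "k n"] by (simp add: abs_less_iff)
   qed
  qed
  moreover have "fst Q ~= 0" using Q P by simp
  ultimately have "snd Q <= 2 * ?N * \<beta>' + \<kappa> * (2 * C * ?N)"
   using blow_up_touching[OF tW sW r c _ \<kappa> quad \<rho>k SQ] by blast
  then show False using N\<beta>(2) \<kappa>1(1) \<kappa>2 \<alpha> by linarith
 qed
qed

section \<open>Sup-convolution\<close>

text \<open>Quartic in space, so that where the spatial slope vanishes the penalisation contributes
  no second order spatial term; quadratic in time.\<close>

definition kern :: "(real^'n) * real => real" where
 "kern v = norm (fst v) ^ 4 + (snd v)^2"

definition kern_grad :: "(real^'n) * real => (real^'n) * real" where
 "kern_grad v = ((4 * (norm (fst v))^2) *\<^sub>R fst v, 2 * snd v)"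

lemma norm_fst_snd_le: "norm (fst z) <= norm z" "\<bar>snd z\<bar> <= norm z" for z :: "(real^'n) * real"
 using dist_fst_le[of z 0] dist_snd_le[of z 0] by auto

lemma kern_nonneg: "kern v >= 0"
 by (simp add: kern_def)

text \<open>In the expansion of the quartic part, \<open>2 * D^2\<close> comes from the product of
  the squared norms and \<open>9 * D^2\<close> from the square of the increment \<open>b\<close>;
  the additional 1 belongs to time.\<close>

lemma kern_upper:
 assumes "norm v <= D" "norm h <= D"
 shows "kern (v + h) <= kern v + kern_grad v \<bullet> h + (11 * D^2 + 1) * (norm h)^2"
proof -
 obtain x s y t where v: "v = (x, s)" and h: "h = (y, t)" by fastforce
 have n: "norm x <= D" "norm y <= D" using assms norm_fst_snd_le(1)[of v] norm_fst_snd_le(1)[of h] by (auto simp: v h)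
 have D: "D >= 0" using n norm_ge_zero[of x] by linarith
 have h2: "(norm h)^2 = (norm y)^2 + t^2" by (simp add: h norm_Pair)
 define b where "b = 2 * (x \<bullet> y) + (norm y)^2"
 have b: "\<bar>b\<bar> <= 3 * D * norm y"
 proof -
  have "\<bar>x \<bullet> y\<bar> <= D * norm y" using Cauchy_Schwarz_ineq2[of x y] mult_right_mono[OF n(1), of "norm y"] by simp
  moreover have "(norm y)^2 <= D * norm y" unfolding power2_eq_square using n(2) by (intro mult_right_mono) auto
  moreover have "3 * D * norm y = 2 * (D * norm y) + D * norm y" by simp
  ultimately show ?thesis unfolding b_def using zero_le_power2[of "norm y"] by linarith
 qed
 have "norm (x + y) ^ 4 = ((norm x)^2 + b)^2"
 proof -
  have "(norm (x + y))^2 = (norm x)^2 + b"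
   unfolding power2_norm_eq_inner b_def by (simp add: inner_add_left inner_add_right inner_commute)
  moreover have "norm (x + y) ^ 4 = ((norm (x + y))^2)^2" by simp
  ultimately show ?thesis by simp
 qed
 also have "... = norm x ^ 4 + 2 * (norm x)^2 * b + b^2" by (simp add: power2_sum)
 also have "b^2 <= (3 * D * norm y)^2" using power_mono[OF b, of 2] by simp
 also have "norm x ^ 4 + 2 * (norm x)^2 * b + (3 * D * norm y)^2 =
   norm x ^ 4 + 4 * (norm x)^2 * (x \<bullet> y) + (2 * (norm x)^2 * (norm y)^2 + 9 * D^2 * (norm y)^2)"
  by (simp add: b_def power_mult_distrib algebra_simps)
 also have "2 * (norm x)^2 * (norm y)^2 <= 2 * D^2 * (norm y)^2"
  using n by (intro mult_right_mono mult_left_mono power_mono) auto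
 finally have "norm (x + y) ^ 4 <= norm x ^ 4 + 4 * (norm x)^2 * (x \<bullet> y) + 11 * D^2 * (norm y)^2" by simp
 moreover have "(s + t)^2 = s^2 + 2 * s * t + t^2" by (simp add: power2_sum)
 moreover have "(11 * D^2 + 1) * (norm h)^2 = 11 * D^2 * (norm y)^2 + 11 * D^2 * t^2 + (norm y)^2 + t^2"
  unfolding h2 by (simp add: algebra_simps)
 moreover have "11 * D^2 * t^2 >= 0" "(norm y)^2 >= 0" by simp_all
 moreover have "kern (v + h) = norm (x + y) ^ 4 + (s + t)^2" "kern v = norm x ^ 4 + s^2"
  "kern_grad v \<bullet> h = 4 * (norm x)^2 * (x \<bullet> y) + 2 * s * t"
  by (simp_all add: v h kern_def kern_grad_def)
 ultimately show ?thesis by linarith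
qed

lemma kern_small:
 assumes "kern v < (\<rho> / 2) ^ 4" "0 < \<rho>" "\<rho> <= 1"
 shows "norm v < \<rho>"
proof -
 have "norm (fst v) ^ 4 < (\<rho> / 2) ^ 4" using assms(1) zero_le_power2[of "snd v"] unfolding kern_def by linarith
 then have 1: "norm (fst v) < \<rho> / 2" by (rule power_less_imp_less_base) (use assms(2) in simp)
 have "norm (fst v) ^ 4 >= 0" by simp
 then have "(snd v)^2 < (\<rho> / 2) ^ 4" using assms(1) unfolding kern_def by linarith
 also have "(\<rho> / 2) ^ 4 <= (\<rho> / 2)^2" using assms by (intro power_decreasing) auto
 finally have "\<bar>snd v\<bar> < \<rho> / 2" using assms(2) by (intro power_less_imp_less_base[of "\<bar>snd v\<bar>" 2]) auto
 moreover have "norm v <= norm (fst v) + \<bar>snd v\<bar>" using norm_Pair_le[of "fst v" "snd v"] by simp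
 ultimately show ?thesis using 1 by linarith
qed

text \<open>A maximiser \<open>Y z\<close> is fixed for every \<open>z\<close>, which makes the
  touching points explicit. The radius \<open>D\<close> bounds the arguments of the kernel and
  thereby the opening \<open>curv\<close> of the supporting paraboloids.\<close>

locale sup_convolution =
 fixes u :: "(real^'n) * real => real" and B and Y :: "(real^'n) * real => (real^'n) * real" and \<epsilon> D :: real
 assumes eps: "\<epsilon> > 0" and Y_mem: "Y z \<in> B"
  and Y_max: "y \<in> B ==> u y - kern (z - y) / \<epsilon> <= u (Y z) - kern (z - Y z) / \<epsilon>"
  and B_bounded: "B <= cball 0 D" and D_pos: "D > 0"
begin

definition conv :: "(real^'n) * real => real" where "conv z = u (Y z) - kern (z - Y z) / \<epsilon>"

definition slope :: "(real^'n) * real => (real^'n) * real" where "slope z = - (1 / \<epsilon>) *\<^sub>R kern_grad (z - Y z)"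

definition "curv = (11 * (2 * D)^2 + 1) / \<epsilon>"

lemma curv_nonneg: "curv >= 0"
 using eps by (simp add: curv_def)

lemma conv_ge: "y \<in> B ==> conv z >= u y - kern (z - y) / \<epsilon>"
 by (simp add: conv_def Y_max)

lemma conv_ge_self: "z \<in> B ==> conv z >= u z"
 using conv_ge[of z z] by (simp add: kern_def)

lemma conv_le: "(!!y. y \<in> B ==> u y <= M) ==> conv z <= M"
 using Y_mem[of z] kern_nonneg[of "z - Y z"] eps unfolding conv_def by (smt (verit) divide_nonneg_pos)

lemma diff_Y: "z \<in> cball 0 D ==> norm (z - Y z) <= 2 * D"
 using Y_mem[of z] B_bounded norm_triangle_ineq4[of z "Y z"] by (smt (verit) mem_cball_0 subsetD)

text \<open>The maximiser for \<open>z\<close> is a competitor for \<open>w\<close>, so the kernel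
  centred at \<open>Y z\<close> yields a supporting paraboloid with gradient
  \<open>slope z\<close>.\<close>

lemma conv_lower:
 assumes "z \<in> cball 0 D" "w \<in> cball 0 D"
 shows "conv w >= conv z + slope z \<bullet> (w - z) - curv * (norm (w - z))^2"
proof -
 have "norm (w - z) <= 2 * D" using assms norm_triangle_ineq4[of w z] by simp
 from kern_upper[OF diff_Y[OF assms(1)] this]
 have "kern (w - Y z) <= kern (z - Y z) + kern_grad (z - Y z) \<bullet> (w - z) + (11 * (2 * D)^2 + 1) * (norm (w - z))^2" by simp
 then have "kern (w - Y z) / \<epsilon> <= (kern (z - Y z) + kern_grad (z - Y z) \<bullet> (w - z) + (11 * (2 * D)^2 + 1) * (norm (w - z))^2) / \<epsilon>"
  using eps by (intro divide_right_mono) auto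
 also have "... = kern (z - Y z) / \<epsilon> - slope z \<bullet> (w - z) + curv * (norm (w - z))^2"
  unfolding slope_def curv_def by (simp add: add_divide_distrib distrib_right)
 finally show ?thesis using conv_ge[OF Y_mem[of z], of w] by (simp add: conv_def)
qed

lemma conv_semiconvex:
 assumes "N <= cball 0 D" "curv <= C"
 shows "semiconvex C conv N" unfolding semiconvex_def
proof (intro ballI exI)
 fix z w assume "z \<in> N" "w \<in> N"
 then have "conv w >= conv z + slope z \<bullet> (w - z) - curv * (norm (w - z))^2" using conv_lower assms(1) by blast
 then show "conv w >= conv z + slope z \<bullet> (w - z) - C * (norm (w - z))^2"
  using mult_right_mono[OF assms(2), of "(norm (w - z))^2"] by simp
qed

lemma conv_continuous: "continuous_on (cball 0 D) conv"
proof -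
 define b where "b = (4 * (2 * D)^2 * (2 * D) + 2 * (2 * D)) / \<epsilon>"
 have b: "norm (slope z) <= b" if "z \<in> cball 0 D" for z
 proof -
  define v where "v = z - Y z"
  have v: "norm (fst v) <= 2 * D" "\<bar>snd v\<bar> <= 2 * D"
   using diff_Y[OF that] norm_fst_snd_le[of v] by (auto simp: v_def)
  have "norm (kern_grad v) <= 4 * (norm (fst v))^2 * norm (fst v) + 2 * \<bar>snd v\<bar>"
   using norm_Pair_le[of "(4 * (norm (fst v))^2) *\<^sub>R fst v" "2 * snd v"] by (simp add: kern_grad_def)
  also have "... <= 4 * (2 * D)^2 * (2 * D) + 2 * (2 * D)"
   using v D_pos by (intro add_mono mult_mono power_mono) auto
  finally have "norm (kern_grad v) / \<epsilon> <= b" using eps unfolding b_def by (intro divide_right_mono) auto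
  then show ?thesis using eps by (simp add: slope_def v_def)
 qed
 define K where "K = b + curv * (2 * D)"
 have one: "conv z - conv w <= K * norm (z - w)" if zw: "z \<in> cball 0 D" "w \<in> cball 0 D" for z w
 proof -
  have n: "norm (w - z) <= 2 * D" using zw norm_triangle_ineq4[of w z] by simp
  have "- (slope z \<bullet> (w - z)) <= norm (slope z) * norm (w - z)"
   using Cauchy_Schwarz_ineq2[of "slope z" "w - z"] by linarith
  also have "... <= b * norm (w - z)" using b[OF zw(1)] by (intro mult_right_mono) auto
  finally have "- (slope z \<bullet> (w - z)) <= b * norm (w - z)" .
  moreover have "curv * (norm (w - z))^2 <= curv * (2 * D * norm (w - z))"
   unfolding power2_eq_square using n curv_nonneg by (intro mult_left_mono mult_right_mono) auto
  ultimately have "conv z - conv w <= b * norm (w - z) + curv * (2 * D * norm (w - z))"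
   using conv_lower[OF zw] by linarith
  then show ?thesis by (simp add: K_def algebra_simps norm_minus_commute)
 qed
 have "b >= 0" using b[of 0] D_pos norm_ge_zero[of "slope 0"] by (smt (verit) centre_in_cball)
 then have "K >= 0" using curv_nonneg D_pos by (simp add: K_def)
 then have "K-lipschitz_on (cball 0 D) conv"
 proof (intro lipschitz_onI)
  fix z w :: "(real^'n) * real" assume "z \<in> cball 0 D" "w \<in> cball 0 D"
  then show "dist (conv z) (conv w) <= K * dist z w"
   using one[of z w] one[of w z] by (simp add: dist_norm abs_le_iff norm_minus_commute)
 qed
 then show ?thesis by (rule lipschitz_on_continuous_on)
qed

text \<open>Shifting by \<open>z1 - Y z1\<close> turns a function touching the sup-convolution from above at \<open>z1\<close> into one
 touching \<open>u\<close> at \<open>Y z1\<close>.\<close>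

lemma conv_translate:
 assumes "open V" "V <= B" "Y z1 \<in> V" and ev: "\<forall>\<^sub>F z in nhds z1. conv z <= conv z1 + g (z - z1)"
 shows "\<forall>\<^sub>F y in nhds (Y z1). u y <= u (Y z1) + g (y - Y z1)"
proof -
 let ?d = "z1 - Y z1"
 obtain e where e: "e > 0" "!!z. dist z z1 < e ==> conv z <= conv z1 + g (z - z1)"
  using ev unfolding eventually_nhds_metric by blast
 have "\<forall>\<^sub>F y in nhds (Y z1). y \<in> V" by (rule eventually_nhds_in_open[OF assms(1,3)])
 moreover have "\<forall>\<^sub>F y in nhds (Y z1). dist y (Y z1) < e" using e(1) by (auto simp: eventually_nhds_metric)
 ultimately show ?thesis
 proof eventually_elim
  case (elim y)
  have "dist (y + ?d) z1 < e" using elim(2) by (simp add: dist_norm)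
  from e(2)[OF this] have "conv (y + ?d) <= conv z1 + g (y - Y z1)" by simp
  moreover have "conv (y + ?d) >= u y - kern ?d / \<epsilon>" using conv_ge[of y "y + ?d"] elim(1) assms(2) by auto
  ultimately show ?case by (simp add: conv_def)
 qed
qed

text \<open>A test at \<open>z1\<close> is translated to \<open>Y z1\<close>, where it touches
  \<open>u\<close> with the same derivatives; since the operator does not depend on the point, the
  inequality carries over.\<close>

lemma conv_tested:
 assumes ls: "local_sub c u" and c: "c >= 0"
  and V: "open V" "V <= B" "!!z. z \<in> N ==> Y z \<in> V" "!!y. y \<in> V ==> snd y > 0"
 shows "tested c conv N" unfolding tested_def
proof (intro ballI allI impI)
 fix z1 \<phi> p a L H
 assume z1: "z1 \<in> N" and p: "(p::real^'n) ~= 0" and L: "\<forall>y \<tau>. L (y, \<tau>) = p \<bullet> y + a * \<tau>"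
  and H: "\<forall>v. linear (H v)" "\<forall>w. linear (%v. H v w)" and se: "second_expansion \<phi> z1 L H"
  and ev: "\<forall>\<^sub>F w in nhds z1. conv w - \<phi> w <= conv z1 - \<phi> z1"
 obtain x t where xt: "Y z1 = (x, t)" by fastforce
 have t: "t > 0" using V(4)[OF V(3)[OF z1]] xt by simp
 let ?\<psi> = "%y. \<phi> (y + (z1 - Y z1))"
 have "\<forall>\<^sub>F y in nhds (Y z1). u y <= u (Y z1) + (\<phi> (z1 + (y - Y z1)) - \<phi> z1)"
  by (rule conv_translate[OF V(1,2) V(3)[OF z1]]) (use ev in eventually_elim, simp)
 then have "\<forall>\<^sub>F y in nhds (x, t). u y - ?\<psi> y <= u (x, t) - ?\<psi> (x, t)"
  unfolding xt[symmetric] by eventually_elim (simp add: algebra_simps)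
 moreover have "second_expansion ?\<psi> (x, t) L H" unfolding second_expansion_def xt[symmetric]
 proof (intro allI impI)
  fix e :: real assume "e > 0"
  then obtain d where d: "d > 0" "!!y. dist y z1 < d ==> \<bar>\<phi> y - \<phi> z1 - L (y - z1) - H (y - z1) (y - z1) / 2\<bar> <= e * (norm (y - z1))^2"
   using se unfolding second_expansion_def eventually_nhds_metric by blast
  show "\<forall>\<^sub>F y in nhds (Y z1). \<bar>?\<psi> y - ?\<psi> (Y z1) - L (y - Y z1) - H (y - Y z1) (y - Y z1) / 2\<bar> <= e * (norm (y - Y z1))^2"
   unfolding eventually_nhds_metric
  proof (intro exI[of _ d] conjI allI impI)
   fix y assume "dist y (Y z1) < d"
   then have "dist (y + (z1 - Y z1)) z1 < d" by (simp add: dist_norm)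
   moreover have "y + (z1 - Y z1) - z1 = y - Y z1" by simp
   ultimately show "\<bar>?\<psi> y - ?\<psi> (Y z1) - L (y - Y z1) - H (y - Y z1) (y - Y z1) / 2\<bar> <= e * (norm (y - Y z1))^2"
    using d(2)[of "y + (z1 - Y z1)"] by simp
  qed (use d in simp)
 qed
 ultimately show "a <= c * ((\<Sum>i\<in>UNIV. H (axis i 1, 0) (axis i 1, 0)) - H (sgn p, 0) (sgn p, 0))"
  using local_sub_C2[OF ls c t p] L H by blast
qed

lemma conv_cubic:
 assumes ls: "local_sub c u" and usc: "usc_on space_time u" and c: "c >= 0"
  and V: "open V" "V <= B" "Y z \<in> V" "snd (Y z) > 0"
  and ev: "\<forall>\<^sub>F w in nhds z. conv w <= conv z + a * (snd w - snd z) + C * norm (fst w - fst z) ^ 3 + C * (snd w - snd z)^2"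
 shows "a <= 0"
proof -
 obtain x t where xt: "Y z = (x, t)" by fastforce
 have "\<forall>\<^sub>F y in nhds (Y z). u y <= u (Y z) + (%h. a * snd h + C * norm (fst h) ^ 3 + C * (snd h)^2) (y - Y z)"
  by (rule conv_translate[OF V(1-3)]) (use ev in eventually_elim, simp)
 then have "\<forall>\<^sub>F y in nhds (x, t). u y <= u (x, t) + a * (snd y - t) + C * norm (fst y - x) ^ 3 + C * (snd y - t)^2"
  unfolding xt by eventually_elim simp
 then show ?thesis using local_sub_cubic[OF ls usc c] V(4) xt by simp
qed

text \<open>A vanishing spatial slope means that \<open>z\<close> and \<open>Y z\<close> have the
  same spatial part, so the kernel is purely quartic in space about \<open>z\<close>.\<close>

lemma conv_lower_flat:
 assumes "fst (slope z) = 0"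
 shows "conv w >= conv z + snd (slope z) * (snd w - snd z) - (norm (fst w - fst z) ^ 4 + (snd w - snd z)^2) / \<epsilon>"
proof -
 have f: "fst z = fst (Y z)" using assms eps by (auto simp: slope_def kern_grad_def)
 have "kern (w - Y z) - kern (z - Y z) =
   norm (fst w - fst z) ^ 4 + (snd w - snd z)^2 + 2 * (snd z - snd (Y z)) * (snd w - snd z)"
  by (simp add: kern_def f) (simp add: power2_eq_square algebra_simps)
 then have "(kern (w - Y z) - kern (z - Y z)) / \<epsilon> =
   (norm (fst w - fst z) ^ 4 + (snd w - snd z)^2) / \<epsilon> - snd (slope z) * (snd w - snd z)"
  by (simp add: slope_def kern_grad_def add_divide_distrib)
 then show ?thesis using conv_ge[OF Y_mem[of z], of w] by (simp add: conv_def diff_divide_distrib)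
qed

end

lemma sup_convolution_exists:
 assumes "compact B" "B ~= {}" "usc_on B u" "B <= cball 0 D" "D > 0" "\<epsilon> > 0"
 obtains Y where "sup_convolution u B Y \<epsilon> D"
proof -
 have "\<exists>y\<in>B. \<forall>y'\<in>B. u y' - kern (z - y') / \<epsilon> <= u y - kern (z - y) / \<epsilon>" for z
 proof -
  define f where "f y = u y - kern (z - y) / \<epsilon>" for y
  have "usc_on B f"
   unfolding f_def[abs_def] using assms(3,6) unfolding kern_def by (intro usc_on_diff continuous_intros) auto
  then obtain y where "y \<in> B" "!!y'. y' \<in> B ==> f y' <= f y"
   by (rule usc_attains_sup[OF assms(1,2)]) blast
  then show ?thesis unfolding f_def by blast
 qed
 then obtain Y where "!!z. Y z \<in> B" "!!z y'. y' \<in> B ==> u y' - kern (z - y') / \<epsilon> <= u (Y z) - kern (z - Y z) / \<epsilon>" by metis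
 then have "sup_convolution u B Y \<epsilon> D" by (intro sup_convolution.intro assms(4-6)) auto
 then show ?thesis by (rule that)
qed

text \<open>A small step in the direction \<open>g = P + Q - R\<close> would gain linearly and lose
  only three quadratic terms.\<close>

lemma gradient_sum:
 fixes P Q R :: "'a::real_inner"
 assumes r: "r > 0" and lU: "!!z. z \<in> ball z0 r ==> U z >= U z0 + P \<bullet> (z - z0) - C * (norm (z - z0))^2"
  and lW: "!!z. z \<in> ball z0 r ==> W z >= W z0 + Q \<bullet> (z - z0) - C * (norm (z - z0))^2"
  and mx: "!!z. z \<in> ball z0 r ==> U z + W z <= U z0 + W z0 + R \<bullet> (z - z0) + C * (norm (z - z0))^2"
  and C: "C >= 0"
 shows "P + Q = R"
proof (rule ccontr)
 define g where "g = P + Q - R"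
 assume "P + Q ~= R"
 then have g: "norm g > 0" by (simp add: g_def)
 define s where "s = min (r / (2 * norm g)) (1 / (6 * C + 1))"
 have s: "s > 0" "s <= r / (2 * norm g)" "s <= 1 / (6 * C + 1)" using r g C by (auto simp: s_def)
 have "s * norm g <= r / 2" using s(2) g by (simp add: pos_le_divide_eq mult_ac)
 then have z: "z0 + s *\<^sub>R g \<in> ball z0 r" using s(1) r by (simp add: dist_norm)
 have "s * (g \<bullet> g) <= 3 * C * (s * norm g)^2"
 proof -
  have "s * (g \<bullet> g) = P \<bullet> (s *\<^sub>R g) + Q \<bullet> (s *\<^sub>R g) - R \<bullet> (s *\<^sub>R g)"
   by (simp add: g_def inner_diff_left inner_add_left algebra_simps)
  then show ?thesis using lU[OF z] lW[OF z] mx[OF z] s(1) by simp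
 qed
 then have "s * (norm g)^2 <= s * (norm g)^2 * (3 * C * s)"
  by (simp add: power2_norm_eq_inner[symmetric] power2_eq_square mult_ac)
 then have "1 <= 3 * C * s" using s(1) g by (simp add: mult_le_cancel_left1 mult_ac)
 moreover have "(6 * C + 1) * s <= 1" using s(3) C by (simp add: pos_le_divide_eq mult.commute)
 ultimately show False using s(1) by (simp add: algebra_simps)
qed

section \<open>Comparison\<close>

lemma comparison:
 fixes u w :: "(real^'n) * real => real"
 assumes lu: "local_sub c u" and lw: "local_sub c w" and c: "c >= 0"
  and uu: "usc_on space_time u" and uw: "usc_on space_time w"
  and cu: "const_outside_compact {0..} u" and cw: "const_outside_compact {0..} w"
  and init: "!!x. u (x, 0) + w (x, 0) <= 0" and zs: "zs \<in> space_time"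
 shows "u zs + w zs <= 0"
proof (rule ccontr)
 assume "~ u zs + w zs <= 0"
 then have v: "u zs + w zs > 0" by simp
 obtain xs ts where zs': "zs = (xs, ts)" by fastforce
 have ts: "ts >= 0" using zs by (simp add: zs')
 define T where "T = ts + 3"
 obtain R1 where R1: "R1 > 0" "!!t (x::real^'n) y. 0 <= t ==> t < T + 1 ==> norm x > R1 ==> norm y > R1 ==> u (x, t) = u (y, t)"
  using const_outside_ball[OF cu, of "T + 1"] ts by (auto simp: T_def)
 obtain R2 where R2: "R2 > 0" "!!t (x::real^'n) y. 0 <= t ==> t < T + 1 ==> norm x > R2 ==> norm y > R2 ==> w (x, t) = w (y, t)"
  using const_outside_ball[OF cw, of "T + 1"] ts by (auto simp: T_def)
 define R where "R = max (max R1 R2) (norm xs)"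
 have R: "R > 0" "R1 <= R" "R2 <= R" "norm xs <= R" using R1(1) by (auto simp: R_def)
 \<comment> \<open>The margin 2 allows the maximum to be moved to \<open>norm x \<le> R + 1\<close>
   with the maximisers \<open>Y1\<close> and \<open>Y2\<close> still in the interior of
   \<open>B\<close>.\<close>
 define B where "B = cball (0::real^'n) (R + 2) \<times> {0..T}"
 have B: "compact B" "B <= space_time" "zs \<in> B"
  using R ts by (auto simp: B_def zs' T_def intro!: compact_Times)
 have Bne: "B ~= {}" using B(3) by blast
 have uB: "usc_on B u" "usc_on B w" using usc_on_subset[OF uu B(2)] usc_on_subset[OF uw B(2)] by auto
 obtain M1 where M1: "!!z. z \<in> B ==> u z <= M1" using usc_attains_sup[OF B(1) Bne uB(1)] by metis
 obtain M2 where M2: "!!z. z \<in> B ==> w z <= M2" using usc_attains_sup[OF B(1) Bne uB(2)] by metis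
 define M where "M = max (max M1 M2) 1"
 have M: "M >= 1" "!!z. z \<in> B ==> u z <= M" "!!z. z \<in> B ==> w z <= M"
  using M1 M2 by (fastforce simp: M_def le_max_iff_disj)+
 obtain D where D: "D > 0" "B <= ball 0 D"
  using compact_imp_bounded[OF B(1)] by (metis bounded_subset_ballD)
 have Dc: "B <= cball 0 D" using D(2) by auto
 define \<theta> where "\<theta> = (u zs + w zs) / 2"
 have \<theta>: "\<theta> > 0" using v by (simp add: \<theta>_def)
 \<comment> \<open>Large enough for both \<open>exp (- k) < \<theta>\<close> and
   \<open>exp k > 2 * M\<close>.\<close>
 define k where "k = 1 / \<theta> + 2 * M"
 have k: "k > 0" using \<theta> M(1) by (simp add: k_def add_pos_pos)
 have expk: "exp k > 2 * M" "exp (- k) < \<theta>"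
 proof -
  have e: "1 + (1 / \<theta> + 2 * M) <= exp k" using exp_ge_add_one_self[of k] by (simp add: k_def)
  have t0: "1 / \<theta> > 0" using \<theta> by simp
  show "exp k > 2 * M" using e t0 by linarith
  have "exp k > 1 / \<theta>" using e M(1) by linarith
  then show "exp (- k) < \<theta>" using \<theta> by (simp add: exp_minus field_simps)
 qed
 \<comment> \<open>A strictly increasing penalty: below \<open>\<theta>\<close> at
   \<open>ts\<close>, so the maximum stays positive, and above \<open>2 * M\<close> from
   \<open>ts + 2\<close> on, so it stays away from \<open>T\<close>. Its derivative supplies the
   positive \<open>\<alpha>\<close>.\<close>
 define \<pi> where "\<pi> t = exp (k * (t - ts - 1))" for t
 have \<pi>: "\<pi> t > 0" "\<pi> ts < \<theta>" "t >= ts + 2 ==> \<pi> t > 2 * M" for t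
 proof -
  show "\<pi> t > 0" "\<pi> ts < \<theta>" using expk(2) by (simp_all add: \<pi>_def)
  assume "t >= ts + 2"
  then have "k * 1 <= k * (t - ts - 1)" using k by (intro mult_left_mono) auto
  then have "exp k <= \<pi> t" by (simp add: \<pi>_def)
  then show "\<pi> t > 2 * M" using expk(1) by linarith
 qed
 \<comment> \<open>Otherwise points with times tending to 0 would, by compactness, accumulate at a
   point of time 0, against upper semicontinuity and the ordering of the initial values.\<close>
 have "\<exists>\<rho>>0. \<rho> <= 1 / 4 & (\<forall>z y y'. z \<in> B --> y \<in> B --> y' \<in> B --> dist y z < \<rho> --> dist y' z < \<rho> --> \<theta> <= u y + w y' --> snd z > 4 * \<rho>)"
 proof (rule ccontr)
  assume neg: "~ ?thesis"
  have "\<exists>p. (fst p \<in> B & fst (snd p) \<in> B & snd (snd p) \<in> B) &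
    dist (fst (snd p)) (fst p) < 1 / real (n + 4) & dist (snd (snd p)) (fst p) < 1 / real (n + 4) &
    \<theta> <= u (fst (snd p)) + w (snd (snd p)) & snd (fst p) <= 4 * (1 / real (n + 4))" for n
  proof -
   have n: "1 / real (n + 4) > 0" "1 / real (n + 4) <= 1 / 4" by (auto simp: field_simps)
   obtain z y y' where "z \<in> B" "y \<in> B" "y' \<in> B" "dist y z < 1 / real (n + 4)" "dist y' z < 1 / real (n + 4)"
    "\<theta> <= u y + w y'" "~ snd z > 4 * (1 / real (n + 4))" using neg n by blast
   then show ?thesis by (intro exI[of _ "(z, y, y')"]) simp
  qed
  then obtain p where p: "!!n. fst (p n) \<in> B" "!!n. fst (snd (p n)) \<in> B" "!!n. snd (snd (p n)) \<in> B"
   "!!n. dist (fst (snd (p n))) (fst (p n)) < 1 / real (n + 4)" "!!n. dist (snd (snd (p n))) (fst (p n)) < 1 / real (n + 4)"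
   "!!n. \<theta> <= u (fst (snd (p n))) + w (snd (snd (p n)))" "!!n. snd (fst (p n)) <= 4 * (1 / real (n + 4))"
   by metis
  define z y y' where "z n = fst (p n)" and "y n = fst (snd (p n))" and "y' n = snd (snd (p n))" for n
  note p = p[folded z_def y_def y'_def]
  obtain zl g where zl: "zl \<in> B" "strict_mono g" "(z \<circ> g) \<longlonglongrightarrow> zl"
   using B(1) p(1) unfolding compact_def by metis
  have lim: "(%n. 1 / real (g n + 4)) \<longlonglongrightarrow> 0"
  proof -
   have "(%n. 1 / real (n + 4)) \<longlonglongrightarrow> 0"
    using LIMSEQ_ignore_initial_segment[OF lim_1_over_n, of 4] by simp
   from LIMSEQ_subseq_LIMSEQ[OF this zl(2)] show ?thesis by (simp add: o_def)
  qed
  have ylim: "(%n. q (g n)) \<longlonglongrightarrow> zl" if q: "!!n. dist (q n) (z n) < 1 / real (n + 4)" for q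
  proof -
   have "(%n. q (g n) - z (g n)) \<longlonglongrightarrow> 0"
    by (rule Lim_null_comparison[OF _ lim]) (use q in \<open>auto simp: dist_norm intro!: always_eventually less_imp_le\<close>)
   from tendsto_add[OF this zl(3)] show ?thesis by (simp add: o_def)
  qed
  have "snd zl <= 0"
  proof (rule tendsto_le[OF trivial_limit_sequentially])
   show "(%n. snd (z (g n))) \<longlonglongrightarrow> snd zl" using tendsto_snd[OF zl(3)] by (simp add: o_def)
   show "(%n. 4 * (1 / real (g n + 4))) \<longlonglongrightarrow> 0" using tendsto_mult_left[OF lim, of 4] by simp
   show "\<forall>\<^sub>F n in sequentially. snd (z (g n)) <= 4 * (1 / real (g n + 4))" using p(7) by (intro always_eventually) blast
  qed
  then have zl0: "zl = (fst zl, 0)" using zl(1) B(2) by (cases zl) (auto simp: B_def)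
  have "\<forall>\<^sub>F n in sequentially. u (y (g n)) < u zl + \<theta> / 2"
   by (rule usc_on_sequentially[OF uB(1) _ ylim[OF p(4)] zl(1)]) (use p(2) \<theta> in auto)
  moreover have "\<forall>\<^sub>F n in sequentially. w (y' (g n)) < w zl + \<theta> / 2"
   by (rule usc_on_sequentially[OF uB(2) _ ylim[OF p(5)] zl(1)]) (use p(3) \<theta> in auto)
  ultimately have "\<forall>\<^sub>F n in sequentially. False"
  proof eventually_elim
   case (elim n)
   have "u zl + w zl <= 0" using init[of "fst zl"] zl0 by metis
   then show ?case using elim p(6)[of "g n"] by linarith
  qed
  then show False by simp
 qed
 then obtain \<rho> where \<rho>: "\<rho> > 0" "\<rho> <= 1 / 4" and \<rho>t: "!!z y y'. z \<in> B ==> y \<in> B ==> y' \<in> B ==>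
   dist y z < \<rho> ==> dist y' z < \<rho> ==> \<theta> <= u y + w y' ==> snd z > 4 * \<rho>" by blast
 \<comment> \<open>If a convolution is at least \<open>- M\<close>, its kernel is at most
   \<open>2 * M * \<epsilon> < (\<rho> / 2) ^ 4\<close>, so by \<open>kern_small\<close> the
   maximiser lies within \<open>\<rho>\<close>.\<close>
 define \<epsilon> where "\<epsilon> = (\<rho> / 2) ^ 4 / (2 * M + 1)"
 have \<epsilon>: "\<epsilon> > 0" using \<rho> M(1) by (simp add: \<epsilon>_def)
 obtain Y1 where "sup_convolution u B Y1 \<epsilon> D" using sup_convolution_exists[OF B(1) Bne uB(1) Dc D(1) \<epsilon>] by blast
 then interpret U: sup_convolution u B Y1 \<epsilon> D .
 obtain Y2 where "sup_convolution w B Y2 \<epsilon> D" using sup_convolution_exists[OF B(1) Bne uB(2) Dc D(1) \<epsilon>] by blast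
 then interpret W: sup_convolution w B Y2 \<epsilon> D .
 have near: "dist y z < \<rho>" if "kern (z - y) / \<epsilon> <= 2 * M" for y z :: "(real^'n) * real"
 proof -
  have "kern (z - y) <= 2 * M * \<epsilon>" using that \<epsilon> by (simp add: pos_divide_le_eq)
  also have "... < (2 * M + 1) * \<epsilon>" using \<epsilon> by simp
  also have "... = (\<rho> / 2) ^ 4" using M(1) by (simp add: \<epsilon>_def)
  finally have "norm (z - y) < \<rho>" using \<rho> by (intro kern_small) auto
  then show ?thesis by (simp add: dist_norm norm_minus_commute)
 qed
 have nearU: "dist (Y1 z) z < \<rho>" if "U.conv z >= - M" for z
  using near[of z "Y1 z"] that M(2)[OF U.Y_mem[of z]] unfolding U.conv_def by linarith
 have nearW: "dist (Y2 z) z < \<rho>" if "W.conv z >= - M" for z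
  using near[of z "Y2 z"] that M(3)[OF W.Y_mem[of z]] unfolding W.conv_def by linarith
 have upU: "U.conv z <= M" for z by (rule U.conv_le[OF M(2)])
 have upW: "W.conv z <= M" for z by (rule W.conv_le[OF M(3)])
 \<comment> \<open>The additional variables of the doubling are inside the two convolutions, so a
   single point is left to be maximised over.\<close>
 let ?\<Psi> = "%z. U.conv z + W.conv z - \<pi> (snd z)"
 have "continuous_on B ?\<Psi>" unfolding \<pi>_def
  by (intro continuous_intros continuous_on_subset[OF U.conv_continuous Dc] continuous_on_subset[OF W.conv_continuous Dc])
 then obtain z1 where z1: "z1 \<in> B" "!!z. z \<in> B ==> ?\<Psi> z <= ?\<Psi> z1"
  using continuous_attains_sup[OF B(1) Bne, of ?\<Psi>] by blast
 have \<Psi>1: "?\<Psi> z1 > \<theta>"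
  using z1(2)[OF B(3)] U.conv_ge_self[OF B(3)] W.conv_ge_self[OF B(3)] \<pi>(2) by (simp add: zs' \<theta>_def)
 have pr0: "U.conv z > - M" "W.conv z > - M" "dist (Y1 z) z < \<rho>" "dist (Y2 z) z < \<rho>" "snd z < ts + 2"
  if "z \<in> B" "?\<Psi> z > \<theta>" for z
 proof -
  show 1: "U.conv z > - M" "W.conv z > - M" using that(2) upU[of z] upW[of z] \<pi>(1)[of "snd z"] \<theta> by auto
  show "dist (Y1 z) z < \<rho>" "dist (Y2 z) z < \<rho>" using nearU[of z] nearW[of z] 1 by auto
  show "snd z < ts + 2"
  proof (rule ccontr)
   assume "~ snd z < ts + 2"
   then have "\<pi> (snd z) > 2 * M" by (intro \<pi>(3)) simp
   then show False using that(2) upU[of z] upW[of z] \<theta> by linarith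
  qed
 qed
 \<comment> \<open>A maximum close to the lateral boundary is replaced by one at
   \<open>norm x = R + 1\<close>: there \<open>u\<close> and \<open>w\<close> depend on time only,
   and competitors at the same spatial position have no spatial penalty.\<close>
 have "\<exists>z0\<in>B. norm (fst z0) <= R + 1 & (\<forall>z\<in>B. ?\<Psi> z <= ?\<Psi> z0)"
 proof (cases "norm (fst z1) <= R + 1")
  case True
  then show ?thesis using z1 by blast
 next
  case False
  obtain x' :: "real^'n" where x': "norm x' = R + 1" using vector_choose_size[of "R + 1"] R(1) by auto
  define z0 where "z0 = (x', snd z1)"
  have z0: "z0 \<in> B" using z1(1) x' by (auto simp: z0_def B_def)
  have Yb: "(x', snd (Y1 z1)) \<in> B" "(x', snd (Y2 z1)) \<in> B"
   using U.Y_mem[of z1] W.Y_mem[of z1] x' by (auto simp: B_def mem_Times_iff)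
  have far: "norm (fst y) > R" if "dist y z1 < \<rho>" for y
  proof -
   have "norm (fst y - fst z1) < \<rho>" using dist_fst_le[of y z1] that by (simp add: dist_norm)
   then show ?thesis using False \<rho> norm_triangle_ineq2[of "fst z1" "fst y"] by (simp add: norm_minus_commute)
  qed
  have tim: "0 <= snd y" "snd y < T + 1" if "y \<in> B" for y using that by (auto simp: B_def)
  have "u (x', snd (Y1 z1)) = u (fst (Y1 z1), snd (Y1 z1))"
   by (rule R1(2)[OF tim[OF U.Y_mem]]) (use x' far[OF pr0(3)[OF z1(1) \<Psi>1]] R in auto)
  moreover have "w (x', snd (Y2 z1)) = w (fst (Y2 z1), snd (Y2 z1))"
   by (rule R2(2)[OF tim[OF W.Y_mem]]) (use x' far[OF pr0(4)[OF z1(1) \<Psi>1]] R in auto)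
  moreover have "kern (z0 - (x', snd y)) / \<epsilon> <= kern (z1 - y) / \<epsilon>" for y
   using \<epsilon> by (intro divide_right_mono) (auto simp: kern_def z0_def)
  ultimately have "U.conv z0 >= U.conv z1" "W.conv z0 >= W.conv z1"
   using U.conv_ge[OF Yb(1), of z0] W.conv_ge[OF Yb(2), of z0] unfolding U.conv_def[of z1] W.conv_def[of z1]
   by (smt (verit) prod.collapse)+
  then have "?\<Psi> z0 >= ?\<Psi> z1" by (simp add: z0_def)
  then have "\<forall>z\<in>B. ?\<Psi> z <= ?\<Psi> z0" using z1(2) by fastforce
  moreover have "norm (fst z0) <= R + 1" using x' by (simp add: z0_def)
  ultimately show ?thesis using z0 by blast
 qed
 then obtain z0 where z0: "z0 \<in> B" "norm (fst z0) <= R + 1" "!!z. z \<in> B ==> ?\<Psi> z <= ?\<Psi> z0" by blast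
 have \<Psi>0: "?\<Psi> z0 > \<theta>" using z0(3)[OF z1(1)] \<Psi>1 by linarith
 note pr = pr0[OF z0(1) \<Psi>0]
 have t0: "snd z0 > 4 * \<rho>"
 proof (rule \<rho>t[OF z0(1) U.Y_mem W.Y_mem pr(3,4)])
  have "U.conv z0 <= u (Y1 z0)" "W.conv z0 <= w (Y2 z0)"
   unfolding U.conv_def W.conv_def using kern_nonneg[of "z0 - Y1 z0"] kern_nonneg[of "z0 - Y2 z0"] \<epsilon> by auto
  then show "\<theta> <= u (Y1 z0) + w (Y2 z0)" using \<Psi>0 \<pi>(1)[of "snd z0"] by linarith
 qed
 have z0D: "z0 \<in> ball 0 D" using z0(1) D(2) by blast
 define V where "V = ball (0::real^'n) (R + 2) \<times> {0<..<T}"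
 have V: "open V" "V <= B" "!!y. y \<in> V ==> snd y > 0"
  by (auto simp: V_def B_def intro!: open_Times)
 have inV: "y \<in> V" if "dist y z0 < 2 * \<rho>" for y
 proof -
  have "norm (fst y - fst z0) < 2 * \<rho>" "\<bar>snd y - snd z0\<bar> < 2 * \<rho>"
   using dist_fst_le[of y z0] dist_snd_le[of y z0] that by (auto simp: dist_norm)
  moreover have "norm (fst y) <= norm (fst z0) + norm (fst y - fst z0)" using norm_triangle_ineq[of "fst z0" "fst y - fst z0"] by simp
  ultimately have "norm (fst y) < R + 2" "0 < snd y" "snd y < T" using z0(2) \<rho> t0 pr(5) by (auto simp: T_def)
  then show ?thesis by (cases y) (auto simp: V_def)
 qed
 have "\<forall>\<^sub>F z in nhds z0. U.conv z > - M & W.conv z > - M & dist z z0 < \<rho> & z \<in> ball 0 D"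
 proof (intro eventually_conj)
  have "isCont U.conv z0" "isCont W.conv z0"
   using U.conv_continuous W.conv_continuous z0D by (auto intro: continuous_on_interior)
  then show "\<forall>\<^sub>F z in nhds z0. U.conv z > - M" "\<forall>\<^sub>F z in nhds z0. W.conv z > - M"
   using pr(1,2) unfolding isCont_def tendsto_at_iff_tendsto_nhds by (auto dest: order_tendstoD(1))
  show "\<forall>\<^sub>F z in nhds z0. dist z z0 < \<rho>" using \<rho>(1) by (auto simp: eventually_nhds_metric)
  show "\<forall>\<^sub>F z in nhds z0. z \<in> ball 0 D" by (rule eventually_nhds_in_open[OF open_ball z0D])
 qed
 then obtain r where r: "r > 0" "!!z. z \<in> ball z0 r ==> U.conv z > - M & W.conv z > - M & dist z z0 < \<rho> & z \<in> ball 0 D"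
  unfolding eventually_nhds_metric by (metis dist_commute mem_ball)
 have rD: "ball z0 r <= cball 0 D" using r(2) by force
 have Y1V: "Y1 z \<in> V" and Y2V: "Y2 z \<in> V" and zB: "z \<in> B" if "z \<in> ball z0 r" for z
 proof -
  note rz = r(2)[OF that]
  have "dist (Y1 z) z < \<rho>" "dist (Y2 z) z < \<rho>" using nearU[of z] nearW[of z] rz by auto
  then show "Y1 z \<in> V" "Y2 z \<in> V" using rz dist_triangle[of "Y1 z" z0 z] dist_triangle[of "Y2 z" z0 z] by (auto intro!: inV)
  show "z \<in> B" using inV[of z] rz V(2) \<rho>(1) by auto
 qed
 define \<alpha> where "\<alpha> = k * \<pi> (snd z0)"
 have \<alpha>: "\<alpha> > 0" using k \<pi>(1) by (simp add: \<alpha>_def)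
 define C where "C = max U.curv (\<pi> (snd z0) * (exp k * k^2))"
 have C: "C >= 0" "U.curv <= C" "W.curv <= C" "\<pi> (snd z0) * (exp k * k^2) <= C"
  using U.curv_nonneg by (auto simp: C_def U.curv_def W.curv_def)
 have quad: "C' * (norm (z - z0))^2 <= C * (norm (z - z0))^2" if "C' <= C" for C' z using that by (intro mult_right_mono) auto
 have lU: "U.conv z >= U.conv z0 + U.slope z0 \<bullet> (z - z0) - C * (norm (z - z0))^2" if "z \<in> ball z0 r" for z
  using U.conv_lower[of z0 z] that rD r(1) quad[OF C(2), of z] by (smt (verit) centre_in_ball subsetD)
 have lW: "W.conv z >= W.conv z0 + W.slope z0 \<bullet> (z - z0) - C * (norm (z - z0))^2" if "z \<in> ball z0 r" for z
  using W.conv_lower[of z0 z] that rD r(1) quad[OF C(3), of z] by (smt (verit) centre_in_ball subsetD)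
 have mx: "U.conv z + W.conv z <= U.conv z0 + W.conv z0 + \<alpha> * (snd z - snd z0) + C * (snd z - snd z0)^2" if z: "z \<in> ball z0 r" for z
 proof -
  define d where "d = snd z - snd z0"
  have d: "\<bar>d\<bar> <= 1" using dist_snd_le[of z z0] r(2)[OF z] \<rho> by (auto simp: d_def dist_real_def)
  have "\<pi> (snd z) = \<pi> (snd z0) * exp (k * d)" by (simp add: \<pi>_def d_def exp_add[symmetric] algebra_simps)
  also have "... <= \<pi> (snd z0) * (1 + k * d + exp k * (k * d)^2)"
  proof -
   have "\<bar>k * d\<bar> <= k" using d k by (simp add: abs_mult)
   then have "exp \<bar>k * d\<bar> * (k * d)^2 <= exp k * (k * d)^2" by (intro mult_right_mono) auto
   then have "exp (k * d) <= 1 + k * d + exp k * (k * d)^2" using exp_quadratic_error[of "k * d"] by linarith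
   then show ?thesis using \<pi>(1)[of "snd z0"] by (intro mult_left_mono) auto
  qed
  also have "... = \<pi> (snd z0) + \<alpha> * d + \<pi> (snd z0) * (exp k * k^2) * d^2"
   by (simp add: \<alpha>_def power_mult_distrib algebra_simps)
  also have "\<pi> (snd z0) * (exp k * k^2) * d^2 <= C * d^2" using C(4) by (intro mult_right_mono) auto
  finally show ?thesis using z0(3)[OF zB[OF z]] by (simp add: d_def)
 qed
 have PQ: "U.slope z0 + W.slope z0 = (0, \<alpha>)"
 proof (rule gradient_sum[OF r(1) lU lW _ C(1)])
  fix z assume z: "z \<in> ball z0 r"
  have "\<bar>snd z - snd z0\<bar>\<^sup>2 <= (norm (z - z0))^2"
   using dist_snd_le[of z z0] by (intro power_mono) (auto simp: dist_norm)
  then have "C * (snd z - snd z0)^2 <= C * (norm (z - z0))^2" using C(1) by (intro mult_left_mono) auto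
  moreover have "(0, \<alpha>) \<bullet> (z - z0) = \<alpha> * (snd z - snd z0)" by (simp add: inner_prod_def)
  ultimately show "U.conv z + W.conv z <= U.conv z0 + W.conv z0 + (0, \<alpha>) \<bullet> (z - z0) + C * (norm (z - z0))^2"
   using mx[OF z] by linarith
 qed
 have tU: "tested c U.conv (ball z0 r)" by (rule U.conv_tested[OF lu c V(1,2) Y1V V(3)])
 have tW: "tested c W.conv (ball z0 r)" by (rule W.conv_tested[OF lw c V(1,2) Y2V V(3)])
 have sU: "semiconvex C U.conv (ball z0 r)" by (rule U.conv_semiconvex[OF rD C(2)])
 have sW: "semiconvex C W.conv (ball z0 r)" by (rule W.conv_semiconvex[OF rD C(3)])
 have z0r: "z0 \<in> ball z0 r" using r(1) by simp
 show False
 proof (cases "fst (U.slope z0) = 0")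
  case False
  then show False using blow_up_contradiction[OF tU tW sU sW lU lW mx C(1) r(1) c \<alpha> PQ] by blast
 next
  case True
  \<comment> \<open>With vanishing spatial slopes each convolution bounds the other from above by a
    function of cubic order in space. Both time slopes are then nonpositive, although their sum is
    \<open>\<alpha> > 0\<close>.\<close>
  have sP: "fst (W.slope z0) = 0" "snd (U.slope z0) + snd (W.slope z0) = \<alpha>" using PQ True by (auto simp: prod_eq_iff)
  define C' where "C' = C + 1 / \<epsilon>"
  have C': "C' >= 1 / \<epsilon>" "1 / \<epsilon> > 0" using C(1) \<epsilon> by (auto simp: C'_def)
  have ev: "\<forall>\<^sub>F z in nhds z0. z \<in> ball z0 r" by (rule eventually_nhds_in_open[OF open_ball z0r])
  have step: "X z <= X z0 + a * (snd z - snd z0) + C' * norm (fst z - fst z0) ^ 3 + C' * (snd z - snd z0)^2"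
   if z: "z \<in> ball z0 r" and X: "X z + X' z = U.conv z + W.conv z" "X z0 + X' z0 = U.conv z0 + W.conv z0"
    and a: "a + a' = \<alpha>"
    and low: "X' z >= X' z0 + a' * (snd z - snd z0) - (norm (fst z - fst z0) ^ 4 + (snd z - snd z0)^2) / \<epsilon>"
   for X X' z a a'
  proof -
   let ?n = "norm (fst z - fst z0)" and ?d = "snd z - snd z0"
   have "?n <= 1" using dist_fst_le[of z z0] r(2)[OF z] \<rho> by (auto simp: dist_norm)
   then have "?n ^ 4 <= ?n ^ 3" by (intro power_decreasing) auto
   then have "?n ^ 4 / \<epsilon> <= 1 / \<epsilon> * ?n ^ 3" using \<epsilon> by (simp add: divide_right_mono)
   also have "... <= C' * ?n ^ 3" using C' by (intro mult_right_mono) auto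
   finally have 1: "?n ^ 4 / \<epsilon> <= C' * ?n ^ 3" .
   have 2: "C' * ?d^2 = C * ?d^2 + ?d^2 / \<epsilon>" by (simp add: C'_def algebra_simps)
   have 3: "\<alpha> * ?d = a * ?d + a' * ?d" unfolding a[symmetric] by (simp add: algebra_simps)
   have "X z <= X z0 + (\<alpha> * ?d - a' * ?d) + C * ?d^2 + (?n ^ 4 / \<epsilon> + ?d^2 / \<epsilon>)"
    using mx[OF z] X low by (simp add: add_divide_distrib)
   then show ?thesis using 1 2 3 by linarith
  qed
  have "\<forall>\<^sub>F z in nhds z0. U.conv z <= U.conv z0 + snd (U.slope z0) * (snd z - snd z0)
    + C' * norm (fst z - fst z0) ^ 3 + C' * (snd z - snd z0)^2" using ev
  proof eventually_elim
   case (elim z)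
   show ?case
    by (rule step[where X = U.conv and X' = W.conv, OF elim _ _ sP(2) W.conv_lower_flat[OF sP(1)]]) auto
  qed
  from U.conv_cubic[OF lu uu c V(1,2) Y1V[OF z0r] V(3)[OF Y1V[OF z0r]] this] have 1: "snd (U.slope z0) <= 0" .
  have "\<forall>\<^sub>F z in nhds z0. W.conv z <= W.conv z0 + snd (W.slope z0) * (snd z - snd z0)
    + C' * norm (fst z - fst z0) ^ 3 + C' * (snd z - snd z0)^2" using ev
  proof eventually_elim
   case (elim z)
   show ?case
    by (rule step[where X = W.conv and X' = U.conv, OF elim _ _ _ U.conv_lower_flat[OF True]]) (use sP(2) in auto)
  qed
  from W.conv_cubic[OF lw uw c V(1,2) Y2V[OF z0r] V(3)[OF Y2V[OF z0r]] this] have 2: "snd (W.slope z0) <= 0" .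
  show False using 1 2 sP(2) \<alpha> by linarith
 qed
qed

section \<open>Passage to the limit\<close>

text \<open>The barrier is iterated \<open>j\<close> times over intervals of length
  \<open>\<tau>\<close>; each step costs a distance \<open>2 * D\<close>.\<close>

lemma (in subsolution_family) finite_speed:
 assumes D: "D > 0"
 obtains \<tau> where "\<tau> > 0" "!!n j x A t. (!!y. dist x y <= 2 * D * real j ==> u0 y <= A) ==>
  0 <= t ==> t <= real j * \<tau> ==> v n (x, t) <= A"
proof -
 obtain \<tau> where \<tau>: "\<tau> > 0" "!!n x1 t1 A t. t1 >= 0 ==> (!!x. x \<in> cball x1 (2 * D) ==> v n (x, t1) <= A) ==>
  t1 <= t ==> t <= t1 + \<tau> ==> v n (x1, t) <= A" using barrier_uniform[OF D] by metis
 have "v n (x, t) <= A" if "!!y. dist x y <= 2 * D * real j ==> u0 y <= A" "0 <= t" "t <= real j * \<tau>" for n j x A t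
  using that
 proof (induction j arbitrary: x t)
  case 0
  have "v n (x, 0) <= u0 x" using sub[of n] by (simp add: subsolution_def)
  then show ?case using 0(1)[of x] 0(2,3) by simp
 next
  case (Suc j)
  have "v n (y, real j * \<tau>) <= A" if y: "y \<in> cball x (2 * D)" for y
  proof (rule Suc.IH)
   fix z assume "dist y z <= 2 * D * real j"
   then have "dist x z <= 2 * D * real (Suc j)" using dist_triangle[of x z y] y by (simp add: algebra_simps)
   then show "u0 z <= A" by (rule Suc.prems(1))
  qed (use \<tau> in auto)
  then have late: "v n (x, t) <= A" if "real j * \<tau> <= t"
   using \<tau>(2)[of "real j * \<tau>" x n A t] that Suc.prems(3) \<tau>(1) by (simp add: algebra_simps)
  have early: "v n (x, t) <= A" if "t <= real j * \<tau>"
  proof (rule Suc.IH)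
   fix z assume "dist x z <= 2 * D * real j"
   moreover have "2 * D * real j <= 2 * D * real (Suc j)" using D by (intro mult_left_mono) auto
   ultimately show "u0 z <= A" by (intro Suc.prems(1)) linarith
  qed (use that Suc.prems in auto)
  show ?case using early late by linarith
 qed
 then show ?thesis using that \<tau>(1) by blast
qed

text \<open>Three uses of finite speed: a global bound, control near infinity over a bounded time,
  and, with \<open>D\<close> small compared to the modulus of continuity of \<open>u0\<close> and
  one step, control at initial time. None depends on \<open>n\<close>.\<close>

lemma (in subsolution_family) upper_bounds:
 shows "(!!y. u0 y <= A) ==> t >= 0 ==> v n (x, t) <= A"
  and "(!!y. norm y > R ==> u0 y <= A) ==> \<exists>R'. \<forall>n x t. norm x > R' --> 0 <= t --> t <= T --> v n (x, t) <= A"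
  and "continuous_on UNIV u0 ==> u0 x < A ==> \<exists>e>0. \<forall>n. \<forall>w\<in>ball (x, 0) e Int space_time. v n w <= A"
proof -
 obtain \<tau> where \<tau>: "\<tau> > 0" "!!n j x A t. (!!y. dist x y <= 2 * 1 * real j ==> u0 y <= A) ==>
  0 <= t ==> t <= real j * \<tau> ==> v n (x, t) <= A" using finite_speed[of 1] by auto
 have ex: "\<exists>j. T <= real j * \<tau>" for T using ex_less_of_nat_mult[OF \<tau>(1), of T] by (auto intro: less_imp_le)
 show "v n (x, t) <= A" if "!!y. u0 y <= A" "t >= 0" using ex[of t] \<tau>(2)[of x _ A t n] that by blast
 show "\<exists>R'. \<forall>n x t. norm x > R' --> 0 <= t --> t <= T --> v n (x, t) <= A" if R: "!!y. norm y > R ==> u0 y <= A"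
 proof -
  obtain j where j: "T <= real j * \<tau>" using ex by blast
  have "v n (x, t) <= A" if "norm x > R + 2 * real j" "0 <= t" "t <= T" for n x t
  proof (rule \<tau>(2))
   fix y assume "dist x y <= 2 * 1 * real j"
   then have "norm y > R" using that(1) norm_triangle_ineq2[of x y] by (simp add: dist_norm)
   then show "u0 y <= A" by (rule R)
  qed (use that j in auto)
  then show ?thesis by blast
 qed
 show "\<exists>e>0. \<forall>n. \<forall>w\<in>ball (x, 0) e Int space_time. v n w <= A" if u0: "continuous_on UNIV u0" "u0 x < A"
 proof -
  have "\<forall>\<^sub>F y in nhds x. u0 y < A"
   using u0 unfolding continuous_on_eq_continuous_at[OF open_UNIV] isCont_def tendsto_at_iff_tendsto_nhds
   by (auto dest: order_tendstoD(2))
  then obtain d where d: "d > 0" "!!y. dist y x < d ==> u0 y < A" unfolding eventually_nhds_metric by blast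
  define D where "D = d / 8"
  have D: "D > 0" using d by (simp add: D_def)
  obtain \<tau> where \<tau>: "\<tau> > 0" "!!n j x A t. (!!y. dist x y <= 2 * D * real j ==> u0 y <= A) ==>
   0 <= t ==> t <= real j * \<tau> ==> v n (x, t) <= A" using finite_speed[OF D] by metis
  show ?thesis
  proof (intro exI[of _ "min D \<tau>"] conjI allI ballI)
   fix n w assume "w \<in> ball (x, 0) (min D \<tau>) Int space_time"
   then obtain y t where w: "w = (y, t)" "0 <= t" "dist (x, 0) (y, t) < min D \<tau>" by auto
   have y: "dist x y < D" "t < \<tau>" using w(2,3) dist_fst_le[of "(x, 0)" "(y, t)"] dist_snd_le[of "(x, 0::real)" "(y, t)"] by auto
   have "v n (y, t) <= A"
   proof (rule \<tau>(2)[of y 1])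
    fix z assume "dist y z <= 2 * D * real 1"
    then have "dist z x < d" using y(1) dist_triangle[of x z y] D by (simp add: D_def dist_commute)
    then show "u0 z <= A" using d(2) by (simp add: less_imp_le)
   qed (use w y in auto)
   then show "v n w <= A" by (simp add: w)
  qed (use D \<tau> in auto)
 qed
qed

section \<open>Semicontinuous envelopes\<close>

lemma usc_envelope_ge: "z \<in> space_time ==> ereal (u z) <= usc_envelope u z"
 unfolding usc_envelope_def by (intro INF_greatest SUP_upper2[of z]) auto

lemma lsc_envelope_uminus: "lsc_envelope u z = - usc_envelope (%w. - u w) z"
 unfolding usc_envelope_def lsc_envelope_def
 by (simp add: ereal_INF_uminus_eq[symmetric] ereal_SUP_uminus_eq[symmetric] flip: uminus_ereal.simps)

lemma usc_envelope_cong: "(!!w. w \<in> space_time ==> u w = v w) ==> usc_envelope u z = usc_envelope v z"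
 unfolding usc_envelope_def by (intro INF_cong SUP_cong) auto

lemma usc_envelope_eq:
 assumes "usc_on space_time u" "z \<in> space_time"
 shows "usc_envelope u z = ereal (u z)"
proof (rule antisym[OF _ usc_envelope_ge[OF assms(2)]])
 show "usc_envelope u z <= ereal (u z)"
 proof (rule ereal_le_epsilon2)
  fix e :: real assume "e > 0"
  then have "\<forall>\<^sub>F w in at z within space_time. u w < u z + e" using bspec[OF assms(1)[unfolded usc_on_def] assms(2)] by simp
  then obtain d where d: "d > 0" "!!w. w \<in> space_time ==> w ~= z ==> dist w z < d ==> u w < u z + e"
   unfolding eventually_at by blast
  have "usc_envelope u z <= (SUP w\<in>ball z d Int space_time. ereal (u w))"
   unfolding usc_envelope_def using d(1) by (intro INF_lower) simp
  also have "... <= ereal (u z + e)"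
  proof (rule SUP_least)
   fix w assume "w \<in> ball z d Int space_time"
   then show "ereal (u w) <= ereal (u z + e)" using d(2)[of w] \<open>e > 0\<close> by (cases "w = z") (auto simp: dist_commute)
  qed
  finally show "usc_envelope u z <= ereal (u z) + ereal e" by simp
 qed
qed

lemma usc_continuous_on:
 fixes U V :: "'a::metric_space => real"
 assumes "usc_on S U" "usc_on S V" "!!z. z \<in> S ==> U z + V z = 0"
 shows "continuous_on S U" unfolding continuous_on_def
proof (intro ballI order_tendstoI)
 fix z a assume z: "z \<in> S"
 show "\<forall>\<^sub>F w in at z within S. U w < a" if "U z < a"
  using assms(1) z that unfolding usc_on_def by blast
 assume "a < U z"
 then have "V z < - a" using assms(3)[OF z] by linarith
 then have "\<forall>\<^sub>F w in at z within S. V w < - a" using assms(2) z unfolding usc_on_def by blast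
 moreover have "\<forall>\<^sub>F w in at z within S. w \<in> S" by (simp add: eventually_at_filter)
 ultimately show "\<forall>\<^sub>F w in at z within S. a < U w"
  by eventually_elim (use assms(3) in fastforce)
qed

text \<open>Each \<open>u n\<close> lies between \<open>- w n\<close> and \<open>v n\<close>, and
  both \<open>v n\<close> and \<open>w n\<close> are subsolutions. Their upper half-relaxed limits
  have nonnegative sum by construction and nonpositive sum by comparison, so they are continuous and
  opposite, and the one-sided bounds on compact sets combine to uniform convergence. Stated for a
  general curvature family, it also applies to constant sequences.\<close>

lemma solution_limit:
 fixes u :: "nat => (real^'n) * real => real"
 assumes fam: "curvature_family c H" and \<gamma>: "!!n. antimono_on {0<..} (\<gamma> n)"
  and sol: "!!n. viscosity_solution (\<gamma> n) (H n) u0 (u n)"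
  and u0: "continuous_on UNIV u0" and co: "\<exists>K c. compact K & (\<forall>x. x ~: K --> u0 x = c)"
 obtains U V where "local_sub c U" "local_sub c V" "usc_on space_time U" "usc_on space_time V"
  "const_outside_compact {0..} U" "const_outside_compact {0..} V"
  "!!x. U (x, 0) <= u0 x" "!!x. V (x, 0) <= - u0 x" "!!z. z \<in> space_time ==> U z + V z = 0"
  "!!K. compact K ==> K <= space_time ==> uniform_limit K u U sequentially"
proof -
 have c: "c >= 0" and anti: "\<forall>q a x. regular_level q a & q x = a --> H n x {y. q y <= a} = - H n x {y. q y >= a}" for n
  using fam by (auto simp: curvature_family_def)
 have "\<exists>v. (\<forall>z\<in>space_time. ereal (v z) = usc_envelope (u n) z) & subsolution (\<gamma> n) (H n) u0 v" for n
  using sol[of n] by (simp add: viscosity_solution_def)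
 then obtain v where v: "!!n z. z \<in> space_time ==> ereal (v n z) = usc_envelope (u n) z"
  and v_sub: "!!n. subsolution (\<gamma> n) (H n) u0 (v n)" by metis
 have "\<exists>w. (\<forall>z\<in>space_time. ereal (- w z) = lsc_envelope (u n) z) & subsolution (\<gamma> n) (H n) (%x. - u0 x) w" for n
 proof -
  obtain w where w: "\<forall>z\<in>space_time. ereal (w z) = lsc_envelope (u n) z" "supersolution (\<gamma> n) (H n) u0 w"
   using sol[of n] by (auto simp: viscosity_solution_def)
  then have "subsolution (\<gamma> n) (H n) (%x. - u0 x) (%z. - w z)"
   using supersolution_iff_subsolution_uminus[OF anti] by blast
  then show ?thesis using w(1) by (intro exI[of _ "%z. - w z"]) simp
 qed
 then obtain w where w: "!!n z. z \<in> space_time ==> ereal (- w n z) = lsc_envelope (u n) z"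
  and w_sub: "!!n. subsolution (\<gamma> n) (H n) (%x. - u0 x) (w n)" by metis
 have uv: "u n z <= v n z" and uw: "- u n z <= w n z" if z: "z \<in> space_time" for n z
 proof -
  show "u n z <= v n z" using usc_envelope_ge[OF z, of "u n"] unfolding v[OF z, symmetric] by simp
  have "- ereal (w n z) = - usc_envelope (%z. - u n z) z"
   using w[OF z, of n] unfolding lsc_envelope_uminus by simp
  then have "ereal (w n z) = usc_envelope (%z. - u n z) z" by (simp only: ereal_uminus_eq_iff)
  then show "- u n z <= w n z" using usc_envelope_ge[OF z, of "%z. - u n z"] by (metis ereal_less_eq(3))
 qed
 obtain K c0 where K: "compact K" "!!x. x ~: K ==> u0 x = c0" using co by blast
 obtain R where R: "!!x. x \<in> K ==> norm x <= R" using compact_imp_bounded[OF K(1)] unfolding bounded_iff by blast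
 have c0: "u0 x = c0" if "norm x > R" for x using K(2)[of x] R[of x] that by auto
 have "compact (u0 ` K)" by (rule compact_continuous_image[OF continuous_on_subset[OF u0] K(1)]) simp
 then obtain m where "\<forall>y\<in>u0 ` K. norm y <= m" using compact_imp_bounded bounded_iff by metis
 then have m: "\<bar>u0 x\<bar> <= m" if "x \<in> K" for x using that by auto
 define M where "M = max m \<bar>c0\<bar>"
 have M: "\<bar>u0 x\<bar> <= M" for x using m[of x] K(2)[of x] by (cases "x \<in> K") (auto simp: M_def)
 interpret Fv: subsolution_family v \<gamma> H u0 c by standard (rule v_sub \<gamma> fam)+
 interpret Fw: subsolution_family w \<gamma> H "%x. - u0 x" c by standard (rule w_sub \<gamma> fam)+
 have ub: "v n z <= M" "w n z <= M" if "z \<in> space_time" for n z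
 proof -
  obtain x t where z: "z = (x, t)" "t >= 0" using \<open>z \<in> space_time\<close> by auto
  show "v n z <= M" unfolding z(1) by (rule Fv.upper_bounds(1)[OF _ z(2)]) (use M in \<open>auto simp: abs_le_iff\<close>)
  show "w n z <= M" unfolding z(1) by (rule Fw.upper_bounds(1)[OF _ z(2)]) (use M in \<open>auto simp: abs_le_iff\<close>)
 qed
 \<comment> \<open>The lower bound comes from the other family:
   \<open>v n \<ge> u n \<ge> - w n \<ge> - M\<close>.\<close>
 interpret V: subsolution_sequence v \<gamma> H u0 c M
 proof standard
  show "\<bar>v n z\<bar> <= M" if "z \<in> space_time" for n z using ub[OF that, of n] uv[OF that, of n] uw[OF that, of n] by linarith
 qed
 interpret W: subsolution_sequence w \<gamma> H "%x. - u0 x" c M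
 proof standard
  show "\<bar>w n z\<bar> <= M" if "z \<in> space_time" for n z using ub[OF that, of n] uv[OF that, of n] uw[OF that, of n] by linarith
 qed
 define U where "U = relaxed_limsup v space_time"
 define Z where "Z = relaxed_limsup w space_time"
 \<comment> \<open>The inequality \<open>v n + w n \<ge> 0\<close> passes to the limits.\<close>
 have ge: "U z + Z z >= 0" if z: "z \<in> space_time" for z
 proof (rule ccontr)
  assume neg: "~ ?thesis"
  define d where "d = - (U z + Z z) / 4"
  have d: "d > 0" "U z + d + (Z z + d) < 0" using neg by (simp_all add: d_def field_simps)
  obtain e1 N1 where e1: "e1 > 0" "!!n y. n >= N1 ==> y \<in> ball z e1 Int space_time ==> v n y <= U z + d"
   using V.limsup_less[OF z, of "U z + d"] d(1) by (auto simp: U_def)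
  obtain e2 N2 where e2: "e2 > 0" "!!n y. n >= N2 ==> y \<in> ball z e2 Int space_time ==> w n y <= Z z + d"
   using W.limsup_less[OF z, of "Z z + d"] d(1) by (auto simp: Z_def)
  have "v (max N1 N2) z <= U z + d" "w (max N1 N2) z <= Z z + d" using e1 e2 z by auto
  then show False using uv[OF z, of "max N1 N2"] uw[OF z, of "max N1 N2"] d(2) by linarith
 qed
 have init: "U (x, 0) <= u0 x" "Z (x, 0) <= - u0 x" for x
 proof -
  have z: "(x, 0) \<in> space_time" by simp
  show "U (x, 0) <= u0 x"
  proof (rule field_le_epsilon)
   fix d :: real assume "d > 0"
   then obtain e where "e > 0" "!!n y. y \<in> ball (x, 0) e Int space_time ==> v n y <= u0 x + d"
    using Fv.upper_bounds(3)[OF u0, of x "u0 x + d"] by auto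
   then show "U (x, 0) <= u0 x + d" unfolding U_def by (rule V.limsup_le[OF z, of e 0])
  qed
  show "Z (x, 0) <= - u0 x"
  proof (rule field_le_epsilon)
   fix d :: real assume "d > 0"
   then obtain e where "e > 0" "!!n y. y \<in> ball (x, 0) e Int space_time ==> w n y <= - u0 x + d"
    using Fw.upper_bounds(3)[OF continuous_on_minus[OF u0], of x "- u0 x + d"] by auto
   then show "Z (x, 0) <= - u0 x + d" unfolding Z_def by (rule W.limsup_le[OF z, of e 0])
  qed
 qed
 \<comment> \<open>Far away finite speed bounds \<open>U\<close> by \<open>c0\<close> and
   \<open>Z\<close> by \<open>- c0\<close>; nonnegativity of \<open>U + Z\<close> turns both bounds
   into equalities.\<close>
 have far: "\<exists>R'. \<forall>x t. norm x > R' --> 0 <= t --> t < T --> U (x, t) = c0 & Z (x, t) = - c0" for T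
 proof -
  obtain R1 where R1: "!!n x t. norm x > R1 ==> 0 <= t ==> t <= T + 1 ==> v n (x, t) <= c0"
   using Fv.upper_bounds(2)[of R c0 "T + 1"] c0 by fastforce
  obtain R2 where R2: "!!n x t. norm x > R2 ==> 0 <= t ==> t <= T + 1 ==> w n (x, t) <= - c0"
   using Fw.upper_bounds(2)[of R "- c0" "T + 1"] c0 by fastforce
  have "U (x, t) = c0 & Z (x, t) = - c0" if x: "norm x > max R1 R2 + 1" "0 <= t" "t < T" for x t
  proof -
   have z: "(x, t) \<in> space_time" using x by simp
   have *: "norm (fst y) > max R1 R2 & 0 <= snd y & snd y <= T + 1" if y: "y \<in> ball (x, t) 1 Int space_time" for y
   proof -
    have "norm (x - fst y) < 1" "\<bar>t - snd y\<bar> < 1"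
     using y dist_fst_le[of "(x, t)" y] dist_snd_le[of "(x, t)" y] by (auto simp: dist_norm)
    then show ?thesis using x y norm_triangle_ineq2[of x "fst y"] by (auto simp: mem_Times_iff)
   qed
   have "v n y <= c0" "w n y <= - c0" if "y \<in> ball (x, t) 1 Int space_time" for n y
    using R1[of "fst y" "snd y" n] R2[of "fst y" "snd y" n] *[OF that] by auto
   then have "U (x, t) <= c0" "Z (x, t) <= - c0"
    unfolding U_def Z_def by (intro V.limsup_le[OF z, of 1 0] W.limsup_le[OF z, of 1 0]; simp)+
   then show ?thesis using ge[OF z] by simp
  qed
  then show ?thesis by blast
 qed
 have const: "const_outside_compact {0..} U" "const_outside_compact {0..} Z"
 proof -
  have "\<exists>K. compact K & (\<forall>t'\<in>{0..} Int {0..<t}. \<forall>x. x ~: K --> U (x, t') = c0 & Z (x, t') = - c0)" for t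
  proof -
   obtain R' where R': "!!x s. norm x > R' ==> 0 <= s ==> s < t ==> U (x, s) = c0 & Z (x, s) = - c0" using far[of t] by blast
   then show ?thesis by (intro exI[of _ "cball 0 R'"]) auto
  qed
  then show "const_outside_compact {0..} U" "const_outside_compact {0..} Z"
   unfolding const_outside_compact_def by meson+
 qed
 have ls: "local_sub c U" "local_sub c Z" unfolding U_def Z_def by (rule V.local_sub_limsup, rule W.local_sub_limsup)
 have usc: "usc_on space_time U" "usc_on space_time Z" unfolding U_def Z_def by (rule V.usc_limsup, rule W.usc_limsup)
 have "U (x, 0) + Z (x, 0) <= 0" for x using init[of x] by linarith
 then have zero: "U z + Z z = 0" if "z \<in> space_time" for z
  using comparison[OF ls c usc const _ that] ge[OF that] by force
 have "uniform_limit K u U sequentially" if K: "compact K" "K <= space_time" for K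
  unfolding uniform_limit_sequentially_iff
 proof (intro allI impI)
  fix e :: real assume e: "e > 0"
  have cU: "continuous_on K U" "continuous_on K Z"
   using continuous_on_subset[OF usc_continuous_on[OF usc zero] K(2)]
    continuous_on_subset[OF usc_continuous_on[OF usc(2,1)] K(2)] zero by (auto simp: add.commute)
  obtain N1 where N1: "!!n z. n >= N1 ==> z \<in> K ==> v n z < U z + e"
   by (rule V.limsup_compact[OF K, of "%z. U z + e"])
    (use cU(1) e in \<open>auto simp: U_def[symmetric] intro!: continuous_intros\<close>)
  obtain N2 where N2: "!!n z. n >= N2 ==> z \<in> K ==> w n z < Z z + e"
   by (rule W.limsup_compact[OF K, of "%z. Z z + e"])
    (use cU(2) e in \<open>auto simp: Z_def[symmetric] intro!: continuous_intros\<close>)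
  have "dist (u n z) (U z) < e" if "n >= max N1 N2" "z \<in> K" for n z
  proof -
   have z: "z \<in> space_time" using that(2) K(2) by blast
   show ?thesis using N1[of n z] N2[of n z] uv[OF z, of n] uw[OF z, of n] zero[OF z] that
    by (simp add: dist_real_def abs_less_iff)
  qed
  then show "\<exists>N. \<forall>n\<ge>N. \<forall>x\<in>K. dist (u n x) (U x) < e" by blast
 qed
 then show ?thesis using that[OF ls usc const init zero] by blast
qed

theorem theorem6p3:
  fixes f :: "real \<Rightarrow> real" and r :: "nat \<Rightarrow> real"
    and u0 :: "real^'n \<Rightarrow> real" and u :: "nat \<Rightarrow> (real^'n) \<times> real \<Rightarrow> real"
    and l :: nat and \<beta> :: real
    and \<gamma> :: "nat \<Rightarrow> real \<Rightarrow> real" and \<gamma>_lim :: "real \<Rightarrow> real"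
  defines "H \<equiv> \<lambda>n. on_regular l \<beta> (kappa_f f (r n))"
    and "H_lim \<equiv> on_regular l \<beta> (\<lambda>x E. integral {0..1} f * mean_curvature x E)"
  assumes dim: "CARD('n) \<ge> 2"
    and reg: "l \<ge> 2" "0 \<le> \<beta>" "\<beta> \<le> 1"
    and f_nonneg: "\<And>s. f s \<ge> 0"
    and f_even: "\<And>s. f (- s) = f s"
    and f_smooth: "smooth_on UNIV f"
    and f_mono: "antimono_on {0..} f"
    and f_supp: "closure {s. f s \<noteq> 0} \<subseteq> {-1..1}"
    and r_pos: "\<And>n. r n > 0"
    and r_lim: "r \<longlonglongrightarrow> 0"
    and u0_cont: "uniformly_continuous_on UNIV u0"
    and u0_const: "\<exists>K c. compact K \<and> (\<forall>x. x \<notin> K \<longrightarrow> u0 x = c)"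
    and gamma: "\<And>n. majorizes_cbar (H n) (\<gamma> n)"
    and gamma_lim: "majorizes_cbar H_lim \<gamma>_lim"
    and sol: "\<And>n. viscosity_solution (\<gamma> n) (H n) u0 (u n)"
  shows "\<exists>u_lim. viscosity_solution \<gamma>_lim H_lim u0 u_lim \<and>
           (\<forall>v. viscosity_solution \<gamma>_lim H_lim u0 v \<longrightarrow> (\<forall>z\<in>space_time. v z = u_lim z)) \<and>
           (\<forall>K. compact K \<and> K \<subseteq> space_time \<longrightarrow> uniform_limit K u u_lim sequentially)"
proof -
 let ?c = "integral {0..1} f"
 interpret bump f by standard (fact f_nonneg f_smooth f_mono f_supp)+
 have c: "?c >= 0" by (rule integral_nonneg')
 have fam: "curvature_family ?c H" unfolding H_def by (rule kappa_f_family[OF reg(2,3) r_pos r_lim])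
 have fam_lim: "curvature_family ?c (%n. H_lim)" unfolding H_lim_def by (rule mean_curvature_family[OF reg(2,3) c])
 have u0: "continuous_on UNIV u0" by (rule uniformly_continuous_imp_continuous[OF u0_cont])
 have mono: "antimono_on {0<..} (\<gamma> n)" "antimono_on {0<..} \<gamma>_lim" for n
  using gamma[of n] gamma_lim by (simp_all add: majorizes_cbar_def)
 obtain U V where UV: "local_sub ?c U" "local_sub ?c V" "usc_on space_time U" "usc_on space_time V"
  "const_outside_compact {0..} U" "const_outside_compact {0..} V"
  "!!x. U (x, 0) <= u0 x" "!!x. V (x, 0) <= - u0 x" "!!z. z \<in> space_time ==> U z + V z = 0"
  "!!K. compact K ==> K <= space_time ==> uniform_limit K u U sequentially"
  by (rule solution_limit[OF fam mono(1) sol u0 u0_const]) blast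
 have "viscosity_solution \<gamma>_lim H_lim u0 U" unfolding viscosity_solution_def
 proof (intro conjI exI ballI)
  show "ereal (U z) = usc_envelope U z" if "z \<in> space_time" for z
   by (rule usc_envelope_eq[OF UV(3) that, symmetric])
  show "subsolution \<gamma>_lim H_lim u0 U"
   unfolding H_lim_def by (rule local_sub_imp_subsolution[OF UV(1,3,5,7) c reg(2,3)])
  show "ereal (- V z) = lsc_envelope U z" if "z \<in> space_time" for z
  proof -
   have "usc_envelope (%w. - U w) z = usc_envelope V z"
   proof (rule usc_envelope_cong)
    fix w :: "(real^'n) * real" assume "w \<in> space_time"
    from UV(9)[OF this] show "- U w = V w" by linarith
   qed
   then show ?thesis using usc_envelope_eq[OF UV(4) that] by (simp add: lsc_envelope_uminus)
  qed
  have "subsolution \<gamma>_lim H_lim (%x. - u0 x) V"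
   unfolding H_lim_def by (rule local_sub_imp_subsolution[OF UV(2,4,6,8) c reg(2,3)])
  moreover have "\<forall>q a x. regular_level q a & q x = a --> H_lim x {y. q y <= a} = - H_lim x {y. q y >= a}"
   using fam_lim by (simp add: curvature_family_def)
  ultimately show "supersolution \<gamma>_lim H_lim u0 (%z. - V z)"
   by (subst supersolution_iff_subsolution_uminus) simp_all
 qed
 \<comment> \<open>\<open>solution_limit\<close> is applied to the constant sequence
   \<open>v\<close>, whose limit \<open>U'\<close> must be \<open>v\<close> itself; comparing
   \<open>U'\<close> with \<open>V\<close> and \<open>U\<close> with \<open>V'\<close> yields the
   two inequalities.\<close>
 moreover have "v z = U z" if v: "viscosity_solution \<gamma>_lim H_lim u0 v" and z: "z \<in> space_time" for v z
 proof -
  obtain U' V' where UV': "local_sub ?c U'" "local_sub ?c V'" "usc_on space_time U'" "usc_on space_time V'"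
   "const_outside_compact {0..} U'" "const_outside_compact {0..} V'"
   "!!x. U' (x, 0) <= u0 x" "!!x. V' (x, 0) <= - u0 x" "!!z. z \<in> space_time ==> U' z + V' z = 0"
   "!!K. compact K ==> K <= space_time ==> uniform_limit K (%n::nat. v) U' sequentially"
   by (rule solution_limit[OF fam_lim mono(2) v u0 u0_const]) blast
  have "(%n::nat. v z) \<longlonglongrightarrow> U' z"
   by (rule tendsto_uniform_limitI[OF UV'(10)[of "{z}"]]) (use z in auto)
  then have "v z = U' z" by (simp add: LIMSEQ_const_iff)
  moreover have "U' z + V z <= 0"
   by (rule comparison[OF UV'(1) UV(2) c UV'(3) UV(4) UV'(5) UV(6) _ z]) (use UV'(7) UV(8) in \<open>smt (verit)\<close>)
  moreover have "U z + V' z <= 0"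
   by (rule comparison[OF UV(1) UV'(2) c UV(3) UV'(4) UV(5) UV'(6) _ z]) (use UV(7) UV'(8) in \<open>smt (verit)\<close>)
  ultimately show ?thesis using UV(9)[OF z] UV'(9)[OF z] by linarith
 qed
 ultimately show ?thesis using UV(10) by blast
qed

end
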